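(* Let $\eta\in(0,1)$, $N_{B1},N_{B2}>0$, $\varepsilon,\delta\in(0,1)$ and $\kappa\in(0,\frac\delta2)$. In the round-trip covert communication model with two-mode squeezed vacuum (TMSV) states, there exists a sequence (in $n$) of $\varepsilon$-reliable and $\delta$-covert codes operating on $n$ phase-modulated TMSV states, with the assistance of a secret key, with $M=M_n$ messages such that $$\lim_{n\to\infty}\frac{\log M}{\sqrt n\,\log n}\ \ge\ \frac{\eta^2}{2\big((1-\eta)\eta N_{B1}+(1-\eta)N_{B2}+1\big)}\cdot\frac1{\sqrt{C_2''}}\,(\delta-\kappa),$$ where \begin{align*} C_2''={}&\Big(N_{B1}^3\big(2\eta^2N_{B2}+\eta^2-\eta+1\big)+N_{B1}^2\big(4\eta^3N_{B2}^2+\eta(4\eta^2+3)N_{B2}+1\big)\\ &+N_{B1}N_{B2}\,\eta\big(2\eta^3N_{B2}^2+\eta(3\eta^2+\eta+3)N_{B2}+\eta^3+2\eta^2+\eta+2\big)+\eta^2N_{B2}^2(\eta N_{B2}+1)\Big)\\ &\times\frac{(1-\eta)^2}{N_{B1}(2\eta^2N_{B2}+\eta^2-\eta+1)+\eta N_{B2}}\\ &\times\frac1{4\eta^2N_{B1}N_{B2}\big(N_{B1}(\eta^2N_{B2}+\eta^2-\eta+1)+\eta N_{B2}+1\big)} . \end{align*}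
   Context: All logarithms are natural. Resource: $n$ copies of a TMSV state $\rho_{SI}=|\psi\rangle\langle\psi|_{SI}$, $|\psi\rangle_{SI}=\sum_{k\ge0}\sqrt{\frac{N_S^k}{(N_S+1)^{k+1}}}\,|k\rangle_S|k\rangle_I$, held by Bob; the mean photon number $N_S>0$ may depend on $n$. Round-trip model: in each channel use Bob keeps the idler $I$ and sends the signal mode $\hat s$ to Alice through a forward lossy thermal channel of transmissivity $\eta$ with environment mode $\hat c_1$ in the thermal state of mean photon number $N_{B1}$: Alice receives $\hat a=\sqrt\eta\,\hat s+\sqrt{1-\eta}\,\hat c_1$ and Eve receives $\hat e_1=-\sqrt{1-\eta}\,\hat s+\sqrt\eta\,\hat c_1$ (system $E_1$). Alice applies a phase shift $\theta$ to her mode, giving $\hat a_\theta=e^{i\theta}\hat a$, and sends it back to Bob through a backward lossy thermal channel of transmissivity $\eta$ with environment mode $\hat c_2$ in the thermal state of mean photon number $N_{B2}$: Bob receives $\hat b=\sqrt\eta\,\hat a_\theta+\sqrt{1-\eta}\,\hat c_2$ and Eve receives $\hat e_2=-\sqrt{1-\eta}\,\hat a_\theta+\sqrt\eta\,\hat c_2$ (system $E_2$). The thermal state of mean photon number $N$ is $\sum_{n\ge0}\frac{N^n}{(N+1)^{n+1}}|n\rangle\langle n|$. Code: a message $w\in\{1,\dots,M\}$ and a secret key $k\in\{1,\dots,L\}$ shared by Alice and Bob (message $W$ and key $K$ uniform and independent) are encoded into a phase sequence $\theta^n=(\theta_1,\dots,\theta_n)$, $\theta_i$ being applied by Alice in the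 $i$-th use; the encoding is publicly known. Bob, knowing $k$, produces an estimate $\widehat W$ by a POVM on $B^nI^n$. The code is $\varepsilon$-reliable if $\mathbb E_K[\mathbb P(\widehat W\ne W\mid K)]\le\varepsilon$. Let $\hat\rho^n_{E_1E_2}$ be the state of Eve's $2n$ modes when communication occurs, averaged uniformly over $(w,k)$, and let $\rho_{0,E_1E_2}$ be the no-communication state, defined as the single-use state of $E_1E_2$ when $N_S=0$ and the phase difference $\theta$ between $E_1$ and $E_2$ is uniformly distributed over $[0,2\pi)$. The code is $\delta$-covert if $\frac12\|\hat\rho^n_{E_1E_2}-\rho_{0,E_1E_2}^{\otimes n}\|_1\le\delta$. *)

theory Defs
  imports "HOL-Analysis.Analysis"
begin

section \<open>Operators as matrices over an orthonormal basis\<close>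

text \<open>
  Operators on the Hilbert space with orthonormal basis indexed by \<open>'a\<close> are represented by
  their matrices; \<open>A x y\<close> is the entry in row \<open>x\<close> and column \<open>y\<close>. Every operator
  that is multiplied or traced below is bounded (respectively trace class), so the unconditional
  sums converge.
\<close>

type_synonym 'a mtx = "'a \<Rightarrow> 'a \<Rightarrow> complex"

definition mtx_mult :: "'a mtx \<Rightarrow> 'a mtx \<Rightarrow> 'a mtx" (infixl "\<odot>" 70)
  where "A \<odot> B = (\<lambda>x y. \<Sum>\<^sub>\<infinity>z. A x z * B z y)"

definition mtx_adjoint :: "'a mtx \<Rightarrow> 'a mtx"
  where "mtx_adjoint A = (\<lambda>x y. cnj (A y x))"

definition conjugate_by :: "'a mtx \<Rightarrow> 'a mtx \<Rightarrow> 'a mtx"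
  where "conjugate_by U \<rho> = U \<odot> \<rho> \<odot> mtx_adjoint U"

definition mtx_trace :: "'a mtx \<Rightarrow> complex"
  where "mtx_trace A = (\<Sum>\<^sub>\<infinity>x. A x x)"

definition bounded_mtx :: "'a mtx \<Rightarrow> bool"
  where "bounded_mtx A \<longleftrightarrow> (\<exists>c. \<forall>F u v. finite F \<longrightarrow>
     cmod (\<Sum>x\<in>F. \<Sum>y\<in>F. cnj (u x) * A x y * v y)
       \<le> c * L2_set (\<lambda>x. cmod (u x)) F * L2_set (\<lambda>y. cmod (v y)) F)"

definition positive_mtx :: "'a mtx \<Rightarrow> bool"
  where "positive_mtx A \<longleftrightarrow> (\<forall>F v. finite F \<longrightarrow>
     (\<Sum>x\<in>F. \<Sum>y\<in>F. cnj (v x) * A x y * v y) \<in> \<real>\<^sub>\<ge>\<^sub>0)"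

text \<open>The modulus is the positive square root of \<open>T\<^sup>* T\<close>.\<close>

definition mtx_modulus :: "'a mtx \<Rightarrow> 'a mtx"
  where "mtx_modulus T =
    (THE P. bounded_mtx P \<and> positive_mtx P \<and> P \<odot> P = mtx_adjoint T \<odot> T)"

definition trace_norm :: "'a mtx \<Rightarrow> real"
  where "trace_norm T = Re (mtx_trace (mtx_modulus T))"

text \<open>
  The operators on the \<open>n\<close>-fold tensor power of the space with basis \<open>'a\<close> are the
  matrices over \<open>'a list\<close> supported on the lists of length \<open>n\<close>.
\<close>

definition tensor_prod :: "nat \<Rightarrow> (nat \<Rightarrow> 'a mtx) \<Rightarrow> 'a list mtx"
  where "tensor_prod n \<rho> = (\<lambda>xs ys.
    if length xs = n \<and> length ys = n then (\<Prod>i<n. \<rho> i (xs ! i) (ys ! i)) else 0)"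

definition tensor_id :: "nat \<Rightarrow> 'a list mtx"
  where "tensor_id n = (\<lambda>xs ys. of_bool (length xs = n \<and> xs = ys))"

section \<open>Bosonic modes in the number basis\<close>

definition tmsv_vec :: "real \<Rightarrow> nat \<times> nat \<Rightarrow> complex"
  where "tmsv_vec N = (\<lambda>(s, i).
    if s = i then complex_of_real (sqrt (N ^ s / (N + 1) ^ (s + 1))) else 0)"

definition tmsv :: "real \<Rightarrow> (nat \<times> nat) mtx"
  where "tmsv N = (\<lambda>x y. tmsv_vec N x * cnj (tmsv_vec N y))"

definition thermal :: "real \<Rightarrow> nat mtx"
  where "thermal N = (\<lambda>k l. if k = l then complex_of_real (N ^ k / (N + 1) ^ (k + 1)) else 0)"

text \<open>Creation and annihilation operators of two modes, acting on coefficient families.\<close>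

definition create1 :: "(nat \<times> nat \<Rightarrow> complex) \<Rightarrow> nat \<times> nat \<Rightarrow> complex"
  where "create1 v = (\<lambda>(p, q). complex_of_real (sqrt (real p)) * v (p - 1, q))"

definition create2 :: "(nat \<times> nat \<Rightarrow> complex) \<Rightarrow> nat \<times> nat \<Rightarrow> complex"
  where "create2 v = (\<lambda>(p, q). complex_of_real (sqrt (real q)) * v (p, q - 1))"

definition annihilate1 :: "(nat \<times> nat \<Rightarrow> complex) \<Rightarrow> nat \<times> nat \<Rightarrow> complex"
  where "annihilate1 v = (\<lambda>(p, q). complex_of_real (sqrt (real (p + 1))) * v (p + 1, q))"

definition annihilate2 :: "(nat \<times> nat \<Rightarrow> complex) \<Rightarrow> nat \<times> nat \<Rightarrow> complex"
  where "annihilate2 v = (\<lambda>(p, q). complex_of_real (sqrt (real (q + 1))) * v (p, q + 1))"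

definition vacuum :: "nat \<times> nat \<Rightarrow> complex"
  where "vacuum = (\<lambda>x. if x = (0, 0) then 1 else 0)"

text \<open>
  Let \<open>U\<close> be the unitary that fixes the vacuum and realises, in the Heisenberg picture,
  \<open>U\<^sup>* a U = \<surd>\<eta> a + \<surd>(1-\<eta>) c\<close> and
  \<open>U\<^sup>* c U = -\<surd>(1-\<eta>) a + \<surd>\<eta> c\<close>, where mode 1 is \<open>a\<close> and mode 2 is \<open>c\<close>.
  Then \<open>U a\<^sup>* U\<^sup>* = \<surd>\<eta> a\<^sup>* - \<surd>(1-\<eta>) c\<^sup>*\<close> and
  \<open>U c\<^sup>* U\<^sup>* = \<surd>(1-\<eta>) a\<^sup>* + \<surd>\<eta> c\<^sup>*\<close>; applying powers of these two operators
  to the vacuum yields the columns of \<open>U\<close>.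
\<close>

definition rotated1 :: "real \<Rightarrow> (nat \<times> nat \<Rightarrow> complex) \<Rightarrow> nat \<times> nat \<Rightarrow> complex"
  where "rotated1 \<eta> v = (\<lambda>x. complex_of_real (sqrt \<eta>) * create1 v x
                            - complex_of_real (sqrt (1 - \<eta>)) * create2 v x)"

definition rotated2 :: "real \<Rightarrow> (nat \<times> nat \<Rightarrow> complex) \<Rightarrow> nat \<times> nat \<Rightarrow> complex"
  where "rotated2 \<eta> v = (\<lambda>x. complex_of_real (sqrt (1 - \<eta>)) * create1 v x
                            + complex_of_real (sqrt \<eta>) * create2 v x)"

definition beam_splitter :: "real \<Rightarrow> (nat \<times> nat) mtx"
  where "beam_splitter \<eta> = (\<lambda>x (m, n).
    (rotated1 \<eta> ^^ m) ((rotated2 \<eta> ^^ n) vacuum) x / complex_of_real (sqrt (fact m * fact n)))"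

text \<open>
  The identities \<open>a U = U (\<surd>\<eta> a + \<surd>(1-\<eta>) c)\<close> and
  \<open>c U = U (-\<surd>(1-\<eta>) a + \<surd>\<eta> c)\<close>, column by column. At \<open>m = 0\<close> or
  \<open>n = 0\<close> the corresponding summand vanishes because of its factor.
\<close>

lemma create_commute: "create1 (create2 v) = create2 (create1 v)"
  by (auto simp: create1_def create2_def fun_eq_iff)

lemma annihilate_create [simp]:
  "annihilate1 (create1 v) = (\<lambda>x. v x + create1 (annihilate1 v) x)"
  "annihilate2 (create2 v) = (\<lambda>x. v x + create2 (annihilate2 v) x)"
  "annihilate1 (create2 v) = create2 (annihilate1 v)"
  "annihilate2 (create1 v) = create1 (annihilate2 v)"
proof -
  have sq: "complex_of_real (sqrt (1 + real p)) * (complex_of_real (sqrt (1 + real p)) * z)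
    = z + real p * z" for p and z :: complex
    by (simp add: mult.assoc [symmetric] of_real_mult [symmetric] distrib_right
        del: of_real_mult)
  have sq': "complex_of_real (sqrt (real p)) * (complex_of_real (sqrt (real p)) * z)
    = real p * z" for p and z :: complex
    by (simp add: mult.assoc [symmetric] of_real_mult [symmetric] del: of_real_mult)
  show "annihilate1 (create1 v) = (\<lambda>x. v x + create1 (annihilate1 v) x)"
  proof
    fix x :: "nat \<times> nat" obtain p q where x: "x = (p, q)" by force
    show "annihilate1 (create1 v) x = v x + create1 (annihilate1 v) x"
      unfolding x by (cases p) (simp_all add: annihilate1_def create1_def sq sq' distrib_right)
  qed
  show "annihilate2 (create2 v) = (\<lambda>x. v x + create2 (annihilate2 v) x)"
  proof
    fix x :: "nat \<times> nat" obtain p q where x: "x = (p, q)" by force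
    show "annihilate2 (create2 v) x = v x + create2 (annihilate2 v) x"
      unfolding x by (cases q) (simp_all add: annihilate2_def create2_def sq sq' distrib_right)
  qed
qed (auto simp: annihilate1_def annihilate2_def create1_def create2_def fun_eq_iff)

lemma create_linear:
  "create1 (\<lambda>x. c * v x + d * w x) = (\<lambda>x. c * create1 v x + d * create1 w x)"
  "create2 (\<lambda>x. c * v x + d * w x) = (\<lambda>x. c * create2 v x + d * create2 w x)"
  "annihilate1 (\<lambda>x. c * v x + d * w x) = (\<lambda>x. c * annihilate1 v x + d * annihilate1 w x)"
  "annihilate2 (\<lambda>x. c * v x + d * w x) = (\<lambda>x. c * annihilate2 v x + d * annihilate2 w x)"
  by (auto simp: create1_def create2_def annihilate1_def annihilate2_def fun_eq_iff algebra_simps)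

lemma rotated_eq:
  "rotated1 \<eta> v = (\<lambda>x. complex_of_real (sqrt \<eta>) * create1 v x
                    + (- complex_of_real (sqrt (1 - \<eta>))) * create2 v x)"
  "rotated2 \<eta> v = (\<lambda>x. complex_of_real (sqrt (1 - \<eta>)) * create1 v x
                    + complex_of_real (sqrt \<eta>) * create2 v x)"
  by (simp_all add: rotated1_def rotated2_def)

lemma rotated_linear:
  "rotated1 \<eta> (\<lambda>x. c * v x + d * w x) = (\<lambda>x. c * rotated1 \<eta> v x + d * rotated1 \<eta> w x)"
  "rotated2 \<eta> (\<lambda>x. c * v x + d * w x) = (\<lambda>x. c * rotated2 \<eta> v x + d * rotated2 \<eta> w x)"
  by (auto simp: rotated_eq create_linear fun_eq_iff algebra_simps)

lemma rotated_commute: "rotated1 \<eta> (rotated2 \<eta> v) = rotated2 \<eta> (rotated1 \<eta> v)"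
  unfolding rotated_eq create_linear create_commute by (simp add: fun_eq_iff algebra_simps)

lemma rotated_power_commute:
  "rotated1 \<eta> ((rotated2 \<eta> ^^ n) v) = (rotated2 \<eta> ^^ n) (rotated1 \<eta> v)"
  by (induction n) (simp_all add: rotated_commute)

lemma annihilate_rotated:
  "annihilate1 (rotated1 \<eta> v) = (\<lambda>x. complex_of_real (sqrt \<eta>) * v x + 1 * rotated1 \<eta> (annihilate1 v) x)"
  "annihilate1 (rotated2 \<eta> v) = (\<lambda>x. complex_of_real (sqrt (1 - \<eta>)) * v x + 1 * rotated2 \<eta> (annihilate1 v) x)"
  "annihilate2 (rotated1 \<eta> v) = (\<lambda>x. (- complex_of_real (sqrt (1 - \<eta>))) * v x + 1 * rotated1 \<eta> (annihilate2 v) x)"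
  "annihilate2 (rotated2 \<eta> v) = (\<lambda>x. complex_of_real (sqrt \<eta>) * v x + 1 * rotated2 \<eta> (annihilate2 v) x)"
  unfolding rotated_eq create_linear annihilate_create by (simp_all add: fun_eq_iff algebra_simps)

lemma annihilate_rotated_powers:
  fixes ann
  assumes r1: "\<And>v. ann (rotated1 \<eta> v) = (\<lambda>x. c1 * v x + 1 * rotated1 \<eta> (ann v) x)"
    and r2: "\<And>v. ann (rotated2 \<eta> v) = (\<lambda>x. c2 * v x + 1 * rotated2 \<eta> (ann v) x)"
    and vac: "ann vacuum = (\<lambda>x. 0)"
  shows "ann ((rotated1 \<eta> ^^ m) ((rotated2 \<eta> ^^ n) vacuum)) =
    (\<lambda>x. (c1 * of_nat m) * (rotated1 \<eta> ^^ (m - 1)) ((rotated2 \<eta> ^^ n) vacuum) x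
       + (c2 * of_nat n) * (rotated1 \<eta> ^^ m) ((rotated2 \<eta> ^^ (n - 1)) vacuum) x)"
proof (induction m)
  case 0
  show ?case
  proof (induction n)
    case 0
    show ?case by (simp add: vac)
  next
    case (Suc n)
    have IH: "ann ((rotated2 \<eta> ^^ n) vacuum)
        = (\<lambda>x. (c2 * of_nat n) * (rotated2 \<eta> ^^ (n - 1)) vacuum x + 0 * vacuum x)"
      using Suc by simp
    have "rotated2 \<eta> (ann ((rotated2 \<eta> ^^ n) vacuum))
        = (\<lambda>x. (c2 * of_nat n) * (rotated2 \<eta> ^^ n) vacuum x)"
      unfolding IH rotated_linear by (cases n) simp_all
    then show ?case
      by (simp add: r2 fun_eq_iff algebra_simps)
  qed
next
  case (Suc m)
  let ?v = "(rotated2 \<eta> ^^ n) vacuum" and ?w = "(rotated2 \<eta> ^^ (n - 1)) vacuum"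
  have "rotated1 \<eta> (ann ((rotated1 \<eta> ^^ m) ?v))
      = (\<lambda>x. (c1 * of_nat m) * (rotated1 \<eta> ^^ m) ?v x
           + (c2 * of_nat n) * (rotated1 \<eta> ^^ Suc m) ?w x)"
    unfolding Suc rotated_linear by (cases m) simp_all
  then show ?case
    by (simp add: r1 fun_eq_iff algebra_simps)
qed

lemma beam_splitter_columns:
  assumes "\<And>v c. ann (\<lambda>x. v x / c) = (\<lambda>x. ann v x / c)"
    and "\<And>v. ann (rotated1 \<eta> v) = (\<lambda>x. c1 * v x + 1 * rotated1 \<eta> (ann v) x)"
    and "\<And>v. ann (rotated2 \<eta> v) = (\<lambda>x. c2 * v x + 1 * rotated2 \<eta> (ann v) x)"
    and "ann vacuum = (\<lambda>x. 0)"
  shows "ann (\<lambda>x. beam_splitter \<eta> x (m, n)) =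
    (\<lambda>x. c1 * complex_of_real (sqrt (real m)) * beam_splitter \<eta> x (m - 1, n)
       + c2 * complex_of_real (sqrt (real n)) * beam_splitter \<eta> x (m, n - 1))"
proof -
  have sqm: "of_nat k / complex_of_real (sqrt (fact k * r))
    = complex_of_real (sqrt (real k)) / complex_of_real (sqrt (fact (k - 1) * r))"
    if "r > 0" for k and r :: real
  proof (cases k)
    case (Suc j)
    have "complex_of_real (sqrt (1 + real j)) * complex_of_real (sqrt (1 + real j)) = 1 + of_nat j"
      by (simp add: of_real_mult [symmetric] del: of_real_mult)
    then show ?thesis
      using Suc that by (simp add: real_sqrt_mult divide_simps)
  qed simp
  have 1: "of_nat m / complex_of_real (sqrt (fact m * fact n))
    = complex_of_real (sqrt (real m)) / complex_of_real (sqrt (fact (m - 1) * fact n))"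
    by (rule sqm) simp
  have 2: "of_nat n / complex_of_real (sqrt (fact m * fact n))
    = complex_of_real (sqrt (real n)) / complex_of_real (sqrt (fact m * fact (n - 1)))"
    using sqm[of "fact m" n] by (simp add: mult.commute)
  have "ann (\<lambda>x. beam_splitter \<eta> x (m, n)) = (\<lambda>x.
      c1 * (of_nat m / complex_of_real (sqrt (fact m * fact n)))
        * (rotated1 \<eta> ^^ (m - 1)) ((rotated2 \<eta> ^^ n) vacuum) x
    + c2 * (of_nat n / complex_of_real (sqrt (fact m * fact n)))
        * (rotated1 \<eta> ^^ m) ((rotated2 \<eta> ^^ (n - 1)) vacuum) x)"
    unfolding beam_splitter_def prod.case assms(1)
      annihilate_rotated_powers[OF assms(2-4)]
    by (simp add: add_divide_distrib)
  then show ?thesis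
    unfolding 1 2 by (simp add: beam_splitter_def)
qed

lemma beam_splitter_heisenberg:
  "annihilate1 (\<lambda>x. beam_splitter \<eta> x (m, n)) =
    (\<lambda>x. complex_of_real (sqrt \<eta>) * complex_of_real (sqrt (real m)) * beam_splitter \<eta> x (m - 1, n)
       + complex_of_real (sqrt (1 - \<eta>)) * complex_of_real (sqrt (real n)) * beam_splitter \<eta> x (m, n - 1))" (is ?A)
  "annihilate2 (\<lambda>x. beam_splitter \<eta> x (m, n)) =
    (\<lambda>x. (- complex_of_real (sqrt (1 - \<eta>))) * complex_of_real (sqrt (real m)) * beam_splitter \<eta> x (m - 1, n)
       + complex_of_real (sqrt \<eta>) * complex_of_real (sqrt (real n)) * beam_splitter \<eta> x (m, n - 1))" (is ?B)
proof -
  have "annihilate1 (\<lambda>x. v x / c) = (\<lambda>x. annihilate1 v x / c)"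
    "annihilate2 (\<lambda>x. v x / c) = (\<lambda>x. annihilate2 v x / c)"
    "annihilate1 vacuum = (\<lambda>x. 0)" "annihilate2 vacuum = (\<lambda>x. 0)" for v c
    by (auto simp: annihilate1_def annihilate2_def vacuum_def fun_eq_iff)
  note facts = this
  show ?A
    by (rule beam_splitter_columns[where ann = annihilate1,
          OF facts(1) annihilate_rotated(1,2) facts(3)])
  show ?B
    by (rule beam_splitter_columns[where ann = annihilate2,
          OF facts(2) annihilate_rotated(3,4) facts(4)])
qed

section \<open>One round trip\<close>

text \<open>
  The modes are ordered as signal, idler, first environment, second environment. The signal slot
  successively holds Bob's outgoing signal, Alice's mode and the mode \<open>B\<close> returned to Bob; after
  their interaction with it the two environment slots hold \<open>E\<^sub>1\<close> and \<open>E\<^sub>2\<close>.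
\<close>

type_synonym modes = "nat \<times> nat \<times> nat \<times> nat"

definition initial_state :: "real \<Rightarrow> real \<Rightarrow> real \<Rightarrow> modes mtx"
  where "initial_state NB1 NB2 NS = (\<lambda>(s, i, c1, c2) (s', i', c1', c2').
    tmsv NS (s, i) (s', i') * thermal NB1 c1 c1' * thermal NB2 c2 c2')"

definition forward_channel :: "real \<Rightarrow> modes mtx"
  where "forward_channel \<eta> = (\<lambda>(s, i, c1, c2) (s', i', c1', c2').
    beam_splitter \<eta> (s, c1) (s', c1') * of_bool (i = i' \<and> c2 = c2'))"

text \<open>The unitary \<open>exp (\<i> \<theta> a\<^sup>* a)\<close>, which maps \<open>a\<close> to \<open>exp (\<i> \<theta>) a\<close> in the Heisenberg picture.\<close>

definition phase_shift :: "real \<Rightarrow> modes mtx"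
  where "phase_shift \<theta> = (\<lambda>x y. if x = y then cis (\<theta> * real (fst x)) else 0)"

definition backward_channel :: "real \<Rightarrow> modes mtx"
  where "backward_channel \<eta> = (\<lambda>(s, i, c1, c2) (s', i', c1', c2').
    beam_splitter \<eta> (s, c2) (s', c2') * of_bool (i = i' \<and> c1 = c1'))"

definition round_trip_state :: "real \<Rightarrow> real \<Rightarrow> real \<Rightarrow> real \<Rightarrow> real \<Rightarrow> modes mtx"
  where "round_trip_state \<eta> NB1 NB2 NS \<theta> =
    conjugate_by (backward_channel \<eta>) (conjugate_by (phase_shift \<theta>)
      (conjugate_by (forward_channel \<eta>) (initial_state NB1 NB2 NS)))"

definition bob_state :: "real \<Rightarrow> real \<Rightarrow> real \<Rightarrow> real \<Rightarrow> real \<Rightarrow> (nat \<times> nat) mtx"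
  where "bob_state \<eta> NB1 NB2 NS \<theta> = (\<lambda>(b, i) (b', i').
    \<Sum>\<^sub>\<infinity>(e1, e2). round_trip_state \<eta> NB1 NB2 NS \<theta> (b, i, e1, e2) (b', i', e1, e2))"

definition eve_state :: "real \<Rightarrow> real \<Rightarrow> real \<Rightarrow> real \<Rightarrow> real \<Rightarrow> (nat \<times> nat) mtx"
  where "eve_state \<eta> NB1 NB2 NS \<theta> = (\<lambda>(e1, e2) (e1', e2').
    \<Sum>\<^sub>\<infinity>(b, i). round_trip_state \<eta> NB1 NB2 NS \<theta> (b, i, e1, e2) (b, i, e1', e2'))"

text \<open>
  At \<open>NS = 0\<close> the signal is the vacuum, and Alice's phase is the phase difference between
  \<open>E\<^sub>1\<close> and \<open>E\<^sub>2\<close>.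
\<close>

definition no_comm_state :: "real \<Rightarrow> real \<Rightarrow> real \<Rightarrow> (nat \<times> nat) mtx"
  where "no_comm_state \<eta> NB1 NB2 = (\<lambda>x y.
    complex_of_real (1 / (2 * pi)) * integral {0..2 * pi} (\<lambda>\<theta>. eve_state \<eta> NB1 NB2 0 \<theta> x y))"

section \<open>Codes\<close>

text \<open>
  Messages and keys range over \<open>{1..num_msgs}\<close> and \<open>{1..num_keys}\<close>. The phase in use
  \<open>i < n\<close> for message \<open>w\<close> and key \<open>k\<close> is \<open>phases w k i\<close>, and \<open>decoder k w\<close> is
  the element of Bob's measurement for key \<open>k\<close> announcing the estimate \<open>w\<close>.
\<close>

record phase_code =
  num_msgs :: nat
  num_keys :: nat
  phases :: "nat \<Rightarrow> nat \<Rightarrow> nat \<Rightarrow> real"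
  decoder :: "nat \<Rightarrow> nat \<Rightarrow> (nat \<times> nat) list mtx"

definition povm :: "nat \<Rightarrow> nat set \<Rightarrow> (nat \<Rightarrow> 'a list mtx) \<Rightarrow> bool"
  where "povm n W \<Lambda> \<longleftrightarrow> finite W \<and> (\<forall>w\<in>W. positive_mtx (\<Lambda> w)) \<and>
    (\<lambda>x y. \<Sum>w\<in>W. \<Lambda> w x y) = tensor_id n"

definition is_code :: "nat \<Rightarrow> phase_code \<Rightarrow> bool"
  where "is_code n C \<longleftrightarrow> num_msgs C \<ge> 1 \<and> num_keys C \<ge> 1 \<and>
    (\<forall>k\<in>{1..num_keys C}. povm n {1..num_msgs C} (decoder C k))"

definition decision_prob ::
    "real \<Rightarrow> real \<Rightarrow> real \<Rightarrow> real \<Rightarrow> nat \<Rightarrow> phase_code \<Rightarrow> nat \<Rightarrow> nat \<Rightarrow> nat \<Rightarrow> real"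
  where "decision_prob \<eta> NB1 NB2 NS n C k w w' =
    Re (mtx_trace (decoder C k w' \<odot>
      tensor_prod n (\<lambda>i. bob_state \<eta> NB1 NB2 NS (phases C w k i))))"

definition error_prob :: "real \<Rightarrow> real \<Rightarrow> real \<Rightarrow> real \<Rightarrow> nat \<Rightarrow> phase_code \<Rightarrow> nat \<Rightarrow> real"
  where "error_prob \<eta> NB1 NB2 NS n C k =
    (\<Sum>w\<in>{1..num_msgs C}. \<Sum>w'\<in>{1..num_msgs C} - {w}. decision_prob \<eta> NB1 NB2 NS n C k w w')
      / real (num_msgs C)"

definition reliable ::
    "real \<Rightarrow> real \<Rightarrow> real \<Rightarrow> real \<Rightarrow> nat \<Rightarrow> real \<Rightarrow> phase_code \<Rightarrow> bool"
  where "reliable \<eta> NB1 NB2 NS n \<epsilon> C \<longleftrightarrow>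
    (\<Sum>k\<in>{1..num_keys C}. error_prob \<eta> NB1 NB2 NS n C k) / real (num_keys C) \<le> \<epsilon>"

definition eve_average_state ::
    "real \<Rightarrow> real \<Rightarrow> real \<Rightarrow> real \<Rightarrow> nat \<Rightarrow> phase_code \<Rightarrow> (nat \<times> nat) list mtx"
  where "eve_average_state \<eta> NB1 NB2 NS n C = (\<lambda>x y.
    (\<Sum>w\<in>{1..num_msgs C}. \<Sum>k\<in>{1..num_keys C}.
        tensor_prod n (\<lambda>i. eve_state \<eta> NB1 NB2 NS (phases C w k i)) x y)
      / of_nat (num_msgs C * num_keys C))"

definition covert ::
    "real \<Rightarrow> real \<Rightarrow> real \<Rightarrow> real \<Rightarrow> nat \<Rightarrow> real \<Rightarrow> phase_code \<Rightarrow> bool"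
  where "covert \<eta> NB1 NB2 NS n \<delta> C \<longleftrightarrow>
    1 / 2 * trace_norm (\<lambda>x y. eve_average_state \<eta> NB1 NB2 NS n C x y
        - tensor_prod n (\<lambda>_. no_comm_state \<eta> NB1 NB2) x y) \<le> \<delta>"

definition covert_const :: "real \<Rightarrow> real \<Rightarrow> real \<Rightarrow> real"
  where "covert_const \<eta> NB1 NB2 =
    (NB1 ^ 3 * (2 * \<eta>\<^sup>2 * NB2 + \<eta>\<^sup>2 - \<eta> + 1)
      + NB1\<^sup>2 * (4 * \<eta> ^ 3 * NB2\<^sup>2 + \<eta> * (4 * \<eta>\<^sup>2 + 3) * NB2 + 1)
      + NB1 * NB2 * \<eta> * (2 * \<eta> ^ 3 * NB2\<^sup>2 + \<eta> * (3 * \<eta>\<^sup>2 + \<eta> + 3) * NB2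
          + \<eta> ^ 3 + 2 * \<eta>\<^sup>2 + \<eta> + 2)
      + \<eta>\<^sup>2 * NB2\<^sup>2 * (\<eta> * NB2 + 1))
    * ((1 - \<eta>)\<^sup>2 / (NB1 * (2 * \<eta>\<^sup>2 * NB2 + \<eta>\<^sup>2 - \<eta> + 1) + \<eta> * NB2))
    * (1 / (4 * \<eta>\<^sup>2 * NB1 * NB2 * (NB1 * (\<eta>\<^sup>2 * NB2 + \<eta>\<^sup>2 - \<eta> + 1) + \<eta> * NB2 + 1)))"

end

(* Photon number statistics. Each lossy use is a passive linear network, so its matrix elements are
the amplitudes of two beam splitters, and annihilating a photon at an output is a combination of
annihilations at the inputs. Combined with the recursion of the thermal weights this gives a
Lyapunov equation, whose solution is the symmetric logarithmic derivative of Eve's statistics.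

Covertness. With Q equally spaced phases drawn independently for each letter and the whole codebook
as the key, Eve's averaged state is an n-fold product in which coherences survive only between photon
numbers that differ by a multiple of Q. For large Q only the diagonal matters up to a small tail, and the total
variation distance of the n-fold diagonals is bounded by the Hellinger affinity, whose second-order
expansion in the photon number produces the constant.

Reliability. At low signal photon number Bob's state is, on each block of constant photon number
difference, a rank-one matrix plus a remainder. The projection onto products of the rank-one
directions with few exceptional positions accepts the right codeword and has small trace against the
dephased state, so testing the codewords one after the other decodes a random codebook. The gain over
the trivial bound is the factor log (1 / N_S) = (log n) / 2 per signal photon. *)
theory Submission
 imports Defs "HOL-Real_Asymp.Real_Asymp"
begin

text \<open>The trace norm is defined through a root that must be unique among all bounded positive
  matrices. Finite blocks make it accessible: there the root comes from the finite spectral theorem,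
  and uniqueness from its action on eigenvectors. The constants arise as follows. One signal photon
  shifts Eve's diagonal in a direction whose chi-square norm is at most
  \<open>4 * covert_const\<close>, the variance of the symmetric logarithmic derivative. The
  affinity then drops by about \<open>covert_const / 2 * NS^2\<close> per use, so that n uses are at
  distance about \<open>sqrt (n * covert_const) * NS\<close>, and \<open>NS\<close> is chosen near
  \<open>\<delta> / sqrt (n * covert_const)\<close>. For Bob, \<open>\<eta>^2 / (1 + N_eff)\<close>
  bounds from below the fraction of the one-photon weight that is coherent with the idler vacuum.
  Each received one-photon pair multiplies the probability of confusion by a constant times
  \<open>NS\<close>; an incoherent one also costs a free position in the test, which loses that
  factor again. The slack \<open>\<kappa>\<close> absorbs the second-order errors, the fluctuations
  and the finite number of phases.\<close>

abbreviation cr :: "real => complex"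
 where "cr == complex_of_real"

section \<open>Hermitian matrices over a finite index set\<close>

lemma sum_rotate:
 "(\<Sum>x\<in>A. \<Sum>y\<in>B. \<Sum>z\<in>C. f x y z) = (\<Sum>y\<in>B. \<Sum>z\<in>C. \<Sum>x\<in>A. f x y z)"
 by (subst sum.swap) (intro sum.cong refl sum.swap)

lemma sum_of_bool_mult:
 fixes f :: "'a => 'b::semiring_1"
 assumes "finite F" "z \<in> F"
 shows "(\<Sum>x\<in>F. of_bool (x = z) * f x) = f z" "(\<Sum>x\<in>F. f x * of_bool (x = z)) = f z"
  "(\<Sum>x\<in>F. of_bool (z = x) * f x) = f z" "(\<Sum>x\<in>F. f x * of_bool (z = x)) = f z"
 using assms by (simp_all add: of_bool_def if_distrib[of "%a. a * b" for b] if_distrib[of "%a. b * a" for b] cong: if_cong)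

lemma cnj_of_bool [simp]: "cnj (of_bool b) = of_bool b"
 by (cases b) auto

definition ip :: "'a set => ('a => complex) => ('a => complex) => complex"
 where "ip F u v = (\<Sum>x\<in>F. cnj (u x) * v x)"

definition nsq :: "'a set => ('a => complex) => real"
 where "nsq F v = (\<Sum>x\<in>F. (cmod (v x))\<^sup>2)"

definition app :: "'a set => 'a mtx => ('a => complex) => 'a => complex"
 where "app F A v = (%x. \<Sum>y\<in>F. A x y * v y)"

definition hermitian_on :: "'a set => 'a mtx => bool"
 where "hermitian_on F A \<longleftrightarrow> (\<forall>x\<in>F. \<forall>y\<in>F. A y x = cnj (A x y))"

definition psd_on :: "'a set => 'a mtx => bool"
 where "psd_on F A \<longleftrightarrow> (\<forall>v. (\<Sum>x\<in>F. \<Sum>y\<in>F. cnj (v x) * A x y * v y) \<in> \<real>\<^sub>\<ge>\<^sub>0)"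

lemma positive_mtx_iff_psd_on: "positive_mtx A \<longleftrightarrow> (\<forall>F. finite F --> psd_on F A)"
 by (auto simp: positive_mtx_def psd_on_def)

lemma quad_eq_ip: "(\<Sum>x\<in>F. \<Sum>y\<in>F. cnj (v x) * A x y * v y) = ip F v (app F A v)"
 by (simp add: ip_def app_def sum_distrib_left mult.assoc)

lemma ip_self: "ip F v v = cr (nsq F v)"
 by (simp add: ip_def nsq_def complex_norm_square mult.commute del: of_real_power)

lemma ip_cnj: "cnj (ip F u v) = ip F v u"
 by (simp add: ip_def mult.commute)

lemma ip_lin_right: "ip F u (%x. a * v x + b * w x) = a * ip F u v + b * ip F u w"
 by (simp add: ip_def sum.distrib sum_distrib_left algebra_simps)

lemma ip_lin_left: "ip F (%x. a * v x + b * w x) u = cnj a * ip F v u + cnj b * ip F w u"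
 by (simp add: ip_def sum.distrib sum_distrib_left algebra_simps)

lemma ip_scale_right: "ip F u (%x. a * v x) = a * ip F u v"
 by (simp add: ip_def sum_distrib_left algebra_simps)

lemma ip_diff_right: "ip F u (%x. v x - w x) = ip F u v - ip F u w"
 by (simp add: ip_def sum_subtractf algebra_simps)

lemma ip_sum_right: "ip F u (%x. \<Sum>k\<in>K. v k x) = (\<Sum>k\<in>K. ip F u (v k))"
 unfolding ip_def by (subst sum.swap) (simp add: sum_distrib_left)

lemma ip_cong: "(!!x. x \<in> F ==> u x = u' x) ==> (!!x. x \<in> F ==> v x = v' x) ==> ip F u v = ip F u' v'"
 by (simp add: ip_def)

lemma nsq_nonneg: "nsq F v >= 0"
 by (simp add: nsq_def sum_nonneg)

lemma nsq_eq_0: "finite F ==> nsq F v = 0 \<longleftrightarrow> (\<forall>x\<in>F. v x = 0)"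
 by (simp add: nsq_def sum_nonneg_eq_0_iff)

lemma app_lin: "app F A (%x. a * v x + b * w x) = (%x. a * app F A v x + b * app F A w x)"
 by (auto simp: app_def sum.distrib sum_distrib_left algebra_simps fun_eq_iff)

lemma cmod_ip_le: "cmod (ip F u v) <= sqrt (nsq F u) * sqrt (nsq F v)"
proof -
 have "cmod (ip F u v) <= (\<Sum>x\<in>F. \<bar>cmod (u x)\<bar> * \<bar>cmod (v x)\<bar>)"
  unfolding ip_def by (rule sum_norm_le) (simp add: norm_mult)
 also have "... <= L2_set (%x. cmod (u x)) F * L2_set (%x. cmod (v x)) F" by (rule L2_set_mult_ineq)
 finally show ?thesis by (simp add: L2_set_def nsq_def)
qed

lemma ip_hermitian:
 assumes "hermitian_on F A"
 shows "ip F u (app F A v) = ip F (app F A u) v"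
proof -
 have "ip F u (app F A v) = (\<Sum>x\<in>F. \<Sum>y\<in>F. cnj (u x) * A x y * v y)"
  by (simp add: ip_def app_def sum_distrib_left mult.assoc)
 also have "... = (\<Sum>y\<in>F. \<Sum>x\<in>F. cnj (u x) * A x y * v y)" by (rule sum.swap)
 also have "... = (\<Sum>y\<in>F. \<Sum>x\<in>F. cnj (A y x * u x) * v y)"
 proof (intro sum.cong refl)
  fix x y assume "y \<in> F" "x \<in> F"
  then have "A x y = cnj (A y x)" using assms unfolding hermitian_on_def by blast
  then show "cnj (u x) * A x y * v y = cnj (A y x * u x) * v y" by simp
 qed
 also have "... = ip F (app F A u) v" by (simp add: ip_def app_def sum_distrib_right)
 finally show ?thesis .
qed

text \<open>Polarisation: the form is real at \<open>e x + c * e y\<close>, and the cases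
  \<open>c = 1\<close> and \<open>c = \<i>\<close> compare the imaginary and the real parts of the
  two off-diagonal entries.\<close>

lemma psd_on_hermitian:
 assumes "finite F" "psd_on F A"
 shows "hermitian_on F A" unfolding hermitian_on_def
proof (intro ballI)
 fix x y assume xy: "x \<in> F" "y \<in> F"
 have real: "ip F v (app F A v) \<in> \<real>\<^sub>\<ge>\<^sub>0" for v
  using assms(2) by (simp add: psd_on_def quad_eq_ip)
 define e where "e = (%(z::'a) w. of_bool (w = z) :: complex)"
 have ipe: "ip F (e z) v = v z" if "z \<in> F" for z v
  using assms(1) that by (simp add: ip_def e_def sum_of_bool_mult)
 have appe: "app F A (e z) = (%w. A w z)" if "z \<in> F" for z
  using assms(1) that by (simp add: app_def e_def sum_of_bool_mult)
 have A: "ip F (%w. 1 * e x w + c * e y w) (app F A (%w. 1 * e x w + c * e y w))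
  = A x x + c * A x y + cnj c * A y x + cnj c * c * A y y" for c
  unfolding app_lin ip_lin_left ip_lin_right appe[OF xy(1)] appe[OF xy(2)] using xy by (simp add: ipe algebra_simps)
 have im: "Im (A x x + c * A x y + cnj c * A y x + cnj c * c * A y y) = 0" for c
  using real unfolding A[symmetric] by (metis complex_nonneg_Reals_iff)
 have "Im (A x x) = 0" using im[of 0] by simp
 moreover have "Im (A y y) = 0" using real[of "e y"] by (simp add: appe xy ipe complex_nonneg_Reals_iff)
 ultimately show "A y x = cnj (A x y)" using im[of 1] im[of \<i>] by (simp add: complex_eq_iff)
qed

text \<open>The Rayleigh quotient is maximised over the unit vectors orthogonal to the eigenvectors
  found so far. The maximiser is an eigenvector, because a step along its residual \<open>r\<close>
  would otherwise increase the quotient to first order.\<close>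

lemma next_eigenvector:
 assumes fin: "finite F" and herm: "hermitian_on F A"
  and orth: "!!j k. j < m ==> k < m ==> ip F (\<phi> j) (\<phi> k) = of_bool (j = k)"
  and eig: "!!k x. k < m ==> x \<in> F ==> app F A (\<phi> k) x = cr (\<mu> k) * \<phi> k x"
  and m: "m < card F"
 shows "\<exists>v c. nsq F v = 1 & (\<forall>k<m. ip F (\<phi> k) v = 0)
   & (\<forall>x\<in>F. app F A v x = cr c * v x)"
proof -
 \<comment> \<open>The residual of the basis vector at \<open>x\<close>. If all residuals vanished,
   comparing traces would give \<open>m = card F\<close>.\<close>
 define w where "w = (%(x::'a) y. of_bool (y = x) - (\<Sum>k<m. cnj (\<phi> k x) * \<phi> k y))"
 have ip_w: "ip F (\<phi> j) (w x) = 0" if "j < m" "x \<in> F" for j x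
 proof -
  have 1: "ip F (\<phi> j) (%y. of_bool (y = x)) = cnj (\<phi> j x)"
   using fin that by (simp add: ip_def sum_of_bool_mult)
  have "ip F (\<phi> j) (%y. \<Sum>k<m. cnj (\<phi> k x) * \<phi> k y) = (\<Sum>k<m. cnj (\<phi> k x) * of_bool (j = k))"
   unfolding ip_sum_right ip_scale_right using that orth by (intro sum.cong) auto
  also have "... = cnj (\<phi> j x)" using that by (simp add: sum_of_bool_mult)
  finally show ?thesis unfolding w_def ip_diff_right 1 by simp
 qed
 have "\<exists>x\<in>F. nsq F (w x) ~= 0"
 proof (rule ccontr)
  assume "\<not> (\<exists>x\<in>F. nsq F (w x) ~= 0)"
  then have "nsq F (w x) = 0" if "x \<in> F" for x using that by blast
  then have "w x x = 0" if "x \<in> F" for x using fin that by (simp add: nsq_eq_0)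
  then have "(\<Sum>k<m. cnj (\<phi> k x) * \<phi> k x) = 1" if "x \<in> F" for x using that by (simp add: w_def)
  then have "(\<Sum>x\<in>F. \<Sum>k<m. cnj (\<phi> k x) * \<phi> k x) = of_nat (card F)" by simp
  moreover have "(\<Sum>x\<in>F. \<Sum>k<m. cnj (\<phi> k x) * \<phi> k x) = (\<Sum>k<m. ip F (\<phi> k) (\<phi> k))"
   unfolding ip_def by (subst sum.swap) (simp add: mult.commute)
  moreover have "... = of_nat m" using orth by simp
  ultimately show False using m by simp
 qed
 then obtain x where x: "x \<in> F" "nsq F (w x) ~= 0" by blast
 \<comment> \<open>Vectors are set to zero off \<open>F\<close>, which makes the admissible unit
   vectors a closed subset of a compact product of discs.\<close>
 define K where "K = {v. (\<forall>x. v x \<in> (if x \<in> F then cball 0 1 else {0})) & nsq F v = 1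
  & (\<forall>k<m. ip F (\<phi> k) v = 0)}"
 have unit: "(%y. cr (1 / sqrt (nsq F u)) * (if y \<in> F then u y else 0)) \<in> K"
  if "nsq F u ~= 0" "\<forall>k<m. ip F (\<phi> k) u = 0" for u
 proof -
  have pos: "nsq F u > 0" using that nsq_nonneg[of F u] by linarith
  let ?v = "%y. cr (1 / sqrt (nsq F u)) * (if y \<in> F then u y else 0)"
  have n1: "nsq F ?v = 1"
  proof -
   have "nsq F ?v = (\<Sum>x\<in>F. (cmod (u x))\<^sup>2 / nsq F u)" unfolding nsq_def[of F ?v] using pos
    by (intro sum.cong) (auto simp: norm_mult norm_divide power_mult_distrib power_divide)
   also have "... = 1" using pos unfolding sum_divide_distrib[symmetric] nsq_def[symmetric] by simp
   finally show ?thesis .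
  qed
  have "cmod (?v x) <= 1" if "x \<in> F" for x
  proof -
   have "(cmod (?v x))\<^sup>2 <= nsq F ?v" unfolding nsq_def using fin that by (intro member_le_sum) auto
   then show ?thesis using n1 by (simp add: power_le_one_iff abs_le_square_iff)
  qed
  moreover have "ip F (\<phi> k) ?v = 0" if "k < m" for k
  proof -
   have "ip F (\<phi> k) ?v = cr (1 / sqrt (nsq F u)) * ip F (\<phi> k) (%y. if y \<in> F then u y else 0)"
    by (rule ip_scale_right)
   also have "ip F (\<phi> k) (%y. if y \<in> F then u y else 0) = ip F (\<phi> k) u" by (rule ip_cong) auto
   finally show ?thesis using that \<open>\<forall>k<m. ip F (\<phi> k) u = 0\<close> by simp
  qed
  ultimately show ?thesis using n1 by (auto simp: K_def)
 qed
 have "compact K"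
 proof -
  have cont [continuous_intros]: "continuous_on UNIV (%v::'a => complex. v x)" for x by simp
  have "compactin (product_topology (%_. euclidean) UNIV)
    (PiE UNIV (%x. if x \<in> F then cball (0::complex) 1 else {0}))" unfolding compactin_PiE by auto
  then have "compact (PiE UNIV (%x. if x \<in> F then cball (0::complex) 1 else {0}))"
   by (simp add: euclidean_product_topology)
  moreover have "closed {v. nsq F v = 1}" "closed {v. ip F (\<phi> k) v = 0}" for k
   unfolding nsq_def ip_def by (intro closed_Collect_eq continuous_intros)+
  then have "closed ({v. nsq F v = 1} \<inter> (\<Inter>k<m. {v. ip F (\<phi> k) v = 0}))"
   by (intro closed_Int closed_INT) auto
  ultimately have "compact (PiE UNIV (%x. if x \<in> F then cball (0::complex) 1 else {0})
   \<inter> ({v. nsq F v = 1} \<inter> (\<Inter>k<m. {v. ip F (\<phi> k) v = 0})))" by (rule compact_Int_closed)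
  also have "... = K" by (auto simp: K_def PiE_def Pi_def)
  finally show ?thesis .
 qed
 moreover have "K ~= {}" using unit[of "w x"] x ip_w by auto
 moreover have "continuous_on K (%v. Re (ip F v (app F A v)))"
 proof -
  have cont [continuous_intros]: "continuous_on UNIV (%v::'a => complex. v x)" for x by simp
  have "continuous_on UNIV (%v. Re (ip F v (app F A v)))" unfolding ip_def app_def by (intro continuous_intros)
  then show ?thesis by (rule continuous_on_subset) simp
 qed
 ultimately obtain v where v: "v \<in> K"
  and max: "!!u. u \<in> K ==> Re (ip F u (app F A u)) <= Re (ip F v (app F A v))"
  using continuous_attains_sup[of K] by blast
 define c where "c = Re (ip F v (app F A v))"
 have max': "Re (ip F u (app F A u)) <= c * nsq F u" if u: "\<forall>k<m. ip F (\<phi> k) u = 0" for u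
 proof (cases "nsq F u = 0")
  case True
  then have "ip F u (app F A u) = 0" using fin by (simp add: nsq_eq_0 ip_def)
  then show ?thesis using True by simp
 next
  case False
  define a where "a = 1 / sqrt (nsq F u)"
  let ?u = "%y. cr a * (if y \<in> F then u y else 0)"
  have "app F A ?u = (%x. cr a * app F A u x)" unfolding app_def sum_distrib_left by (intro ext sum.cong) auto
  then have E: "ip F ?u (app F A ?u) = cr (a^2) * ip F u (app F A u)"
   unfolding ip_def sum_distrib_left by (intro sum.cong) (auto simp: power2_eq_square mult_ac)
  have "Re (ip F ?u (app F A ?u)) <= c" unfolding c_def using max unit[OF False u, folded a_def] by blast
  then have "a^2 * Re (ip F u (app F A u)) <= c" unfolding E by (simp del: of_real_power)
  moreover have "a^2 = 1 / nsq F u" by (simp add: a_def power_divide nsq_nonneg)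
  ultimately show ?thesis using False nsq_nonneg[of F u] by (simp add: divide_le_eq)
 qed
 have v1: "nsq F v = 1" and vo: "ip F (\<phi> k) v = 0" if "k < m" for k using v that by (auto simp: K_def)
 have v1: "nsq F v = 1" using v by (auto simp: K_def)
 have ipv: "ip F v (app F A v) = cr c"
 proof -
  have "cnj (ip F v (app F A v)) = ip F v (app F A v)" by (simp add: ip_cnj ip_hermitian[OF herm])
  then show ?thesis by (simp add: c_def complex_eq_iff)
 qed
 define r where "r = (%x. 1 * app F A v x + (- cr c) * v x)"
 have r1: "ip F (\<phi> k) r = 0" if "k < m" for k
 proof -
  have "ip F (app F A (\<phi> k)) v = ip F (%x. cr (\<mu> k) * \<phi> k x) v" using eig that by (intro ip_cong) auto
  also have "... = cnj (ip F v (%x. cr (\<mu> k) * \<phi> k x))" by (simp add: ip_cnj)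
  also have "... = 0" unfolding ip_scale_right using vo[OF that] ip_cnj[of F "\<phi> k" v] by simp
  finally show ?thesis unfolding r_def ip_lin_right ip_hermitian[OF herm] using vo[OF that] by simp
 qed
 have r2: "ip F v r = 0" unfolding r_def ip_lin_right ip_self ipv v1 by simp
 have Av: "app F A v = (%x. 1 * r x + cr c * v x)" by (simp add: r_def)
 have r3: "ip F r (app F A v) = cr (nsq F r)" unfolding Av ip_lin_right ip_self using r2 ip_cnj[of F v r] by simp
 have r3': "ip F v (app F A r) = cr (nsq F r)"
  using r3 by (metis ip_cnj ip_hermitian[OF herm] complex_cnj_complex_of_real)
 define d where "d = c * nsq F r - Re (ip F r (app F A r))"
 \<comment> \<open>Maximality at \<open>v + s * r\<close>: the term linear in \<open>s\<close> must
   be dominated by the quadratic one, for every \<open>s\<close>.\<close>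
 have key: "2 * s * nsq F r <= s^2 * d" for s
 proof -
  let ?u = "%x. 1 * v x + cr s * r x"
  have "Re (ip F ?u (app F A ?u)) <= c * nsq F ?u"
   by (rule max') (use vo r1 in \<open>simp add: ip_lin_right[where a = 1, simplified]\<close>)
  moreover have "ip F ?u ?u = cr (1 + s^2 * nsq F r)"
   unfolding ip_lin_left ip_lin_right ip_self v1 using r2 ip_cnj[of F v r] by (simp add: power2_eq_square)
  then have "nsq F ?u = 1 + s^2 * nsq F r" unfolding ip_self of_real_eq_iff .
  moreover have "ip F ?u (app F A ?u) = cr (c + 2 * s * nsq F r) + s^2 * ip F r (app F A r)"
   unfolding app_lin ip_lin_left ip_lin_right ipv r3 r3' by (simp add: power2_eq_square algebra_simps)
  ultimately show ?thesis by (simp add: d_def algebra_simps)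
 qed
 have "nsq F r = 0"
 proof (rule ccontr)
  assume "nsq F r ~= 0"
  then have N: "nsq F r > 0" using nsq_nonneg[of F r] by linarith
  \<comment> \<open>Small enough that \<open>s * d <= nsq F r\<close>, which contradicts
    \<open>2 * nsq F r <= s * d\<close>.\<close>
  define s where "s = nsq F r / (\<bar>d\<bar> + 1)"
  have s: "s > 0" using N by (simp add: s_def)
  then have "2 * nsq F r <= s * d" using key[of s] by (simp add: power2_eq_square)
  also have "... <= s * (\<bar>d\<bar> + 1)" using s by (intro mult_left_mono) auto
  also have "... = nsq F r" by (simp add: s_def)
  finally show False using N by simp
 qed
 then have "\<forall>x\<in>F. app F A v x = cr c * v x" using fin by (simp add: nsq_eq_0 r_def)
 then show ?thesis using v1 vo by blast
qed

lemma eigenvector_family: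
 assumes fin: "finite F" and herm: "hermitian_on F A" and "m <= card F"
 shows "\<exists>\<phi> \<mu>. (\<forall>j<m. \<forall>k<m. ip F (\<phi> j) (\<phi> k) = of_bool (j = k)) &
  (\<forall>k<m. \<forall>x\<in>F. app F A (\<phi> k) x = cr (\<mu> k) * \<phi> k x)" using assms(3)
proof (induction m)
 case (Suc m)
 then obtain \<phi> \<mu> where IH: "!!j k. j < m ==> k < m ==> ip F (\<phi> j) (\<phi> k) = of_bool (j = k)"
  "!!k x. k < m ==> x \<in> F ==> app F A (\<phi> k) x = cr (\<mu> k) * \<phi> k x" using Suc_leD by metis
 obtain v c where v: "nsq F v = 1" "!!k. k < m ==> ip F (\<phi> k) v = 0"
   "!!x. x \<in> F ==> app F A v x = cr c * v x"
  using next_eigenvector[OF fin herm IH(1) IH(2), of m] Suc.prems by auto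
 have v': "ip F v (\<phi> k) = 0" if "k < m" for k using v(2)[OF that] by (metis ip_cnj complex_cnj_zero)
 show ?case by (rule exI[of _ "\<phi>(m := v)"], rule exI[of _ "\<mu>(m := c)"])
   (use IH v v' in \<open>auto simp: less_Suc_eq ip_self\<close>)
qed auto

text \<open>Completeness comes from counting: the squared residuals of all basis vectors against
  \<open>card F\<close> orthonormal vectors add up to \<open>card F - card F\<close>. Indexing the
  eigenvectors by \<open>F\<close> itself avoids a second index type.\<close>

theorem spectral_decomposition:
 assumes fin: "finite F" and herm: "hermitian_on F A"
 shows "\<exists>\<phi> \<mu>. (\<forall>j\<in>F. \<forall>k\<in>F. ip F (\<phi> j) (\<phi> k) = of_bool (j = k))
  & (\<forall>k\<in>F. \<forall>x\<in>F. app F A (\<phi> k) x = cr (\<mu> k) * \<phi> k x)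
  & (\<forall>x\<in>F. \<forall>y\<in>F. (\<Sum>k\<in>F. \<phi> k x * cnj (\<phi> k y)) = of_bool (x = y))
  & (\<forall>x\<in>F. \<forall>y\<in>F. A x y = (\<Sum>k\<in>F. cr (\<mu> k) * \<phi> k x * cnj (\<phi> k y)))"
proof -
 obtain \<phi>0 \<mu>0 where 0: "!!j k. j < card F ==> k < card F ==> ip F (\<phi>0 j) (\<phi>0 k) = of_bool (j = k)"
  "!!k x. k < card F ==> x \<in> F ==> app F A (\<phi>0 k) x = cr (\<mu>0 k) * \<phi>0 k x"
  using eigenvector_family[OF assms order_refl] by blast
 obtain h where h: "bij_betw h F {0..<card F}" using ex_bij_betw_finite_nat[OF fin] by blast
 define \<phi> \<mu> where "\<phi> = \<phi>0 \<circ> h" and "\<mu> = \<mu>0 \<circ> h"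
 have hF: "h k < card F" if "k \<in> F" for k using h that by (auto simp: bij_betw_def)
 have hinj: "h j = h k \<longleftrightarrow> j = k" if "j \<in> F" "k \<in> F" for j k
  using h that by (auto simp: bij_betw_def inj_on_def)
 have orth: "ip F (\<phi> j) (\<phi> k) = of_bool (j = k)" if "j \<in> F" "k \<in> F" for j k
  using that by (simp add: \<phi>_def 0 hF hinj)
 have eig: "app F A (\<phi> k) x = cr (\<mu> k) * \<phi> k x" if "k \<in> F" "x \<in> F" for k x
  using that by (simp add: \<phi>_def \<mu>_def 0 hF)
 define w where "w = (%(x::'a) y. of_bool (y = x) - (\<Sum>k\<in>F. cnj (\<phi> k x) * \<phi> k y))"
 have ip_w: "ip F (\<phi> j) (w x) = 0" if "j \<in> F" "x \<in> F" for j x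
 proof -
  have 1: "ip F (\<phi> j) (%y. of_bool (y = x)) = cnj (\<phi> j x)"
   using fin that by (simp add: ip_def sum_of_bool_mult)
  have "ip F (\<phi> j) (%y. \<Sum>k\<in>F. cnj (\<phi> k x) * \<phi> k y) = (\<Sum>k\<in>F. cnj (\<phi> k x) * of_bool (j = k))"
   unfolding ip_sum_right ip_scale_right using that orth by (intro sum.cong) auto
  also have "... = cnj (\<phi> j x)" using fin that by (simp add: sum_of_bool_mult)
  finally show ?thesis unfolding w_def ip_diff_right 1 by simp
 qed
 have nw: "cr (nsq F (w x)) = w x x" if x: "x \<in> F" for x
 proof -
  have "ip F (w x) (%y. of_bool (y = x)) = cnj (w x x)" using fin x by (simp add: ip_def sum_of_bool_mult)
  moreover have "ip F (w x) (%y. \<Sum>k\<in>F. cnj (\<phi> k x) * \<phi> k y) = 0"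
   unfolding ip_sum_right ip_scale_right
   using ip_w[OF _ x] ip_cnj[of F _ "w x"] by (intro sum.neutral) (metis complex_cnj_zero mult_zero_right)
  moreover have "ip F (w x) (w x) = ip F (w x) (%y. of_bool (y = x))
    - ip F (w x) (%y. \<Sum>k\<in>F. cnj (\<phi> k x) * \<phi> k y)"
   unfolding ip_diff_right[symmetric] w_def[of, symmetric] by (simp add: w_def)
  ultimately have "cr (nsq F (w x)) = cnj (w x x)" by (simp add: ip_self)
  then show ?thesis by (metis complex_cnj_cnj complex_cnj_complex_of_real)
 qed
 have "(\<Sum>x\<in>F. w x x) = of_nat (card F) - (\<Sum>x\<in>F. \<Sum>k\<in>F. cnj (\<phi> k x) * \<phi> k x)"
  by (simp add: w_def sum_subtractf)
 also have "(\<Sum>x\<in>F. \<Sum>k\<in>F. cnj (\<phi> k x) * \<phi> k x) = (\<Sum>k\<in>F. ip F (\<phi> k) (\<phi> k))"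
  unfolding ip_def by (rule sum.swap)
 also have "... = of_nat (card F)" using orth by simp
 finally have "(\<Sum>x\<in>F. cr (nsq F (w x))) = 0" using nw by simp
 then have "(\<Sum>x\<in>F. nsq F (w x)) = 0" by (metis of_real_sum of_real_eq_0_iff)
 then have "\<forall>x\<in>F. nsq F (w x) = 0" using fin by (subst (asm) sum_nonneg_eq_0_iff) (auto simp: nsq_nonneg)
 then have w0: "w x y = 0" if "x \<in> F" "y \<in> F" for x y using fin that by (simp add: nsq_eq_0)
 have compl: "(\<Sum>k\<in>F. \<phi> k x * cnj (\<phi> k y)) = of_bool (x = y)" if "x \<in> F" "y \<in> F" for x y
  using w0[OF that(2,1)] by (simp add: w_def mult.commute)
 have dec: "A x y = (\<Sum>k\<in>F. cr (\<mu> k) * \<phi> k x * cnj (\<phi> k y))" if "x \<in> F" "y \<in> F" for x y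
 proof -
  have "(\<Sum>k\<in>F. cr (\<mu> k) * \<phi> k x * cnj (\<phi> k y))
   = (\<Sum>k\<in>F. app F A (\<phi> k) x * cnj (\<phi> k y))" using eig that by simp
  also have "... = (\<Sum>k\<in>F. \<Sum>z\<in>F. A x z * (\<phi> k z * cnj (\<phi> k y)))"
   by (simp add: app_def sum_distrib_right mult.assoc)
  also have "... = (\<Sum>z\<in>F. \<Sum>k\<in>F. A x z * (\<phi> k z * cnj (\<phi> k y)))" by (rule sum.swap)
  also have "... = (\<Sum>z\<in>F. A x z * of_bool (z = y))"
   using compl that by (simp add: sum_distrib_left[symmetric])
  also have "... = A x y" using fin that by (simp add: sum_of_bool_mult)
  finally show ?thesis by simp
 qed
 show ?thesis using orth eig compl dec by blast
qed

text \<open>The roots of the eigenvalues are absorbed into the eigenvectors. Positivity is mostly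
  used in this form below: traces against projections become sums of squared norms.\<close>

lemma psd_on_gram:
 assumes fin: "finite F" and psd: "psd_on F A"
 obtains \<psi> :: "'a => 'a => complex"
 where "!!x y. x \<in> F ==> y \<in> F ==> A x y = (\<Sum>k\<in>F. \<psi> k x * cnj (\<psi> k y))"
proof -
 obtain \<phi> \<mu> where orth: "!!j k. j \<in> F ==> k \<in> F ==> ip F (\<phi> j) (\<phi> k) = of_bool (j = k)"
  and eig: "!!k x. k \<in> F ==> x \<in> F ==> app F A (\<phi> k) x = cr (\<mu> k) * \<phi> k x"
  and dec: "!!x y. x \<in> F ==> y \<in> F ==> A x y = (\<Sum>k\<in>F. cr (\<mu> k) * \<phi> k x * cnj (\<phi> k y))"
  using spectral_decomposition[OF fin psd_on_hermitian[OF assms]] by blast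
 have mu: "\<mu> k >= 0" if "k \<in> F" for k
 proof -
  have "ip F (\<phi> k) (app F A (\<phi> k)) = ip F (\<phi> k) (%x. cr (\<mu> k) * \<phi> k x)"
   using eig that by (intro ip_cong) auto
  also have "... = cr (\<mu> k)" unfolding ip_scale_right using orth that by simp
  finally show ?thesis using psd unfolding psd_on_def quad_eq_ip by (metis nonneg_Reals_of_real_iff)
 qed
 show thesis
 proof (rule that[of "%k x. cr (sqrt (\<mu> k)) * \<phi> k x"])
  fix x y assume xy: "x \<in> F" "y \<in> F"
  show "A x y = (\<Sum>k\<in>F. cr (sqrt (\<mu> k)) * \<phi> k x * cnj (cr (sqrt (\<mu> k)) * \<phi> k y))"
   unfolding dec[OF xy]
  proof (rule sum.cong)
   fix k assume "k \<in> F"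
   then have "cr (\<mu> k) = cr (sqrt (\<mu> k)) * cr (sqrt (\<mu> k))" using mu by (simp flip: of_real_mult)
   then show "cr (\<mu> k) * \<phi> k x * cnj (\<phi> k y)
    = cr (sqrt (\<mu> k)) * \<phi> k x * cnj (cr (sqrt (\<mu> k)) * \<phi> k y)" by (simp add: mult_ac)
  qed simp
 qed
qed

lemma gram_psd_on:
 assumes "!!x y. x \<in> F ==> y \<in> F ==> A x y = (\<Sum>k\<in>K. \<psi> k x * cnj (\<psi> k y))"
 shows "psd_on F A" unfolding psd_on_def
proof
 fix v
 have "(\<Sum>x\<in>F. \<Sum>y\<in>F. cnj (v x) * A x y * v y)
  = (\<Sum>x\<in>F. \<Sum>y\<in>F. \<Sum>k\<in>K. cnj (cnj (\<psi> k x) * v x) * (cnj (\<psi> k y) * v y))"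
  using assms by (simp add: sum_distrib_left sum_distrib_right mult_ac)
 also have "... = (\<Sum>k\<in>K. \<Sum>x\<in>F. \<Sum>y\<in>F. cnj (cnj (\<psi> k x) * v x) * (cnj (\<psi> k y) * v y))"
  by (rule sum_rotate[symmetric])
 also have "... = (\<Sum>k\<in>K. cnj (ip F (\<psi> k) v) * ip F (\<psi> k) v)" by (simp add: ip_def sum_product)
 also have "... = cr (\<Sum>k\<in>K. (cmod (ip F (\<psi> k) v))\<^sup>2)"
  by (simp add: complex_norm_square mult.commute del: of_real_power)
 also have "... \<in> \<real>\<^sub>\<ge>\<^sub>0" unfolding nonneg_Reals_of_real_iff by (intro sum_nonneg) simp
 finally show "(\<Sum>x\<in>F. \<Sum>y\<in>F. cnj (v x) * A x y * v y) \<in> \<real>\<^sub>\<ge>\<^sub>0" .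
qed

text \<open>Only the finitely many letters occurring in \<open>F\<close> matter, so each factor has
  a finite Gram representation. Products of Gram vectors, one choice \<open>f i\<close> per
  position, represent the tensor product.\<close>

lemma positive_tensor_prod:
 assumes "!!i. i < n ==> positive_mtx (A i)"
 shows "positive_mtx (tensor_prod n A)" unfolding positive_mtx_iff_psd_on
proof (intro allI impI)
 fix F :: "'a list set" assume "finite F"
 define X where "X = \<Union> (set ` F)"
 have X: "finite X" using \<open>finite F\<close> by (auto simp: X_def)
 have "\<exists>\<psi>. \<forall>x\<in>X. \<forall>y\<in>X. A i x y = (\<Sum>k\<in>X. \<psi> k x * cnj (\<psi> k y))" if i: "i < n" for i
 proof -
  have "psd_on X (A i)" using assms[OF i] X by (simp add: positive_mtx_iff_psd_on)
  then obtain \<psi> where "!!x y. x \<in> X ==> y \<in> X ==> A i x y = (\<Sum>k\<in>X. \<psi> k x * cnj (\<psi> k y))"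
   using psd_on_gram[OF X] by metis
  then show ?thesis by blast
 qed
 then obtain \<psi> where \<psi>: "!!i x y. i < n ==> x \<in> X ==> y \<in> X ==> A i x y = (\<Sum>k\<in>X. \<psi> i k x * cnj (\<psi> i k y))"
  by metis
 show "psd_on F (tensor_prod n A)"
 proof (rule gram_psd_on[where K = "PiE {..<n} (%_. X)"
    and \<psi> = "%f xs. if length xs = n then \<Prod>i<n. \<psi> i (f i) (xs ! i) else 0"])
  fix xs ys assume xy: "xs \<in> F" "ys \<in> F"
  show "tensor_prod n A xs ys = (\<Sum>f\<in>{..<n} \<rightarrow>\<^sub>E X. (if length xs = n then \<Prod>i<n. \<psi> i (f i) (xs ! i) else 0)
   * cnj (if length ys = n then \<Prod>i<n. \<psi> i (f i) (ys ! i) else 0))"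
  proof (cases "length xs = n & length ys = n")
   case True
   have "xs ! i \<in> X" "ys ! i \<in> X" if "i < n" for i using xy True that unfolding X_def by (metis UN_I nth_mem)+
   then have "tensor_prod n A xs ys = (\<Prod>i<n. \<Sum>k\<in>X. \<psi> i k (xs ! i) * cnj (\<psi> i k (ys ! i)))"
    using True \<psi> by (simp add: tensor_prod_def)
   also have "... = (\<Sum>f\<in>{..<n} \<rightarrow>\<^sub>E X. \<Prod>i<n. \<psi> i (f i) (xs ! i) * cnj (\<psi> i (f i) (ys ! i)))"
    using X by (subst prod_sum_PiE) auto
   finally show ?thesis using True by (simp add: prod.distrib)
  qed (auto simp: tensor_prod_def)
 qed
qed

section \<open>Projections and sequential measurements\<close>

text \<open>Gram-Schmidt, skipping dependent vectors. Subtracting projections keeps a vector inside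
  its block, because vectors supported in a disjoint block are orthogonal to it. As \<open>J\<close>
  stays inside \<open>I\<close>, bounds for single directions can later be summed over all
  generators.\<close>

lemma block_projection:
 fixes g :: "'i => 'a => complex" and B :: "'i => 'a set"
 assumes fin: "finite F" and "finite I"
  and "!!i x. i \<in> I ==> x \<in> F ==> g i x ~= 0 ==> x \<in> B i"
  and "!!i j. i \<in> I ==> j \<in> I ==> B i = B j \<or> B i \<inter> B j = {}"
 shows "\<exists>J u. J \<subseteq> I & (\<forall>i\<in>J. \<forall>j\<in>J. ip F (u i) (u j) = of_bool (i = j))
  & (\<forall>i\<in>J. \<forall>x\<in>F. u i x ~= 0 --> x \<in> B i)
  & (\<forall>i\<in>I. \<forall>x\<in>F. g i x = (\<Sum>k\<in>J. ip F (u k) (g i) * u k x))" using assms(2-4)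
proof (induction I rule: finite_induct)
 case (insert i I)
 have "\<exists>J u. J \<subseteq> I & (\<forall>i\<in>J. \<forall>j\<in>J. ip F (u i) (u j) = of_bool (i = j))
  & (\<forall>i\<in>J. \<forall>x\<in>F. u i x ~= 0 --> x \<in> B i)
  & (\<forall>i\<in>I. \<forall>x\<in>F. g i x = (\<Sum>k\<in>J. ip F (u k) (g i) * u k x))"
  by (rule insert.IH) (use insert.prems in auto)
 then obtain J u where J: "J \<subseteq> I"
  and o: "\<forall>i\<in>J. \<forall>j\<in>J. ip F (u i) (u j) = of_bool (i = j)"
  and p: "\<forall>i\<in>J. \<forall>x\<in>F. u i x ~= 0 --> x \<in> B i"
  and q: "\<forall>i\<in>I. \<forall>x\<in>F. g i x = (\<Sum>k\<in>J. ip F (u k) (g i) * u k x)" by (elim exE conjE)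
 have orth: "ip F (u i) (u j) = of_bool (i = j)" if "i \<in> J" "j \<in> J" for i j using o that by simp
 have supp: "x \<in> B i" if "i \<in> J" "x \<in> F" "u i x ~= 0" for i x using p that by simp
 have span: "g i x = (\<Sum>k\<in>J. ip F (u k) (g i) * u k x)" if "i \<in> I" "x \<in> F" for i x
  using q that by simp
 have finJ: "finite J" using J insert.hyps(1) finite_subset by blast
 have iJ: "i \<notin> J" using J insert.hyps(2) by blast
 define r where "r = (%x. g i x - (\<Sum>k\<in>J. ip F (u k) (g i) * u k x))"
 have ipr: "ip F (u k) r = 0" if "k \<in> J" for k
 proof -
  have "ip F (u k) (%x. \<Sum>j\<in>J. ip F (u j) (g i) * u j x) = (\<Sum>j\<in>J. ip F (u j) (g i) * of_bool (k = j))"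
   unfolding ip_sum_right ip_scale_right using orth that by (intro sum.cong) auto
  also have "... = ip F (u k) (g i)" using finJ that by (simp add: sum_of_bool_mult)
  finally show ?thesis unfolding r_def ip_diff_right by simp
 qed
 have ipr': "ip F r (u k) = 0" if "k \<in> J" for k using ipr[OF that] ip_cnj[of F "u k" r] by simp
 have r_span: "ip F r v = 0" if "!!x. x \<in> F ==> v x = (\<Sum>k\<in>J. c k * u k x)" for v c
 proof -
  have "ip F r v = ip F r (%x. \<Sum>k\<in>J. c k * u k x)" using that by (intro ip_cong) auto
  also have "... = 0" unfolding ip_sum_right ip_scale_right using ipr' by simp
  finally show ?thesis .
 qed
 show ?case
 proof (cases "nsq F r = 0")
  case True
  then have "g i x = (\<Sum>k\<in>J. ip F (u k) (g i) * u k x)" if "x \<in> F" for x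
   using fin that by (simp add: nsq_eq_0 r_def)
  then show ?thesis using J orth supp span by (intro exI[of _ J] exI[of _ u]) auto
 next
  case False
  define c where "c = cr (1 / sqrt (nsq F r))"
  have pos: "nsq F r > 0" using False nsq_nonneg[of F r] by linarith
  have "(1 / sqrt (nsq F r)) * (1 / sqrt (nsq F r)) * nsq F r = 1" using pos by (simp add: field_simps)
  then have cc: "c * c * cr (nsq F r) = 1" unfolding c_def by (metis of_real_1 of_real_mult)
  have cnjc: "cnj c = c" by (simp add: c_def)
  define u' where "u' = u(i := (%x. c * r x))"
  have u'J: "u' k = u k" if "k \<in> J" for k using iJ that by (auto simp: u'_def)
  have u'i: "u' i = (%x. c * r x)" by (simp add: u'_def)
  have left: "ip F (%x. c * r x) v = c * ip F r v" for v by (simp add: ip_def sum_distrib_left cnjc mult_ac)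
  have rr: "ip F (u' i) (u' i) = 1" unfolding u'i left ip_scale_right ip_self using cc by (simp add: mult.assoc)
  have ri: "ip F (u' i) (u k) = 0" "ip F (u k) (u' i) = 0" if "k \<in> J" for k
   unfolding u'i left ip_scale_right using ipr[OF that] ipr'[OF that] by auto
  have orth': "ip F (u' j) (u' k) = of_bool (j = k)" if "j \<in> insert i J" "k \<in> insert i J" for j k
   using that iJ rr ri orth u'J by (cases "j = i"; cases "k = i") auto
  have supp': "x \<in> B j" if j: "j \<in> insert i J" and x: "x \<in> F" and nz: "u' j x ~= 0" for j x
  proof (cases "j = i")
   case True
   then have "r x ~= 0" using nz by (auto simp: u'i)
   show ?thesis
   proof (rule ccontr)
    assume nB: "x \<notin> B j"
    then have "g i x = 0" using insert.prems(1)[of i x] x True by auto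
    moreover have z: "ip F (u k) (g i) * u k x = 0" if "k \<in> J" for k
    proof (cases "u k x = 0")
     case False
     then have "x \<in> B k" using supp that x by blast
     then have "B k ~= B i" using nB True by auto
     then have dis: "B k \<inter> B i = {}" using insert.prems(2)[of k i] J that by auto
     have "cnj (u k y) * g i y = 0" if "y \<in> F" for y
      using supp[OF \<open>k \<in> J\<close> that] insert.prems(1)[of i y] that dis
      by (cases "u k y = 0"; cases "g i y = 0") auto
     then have "ip F (u k) (g i) = 0" unfolding ip_def by (intro sum.neutral) auto
     then show ?thesis by simp
    qed simp
    moreover have "(\<Sum>k\<in>J. ip F (u k) (g i) * u k x) = 0" using z by (intro sum.neutral ballI)
    ultimately show False using \<open>r x ~= 0\<close> by (simp add: r_def)
   qed
  qed (use j supp[of j x] x nz u'J in auto)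
  have span': "g j x = (\<Sum>k\<in>insert i J. ip F (u' k) (g j) * u' k x)" if j: "j \<in> insert i I" and x: "x \<in> F" for j x
  proof -
   have 1: "(\<Sum>k\<in>insert i J. ip F (u' k) (g j) * u' k x)
    = c * c * ip F r (g j) * r x + (\<Sum>k\<in>J. ip F (u k) (g j) * u k x)"
    using finJ iJ by (simp add: u'i left u'J mult_ac)
   show ?thesis
   proof (cases "j = i")
    case True
    have "ip F r r = ip F r (g i) - ip F r (%x. \<Sum>k\<in>J. ip F (u k) (g i) * u k x)"
     by (subst (2) r_def) (rule ip_diff_right)
    also have "ip F r (%x. \<Sum>k\<in>J. ip F (u k) (g i) * u k x) = 0" by (rule r_span) simp
    finally have 2: "c * c * ip F r (g j) = 1" using cc True by (simp add: ip_self)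
    show ?thesis unfolding 1 2 using True by (simp add: r_def)
   next
    case False
    then have "j \<in> I" using j by simp
    then have "ip F r (g j) = 0" using span by (intro r_span) auto
    then show ?thesis unfolding 1 using span[OF \<open>j \<in> I\<close> x] by simp
   qed
  qed
  show ?thesis by (rule exI[of _ "insert i J"], rule exI[of _ u']) (use J orth' supp' span' in blast)
 qed
qed auto

definition proj :: "'i set => ('i => 'a => complex) => 'a mtx"
 where "proj J u = (%x y. \<Sum>k\<in>J. u k x * cnj (u k y))"

lemma app_proj: "app F (proj J u) v = (%x. \<Sum>k\<in>J. ip F (u k) v * u k x)"
proof
 fix x
 have "app F (proj J u) v x = (\<Sum>y\<in>F. \<Sum>k\<in>J. u k x * (cnj (u k y) * v y))"
  by (simp add: app_def proj_def sum_distrib_right mult.assoc)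
 also have "... = (\<Sum>k\<in>J. \<Sum>y\<in>F. u k x * (cnj (u k y) * v y))" by (rule sum.swap)
 finally show "app F (proj J u) v x = (\<Sum>k\<in>J. ip F (u k) v * u k x)"
  by (simp add: ip_def sum_distrib_left mult.commute)
qed

definition projection_on :: "'a set => 'a mtx => bool"
 where "projection_on F A \<longleftrightarrow> hermitian_on F A & (\<forall>v. app F A (app F A v) = app F A v)"

lemma projection_on_proj:
 assumes "finite J" "!!i j. i \<in> J ==> j \<in> J ==> ip F (u i) (u j) = of_bool (i = j)"
 shows "projection_on F (proj J u)"
proof -
 have "ip F (u k) (%x. \<Sum>j\<in>J. ip F (u j) v * u j x) = ip F (u k) v" if "k \<in> J" for k v
 proof -
  have "ip F (u k) (%x. \<Sum>j\<in>J. ip F (u j) v * u j x) = (\<Sum>j\<in>J. ip F (u j) v * of_bool (k = j))"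
   unfolding ip_sum_right ip_scale_right using assms that by (intro sum.cong) auto
  then show ?thesis using assms(1) that by (simp add: sum_of_bool_mult)
 qed
 then have "app F (proj J u) (app F (proj J u) v) = app F (proj J u) v" for v unfolding app_proj by auto
 moreover have "hermitian_on F (proj J u)" by (auto simp: hermitian_on_def proj_def mult.commute)
 ultimately show ?thesis by (auto simp: projection_on_def)
qed

text \<open>The trace of the product of \<open>A\<close> and \<open>B\<close>, both cut down to
  \<open>F\<close>.\<close>

definition pairing :: "'a set => 'a mtx => 'a mtx => complex"
 where "pairing F A B = (\<Sum>x\<in>F. \<Sum>y\<in>F. A x y * B y x)"

lemma pairing_gram:
 assumes "!!x y. x \<in> F ==> y \<in> F ==> B x y = (\<Sum>k\<in>K. \<psi> k x * cnj (\<psi> k y))"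
 shows "pairing F A B = (\<Sum>k\<in>K. ip F (\<psi> k) (app F A (\<psi> k)))"
proof -
 have "pairing F A B = (\<Sum>x\<in>F. \<Sum>y\<in>F. \<Sum>k\<in>K. cnj (\<psi> k x) * (A x y * \<psi> k y))"
  using assms by (simp add: pairing_def sum_distrib_left mult_ac)
 also have "... = (\<Sum>k\<in>K. \<Sum>x\<in>F. \<Sum>y\<in>F. cnj (\<psi> k x) * (A x y * \<psi> k y))"
  by (rule sum_rotate[symmetric])
 also have "... = (\<Sum>k\<in>K. ip F (\<psi> k) (app F A (\<psi> k)))"
  by (simp add: ip_def app_def sum_distrib_left)
 finally show ?thesis .
qed

lemma ip_projection:
 assumes "projection_on F A"
 shows "ip F u (app F A v) = ip F (app F A u) (app F A v)"
 using assms unfolding projection_on_def by (metis ip_hermitian)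

lemma app_diff: "app F A (%x. v x - w x) = (%x. app F A v x - app F A w x)"
 by (auto simp: app_def sum_subtractf right_diff_distrib)

lemma ip_diff_left: "ip F (%x. v x - w x) u = ip F v u - ip F w u"
 by (simp add: ip_def sum_subtractf algebra_simps)

lemma ip_projection_complement:
 assumes "projection_on F A"
 shows "ip F (%x. u x - app F A u x) (%x. v x - app F A v x) = ip F u v - ip F (app F A u) (app F A v)"
 unfolding ip_diff_left ip_diff_right using ip_projection[OF assms, of u v] ip_projection[OF assms, of v u]
 by (metis ip_cnj add_diff_cancel_right' diff_add_cancel diff_diff_eq2 cancel_comm_monoid_add_class.diff_cancel diff_zero)

text \<open>\<open>projection_on\<close> compares functions on the whole type, so the complement is
  cut off outside \<open>F\<close>; otherwise idempotence could fail there.\<close>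

lemma projection_on_complement:
 assumes fin: "finite F" and A: "projection_on F A"
 shows "projection_on F (%x y. of_bool (x = y) * of_bool (x \<in> F) - A x y * of_bool (x \<in> F))" (is "projection_on F ?A")
 unfolding projection_on_def
proof (intro conjI allI)
 have app: "app F ?A v = (%x. if x \<in> F then v x - app F A v x else 0)" for v
  using fin by (auto simp: app_def fun_eq_iff left_diff_distrib sum_subtractf sum_of_bool_mult)
 show "hermitian_on F ?A" unfolding hermitian_on_def
 proof (intro ballI)
  fix x y assume "x \<in> F" "y \<in> F"
  then have "A y x = cnj (A x y)" using A unfolding projection_on_def hermitian_on_def by blast
  then show "?A y x = cnj (?A x y)"
   using \<open>x \<in> F\<close> \<open>y \<in> F\<close> by (cases "x = y") simp_all
 qed
 fix v
 have "app F A (app F ?A v) = app F A (%x. v x - app F A v x)"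
  unfolding app by (auto simp: app_def intro!: ext sum.cong)
 also have "... = (%x. 0)" using A unfolding app_diff by (simp add: projection_on_def)
 finally have "app F A (app F ?A v) = (%x. 0)" .
 then show "app F ?A (app F ?A v) = app F ?A v" by (subst app) (auto simp: app)
qed

text \<open>The bound behind sequential decoding: the loss in norm along a chain of projections is
 controlled by how much each single projection removes from the initial vector. It follows from
 comparing the telescoped norm with the telescoped inner product with the initial vector.\<close>

lemma sequential_projection_bound:
 fixes \<psi> :: "nat => 'a => complex"
 assumes proj: "!!i. i < k ==> projection_on F (A i)"
  and step: "!!i. i < k ==> \<psi> (Suc i) = app F (A i) (\<psi> i)"
 shows "nsq F (\<psi> 0) - nsq F (\<psi> k) <= 4 * (\<Sum>i<k. nsq F (%x. \<psi> 0 x - app F (A i) (\<psi> 0) x))"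
proof -
 define S where "S = (\<Sum>i<k. nsq F (%x. \<psi> 0 x - app F (A i) (\<psi> 0) x))"
 define d where "d = (%i x. \<psi> i x - app F (A i) (\<psi> i) x)"
 define e where "e = (%i x. \<psi> 0 x - app F (A i) (\<psi> 0) x)"
 have nd: "nsq F (d i) = nsq F (\<psi> i) - nsq F (\<psi> (Suc i))" if "i < k" for i
 proof -
  have "cr (nsq F (d i)) = cr (nsq F (\<psi> i) - nsq F (\<psi> (Suc i)))"
   using ip_projection_complement[OF proj[OF that], of "\<psi> i" "\<psi> i"]
   by (simp add: d_def step[OF that] ip_self[symmetric])
  then show ?thesis unfolding of_real_eq_iff .
 qed
 have ide: "ip F (\<psi> 0) (\<psi> i) - ip F (\<psi> 0) (\<psi> (Suc i)) = ip F (e i) (d i)" if "i < k" for i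
  unfolding d_def e_def ip_projection_complement[OF proj[OF that]] step[OF that]
  using ip_projection[OF proj[OF that], of "\<psi> 0" "\<psi> i"] by simp
 have tel1: "(\<Sum>i<k. nsq F (d i)) = nsq F (\<psi> 0) - nsq F (\<psi> k)"
  using nd sum_lessThan_telescope'[of "%i. nsq F (\<psi> i)" k] by simp
 have tel2: "ip F (\<psi> 0) (\<psi> 0) - ip F (\<psi> 0) (\<psi> k) = (\<Sum>i<k. ip F (e i) (d i))"
  using ide sum_lessThan_telescope'[of "%i. ip F (\<psi> 0) (\<psi> i)" k] by simp
 define p x where "p = sqrt (nsq F (\<psi> 0))" and "x = sqrt (nsq F (\<psi> k))"
 have p: "p >= 0" "p^2 = nsq F (\<psi> 0)" and x: "x >= 0" "x^2 = nsq F (\<psi> k)"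
  by (auto simp: p_def x_def nsq_nonneg)
 have xp: "x <= p"
 proof -
  have "0 <= (\<Sum>i<k. nsq F (d i))" by (intro sum_nonneg) (simp add: nsq_nonneg)
  then show ?thesis unfolding tel1 p_def x_def by simp
 qed
 have S0: "S >= 0" unfolding S_def by (intro sum_nonneg) (simp add: nsq_nonneg)
 have "p^2 - p * x <= cmod (ip F (\<psi> 0) (\<psi> 0)) - cmod (ip F (\<psi> 0) (\<psi> k))"
  using cmod_ip_le[of F "\<psi> 0" "\<psi> k"] p x nsq_nonneg[of F "\<psi> 0"] unfolding ip_self p_def x_def by simp
 also have "... <= cmod (ip F (\<psi> 0) (\<psi> 0) - ip F (\<psi> 0) (\<psi> k))" by (rule norm_triangle_ineq2)
 also have "... <= (\<Sum>i<k. sqrt (nsq F (e i)) * sqrt (nsq F (d i)))"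
  unfolding tel2 by (rule sum_norm_le) (rule cmod_ip_le)
 also have "... <= (\<Sum>i<k. \<bar>sqrt (nsq F (e i))\<bar> * \<bar>sqrt (nsq F (d i))\<bar>)"
  by (intro sum_mono) (simp add: nsq_nonneg)
 also have "... <= L2_set (%i. sqrt (nsq F (e i))) {..<k} * L2_set (%i. sqrt (nsq F (d i))) {..<k}"
  by (rule L2_set_mult_ineq)
 also have "... = sqrt S * sqrt (p^2 - x\<^sup>2)" using tel1 p x by (simp add: L2_set_def nsq_nonneg S_def e_def)
 finally have main: "p * (p - x) <= sqrt S * sqrt (p^2 - x\<^sup>2)" by (simp add: power2_eq_square algebra_simps)
 \<comment> \<open>Squaring \<open>main\<close> and cancelling \<open>p - x\<close> leaves
   \<open>p^2 * (p - x) <= S * (p + x)\<close>; multiplying by \<open>p + x\<close> and using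
   \<open>p + x <= 2 * p\<close> gives the factor 4.\<close>
 have "p^2 - x\<^sup>2 <= 4 * S"
 proof (cases "x = p")
  case True
  then show ?thesis using S0 by simp
 next
  case False
  then have lt: "x < p" using xp by simp
  then have p0: "p > 0" using x by linarith
  have "(p * (p - x))\<^sup>2 <= (sqrt S * sqrt (p^2 - x\<^sup>2))\<^sup>2"
   by (rule power_mono[OF main]) (use p0 lt in auto)
  also have "... = S * (p^2 - x\<^sup>2)" using S0 power_mono[OF xp x(1), of 2] by (simp add: power_mult_distrib)
  finally have "(p - x) * (p^2 * (p - x)) <= (p - x) * (S * (p + x))" by (simp add: power2_eq_square algebra_simps)
  then have 1: "p^2 * (p - x) <= S * (p + x)" using lt by simp
  have "p^2 * (p^2 - x\<^sup>2) = (p^2 * (p - x)) * (p + x)" by (simp add: power2_eq_square algebra_simps)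
  also have "... <= (S * (p + x)) * (p + x)" using 1 p0 x by (intro mult_right_mono) auto
  also have "... = S * (p + x)\<^sup>2" by (simp add: power2_eq_square)
  also have "... <= S * (2 * p)\<^sup>2" using lt p0 x S0 by (intro mult_left_mono power_mono) auto
  finally have "p^2 * (p^2 - x\<^sup>2) <= p^2 * (4 * S)" by (simp add: power_mult_distrib mult_ac)
  then show ?thesis using p0 by simp
 qed
 then show ?thesis by (simp add: p x S_def)
qed


text \<open>The unnormalised vector that remains after the tests \<open>1, ..., w\<close> have all
  been negative; index 0 is the initial vector.\<close>

fun rejected :: "'a set => (nat => 'a mtx) => nat => ('a => complex) => 'a => complex" where
 "rejected F A 0 v = v"
| "rejected F A (Suc w) v = (%x. rejected F A w v x - app F (A (Suc w)) (rejected F A w v) x)"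

text \<open>Linearity in \<open>v\<close>, in the form needed to evaluate effects that are defined
  through basis vectors.\<close>

lemma rejected_expand:
 assumes "finite F" "x \<in> F"
 shows "rejected F A w v x = (\<Sum>y\<in>F. v y * rejected F A w (%z. of_bool (z = y)) x)" using assms(2)
proof (induction w arbitrary: x)
 case 0
 then show ?case using assms(1) by (simp add: sum_of_bool_mult)
next
 case (Suc w)
 have "app F (A (Suc w)) (rejected F A w v) x
  = (\<Sum>z\<in>F. A (Suc w) x z * (\<Sum>y\<in>F. v y * rejected F A w (%z. of_bool (z = y)) z))"
  unfolding app_def using Suc.IH by (intro sum.cong) auto
 also have "... = (\<Sum>z\<in>F. \<Sum>y\<in>F. v y * (A (Suc w) x z * rejected F A w (%z. of_bool (z = y)) z))"
  by (simp add: sum_distrib_left mult_ac)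
 also have "... = (\<Sum>y\<in>F. \<Sum>z\<in>F. v y * (A (Suc w) x z * rejected F A w (%z. of_bool (z = y)) z))"
  by (rule sum.swap)
 also have "... = (\<Sum>y\<in>F. v y * app F (A (Suc w)) (rejected F A w (%z. of_bool (z = y))) x)"
  by (simp add: app_def sum_distrib_left)
 finally have "app F (A (Suc w)) (rejected F A w v) x
  = (\<Sum>y\<in>F. v y * app F (A (Suc w)) (rejected F A w (%z. of_bool (z = y))) x)" .
 then show ?case using Suc.IH[OF Suc.prems] by (simp add: right_diff_distrib sum_subtractf)
qed

text \<open>Each projection splits the inner product into an accepted and a rejected part. For basis
  vectors this is the completeness of the measurement.\<close>

lemma rejected_telescope:
 assumes "!!i. 1 <= i ==> i <= w ==> projection_on F (A i)"
 shows "ip F (rejected F A w u) (rejected F A w v) +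
  (\<Sum>i=1..w. ip F (app F (A i) (rejected F A (i - 1) u)) (app F (A i) (rejected F A (i - 1) v))) = ip F u v"
 using assms
proof (induction w)
 case (Suc w)
 have "ip F (rejected F A (Suc w) u) (rejected F A (Suc w) v) = ip F (rejected F A w u) (rejected F A w v)
  - ip F (app F (A (Suc w)) (rejected F A w u)) (app F (A (Suc w)) (rejected F A w v))"
  unfolding rejected.simps using Suc.prems by (intro ip_projection_complement) auto
 then show ?case using Suc by simp
qed simp

text \<open>An instance of \<open>sequential_projection_bound\<close>: the complements of the
  earlier tests are followed by \<open>A w\<close> itself. The complement of \<open>A i\<close>
  removes exactly \<open>app F (A i) v\<close> from the initial vector.\<close>

lemma nsq_rejected_bound:
 assumes fin: "finite F" and A: "!!i. 1 <= i ==> i <= w ==> projection_on F (A i)" and w: "w >= 1"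
 shows "nsq F v - nsq F (app F (A w) (rejected F A (w - 1) v))
  <= 4 * (nsq F (%x. v x - app F (A w) v x) + (\<Sum>i=1..<w. nsq F (app F (A i) v)))"
proof -
 \<comment> \<open>The tests are numbered from 1, so \<open>B i\<close> is the complement of
   \<open>A (Suc i)\<close>; only the last member of the chain, \<open>B (w - 1)\<close>, is a test
   itself.\<close>
 define B where "B = (%i. if i < w - 1
  then (%x y. of_bool (x = y) * of_bool (x \<in> F) - A (Suc i) x y * of_bool (x \<in> F)) else A w)"
 define v' where "v' = (%x. if x \<in> F then v x else 0)"
 define \<psi> where "\<psi> = (%i. if i < w then (%x. if x \<in> F then rejected F A i v x else 0)
  else app F (A w) (rejected F A (w - 1) v))"
 have app_cong: "app F C u = app F C u'" if "!!x. x \<in> F ==> u x = u' x" for C u u'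
  using that by (auto simp: app_def fun_eq_iff intro!: sum.cong)
 have appB: "app F (B i) u = (%x. if x \<in> F then u x - app F (A (Suc i)) u x else 0)" if "i < w - 1" for i u
  using fin that by (auto simp: B_def app_def fun_eq_iff left_diff_distrib sum_subtractf sum_of_bool_mult)
 have proj: "projection_on F (B i)" if "i < w" for i
  using that w A unfolding B_def by (auto intro!: projection_on_complement fin)
 have step: "\<psi> (Suc i) = app F (B i) (\<psi> i)" if i: "i < w" for i
 proof (cases "i < w - 1")
  case True
  have "app F (A (Suc i)) (%x. if x \<in> F then rejected F A i v x else 0) = app F (A (Suc i)) (rejected F A i v)"
   by (rule app_cong) auto
  then show ?thesis using True by (auto simp: appB \<psi>_def)
 next
  case False
  then have "i = w - 1" using i by simp
  then show ?thesis using w by (auto simp: \<psi>_def B_def intro!: app_cong)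
 qed
 have \<psi>0: "\<psi> 0 = v'" using w by (auto simp: \<psi>_def v'_def fun_eq_iff)
 have n0: "nsq F v' = nsq F v" by (simp add: nsq_def v'_def)
 have av: "app F C v' = app F C v" for C by (rule app_cong) (simp add: v'_def)
 have "nsq F (\<psi> 0) - nsq F (\<psi> w) <= 4 * (\<Sum>i<w. nsq F (%x. \<psi> 0 x - app F (B i) (\<psi> 0) x))"
  by (rule sequential_projection_bound) (use proj step in auto)
 also have "(\<Sum>i<w. nsq F (%x. \<psi> 0 x - app F (B i) (\<psi> 0) x))
  = (\<Sum>i<w. if i < w - 1 then nsq F (app F (A (Suc i)) v) else nsq F (%x. v x - app F (A w) v x))"
 proof (rule sum.cong)
  fix i
  show "nsq F (%x. \<psi> 0 x - app F (B i) (\<psi> 0) x)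
   = (if i < w - 1 then nsq F (app F (A (Suc i)) v) else nsq F (%x. v x - app F (A w) v x))"
   unfolding \<psi>0 by (auto simp: appB av nsq_def v'_def) (auto simp: B_def av[unfolded v'_def])
 qed simp
 also have "... = nsq F (%x. v x - app F (A w) v x) + (\<Sum>i<w-1. nsq F (app F (A (Suc i)) v))"
 proof -
  obtain m where m: "w = Suc m" using w by (cases w) auto
  show ?thesis unfolding m by simp
 qed
 also have "(\<Sum>i<w-1. nsq F (app F (A (Suc i)) v)) = (\<Sum>i=1..<w. nsq F (app F (A i) v))"
  by (rule sum.reindex_bij_witness[of _ "%i. i - 1" Suc]) auto
 finally show ?thesis using w by (simp add: \<psi>0 n0) (simp add: \<psi>_def)
qed

text \<open>Testing the projections \<open>A 1, \<dots>, A M\<close> one after the other; the outcome is the first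
 positive test.\<close>

definition seq_effect :: "'a set => (nat => 'a mtx) => nat => 'a mtx"
 where "seq_effect F A w = (%x y. if x \<in> F & y \<in> F then
  ip F (app F (A w) (rejected F A (w - 1) (%z. of_bool (z = x))))
   (app F (A w) (rejected F A (w - 1) (%z. of_bool (z = y)))) else 0)"

text \<open>The effect of all tests failing. The decoder below assigns it to message 1.\<close>

definition seq_rest :: "'a set => (nat => 'a mtx) => nat => 'a mtx"
 where "seq_rest F A M = (%x y. if x \<in> F & y \<in> F then
  ip F (rejected F A M (%z. of_bool (z = x))) (rejected F A M (%z. of_bool (z = y))) else 0)"

lemma positive_mtx_gram:
 assumes "!!x y. A x y = (\<Sum>k\<in>K. cnj (c k x) * c k y)"
 shows "positive_mtx A" unfolding positive_mtx_iff_psd_on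
 by (intro allI impI gram_psd_on[where K = K and \<psi> = "%k x. cnj (c k x)"]) (simp add: assms)

lemma positive_seq:
 "positive_mtx (seq_effect F A w)" "positive_mtx (seq_rest F A M)"
proof -
 show "positive_mtx (seq_effect F A w)" by (rule positive_mtx_gram[where K = F and c = "%k x. if x \<in> F then
   app F (A w) (rejected F A (w - 1) (%z. of_bool (z = x))) k else 0"]) (auto simp: seq_effect_def ip_def)
 show "positive_mtx (seq_rest F A M)" by (rule positive_mtx_gram[where K = F and c = "%k x. if x \<in> F then
   rejected F A M (%z. of_bool (z = x)) k else 0"]) (auto simp: seq_rest_def ip_def)
qed

lemma seq_complete:
 assumes "finite F" "!!i. 1 <= i ==> i <= M ==> projection_on F (A i)"
 shows "seq_rest F A M x y + (\<Sum>w=1..M. seq_effect F A w x y) = of_bool (x = y & x \<in> F)"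
proof (cases "x \<in> F & y \<in> F")
 case True
 have "ip F (%z. of_bool (z = x)) (%z. of_bool (z = y)) = of_bool (x = y)"
  using True assms(1) by (simp add: ip_def sum_of_bool_mult)
 then show ?thesis
  using rejected_telescope[where F = F and A = A and w = M and u = "%z. of_bool (z = x)" and v = "%z. of_bool (z = y)"]
   assms(2) True by (simp add: seq_rest_def seq_effect_def)
qed (auto simp: seq_rest_def seq_effect_def)

lemma app_seq_effect:
 assumes fin: "finite F"
 shows "ip F v (app F (seq_effect F A w) v) = cr (nsq F (app F (A w) (rejected F A (w - 1) v)))"
proof -
 define c where "c = (%y. app F (A w) (rejected F A (w - 1) (%z. of_bool (z = y))))"
 have "app F (A w) (rejected F A (w - 1) v) z = (\<Sum>y\<in>F. v y * c y z)" for z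
 proof -
  have "app F (A w) (rejected F A (w - 1) v) z
   = (\<Sum>x\<in>F. A w z x * (\<Sum>y\<in>F. v y * rejected F A (w - 1) (%z. of_bool (z = y)) x))"
   unfolding app_def using rejected_expand[OF fin] by (intro sum.cong) auto
  also have "... = (\<Sum>x\<in>F. \<Sum>y\<in>F. v y * (A w z x * rejected F A (w - 1) (%z. of_bool (z = y)) x))"
   by (simp add: sum_distrib_left mult_ac)
  also have "... = (\<Sum>y\<in>F. \<Sum>x\<in>F. v y * (A w z x * rejected F A (w - 1) (%z. of_bool (z = y)) x))"
   by (rule sum.swap)
  also have "... = (\<Sum>y\<in>F. v y * c y z)" by (simp add: c_def app_def sum_distrib_left)
  finally show ?thesis .
 qed
 then have "cr (nsq F (app F (A w) (rejected F A (w - 1) v)))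
  = ip F (%z. \<Sum>x\<in>F. v x * c x z) (%z. \<Sum>y\<in>F. v y * c y z)"
  unfolding ip_self[symmetric] by (simp add: ip_def)
 also have "... = (\<Sum>z\<in>F. \<Sum>x\<in>F. \<Sum>y\<in>F. cnj (v x) * (cnj (c x z) * c y z) * v y)"
  by (simp add: ip_def sum_product sum_distrib_left sum_distrib_right mult_ac)
 also have "... = (\<Sum>x\<in>F. \<Sum>y\<in>F. \<Sum>z\<in>F. cnj (v x) * (cnj (c x z) * c y z) * v y)"
  by (rule sum_rotate)
 also have "... = (\<Sum>x\<in>F. \<Sum>y\<in>F. cnj (v x) * seq_effect F A w x y * v y)"
  by (intro sum.cong refl) (simp add: seq_effect_def c_def ip_def sum_distrib_left sum_distrib_right mult_ac)
 finally show ?thesis by (simp add: quad_eq_ip)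
qed

text \<open>The bound for vectors, summed over the Gram vectors of \<open>\<rho>\<close>: the loss
  is at most four times the rejection by the right test plus the false acceptances by the earlier
  ones.\<close>

lemma seq_effect_bound:
 assumes fin: "finite F" and A: "!!i. 1 <= i ==> i <= M ==> projection_on F (A i)"
  and w: "1 <= w" "w <= M" and psd: "psd_on F \<rho>"
 shows "Re (\<Sum>x\<in>F. \<rho> x x) - Re (pairing F (seq_effect F A w) \<rho>)
  <= 4 * (Re (\<Sum>x\<in>F. \<rho> x x) - Re (pairing F (A w) \<rho>) + (\<Sum>i=1..<w. Re (pairing F (A i) \<rho>)))"
proof -
 obtain \<psi> where \<psi>: "!!x y. x \<in> F ==> y \<in> F ==> \<rho> x y = (\<Sum>k\<in>F. \<psi> k x * cnj (\<psi> k y))"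
  using psd_on_gram[OF fin psd] by metis
 have tr: "Re (\<Sum>x\<in>F. \<rho> x x) = (\<Sum>k\<in>F. nsq F (\<psi> k))"
 proof -
  have "(\<Sum>x\<in>F. \<rho> x x) = (\<Sum>x\<in>F. \<Sum>k\<in>F. cnj (\<psi> k x) * \<psi> k x)"
   using \<psi> by (simp add: mult.commute)
  also have "... = (\<Sum>k\<in>F. ip F (\<psi> k) (\<psi> k))" unfolding ip_def by (rule sum.swap)
  finally show ?thesis by (simp add: ip_self)
 qed
 have pr: "Re (pairing F (A i) \<rho>) = (\<Sum>k\<in>F. nsq F (app F (A i) (\<psi> k)))" if "1 <= i" "i <= M" for i
 proof -
  have "pairing F (A i) \<rho> = (\<Sum>k\<in>F. ip F (\<psi> k) (app F (A i) (\<psi> k)))"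
   by (rule pairing_gram) (rule \<psi>)
  also have "... = (\<Sum>k\<in>F. cr (nsq F (app F (A i) (\<psi> k))))"
   unfolding ip_self[symmetric] by (intro sum.cong refl ip_projection A that)
  finally show ?thesis by simp
 qed
 have sq: "Re (pairing F (seq_effect F A w) \<rho>) = (\<Sum>k\<in>F. nsq F (app F (A w) (rejected F A (w - 1) (\<psi> k))))"
  using pairing_gram[where F = F and B = \<rho> and K = F and \<psi> = \<psi> and A = "seq_effect F A w", OF \<psi>] by (simp add: app_seq_effect[OF fin])
 have comp: "nsq F (%x. v x - app F (A w) v x) = nsq F v - nsq F (app F (A w) v)" for v
 proof -
  have "cr (nsq F (%x. v x - app F (A w) v x)) = cr (nsq F v - nsq F (app F (A w) v))"
   using ip_projection_complement[OF A[OF w], of v v] by (simp add: ip_self)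
  then show ?thesis unfolding of_real_eq_iff .
 qed
 have "Re (\<Sum>x\<in>F. \<rho> x x) - Re (pairing F (seq_effect F A w) \<rho>)
  = (\<Sum>k\<in>F. nsq F (\<psi> k) - nsq F (app F (A w) (rejected F A (w - 1) (\<psi> k))))"
  by (simp only: tr sq sum_subtractf)
 also have "... <= (\<Sum>k\<in>F. 4 * (nsq F (%x. \<psi> k x - app F (A w) (\<psi> k) x) + (\<Sum>i=1..<w. nsq F (app F (A i) (\<psi> k)))))"
  using A w by (intro sum_mono nsq_rejected_bound[OF fin]) auto
 also have "... = 4 * ((\<Sum>k\<in>F. nsq F (\<psi> k)) - (\<Sum>k\<in>F. nsq F (app F (A w) (\<psi> k)))
   + (\<Sum>i=1..<w. \<Sum>k\<in>F. nsq F (app F (A i) (\<psi> k))))"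
  unfolding comp sum_distrib_left[symmetric] sum.distrib sum_subtractf by (subst sum.swap) simp
 also have "(\<Sum>i=1..<w. \<Sum>k\<in>F. nsq F (app F (A i) (\<psi> k))) = (\<Sum>i=1..<w. Re (pairing F (A i) \<rho>))"
  using w by (intro sum.cong) (auto simp: pr)
 finally show ?thesis by (simp only: tr pr[OF w])
qed

section \<open>The trace norm of a block diagonal difference of positive matrices\<close>

lemma has_sum_finite_sum:
 fixes f :: "'b => 'a => 'c::topological_comm_monoid_add"
 assumes "finite K" "!!k. k \<in> K ==> (f k has_sum s k) A"
 shows "((%x. \<Sum>k\<in>K. f k x) has_sum (\<Sum>k\<in>K. s k)) A"
 using assms by (induction K rule: finite_induct) (auto intro: has_sum_add)

lemma summable_on_finite_sum:
 fixes f :: "'b => 'a => 'c::{topological_comm_monoid_add, t2_space}"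
 assumes "finite K" "!!k. k \<in> K ==> f k summable_on A"
 shows "(%x. \<Sum>k\<in>K. f k x) summable_on A"
 using has_sum_finite_sum[OF assms(1), of f A "%k. infsum (f k) A"] assms(2) by (auto simp: summable_on_def)

lemma infsum_finite_sum:
 fixes f :: "'b => 'a => 'c::{topological_comm_monoid_add, t2_space}"
 assumes "finite K" "!!k. k \<in> K ==> f k summable_on A"
 shows "infsum (%x. \<Sum>k\<in>K. f k x) A = (\<Sum>k\<in>K. infsum (f k) A)"
 using assms by (intro infsumI has_sum_finite_sum has_sum_infsum)

lemma positive_mtx_hermitian:
 assumes "positive_mtx Q"
 shows "Q y x = cnj (Q x y)"
proof -
 have "hermitian_on {x, y} Q" using assms by (intro psd_on_hermitian) (auto simp: positive_mtx_iff_psd_on)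
 then show ?thesis unfolding hermitian_on_def by blast
qed

lemma positive_mtx_diag:
 assumes "positive_mtx S"
 shows "S x x \<in> \<real>\<^sub>\<ge>\<^sub>0"
 using assms[unfolded positive_mtx_def, rule_format, of "{x}" "%_. 1"] by simp

lemma square_summable_add:
 fixes f g :: "'a => complex"
 assumes "(%x. (cmod (f x))\<^sup>2) summable_on UNIV" "(%x. (cmod (g x))\<^sup>2) summable_on UNIV"
 shows "(%x. (cmod (f x + g x))\<^sup>2) summable_on UNIV"
proof (rule summable_on_comparison_test)
 show "(%x. 2 * (cmod (f x))\<^sup>2 + 2 * (cmod (g x))\<^sup>2) summable_on UNIV"
  using assms by (intro summable_on_add summable_on_cmult_right)
 fix x
 have "(cmod (f x + g x))\<^sup>2 <= (cmod (f x) + cmod (g x))\<^sup>2" by (intro power_mono norm_triangle_ineq) auto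
 also have "... <= 2 * (cmod (f x))\<^sup>2 + 2 * (cmod (g x))\<^sup>2"
  using zero_le_power2[of "cmod (f x) - cmod (g x)"] by (simp add: power2_eq_square algebra_simps)
 finally show "(cmod (f x + g x))\<^sup>2 <= 2 * (cmod (f x))\<^sup>2 + 2 * (cmod (g x))\<^sup>2" .
qed auto

lemma square_summable_sum:
 fixes f :: "'b => 'a => complex"
 assumes "finite K" "!!k. k \<in> K ==> (%x. (cmod (f k x))\<^sup>2) summable_on UNIV"
 shows "(%x. (cmod (\<Sum>k\<in>K. f k x))\<^sup>2) summable_on UNIV" using assms
proof (induction K rule: finite_induct)
 case (insert k K)
 then show ?case by (simp add: square_summable_add)
qed simp

lemma square_summable_mult:
 fixes f g :: "'a => complex"
 assumes "(%x. (cmod (f x))\<^sup>2) summable_on UNIV" "(%x. (cmod (g x))\<^sup>2) summable_on UNIV"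
 shows "(%x. f x * g x) summable_on UNIV"
proof (rule abs_summable_summable, rule summable_on_comparison_test)
 show "(%x. (cmod (f x))\<^sup>2 + (cmod (g x))\<^sup>2) summable_on UNIV" using assms by (intro summable_on_add)
 fix x
 show "norm (f x * g x) <= (cmod (f x))\<^sup>2 + (cmod (g x))\<^sup>2"
  using sum_squares_bound[of "cmod (f x)" "cmod (g x)"] mult_nonneg_nonneg[OF norm_ge_zero norm_ge_zero, of "f x" "g x"]
  unfolding norm_mult by linarith
qed auto

section \<open>Uniqueness of the positive bounded square root on finitely supported
  eigenvectors\<close>

context
 fixes Q :: "'a mtx" and c :: real
 assumes pos: "positive_mtx Q"
  and bd: "!!F u v. finite F ==> cmod (\<Sum>x\<in>F. \<Sum>y\<in>F. cnj (u x) * Q x y * v y)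
    <= c * L2_set (%x. cmod (u x)) F * L2_set (%y. cmod (v y)) F"
begin

lemma bound_nonneg: "c >= 0"
proof -
 have "0 <= cmod (\<Sum>x\<in>{undefined}. \<Sum>y\<in>{undefined}. cnj 1 * Q x y * 1)" by (rule norm_ge_zero)
 also have "... <= c * L2_set (%x. cmod 1) {undefined} * L2_set (%y. cmod 1) {undefined}"
  using bd[of "{undefined}" "%_. 1" "%_. 1"] by simp
 finally show ?thesis by (simp add: L2_set_def)
qed

text \<open>Testing the bound with the column itself and a basis vector gives
  \<open>s <= c * sqrt s\<close> for every finite part \<open>s\<close> of the sum.\<close>

lemma column_square_summable: "(%x. (cmod (Q x y))\<^sup>2) summable_on UNIV"
proof (rule nonneg_bdd_above_summable_on)
 show "bdd_above (sum (%x. (cmod (Q x y))\<^sup>2) ` {F. F \<subseteq> UNIV & finite F})"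
 proof (rule bdd_aboveI2)
  fix F :: "'a set" assume "F \<in> {F. F \<subseteq> UNIV & finite F}"
  then have fin: "finite (insert y F)" by simp
  define s where "s = (\<Sum>x\<in>insert y F. (cmod (Q x y))\<^sup>2)"
  have s0: "s >= 0" by (simp add: s_def sum_nonneg)
  have "(\<Sum>x\<in>insert y F. \<Sum>z\<in>insert y F. cnj (Q x y) * Q x z * of_bool (z = y)) =
   (\<Sum>x\<in>insert y F. cnj (Q x y) * Q x y)" using fin by (intro sum.cong refl sum_of_bool_mult) auto
  also have "... = cr s" by (simp add: s_def complex_norm_square mult.commute del: of_real_power)
  finally have "s = cmod (\<Sum>x\<in>insert y F. \<Sum>z\<in>insert y F. cnj (Q x y) * Q x z * of_bool (z = y))"
   using s0 by simp
  also have "... <= c * L2_set (%x. cmod (Q x y)) (insert y F) * L2_set (%z. cmod (of_bool (z = y))) (insert y F)"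
   by (rule bd[OF fin])
  also have "L2_set (%x. cmod (Q x y)) (insert y F) = sqrt s" by (simp add: L2_set_def s_def)
  also have "L2_set (%z. cmod (of_bool (z = y))) (insert y F) = 1"
  proof -
   have "(\<Sum>z\<in>insert y F. (cmod (of_bool (z = y)))\<^sup>2) = (\<Sum>z\<in>insert y F. of_bool (z = y) * (1::real))"
    by (intro sum.cong) (auto simp: of_bool_def)
   also have "... = 1" using fin by (subst sum_of_bool_mult) auto
   finally show ?thesis by (simp add: L2_set_def)
  qed
  finally have "sqrt s * sqrt s <= c * sqrt s" using s0 by simp
  then have "sqrt s <= c \<or> s = 0" using s0 by (simp only: mult_le_cancel_right) auto
  then have "s <= c^2" using s0 real_le_lsqrt[of s c] bound_nonneg
   by (metis power_mono real_sqrt_ge_zero real_sqrt_pow2 zero_le_power2)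
  moreover have "sum (%x. (cmod (Q x y))\<^sup>2) F <= s" unfolding s_def using fin by (intro sum_mono2) auto
  ultimately show "sum (%x. (cmod (Q x y))\<^sup>2) F <= c^2" by simp
 qed
qed simp

lemma row_square_summable: "(%y. (cmod (Q x y))\<^sup>2) summable_on UNIV"
proof -
 have "(%y. (cmod (Q x y))\<^sup>2) = (%y. (cmod (Q y x))\<^sup>2)"
  using positive_mtx_hermitian[OF pos] by (metis complex_mod_cnj)
 then show ?thesis using column_square_summable by metis
qed

text \<open>On a finite truncation of \<open>w\<close> the form is nonnegative, while the eigenvalue
  equation makes it nearly \<open>- l * W\<close>. Boundedness controls the difference by the norm
  of the tail.\<close>

lemma no_negative_eigenvector:
 assumes w: "(%x. (cmod (w x))\<^sup>2) summable_on UNIV"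
  and eig: "!!x. (\<Sum>\<^sub>\<infinity>y. Q x y * w y) = - cr l * w x" and l: "l > 0"
 shows "w x = 0"
proof (rule ccontr)
 assume "w x ~= 0"
 define W where "W = (\<Sum>\<^sub>\<infinity>x. (cmod (w x))\<^sup>2)"
 have "(cmod (w x))\<^sup>2 <= W" using finite_sum_le_infsum[OF w, of "{x}"] by (simp add: W_def)
 then have W: "W > 0" using \<open>w x ~= 0\<close> by (meson less_le_trans zero_less_norm_iff zero_less_power)
 have key: "l * (W - \<epsilon>) <= c * sqrt W * sqrt \<epsilon>" if e: "\<epsilon> > 0" for \<epsilon>
 proof -
  obtain G where G: "finite G" "dist (\<Sum>x\<in>G. (cmod (w x))\<^sup>2) W <= \<epsilon>"
   using infsum_finite_approximation[OF w e] unfolding W_def by auto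
  have Gle: "(\<Sum>x\<in>H. (cmod (w x))\<^sup>2) <= W" if "finite H" for H
   unfolding W_def using that by (intro finite_sum_le_infsum w) auto
  have GW: "W - \<epsilon> <= (\<Sum>x\<in>G. (cmod (w x))\<^sup>2)"
   using G(2) by (simp add: dist_real_def abs_le_iff)
  define B where "B = (%H. \<Sum>x\<in>G. \<Sum>y\<in>H. cnj (w x) * Q x y * w y)"
  \<comment> \<open>The restrictions of \<open>w\<close> to \<open>G\<close> and to
    \<open>H - G\<close> have norms at most \<open>sqrt W\<close> and
    \<open>sqrt \<epsilon>\<close>.\<close>
  have tail: "cmod (B H - B G) <= c * sqrt W * sqrt \<epsilon>" if H: "finite H" "G \<subseteq> H" for H
  proof -
   define v where "v = (%y. if y \<in> G then 0 else w y)"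
   define u where "u = (%y. if y \<in> G then w y else 0)"
   have "B H - B G = (\<Sum>x\<in>G. \<Sum>y\<in>H - G. cnj (w x) * Q x y * w y)"
    unfolding B_def sum_subtractf[symmetric] using H G(1) by (intro sum.cong refl) (simp add: sum_diff finite_subset)
   also have "... = (\<Sum>x\<in>G. \<Sum>y\<in>H. cnj (u x) * Q x y * v y)"
    by (intro sum.cong refl sum.mono_neutral_cong_left) (use H in \<open>auto simp: u_def v_def\<close>)
   also have "... = (\<Sum>x\<in>H. \<Sum>y\<in>H. cnj (u x) * Q x y * v y)"
    by (rule sum.mono_neutral_left) (use H in \<open>auto simp: u_def\<close>)
   finally have "cmod (B H - B G) <= c * L2_set (%x. cmod (u x)) H * L2_set (%y. cmod (v y)) H"
    using bd[OF H(1), of u v] by simp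
   also have "L2_set (%x. cmod (u x)) H <= sqrt W"
   proof -
    have "(\<Sum>x\<in>H. (cmod (u x))\<^sup>2) <= (\<Sum>x\<in>H. (cmod (w x))\<^sup>2)"
     by (intro sum_mono) (auto simp: u_def)
    then show ?thesis unfolding L2_set_def using Gle[OF H(1)] by simp
   qed
   also have "L2_set (%y. cmod (v y)) H <= sqrt \<epsilon>"
   proof -
    have "(\<Sum>x\<in>H. (cmod (v x))\<^sup>2) = (\<Sum>x\<in>H - G. (cmod (w x))\<^sup>2)"
     by (rule sum.mono_neutral_cong_right) (use H in \<open>auto simp: v_def\<close>)
    also have "... = (\<Sum>x\<in>H. (cmod (w x))\<^sup>2) - (\<Sum>x\<in>G. (cmod (w x))\<^sup>2)"
     using H G(1) by (simp add: sum_diff)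
    also have "... <= \<epsilon>" using Gle[OF H(1)] GW by simp
    finally show ?thesis unfolding L2_set_def by simp
   qed
   finally show ?thesis using bound_nonneg W e by (simp add: mult_left_mono mult_right_mono mult_mono)
  qed
  have lim: "(B \<longlongrightarrow> (\<Sum>x\<in>G. cnj (w x) * (- cr l * w x))) (finite_subsets_at_top UNIV)"
  proof -
   have "((%H. \<Sum>x\<in>G. cnj (w x) * (\<Sum>y\<in>H. Q x y * w y)) \<longlongrightarrow>
     (\<Sum>x\<in>G. cnj (w x) * (\<Sum>\<^sub>\<infinity>y. Q x y * w y))) (finite_subsets_at_top UNIV)"
    by (intro tendsto_sum tendsto_mult tendsto_const infsum_tendsto
      square_summable_mult row_square_summable w)
   then show ?thesis unfolding B_def eig by (simp add: sum_distrib_left mult.assoc)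
  qed
  have "(\<Sum>x\<in>G. cnj (w x) * (- cr l * w x)) = - cr (l * (\<Sum>x\<in>G. (cmod (w x))\<^sup>2))"
   by (simp add: sum_negf sum_distrib_left complex_norm_square mult_ac del: of_real_power)
  moreover have "cmod ((\<Sum>x\<in>G. cnj (w x) * (- cr l * w x)) - B G) <= c * sqrt W * sqrt \<epsilon>"
  proof (rule tendsto_upperbound)
   show "((%H. cmod (B H - B G)) \<longlongrightarrow>
    cmod ((\<Sum>x\<in>G. cnj (w x) * (- cr l * w x)) - B G)) (finite_subsets_at_top UNIV)"
    by (intro tendsto_norm tendsto_diff lim tendsto_const)
   show "\<forall>\<^sub>F H in finite_subsets_at_top UNIV. cmod (B H - B G) <= c * sqrt W * sqrt \<epsilon>"
    unfolding eventually_finite_subsets_at_top using G(1) tail by blast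
  qed simp
  moreover have "B G \<in> \<real>\<^sub>\<ge>\<^sub>0" using pos G(1) unfolding positive_mtx_def B_def by blast
  then obtain b where b: "B G = cr b" "b >= 0" by (metis nonneg_Reals_cases)
  ultimately have "cmod (cr (- (l * (\<Sum>x\<in>G. (cmod (w x))\<^sup>2)) - b)) <= c * sqrt W * sqrt \<epsilon>"
   by simp
  then have "l * (\<Sum>x\<in>G. (cmod (w x))\<^sup>2) <= c * sqrt W * sqrt \<epsilon>"
   unfolding norm_of_real using b(2) by linarith
  then show ?thesis using mult_left_mono[OF GW, of l] l by linarith
 qed
 have "((%\<epsilon>. c * sqrt W * sqrt \<epsilon> - l * (W - \<epsilon>)) \<longlongrightarrow> c * sqrt W * sqrt 0 - l * (W - 0)) (at_right 0)"
  by (intro tendsto_intros)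
 moreover have "\<forall>\<^sub>F \<epsilon> in at_right 0. 0 <= c * sqrt W * sqrt \<epsilon> - l * (W - \<epsilon>)"
  using key by (auto simp: eventually_at_right_less intro: eventually_mono[OF eventually_at_right_less])
 ultimately have "0 <= c * sqrt W * sqrt 0 - l * (W - 0)" by (rule tendsto_lowerbound) simp
 then show False using mult_pos_pos[OF l W] by simp
qed

text \<open>The vector \<open>w = (Q - l) v\<close> is annihilated by \<open>Q + l\<close>. For
  \<open>l > 0\<close> this excludes a nonzero \<open>w\<close>; for \<open>l = 0\<close> the
  squared norm of \<open>w = Q v\<close> is the inner product of \<open>v\<close> with
  \<open>Q w = 0\<close>.\<close>

lemma sqrt_eigenvector:
 assumes fin: "finite E" and supp: "!!x. x \<notin> E ==> v x = 0"
  and eig: "!!x. (\<Sum>y\<in>E. (Q \<odot> Q) x y * v y) = cr (l^2) * v x" and l: "l >= 0"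
 shows "(\<Sum>y\<in>E. Q x y * v y) = cr l * v x"
proof -
 define w where "w = (%x. (\<Sum>y\<in>E. Q x y * v y) + (- cr l) * v x)"
 have l2v: "(%x. (cmod (a * v x))\<^sup>2) summable_on UNIV" for a
  by (rule finite_nonzero_values_imp_summable_on, rule finite_subset[OF _ fin]) (use supp in auto)
 have l2Q: "(%x. (cmod (Q x y * v y))\<^sup>2) summable_on UNIV" for y
  using summable_on_cmult_left[OF column_square_summable[of y], of "(cmod (v y))\<^sup>2"]
  by (simp add: norm_mult power_mult_distrib)
 have l2w: "(%x. (cmod (w x))\<^sup>2) summable_on UNIV"
  unfolding w_def by (intro square_summable_add square_summable_sum fin l2v l2Q)
 have sumQQ: "(%z. Q x z * Q z y) summable_on UNIV" for x y
  by (intro square_summable_mult row_square_summable column_square_summable)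
 have Qv: "(\<Sum>\<^sub>\<infinity>z. Q x z * v z) = (\<Sum>y\<in>E. Q x y * v y)" for x
  using fin supp by (subst infsum_cong_neutral[of E UNIV _ "%z. Q x z * v z"]) auto
 have Qw: "(\<Sum>\<^sub>\<infinity>z. Q x z * w z) = - cr l * w x" for x
 proof -
  have s1: "(%z. \<Sum>y\<in>E. Q x z * Q z y * v y) summable_on UNIV"
   by (intro summable_on_finite_sum fin summable_on_cmult_left sumQQ)
  have s2: "(%z. - cr l * (Q x z * v z)) summable_on UNIV"
   by (rule finite_nonzero_values_imp_summable_on, rule finite_subset[OF _ fin]) (use supp in auto)
  have "(\<Sum>\<^sub>\<infinity>z. Q x z * w z) = (\<Sum>\<^sub>\<infinity>z. (\<Sum>y\<in>E. Q x z * Q z y * v y) + - cr l * (Q x z * v z))"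
   by (rule infsum_cong) (simp add: w_def algebra_simps sum_distrib_left)
  also have "... = (\<Sum>\<^sub>\<infinity>z. \<Sum>y\<in>E. Q x z * Q z y * v y) + (\<Sum>\<^sub>\<infinity>z. - cr l * (Q x z * v z))"
   by (rule infsum_add[OF s1 s2])
  also have "(\<Sum>\<^sub>\<infinity>z. \<Sum>y\<in>E. Q x z * Q z y * v y) = (\<Sum>y\<in>E. \<Sum>\<^sub>\<infinity>z. Q x z * Q z y * v y)"
   by (intro infsum_finite_sum fin summable_on_cmult_left sumQQ)
  also have "... = (\<Sum>y\<in>E. (Q \<odot> Q) x y * v y)" using sumQQ by (simp add: mtx_mult_def infsum_cmult_left)
  also have "(\<Sum>\<^sub>\<infinity>z. - cr l * (Q x z * v z)) = - cr l * (\<Sum>y\<in>E. Q x y * v y)"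
   by (simp only: infsum_cmult_right' Qv)
  finally show ?thesis unfolding eig by (simp add: w_def power2_eq_square algebra_simps)
 qed
 have "w x = 0" for x
 proof (cases "l = 0")
  case False
  then show ?thesis using no_negative_eigenvector[OF l2w Qw] l by simp
 next
  case True
  have Qcw: "(%z. cnj (Q z y) * w z) summable_on UNIV" for y
   using square_summable_mult[OF row_square_summable l2w, of y] by (simp add: positive_mtx_hermitian[OF pos, of y])
  have "(\<Sum>\<^sub>\<infinity>z. cr ((cmod (w z))\<^sup>2)) = (\<Sum>\<^sub>\<infinity>z. \<Sum>y\<in>E. (cnj (Q z y) * w z) * cnj (v y))"
  proof (rule infsum_cong)
   fix z
   have "cr ((cmod (w z))\<^sup>2) = cnj (w z) * w z"
    by (simp add: complex_norm_square mult.commute del: of_real_power)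
   also have "cnj (w z) = (\<Sum>y\<in>E. cnj (Q z y) * cnj (v y))" by (simp add: w_def True)
   finally show "cr ((cmod (w z))\<^sup>2) = (\<Sum>y\<in>E. (cnj (Q z y) * w z) * cnj (v y))"
    by (simp add: sum_distrib_left mult_ac)
  qed
  also have "... = (\<Sum>y\<in>E. \<Sum>\<^sub>\<infinity>z. (cnj (Q z y) * w z) * cnj (v y))"
   by (intro infsum_finite_sum fin summable_on_cmult_left Qcw)
  also have "... = (\<Sum>y\<in>E. (\<Sum>\<^sub>\<infinity>z. Q y z * w z) * cnj (v y))"
   by (simp only: infsum_cmult_left' positive_mtx_hermitian[OF pos, symmetric])
  also have "... = 0" by (simp add: Qw True)
  finally have "cr (\<Sum>\<^sub>\<infinity>z. (cmod (w z))\<^sup>2) = 0"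
   using has_sum_of_real[OF has_sum_infsum[OF l2w], where 'a = complex] infsumI by metis
  then have "(\<Sum>\<^sub>\<infinity>z. (cmod (w z))\<^sup>2) <= 0" by simp
  then have "(cmod (w x))\<^sup>2 = 0" by (rule nonneg_infsum_le_0D[OF _ l2w]) auto
  then show ?thesis by simp
 qed
 then show ?thesis by (simp add: w_def add_eq_0_iff)
qed

end


section \<open>The modulus of a block diagonal matrix\<close>

lemma sum_over_blocks:
 assumes "finite E"
 shows "(\<Sum>x\<in>E. f x) = (\<Sum>b\<in>blk ` E. \<Sum>x\<in>{x\<in>E. blk x = b}. f x)"
 by (rule sum.image_gen[OF assms])

text \<open>\<open>T\<close> is diagonalised on every finite block, and taking absolute values of
  the eigenvalues gives the matrix selected by \<open>mtx_modulus\<close>. A singleton block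
  contributes the modulus of its entry; any other block is bounded by the traces of
  \<open>S1\<close> and \<open>S2\<close> on it.\<close>

theorem trace_norm_block_le:
 fixes T S1 S2 :: "'a mtx" and blk :: "'a => 'b"
 assumes fin: "!!b. finite {x. blk x = b}"
  and diff: "!!x y. T x y = S1 x y - S2 x y"
  and pos: "positive_mtx S1" "positive_mtx S2"
  and diag: "!!x y. blk x ~= blk y ==> T x y = 0"
  and g: "!!x. g x = (if {y. blk y = blk x} = {x} then cmod (T x x) else Re (S1 x x) + Re (S2 x x))"
  and summ: "g summable_on UNIV"
 shows "trace_norm T <= infsum g UNIV"
proof -
 let ?F = "%b. {x. blk x = b}"
 have hermT: "T y x = cnj (T x y)" for x y
  using positive_mtx_hermitian[OF pos(1), of x y] positive_mtx_hermitian[OF pos(2), of x y] by (simp add: diff)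
 have "hermitian_on F T" for F unfolding hermitian_on_def using hermT by blast
 then have "\<forall>b. \<exists>\<phi> \<mu>. (\<forall>j\<in>?F b. \<forall>k\<in>?F b. ip (?F b) (\<phi> j) (\<phi> k) = of_bool (j = k))
  & (\<forall>k\<in>?F b. \<forall>x\<in>?F b. app (?F b) T (\<phi> k) x = cr (\<mu> k) * \<phi> k x)
  & (\<forall>x\<in>?F b. \<forall>y\<in>?F b. (\<Sum>k\<in>?F b. \<phi> k x * cnj (\<phi> k y)) = of_bool (x = y))
  & (\<forall>x\<in>?F b. \<forall>y\<in>?F b. T x y = (\<Sum>k\<in>?F b. cr (\<mu> k) * \<phi> k x * cnj (\<phi> k y)))"
  using spectral_decomposition[OF fin] by blast
 then obtain \<phi>0 \<mu>0 where A: "\<forall>b. (\<forall>j\<in>?F b. \<forall>k\<in>?F b. ip (?F b) (\<phi>0 b j) (\<phi>0 b k) = of_bool (j = k))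
  & (\<forall>k\<in>?F b. \<forall>x\<in>?F b. app (?F b) T (\<phi>0 b k) x = cr (\<mu>0 b k) * \<phi>0 b k x)
  & (\<forall>x\<in>?F b. \<forall>y\<in>?F b. (\<Sum>k\<in>?F b. \<phi>0 b k x * cnj (\<phi>0 b k y)) = of_bool (x = y))
  & (\<forall>x\<in>?F b. \<forall>y\<in>?F b. T x y = (\<Sum>k\<in>?F b. cr (\<mu>0 b k) * \<phi>0 b k x * cnj (\<phi>0 b k y)))"
  by (elim exE choice[THEN exE])
 define \<phi> \<mu> where "\<phi> = (%k x. if blk k = blk x then \<phi>0 (blk k) k x else 0)" and "\<mu> = (%k. \<mu>0 (blk k) k)"
 have phi_supp: "blk k ~= blk x ==> \<phi> k x = 0" for k x by (simp add: \<phi>_def)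
 have orth: "ip (?F b) (\<phi> j) (\<phi> k) = of_bool (j = k)" if "blk j = b" "blk k = b" for b j k
 proof -
  have "ip (?F b) (\<phi> j) (\<phi> k) = ip (?F b) (\<phi>0 b j) (\<phi>0 b k)"
   using that by (intro ip_cong) (auto simp: \<phi>_def)
  then show ?thesis using A that by simp
 qed
 have eig: "(\<Sum>y\<in>?F b. T x y * \<phi> k y) = cr (\<mu> k) * \<phi> k x" if "blk k = b" "blk x = b" for b k x
 proof -
  have "(\<Sum>y\<in>?F b. T x y * \<phi> k y) = app (?F b) T (\<phi>0 b k) x"
   unfolding app_def using that by (intro sum.cong) (auto simp: \<phi>_def)
  then show ?thesis using A that by (simp add: \<phi>_def \<mu>_def)
 qed
 have compl: "(\<Sum>k\<in>?F b. \<phi> k x * cnj (\<phi> k y)) = of_bool (x = y)" if "blk x = b" "blk y = b" for b x y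
 proof -
  have "(\<Sum>k\<in>?F b. \<phi> k x * cnj (\<phi> k y)) = (\<Sum>k\<in>?F b. \<phi>0 b k x * cnj (\<phi>0 b k y))"
   using that by (intro sum.cong) (auto simp: \<phi>_def)
  then show ?thesis using A that by simp
 qed
 have dec: "T x y = (\<Sum>k\<in>?F b. cr (\<mu> k) * \<phi> k x * cnj (\<phi> k y))" if "blk x = b" "blk y = b" for b x y
 proof -
  have "(\<Sum>k\<in>?F b. cr (\<mu> k) * \<phi> k x * cnj (\<phi> k y))
   = (\<Sum>k\<in>?F b. cr (\<mu>0 b k) * \<phi>0 b k x * cnj (\<phi>0 b k y))"
   using that by (intro sum.cong) (auto simp: \<phi>_def \<mu>_def)
  then show ?thesis using A that by simp
 qed
 \<comment> \<open>Blockwise functional calculus: \<open>M a\<close> has the eigenvalue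
   \<open>a k\<close> on \<open>\<phi> k\<close>, so \<open>T = M \<mu>\<close>, and
   \<open>P\<close> is the candidate for the modulus.\<close>
 define M where "M = (%a x y. if blk x = blk y
  then (\<Sum>k\<in>?F (blk x). cr (a k) * \<phi> k x * cnj (\<phi> k y)) else 0)"
 define P where "P = M (%k. \<bar>\<mu> k\<bar>)"
 have TM: "T = M \<mu>" using dec diag by (auto simp: M_def fun_eq_iff)
 have M_mult: "M a \<odot> M c = M (%k. a k * c k)" for a c
 proof (intro ext)
  fix x y
  show "(M a \<odot> M c) x y = M (%k. a k * c k) x y"
  proof (cases "blk x = blk y")
   case False
   then have 0: "M a x z * M c z y = 0" for z by (cases "blk x = blk z") (auto simp: M_def)
   have "(M a \<odot> M c) x y = 0" unfolding mtx_mult_def 0 by simp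
   then show ?thesis using False by (simp add: M_def)
  next
   case True
   let ?B = "?F (blk x)"
   have "(M a \<odot> M c) x y = (\<Sum>z\<in>?B. M a x z * M c z y)" unfolding mtx_mult_def using fin
    by (subst infsum_cong_neutral[of ?B UNIV _ "%z. M a x z * M c z y"]) (auto simp: M_def)
   also have "... = (\<Sum>z\<in>?B. (\<Sum>k\<in>?B. cr (a k) * \<phi> k x * cnj (\<phi> k z)) *
     (\<Sum>k\<in>?B. cr (c k) * \<phi> k z * cnj (\<phi> k y)))" using True by (intro sum.cong) (auto simp: M_def)
   also have "... = (\<Sum>z\<in>?B. \<Sum>j\<in>?B. \<Sum>k\<in>?B.
     (cr (a j) * cr (c k) * \<phi> j x * cnj (\<phi> k y)) * (cnj (\<phi> j z) * \<phi> k z))"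
    by (simp add: sum_product mult_ac)
   also have "... = (\<Sum>j\<in>?B. \<Sum>k\<in>?B. \<Sum>z\<in>?B.
     (cr (a j) * cr (c k) * \<phi> j x * cnj (\<phi> k y)) * (cnj (\<phi> j z) * \<phi> k z))" by (rule sum_rotate)
   also have "... = (\<Sum>j\<in>?B. \<Sum>k\<in>?B.
     (cr (a j) * cr (c k) * \<phi> j x * cnj (\<phi> k y)) * ip ?B (\<phi> j) (\<phi> k))"
    by (simp add: ip_def sum_distrib_left)
   also have "... = (\<Sum>j\<in>?B. \<Sum>k\<in>?B.
     (cr (a j) * cr (c k) * \<phi> j x * cnj (\<phi> k y)) * of_bool (j = k))" using orth by (intro sum.cong) auto
   also have "... = (\<Sum>j\<in>?B. cr (a j) * cr (c j) * \<phi> j x * cnj (\<phi> j y))"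
    using fin by (intro sum.cong refl sum_of_bool_mult) auto
   finally show ?thesis using True by (simp add: M_def)
  qed
 qed
 have adjT: "mtx_adjoint T = T" unfolding mtx_adjoint_def by (intro ext) (rule hermT[symmetric])
 have PP: "P \<odot> P = mtx_adjoint T \<odot> T"
  unfolding adjT P_def by (subst (1 2) TM) (simp add: M_mult flip: power2_eq_square abs_mult)
 have g0: "g x >= 0" for x
 proof -
  have "Re (S x x) >= 0" if "positive_mtx S" for S :: "'a mtx"
   using positive_mtx_diag[OF that, of x] by (simp add: complex_nonneg_Reals_iff)
  then show ?thesis using pos by (simp add: g)
 qed
 have block_bound: "(\<Sum>k\<in>?F b. \<bar>\<mu> k\<bar>) <= (\<Sum>x\<in>?F b. g x)" for b
 proof (cases "\<exists>x. ?F b = {x}")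
  case True
  then obtain x where x: "?F b = {x}" by blast
  then have b: "blk x = b" by blast
  have "\<phi> x x * cnj (\<phi> x x) = 1" using compl[OF b b] x by simp
  then have "T x x = cr (\<mu> x)" using dec[OF b b] x by (simp add: mult.assoc)
  then show ?thesis using x b by (simp add: g)
 next
  case False
  \<comment> \<open>An eigenvalue is a difference of two nonnegative forms; their sum over an
    eigenbasis is the trace of the block.\<close>
  have mu: "\<bar>\<mu> k\<bar> <= Re (ip (?F b) (\<phi> k) (app (?F b) S1 (\<phi> k))) + Re (ip (?F b) (\<phi> k) (app (?F b) S2 (\<phi> k)))"
   if k: "blk k = b" for k
  proof -
   have e: "app (?F b) T (\<phi> k) = (%x. app (?F b) S1 (\<phi> k) x - app (?F b) S2 (\<phi> k) x)"
    by (simp add: app_def diff left_diff_distrib sum_subtractf)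
   have "ip (?F b) (\<phi> k) (app (?F b) S1 (\<phi> k)) - ip (?F b) (\<phi> k) (app (?F b) S2 (\<phi> k))
    = ip (?F b) (\<phi> k) (app (?F b) T (\<phi> k))" unfolding e ip_diff_right ..
   also have "... = ip (?F b) (\<phi> k) (%x. cr (\<mu> k) * \<phi> k x)"
    using eig[OF k] by (intro ip_cong) (auto simp: app_def)
   also have "... = cr (\<mu> k)" unfolding ip_scale_right using orth[OF k k] by simp
   finally have "\<mu> k = Re (ip (?F b) (\<phi> k) (app (?F b) S1 (\<phi> k))) - Re (ip (?F b) (\<phi> k) (app (?F b) S2 (\<phi> k)))"
    by (metis Re_complex_of_real minus_complex.simps(1))
   moreover have "Re (ip (?F b) (\<phi> k) (app (?F b) S (\<phi> k))) >= 0" if "positive_mtx S" for S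
    using that fin unfolding positive_mtx_def quad_eq_ip by (metis complex_nonneg_Reals_iff)
   ultimately show ?thesis using pos by (smt (verit))
  qed
  have tr: "(\<Sum>k\<in>?F b. ip (?F b) (\<phi> k) (app (?F b) S (\<phi> k))) = (\<Sum>x\<in>?F b. S x x)" for S :: "'a mtx"
  proof -
   have "(\<Sum>k\<in>?F b. ip (?F b) (\<phi> k) (app (?F b) S (\<phi> k)))
    = (\<Sum>k\<in>?F b. \<Sum>x\<in>?F b. \<Sum>y\<in>?F b. S x y * (\<phi> k y * cnj (\<phi> k x)))"
    by (simp add: ip_def app_def sum_distrib_left mult_ac)
   also have "... = (\<Sum>x\<in>?F b. \<Sum>y\<in>?F b. \<Sum>k\<in>?F b. S x y * (\<phi> k y * cnj (\<phi> k x)))"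
    by (rule sum_rotate)
   also have "... = (\<Sum>x\<in>?F b. \<Sum>y\<in>?F b. S x y * of_bool (y = x))"
    using compl by (simp add: sum_distrib_left[symmetric])
   also have "... = (\<Sum>x\<in>?F b. S x x)" using fin by (intro sum.cong refl sum_of_bool_mult) auto
   finally show ?thesis .
  qed
  have "(\<Sum>k\<in>?F b. \<bar>\<mu> k\<bar>) <= (\<Sum>k\<in>?F b. Re (ip (?F b) (\<phi> k) (app (?F b) S1 (\<phi> k)))
    + Re (ip (?F b) (\<phi> k) (app (?F b) S2 (\<phi> k))))" using mu by (intro sum_mono) auto
  also have "... = Re (\<Sum>x\<in>?F b. S1 x x) + Re (\<Sum>x\<in>?F b. S2 x x)"
   unfolding tr[symmetric] by (simp add: sum.distrib)
  also have "... = (\<Sum>x\<in>?F b. g x)"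
  proof -
   have "g x = Re (S1 x x) + Re (S2 x x)" if "x \<in> ?F b" for x using that False by (auto simp: g)
   then show ?thesis by (simp add: sum.distrib)
  qed
  finally show ?thesis .
 qed
 \<comment> \<open>The union of the blocks met by a finite set. It is finite and contains whole
   blocks, so orthonormality and completeness hold on it.\<close>
 define sat where "sat = (%E. \<Union>b\<in>blk ` E. ?F b)"
 have fin_sat: "finite (sat E)" if "finite E" for E using that fin by (auto simp: sat_def)
 have sub_sat: "E \<subseteq> sat E" for E by (auto simp: sat_def)
 have sat_block: "{x \<in> sat E. blk x = b} = ?F b" if "b \<in> blk ` sat E" for E b
  using that by (auto simp: sat_def)
 have sat_F: "?F (blk x) \<subseteq> sat E" if "x \<in> sat E" for x E using that by (auto simp: sat_def)
 have sum_sat: "(\<Sum>x\<in>sat E. \<bar>\<mu> x\<bar>) <= infsum g UNIV" if E: "finite E" for E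
 proof -
  have "(\<Sum>x\<in>sat E. \<bar>\<mu> x\<bar>) = (\<Sum>b\<in>blk ` sat E. \<Sum>x\<in>{x\<in>sat E. blk x = b}. \<bar>\<mu> x\<bar>)"
   by (rule sum_over_blocks[OF fin_sat[OF E]])
  also have "... <= (\<Sum>b\<in>blk ` sat E. \<Sum>x\<in>{x\<in>sat E. blk x = b}. g x)"
  proof (rule sum_mono)
   fix b assume "b \<in> blk ` sat E"
   then show "(\<Sum>x\<in>{x\<in>sat E. blk x = b}. \<bar>\<mu> x\<bar>) <= (\<Sum>x\<in>{x\<in>sat E. blk x = b}. g x)"
    using block_bound[of b] by (simp only: sat_block)
  qed
  also have "... = (\<Sum>x\<in>sat E. g x)" by (rule sum_over_blocks[OF fin_sat[OF E], symmetric])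
  also have "... <= infsum g UNIV" using g0 by (intro finite_sum_le_infsum summ fin_sat E) auto
  finally show ?thesis .
 qed
 define c where "c = infsum g UNIV"
 have mu_le: "\<bar>\<mu> k\<bar> <= c" for k
 proof -
  have "\<bar>\<mu> k\<bar> <= (\<Sum>x\<in>sat {k}. \<bar>\<mu> x\<bar>)"
   using fin_sat[of "{k}"] sub_sat[of "{k}"] by (intro member_le_sum) auto
  then show ?thesis using sum_sat[of "{k}"] by (simp add: c_def)
 qed
 have c0: "c >= 0" using mu_le[of undefined] by linarith
 have P_sat: "P x y = (\<Sum>k\<in>sat E. cr \<bar>\<mu> k\<bar> * \<phi> k x * cnj (\<phi> k y))"
  if "finite E" "x \<in> sat E" "y \<in> sat E" for x y E
 proof (cases "blk x = blk y")
  case True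
  then have "P x y = (\<Sum>k\<in>?F (blk x). cr \<bar>\<mu> k\<bar> * \<phi> k x * cnj (\<phi> k y))"
   by (simp add: P_def M_def)
  also have "... = (\<Sum>k\<in>sat E. cr \<bar>\<mu> k\<bar> * \<phi> k x * cnj (\<phi> k y))"
   using fin_sat[OF that(1)] sat_F[OF that(2)] phi_supp by (intro sum.mono_neutral_left) auto
  finally show ?thesis .
 next
  case False
  then have "\<phi> k x * cnj (\<phi> k y) = 0" for k using phi_supp by (cases "blk k = blk x") auto
  then have "(\<Sum>k\<in>sat E. cr \<bar>\<mu> k\<bar> * \<phi> k x * cnj (\<phi> k y)) = 0"
   by (intro sum.neutral) (simp add: mult.assoc)
  then show ?thesis using False by (simp add: P_def M_def)
 qed
 have posP: "positive_mtx P" unfolding positive_mtx_iff_psd_on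
 proof (intro allI impI)
  fix E :: "'a set" assume E: "finite E"
  show "psd_on E P"
  proof (rule gram_psd_on[where K = "sat E" and \<psi> = "%k x. cr (sqrt \<bar>\<mu> k\<bar>) * \<phi> k x"])
   fix x y assume "x \<in> E" "y \<in> E"
   then have "P x y = (\<Sum>k\<in>sat E. cr \<bar>\<mu> k\<bar> * \<phi> k x * cnj (\<phi> k y))"
    using sub_sat by (intro P_sat E) auto
   also have "... = (\<Sum>k\<in>sat E. cr (sqrt \<bar>\<mu> k\<bar>) * \<phi> k x * cnj (cr (sqrt \<bar>\<mu> k\<bar>) * \<phi> k y))"
   proof (rule sum.cong)
    fix k
    have "cr \<bar>\<mu> k\<bar> = cr (sqrt \<bar>\<mu> k\<bar>) * cr (sqrt \<bar>\<mu> k\<bar>)"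
     by (simp flip: of_real_mult)
    then show "cr \<bar>\<mu> k\<bar> * \<phi> k x * cnj (\<phi> k y) =
     cr (sqrt \<bar>\<mu> k\<bar>) * \<phi> k x * cnj (cr (sqrt \<bar>\<mu> k\<bar>) * \<phi> k y)"
     by (simp add: mult_ac)
   qed simp
   finally show "P x y = (\<Sum>k\<in>sat E. cr (sqrt \<bar>\<mu> k\<bar>) * \<phi> k x * cnj (cr (sqrt \<bar>\<mu> k\<bar>) * \<phi> k y))" .
  qed
 qed
 have parseval: "(\<Sum>k\<in>sat E. (cmod (ip (sat E) (\<phi> k) u))\<^sup>2) = (\<Sum>x\<in>sat E. (cmod (u x))\<^sup>2)" if E: "finite E" for E u
 proof -
  have comp: "(\<Sum>k\<in>sat E. \<phi> k x * cnj (\<phi> k y)) = of_bool (x = y)" if xy: "x \<in> sat E" "y \<in> sat E" for x y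
  proof (cases "blk x = blk y")
   case True
   have "(\<Sum>k\<in>sat E. \<phi> k x * cnj (\<phi> k y)) = (\<Sum>k\<in>?F (blk x). \<phi> k x * cnj (\<phi> k y))"
    using fin_sat[OF E] sat_F[OF xy(1)] phi_supp by (intro sum.mono_neutral_right) auto
   also have "... = of_bool (x = y)" by (rule compl) (simp_all only: True)
   finally show ?thesis .
  next
   case False
   then have "\<phi> k x * cnj (\<phi> k y) = 0" for k using phi_supp by (cases "blk k = blk x") auto
   then have "(\<Sum>k\<in>sat E. \<phi> k x * cnj (\<phi> k y)) = 0" by (intro sum.neutral ballI)
   then show ?thesis using False by auto
  qed
  have "cr (\<Sum>k\<in>sat E. (cmod (ip (sat E) (\<phi> k) u))\<^sup>2)
   = (\<Sum>k\<in>sat E. cnj (ip (sat E) (\<phi> k) u) * ip (sat E) (\<phi> k) u)"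
   by (simp add: complex_norm_square mult.commute del: of_real_power)
  also have "... = (\<Sum>k\<in>sat E. \<Sum>x\<in>sat E. \<Sum>y\<in>sat E. (cnj (u x) * u y) * (\<phi> k x * cnj (\<phi> k y)))"
   unfolding ip_def cnj_sum sum_product by (simp add: mult_ac)
  also have "... = (\<Sum>x\<in>sat E. \<Sum>y\<in>sat E. \<Sum>k\<in>sat E. (cnj (u x) * u y) * (\<phi> k x * cnj (\<phi> k y)))"
   by (rule sum_rotate)
  also have "... = (\<Sum>x\<in>sat E. \<Sum>y\<in>sat E. (cnj (u x) * u y) * of_bool (x = y))"
   using comp by (simp add: sum_distrib_left[symmetric])
  also have "... = (\<Sum>x\<in>sat E. cnj (u x) * u x)"
   using fin_sat[OF E] by (intro sum.cong refl sum_of_bool_mult) auto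
  also have "... = cr (\<Sum>x\<in>sat E. (cmod (u x))\<^sup>2)"
   by (simp add: complex_norm_square mult.commute del: of_real_power)
  finally show ?thesis unfolding of_real_eq_iff .
 qed
 have "cmod (\<Sum>x\<in>E. \<Sum>y\<in>E. cnj (u x) * P x y * v y)
   <= c * L2_set (%x. cmod (u x)) E * L2_set (%y. cmod (v y)) E" if E: "finite E" for E u v
 proof -
  define u' v' where "u' = (%x. if x \<in> E then u x else 0)" and "v' = (%x. if x \<in> E then v x else 0)"
  let ?S = "sat E"
  have "(\<Sum>x\<in>E. \<Sum>y\<in>E. cnj (u x) * P x y * v y) = (\<Sum>x\<in>E. \<Sum>y\<in>?S. cnj (u' x) * P x y * v' y)"
   using fin_sat[OF E] sub_sat[of E] by (intro sum.cong refl sum.mono_neutral_cong_left) (auto simp: u'_def v'_def)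
  also have "... = (\<Sum>x\<in>?S. \<Sum>y\<in>?S. cnj (u' x) * P x y * v' y)" using fin_sat[OF E] sub_sat[of E]
   by (intro sum.mono_neutral_left) (auto simp: u'_def v'_def)
  also have "... = (\<Sum>x\<in>?S. \<Sum>y\<in>?S. \<Sum>k\<in>?S. cr \<bar>\<mu> k\<bar> * cnj (cnj (\<phi> k x) * u' x) * (cnj (\<phi> k y) * v' y))"
   using E by (simp add: P_sat sum_distrib_left sum_distrib_right mult_ac)
  also have "... = (\<Sum>k\<in>?S. \<Sum>x\<in>?S. \<Sum>y\<in>?S. cr \<bar>\<mu> k\<bar> * cnj (cnj (\<phi> k x) * u' x) * (cnj (\<phi> k y) * v' y))"
   by (rule sum_rotate[symmetric])
  also have "... = (\<Sum>k\<in>?S. cr \<bar>\<mu> k\<bar> * (cnj (ip ?S (\<phi> k) u') * ip ?S (\<phi> k) v'))"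
   unfolding ip_def cnj_sum sum_product by (simp add: sum_distrib_left mult.assoc)
  also have "cmod ... <= (\<Sum>k\<in>?S. c * (\<bar>cmod (ip ?S (\<phi> k) u')\<bar> * \<bar>cmod (ip ?S (\<phi> k) v')\<bar>))"
  proof (rule sum_norm_le)
   fix k
   show "cmod (cr \<bar>\<mu> k\<bar> * (cnj (ip ?S (\<phi> k) u') * ip ?S (\<phi> k) v'))
    <= c * (\<bar>cmod (ip ?S (\<phi> k) u')\<bar> * \<bar>cmod (ip ?S (\<phi> k) v')\<bar>)"
    using mult_right_mono[OF mu_le[of k], of "cmod (ip ?S (\<phi> k) u') * cmod (ip ?S (\<phi> k) v')"]
    by (simp add: norm_mult)
  qed
  also have "... <= c * (L2_set (%k. cmod (ip ?S (\<phi> k) u')) ?S * L2_set (%k. cmod (ip ?S (\<phi> k) v')) ?S)"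
   unfolding sum_distrib_left[symmetric] by (intro mult_left_mono L2_set_mult_ineq c0)
  also have "L2_set (%k. cmod (ip ?S (\<phi> k) u')) ?S = L2_set (%x. cmod (u x)) E"
   unfolding L2_set_def parseval[OF E] using fin_sat[OF E] sub_sat[of E]
   by (intro arg_cong[of _ _ sqrt] sum.mono_neutral_cong_right) (auto simp: u'_def)
  also have "L2_set (%k. cmod (ip ?S (\<phi> k) v')) ?S = L2_set (%x. cmod (v x)) E"
   unfolding L2_set_def parseval[OF E] using fin_sat[OF E] sub_sat[of E]
   by (intro arg_cong[of _ _ sqrt] sum.mono_neutral_cong_right) (auto simp: v'_def)
  finally show ?thesis by (simp add: mult.assoc)
 qed
 then have bdP: "bounded_mtx P" unfolding bounded_mtx_def by blast
 \<comment> \<open>\<open>sqrt_eigenvector\<close> fixes \<open>Q\<close> on the eigenvectors of a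
   block, and completeness recovers the columns of \<open>Q\<close> from them.\<close>
 have uniq: "Q = P" if Q: "bounded_mtx Q" "positive_mtx Q" "Q \<odot> Q = mtx_adjoint T \<odot> T" for Q
 proof (intro ext)
  fix x y
  let ?B = "?F (blk y)"
  obtain d where d: "!!F u v. finite F ==> cmod (\<Sum>x\<in>F. \<Sum>y\<in>F. cnj (u x) * Q x y * v y)
    <= d * L2_set (%x. cmod (u x)) F * L2_set (%y. cmod (v y)) F" using Q(1) unfolding bounded_mtx_def by blast
  have QQ: "Q \<odot> Q = M (%k. \<mu> k * \<mu> k)" unfolding Q(3) adjT by (subst (1 2) TM) (rule M_mult)
  have ev: "(\<Sum>z\<in>?B. Q x z * \<phi> k z) = cr \<bar>\<mu> k\<bar> * \<phi> k x" if k: "k \<in> ?B" for k x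
  proof (rule sqrt_eigenvector[OF Q(2) d])
   show "finite ?B" by (rule fin)
   show "\<phi> k z = 0" if "z \<notin> ?B" for z using k that phi_supp[of k z] by auto
   show "(\<Sum>z\<in>?B. (Q \<odot> Q) x z * \<phi> k z) = cr (\<bar>\<mu> k\<bar>\<^sup>2) * \<phi> k x" for x
   proof (cases "blk x = blk y")
    case False
    then show ?thesis using k phi_supp[of k x] by (simp add: QQ M_def)
   next
    case True
    have "(\<Sum>z\<in>?B. (Q \<odot> Q) x z * \<phi> k z) =
     (\<Sum>z\<in>?B. \<Sum>j\<in>?B. cr (\<mu> j * \<mu> j) * \<phi> j x * (cnj (\<phi> j z) * \<phi> k z))"
     using True by (intro sum.cong) (auto simp: QQ M_def sum_distrib_right mult.assoc)
    also have "... = (\<Sum>j\<in>?B. \<Sum>z\<in>?B. cr (\<mu> j * \<mu> j) * \<phi> j x * (cnj (\<phi> j z) * \<phi> k z))"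
     by (rule sum.swap)
    also have "... = (\<Sum>j\<in>?B. cr (\<mu> j * \<mu> j) * \<phi> j x * ip ?B (\<phi> j) (\<phi> k))"
     by (simp add: ip_def sum_distrib_left)
    also have "... = (\<Sum>j\<in>?B. cr (\<mu> j * \<mu> j) * \<phi> j x * of_bool (j = k))"
     using orth[of _ "blk y"] k by (intro sum.cong) auto
    also have "... = cr (\<mu> k * \<mu> k) * \<phi> k x" using fin k by (intro sum_of_bool_mult) auto
    finally show ?thesis by (simp add: power2_eq_square)
   qed
   show "0 <= \<bar>\<mu> k\<bar>" by simp
  qed
  have "Q x y = (\<Sum>z\<in>?B. Q x z * of_bool (z = y))" using fin by (subst sum_of_bool_mult) auto
  also have "... = (\<Sum>z\<in>?B. \<Sum>k\<in>?B. Q x z * \<phi> k z * cnj (\<phi> k y))"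
   using compl by (intro sum.cong) (auto simp: sum_distrib_left[symmetric] mult.assoc)
  also have "... = (\<Sum>k\<in>?B. \<Sum>z\<in>?B. Q x z * \<phi> k z * cnj (\<phi> k y))" by (rule sum.swap)
  also have "... = (\<Sum>k\<in>?B. cr \<bar>\<mu> k\<bar> * \<phi> k x * cnj (\<phi> k y))"
   using ev by (simp add: sum_distrib_right[symmetric])
  also have "... = P x y" using phi_supp[of _ x] by (cases "blk x = blk y") (auto simp: P_def M_def)
  finally show "Q x y = P x y" .
 qed
 have mod: "mtx_modulus T = P" unfolding mtx_modulus_def
 proof (rule the_equality)
  show "bounded_mtx P & positive_mtx P & P \<odot> P = mtx_adjoint T \<odot> T" by (intro conjI bdP posP PP)
  show "Q = P" if "bounded_mtx Q & positive_mtx Q & Q \<odot> Q = mtx_adjoint T \<odot> T" for Q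
   using that by (elim conjE) (rule uniq)
 qed
 define p where "p = (%x. \<Sum>k\<in>?F (blk x). \<bar>\<mu> k\<bar> * (cmod (\<phi> k x))\<^sup>2)"
 have Pp: "P x x = cr (p x)" for x by (simp add: P_def M_def p_def complex_norm_square mult.assoc del: of_real_power)
 have p0: "p x >= 0" for x by (simp add: p_def sum_nonneg)
 have sum_p: "sum p E <= c" if E: "finite E" for E
 proof -
  have "sum p E <= (\<Sum>x\<in>sat E. p x)" using fin_sat[OF E] sub_sat[of E] p0 by (intro sum_mono2) auto
  also have "... = (\<Sum>x\<in>sat E. \<Sum>k\<in>sat E. \<bar>\<mu> k\<bar> * (cmod (\<phi> k x))\<^sup>2)"
   unfolding p_def using fin_sat[OF E] sat_F phi_supp by (intro sum.cong refl sum.mono_neutral_left) auto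
  also have "... = (\<Sum>k\<in>sat E. \<Sum>x\<in>sat E. \<bar>\<mu> k\<bar> * (cmod (\<phi> k x))\<^sup>2)"
   by (rule sum.swap)
  also have "... = (\<Sum>k\<in>sat E. \<bar>\<mu> k\<bar>)"
  proof (rule sum.cong)
   fix k assume k: "k \<in> sat E"
   have "(\<Sum>x\<in>sat E. (cmod (\<phi> k x))\<^sup>2) = (\<Sum>x\<in>?F (blk k). (cmod (\<phi> k x))\<^sup>2)"
    using fin_sat[OF E] sat_F[OF k] phi_supp[of k] by (intro sum.mono_neutral_right) (auto, metis)
   also have "... = 1"
    using orth[of k "blk k" k] ip_self[of "?F (blk k)" "\<phi> k"] by (simp add: nsq_def del: of_real_sum)
   finally show "(\<Sum>x\<in>sat E. \<bar>\<mu> k\<bar> * (cmod (\<phi> k x))\<^sup>2) = \<bar>\<mu> k\<bar>"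
    by (simp add: sum_distrib_left[symmetric])
  qed simp
  also have "... <= c" using sum_sat[OF E] by (simp add: c_def)
  finally show ?thesis .
 qed
 have sump: "p summable_on UNIV" using sum_p p0 by (intro nonneg_bdd_above_summable_on bdd_aboveI2) auto
 have "trace_norm T = infsum p UNIV"
 proof -
  have "((%x. cr (p x)) has_sum cr (infsum p UNIV)) UNIV" using sump by (intro has_sum_of_real has_sum_infsum)
  then show ?thesis unfolding trace_norm_def mod mtx_trace_def Pp by (simp add: infsumI)
 qed
 also have "... <= c" using sum_p by (intro infsum_le_finite_sums sump) auto
 finally show ?thesis by (simp add: c_def)
qed

section \<open>Sums of products over lists\<close>

lemma has_sum_eq_rule:
 assumes "(f has_sum s) A" "!!x. x \<in> A ==> f x = g x" "s = t"
 shows "(g has_sum t) A" using assms has_sum_cong[of A f g] by simp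

lemma prod_Cons_shift:
 fixes f :: "nat => 'a => 'b::comm_monoid_mult"
 shows "(\<Prod>i<Suc n. f i ((x # xs) ! i)) = f 0 x * (\<Prod>i<n. f (Suc i) (xs ! i))"
 by (subst prod.lessThan_Suc_shift) simp

lemma lists_Suc_eq: "{xs. set xs \<subseteq> B & length xs = Suc n}
  = (%(x, xs). x # xs) ` (B \<times> {xs. set xs \<subseteq> B & length xs = n})"
 by (auto simp: length_Suc_conv image_iff)

lemma sum_prod_lists:
 fixes f :: "nat => 'a => 'b::comm_semiring_1"
 assumes "finite B"
 shows "(\<Sum>xs\<in>{xs. set xs \<subseteq> B & length xs = n}. \<Prod>i<n. f i (xs ! i)) = (\<Prod>i<n. \<Sum>x\<in>B. f i x)"
proof (induction n arbitrary: f)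
 case 0
 have "{xs. set xs \<subseteq> B & length xs = 0} = {[]}" by auto
 then show ?case by simp
next
 case (Suc n)
 have "(\<Sum>xs\<in>{xs. set xs \<subseteq> B & length xs = Suc n}. \<Prod>i<Suc n. f i (xs ! i))
  = (\<Sum>(x, xs)\<in>B \<times> {xs. set xs \<subseteq> B & length xs = n}. f 0 x * (\<Prod>i<n. f (Suc i) (xs ! i)))"
  unfolding lists_Suc_eq
  by (subst sum.reindex) (auto simp: inj_on_def prod_Cons_shift case_prod_beta simp del: prod.lessThan_Suc)
 also have "... = (\<Sum>x\<in>B. f 0 x) * (\<Sum>xs\<in>{xs. set xs \<subseteq> B & length xs = n}. \<Prod>i<n. f (Suc i) (xs ! i))"
  by (simp add: sum_product sum.cartesian_product)
 also have "(\<Sum>xs\<in>{xs. set xs \<subseteq> B & length xs = n}. \<Prod>i<n. f (Suc i) (xs ! i)) = (\<Prod>i<n. \<Sum>x\<in>B. f (Suc i) x)"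
  by (rule Suc.IH)
 also have "(\<Sum>x\<in>B. f 0 x) * (\<Prod>i<n. \<Sum>x\<in>B. f (Suc i) x) = (\<Prod>i<Suc n. \<Sum>x\<in>B. f i x)"
  by (subst prod.lessThan_Suc_shift) simp
 finally show ?case .
qed

text \<open>Nonnegativity supplies the summability over the product that iterated sums alone do not
  give.\<close>

lemma has_sum_Sigma_nonneg:
 fixes f :: "'a \<times> 'b => real"
 assumes "!!x. ((%y. f (x, y)) has_sum g x) B" "(g has_sum s) A" "!!x y. f (x, y) >= 0"
 shows "(f has_sum s) (A \<times> B)"
proof (rule has_sum_SigmaI[OF assms(1,2)])
 show "f summable_on A \<times> B"
  by (rule summable_on_SigmaI[OF assms(1)]) (use assms in \<open>auto intro: has_sum_imp_summable\<close>)
qed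

lemmas has_sum_pair_nonneg = has_sum_Sigma_nonneg[where A = UNIV and B = UNIV, simplified]

lemma has_sum_product_nonneg:
 fixes f :: "'a => real" and g :: "'b => real"
 assumes f: "(f has_sum F) A" and g: "(g has_sum G) B" and nn: "!!x. f x >= 0" "!!y. g y >= 0"
 shows "((%(x, y). f x * g y) has_sum F * G) (A \<times> B)" by (rule has_sum_Sigma_nonneg[where g = "%x. f x * G"])
  (use nn in \<open>auto intro: has_sum_cmult_right[OF g] has_sum_cmult_left[OF f]\<close>)

lemmas has_sum_product_UNIV = has_sum_product_nonneg[where A = UNIV and B = UNIV, simplified]

lemma has_sum_bij:
 assumes "(g has_sum s) UNIV" "!!a. i (j a) = a" "!!b. j (i b) = b" "!!a. g (j a) = f a"
 shows "(f has_sum s) UNIV" using has_sum_reindex_bij_witness[of UNIV i j UNIV g f s s] assms by simp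

lemma has_sum_prod_lists:
 fixes f :: "nat => 'a => real"
 assumes "!!i. i < n ==> (f i has_sum s i) UNIV" "!!i x. i < n ==> f i x >= 0"
 shows "((%xs. \<Prod>i<n. f i (xs ! i)) has_sum (\<Prod>i<n. s i)) {xs. length xs = n}" using assms
proof (induction n arbitrary: f s)
 case 0
 have "{xs::'a list. length xs = 0} = {[]}" by auto
 then show ?case by (intro has_sum_finiteI) auto
next
 case (Suc n)
 have IH: "((%xs. \<Prod>i<n. f (Suc i) (xs ! i)) has_sum (\<Prod>i<n. s (Suc i))) {xs. length xs = n}"
  using Suc.prems by (intro Suc.IH) auto
 let ?g = "%xs. \<Prod>i<n. f (Suc i) (xs ! i)"
 define h where "h = (%(x, xs). f 0 x * ?g xs)"
 have "(h has_sum s 0 * (\<Prod>i<n. s (Suc i))) (UNIV \<times> {xs. length xs = n})"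
 proof (rule has_sum_Sigma_nonneg[where g = "%x. f 0 x * (\<Prod>i<n. s (Suc i))"])
  show "h (x, xs) >= 0" for x xs unfolding h_def using Suc.prems(2) by (auto intro!: mult_nonneg_nonneg prod_nonneg)
 qed (use Suc.prems in \<open>auto simp: h_def intro!: has_sum_cmult_right[OF IH] has_sum_cmult_left\<close>)
 then have "((%xs. \<Prod>i<Suc n. f i (xs ! i)) \<circ> (%(x, xs). x # xs) has_sum s 0 * (\<Prod>i<n. s (Suc i)))
  (UNIV \<times> {xs. length xs = n})"
  by (rule has_sum_eq_rule) (auto simp: h_def prod_Cons_shift simp del: prod.lessThan_Suc)
 then have "((%xs. \<Prod>i<Suc n. f i (xs ! i)) has_sum s 0 * (\<Prod>i<n. s (Suc i)))
  ((%(x, xs). x # xs) ` (UNIV \<times> {xs. length xs = n}))" by (subst has_sum_reindex) (auto simp: inj_on_def)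
 also have "(%(x, xs). x # xs) ` (UNIV \<times> {xs. length xs = n}) = {xs :: 'a list. length xs = Suc n}"
  by (auto simp: length_Suc_conv image_iff)
 also have "s 0 * (\<Prod>i<n. s (Suc i)) = (\<Prod>i<Suc n. s i)" by (subst prod.lessThan_Suc_shift) simp
 finally show ?case .
qed

section \<open>Hellinger affinity\<close>

lemma infsum_Cauchy_Schwarz:
 fixes f g :: "'a => real"
 assumes f: "((%x. (f x)\<^sup>2) has_sum a) A" and g: "((%x. (g x)\<^sup>2) has_sum b) A"
 shows "(%x. \<bar>f x\<bar> * \<bar>g x\<bar>) summable_on A" "(\<Sum>\<^sub>\<infinity>x\<in>A. \<bar>f x\<bar> * \<bar>g x\<bar>) <= sqrt a * sqrt b"
proof -
 have bd: "(\<Sum>x\<in>F. \<bar>f x\<bar> * \<bar>g x\<bar>) <= sqrt a * sqrt b" if F: "finite F" "F \<subseteq> A" for F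
 proof -
  have "(\<Sum>x\<in>F. \<bar>f x\<bar> * \<bar>g x\<bar>) <= L2_set f F * L2_set g F" by (rule L2_set_mult_ineq)
  also have "... <= sqrt a * sqrt b"
  proof (intro mult_mono)
   show "L2_set f F <= sqrt a" unfolding L2_set_def using finite_sum_le_has_sum[OF f F] by simp
   show "L2_set g F <= sqrt b" unfolding L2_set_def using finite_sum_le_has_sum[OF g F] by simp
   show "0 <= sqrt a" using has_sum_nonneg[OF f] by simp
  qed (auto simp: L2_set_nonneg)
  finally show ?thesis .
 qed
 show s: "(%x. \<bar>f x\<bar> * \<bar>g x\<bar>) summable_on A"
  using bd by (intro nonneg_bdd_above_summable_on bdd_aboveI2) auto
 show "(\<Sum>\<^sub>\<infinity>x\<in>A. \<bar>f x\<bar> * \<bar>g x\<bar>) <= sqrt a * sqrt b"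
  using bd by (intro infsum_le_finite_sums s) auto
qed

text \<open>The difference \<open>P - Q\<close> factors through the roots, and the two factors have
  squared norms \<open>2 - 2 * \<beta>\<close> and \<open>2 + 2 * \<beta>\<close>; the
  Cauchy-Schwarz inequality does the rest.\<close>

lemma total_variation_le_affinity:
 fixes P Q :: "'a => real"
 assumes P: "(P has_sum 1) A" and Q: "(Q has_sum 1) A" and "!!x. x \<in> A ==> P x >= 0" "!!x. x \<in> A ==> Q x >= 0"
  and B: "((%x. sqrt (P x * Q x)) has_sum \<beta>) A"
 shows "(%x. \<bar>P x - Q x\<bar>) summable_on A" "(\<Sum>\<^sub>\<infinity>x\<in>A. \<bar>P x - Q x\<bar>) <= 2 * sqrt (1 - \<beta>^2)"
proof -
 have "((%x. P x + Q x + (- 2) * sqrt (P x * Q x)) has_sum (1 + 1 + (- 2) * \<beta>)) A"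
  by (intro has_sum_add P Q has_sum_cmult_right B)
 then have 1: "((%x. (sqrt (P x) - sqrt (Q x))\<^sup>2) has_sum (2 - 2 * \<beta>)) A"
  by (rule has_sum_eq_rule) (use assms in \<open>auto simp: power2_eq_square algebra_simps real_sqrt_mult\<close>)
 have "((%x. P x + Q x + 2 * sqrt (P x * Q x)) has_sum (1 + 1 + 2 * \<beta>)) A"
  by (intro has_sum_add P Q has_sum_cmult_right B)
 then have 2: "((%x. (sqrt (P x) + sqrt (Q x))\<^sup>2) has_sum (2 + 2 * \<beta>)) A"
  by (rule has_sum_eq_rule) (use assms in \<open>auto simp: power2_eq_square algebra_simps real_sqrt_mult\<close>)
 have eq: "\<bar>sqrt (P x) - sqrt (Q x)\<bar> * \<bar>sqrt (P x) + sqrt (Q x)\<bar> = \<bar>P x - Q x\<bar>" if "x \<in> A" for x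
  unfolding abs_mult[symmetric] using assms(3,4)[OF that] by (simp add: algebra_simps)
 show "(%x. \<bar>P x - Q x\<bar>) summable_on A"
  using infsum_Cauchy_Schwarz(1)[OF 1 2] by (rule summable_on_cong[THEN iffD1, rotated]) (rule eq)
 have "(\<Sum>\<^sub>\<infinity>x\<in>A. \<bar>P x - Q x\<bar>) = (\<Sum>\<^sub>\<infinity>x\<in>A. \<bar>sqrt (P x) - sqrt (Q x)\<bar> * \<bar>sqrt (P x) + sqrt (Q x)\<bar>)"
  by (rule infsum_cong) (simp add: eq)
 also have "... <= sqrt (2 - 2 * \<beta>) * sqrt (2 + 2 * \<beta>)" by (rule infsum_Cauchy_Schwarz(2)[OF 1 2])
 also have "... = sqrt (2\<^sup>2 * (1 - \<beta>^2))"
  unfolding real_sqrt_mult[symmetric] by (simp add: power2_eq_square algebra_simps)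
 also have "... = 2 * sqrt (1 - \<beta>^2)" unfolding real_sqrt_mult by simp
 finally show "(\<Sum>\<^sub>\<infinity>x\<in>A. \<bar>P x - Q x\<bar>) <= 2 * sqrt (1 - \<beta>^2)" .
qed

lemma sqrt_prod: "sqrt (\<Prod>i\<in>A. f i) = (\<Prod>i\<in>A. sqrt (f i))"
 by (induction A rule: infinite_finite_induct) (simp_all add: real_sqrt_mult)

text \<open>The affinity is multiplicative over independent letters, which total variation is not;
  this is the reason for the detour through it.\<close>

lemma total_variation_power_le:
 fixes p q :: "'a => real"
 assumes p: "(p has_sum 1) UNIV" and q: "(q has_sum 1) UNIV" and "!!x. p x >= 0" "!!x. q x >= 0"
  and B: "((%x. sqrt (p x * q x)) has_sum \<beta>) UNIV"
 shows "(%xs. \<bar>(\<Prod>i<n. p (xs ! i)) - (\<Prod>i<n. q (xs ! i))\<bar>) summable_on {xs. length xs = n}"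
  "(\<Sum>\<^sub>\<infinity>xs\<in>{xs. length xs = n}. \<bar>(\<Prod>i<n. p (xs ! i)) - (\<Prod>i<n. q (xs ! i))\<bar>) <= 2 * sqrt (1 - (\<beta> ^ n)\<^sup>2)"
proof -
 have 1: "((%xs. \<Prod>i<n. p (xs ! i)) has_sum 1) {xs. length xs = n}"
  using has_sum_prod_lists[of n "%_. p" "%_. 1"] assms by simp
 have 2: "((%xs. \<Prod>i<n. q (xs ! i)) has_sum 1) {xs. length xs = n}"
  using has_sum_prod_lists[of n "%_. q" "%_. 1"] assms by simp
 have 3: "((%xs. sqrt ((\<Prod>i<n. p (xs ! i)) * (\<Prod>i<n. q (xs ! i)))) has_sum \<beta> ^ n) {xs. length xs = n}"
  using has_sum_prod_lists[of n "%_ x. sqrt (p x * q x)" "%_. \<beta>"] assms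
  by (simp add: prod.distrib[symmetric] sqrt_prod)
 show "(%xs. \<bar>(\<Prod>i<n. p (xs ! i)) - (\<Prod>i<n. q (xs ! i))\<bar>) summable_on {xs. length xs = n}"
  "(\<Sum>\<^sub>\<infinity>xs\<in>{xs. length xs = n}. \<bar>(\<Prod>i<n. p (xs ! i)) - (\<Prod>i<n. q (xs ! i))\<bar>) <= 2 * sqrt (1 - (\<beta> ^ n)\<^sup>2)"
  by (intro total_variation_le_affinity[OF 1 2 _ _ 3] prod_nonneg ballI assms)+
qed

section \<open>Beam splitter amplitudes\<close>

locale lossy =
 fixes \<eta> :: real
 assumes eta_pos: "0 < \<eta>" and eta_less_1: "\<eta> < 1"
begin

text \<open>All amplitudes are real (\<open>beam_splitter_eq\<close>), so the sums that follow can
  be taken over the reals.\<close>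

definition bs :: "nat \<times> nat => nat \<times> nat => real"
 where "bs x z = Re (beam_splitter \<eta> x z)"

definition \<tau> :: real where "\<tau> = sqrt \<eta>"
definition \<rho> :: real where "\<rho> = sqrt (1 - \<eta>)"

lemma tau_pos: "\<tau> > 0" and rho_pos: "\<rho> > 0"
 using eta_pos eta_less_1 by (auto simp: \<tau>_def \<rho>_def)

lemma tau_sq: "\<tau> * \<tau> = \<eta>" and rho_sq: "\<rho> * \<rho> = 1 - \<eta>"
 using eta_pos eta_less_1 by (auto simp: \<tau>_def \<rho>_def)

lemma tr1: "\<tau>^2 + \<rho>^2 = 1"
 using tau_sq rho_sq by (simp add: power2_eq_square)

lemma rotated_Reals:
 assumes "!!x. v x \<in> \<real>"
 shows "rotated1 \<eta> v x \<in> \<real>" "rotated2 \<eta> v x \<in> \<real>"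
 using assms by (cases x; auto simp: rotated1_def rotated2_def create1_def create2_def)+

lemma rotated_power_Reals:
 assumes "!!x. v x \<in> \<real>"
 shows "(rotated1 \<eta> ^^ m) v x \<in> \<real>" "(rotated2 \<eta> ^^ m) v x \<in> \<real>"
proof -
 show "(rotated1 \<eta> ^^ m) v x \<in> \<real>" using assms by (induction m arbitrary: x) (auto intro: rotated_Reals)
 show "(rotated2 \<eta> ^^ m) v x \<in> \<real>" using assms by (induction m arbitrary: x) (auto intro: rotated_Reals)
qed

lemma beam_splitter_eq: "beam_splitter \<eta> x z = cr (bs x z)"
proof -
 obtain m n where z: "z = (m, n)" by force
 have "beam_splitter \<eta> x z \<in> \<real>" unfolding z beam_splitter_def prod.case
  by (intro Reals_divide rotated_power_Reals) (auto simp: vacuum_def)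
 then show ?thesis by (simp add: bs_def)
qed

lemma rotated_support:
 assumes "!!p q. p + q ~= k ==> v (p, q) = 0" "p + q ~= Suc k"
 shows "rotated1 \<eta> v (p, q) = 0" "rotated2 \<eta> v (p, q) = 0"
proof -
 have 1: "create1 v (p, q) = 0"
 proof (cases p)
  case (Suc p')
  then show ?thesis using assms by (auto simp: create1_def)
 qed (auto simp: create1_def)
 have 2: "create2 v (p, q) = 0"
 proof (cases q)
  case (Suc p')
  then show ?thesis using assms by (auto simp: create2_def)
 qed (auto simp: create2_def)
 show "rotated1 \<eta> v (p, q) = 0" "rotated2 \<eta> v (p, q) = 0" by (simp_all add: rotated1_def rotated2_def 1 2)
qed

lemma rotated_power_support:
 assumes "p + q ~= m + n"
 shows "(rotated1 \<eta> ^^ m) ((rotated2 \<eta> ^^ n) vacuum) (p, q) = 0" using assms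
proof (induction m arbitrary: p q)
 case 0
 then show ?case
 proof (induction n arbitrary: p q)
  case 0
  then show ?case by (auto simp: vacuum_def)
 next
  case (Suc n)
  show ?case unfolding funpow.simps o_def id_def by (rule rotated_support(2)[where k = n]) (use Suc in auto)
 qed
next
 case (Suc m)
 show ?case unfolding funpow.simps o_def by (rule rotated_support(1)[where k = "m + n"]) (use Suc in auto)
qed

lemma bs_support: "p + q ~= m + n ==> bs (p, q) (m, n) = 0"
 by (simp add: bs_def beam_splitter_def rotated_power_support)

lemma bs_annihilate1:
 "sqrt (real (Suc p)) * bs (Suc p, q) (m, n) =
  \<tau> * sqrt (real m) * bs (p, q) (m - 1, n) + \<rho> * sqrt (real n) * bs (p, q) (m, n - 1)"
proof -
 have "cr (sqrt (real (Suc p)) * bs (Suc p, q) (m, n)) = cr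
  (\<tau> * sqrt (real m) * bs (p, q) (m - 1, n) + \<rho> * sqrt (real n) * bs (p, q) (m, n - 1))"
  using fun_cong[OF beam_splitter_heisenberg(1)[of \<eta> m n], of "(p, q)"]
  by (simp add: annihilate1_def beam_splitter_eq \<tau>_def \<rho>_def)
 then show ?thesis by (simp only: of_real_eq_iff)
qed

lemma bs_annihilate2:
 "sqrt (real (Suc q)) * bs (p, Suc q) (m, n) =
  - \<rho> * sqrt (real m) * bs (p, q) (m - 1, n) + \<tau> * sqrt (real n) * bs (p, q) (m, n - 1)"
proof -
 have "cr (sqrt (real (Suc q)) * bs (p, Suc q) (m, n)) = cr
  (- \<rho> * sqrt (real m) * bs (p, q) (m - 1, n) + \<tau> * sqrt (real n) * bs (p, q) (m, n - 1))"
  using fun_cong[OF beam_splitter_heisenberg(2)[of \<eta> m n], of "(p, q)"]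
  by (simp add: annihilate2_def beam_splitter_eq \<tau>_def \<rho>_def)
 then show ?thesis by (simp only: of_real_eq_iff)
qed

text \<open>The columns are built from powers of \<open>rotated1\<close> and
  \<open>rotated2\<close>; applying one more of them raises an input photon number.\<close>

lemma bs_rotated:
 "\<tau> * sqrt (real p) * bs (p - 1, q) (m, n) - \<rho> * sqrt (real q) * bs (p, q - 1) (m, n)
  = sqrt (real (Suc m)) * bs (p, q) (Suc m, n)" (is ?A)
 "\<rho> * sqrt (real p) * bs (p - 1, q) (m, n) + \<tau> * sqrt (real q) * bs (p, q - 1) (m, n)
  = sqrt (real (Suc n)) * bs (p, q) (m, Suc n)" (is ?B)
proof -
 let ?v = "(rotated1 \<eta> ^^ m) ((rotated2 \<eta> ^^ n) vacuum)"
 let ?d = "cr (sqrt (fact m * fact n))"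
 have v: "?v x = beam_splitter \<eta> x (m, n) * ?d" for x by (simp add: beam_splitter_def)
 have s1: "rotated1 \<eta> ?v (p, q) = beam_splitter \<eta> (p, q) (Suc m, n)
   * cr (sqrt (real (Suc m))) * ?d" by (simp add: beam_splitter_def real_sqrt_mult)
 have "rotated2 \<eta> ?v = (rotated1 \<eta> ^^ m) ((rotated2 \<eta> ^^ Suc n) vacuum)"
  by (induction m) (simp_all add: rotated_commute[symmetric])
 then have s2: "rotated2 \<eta> ?v (p, q) = beam_splitter \<eta> (p, q) (m, Suc n)
   * cr (sqrt (real (Suc n))) * ?d" by (simp add: beam_splitter_def real_sqrt_mult)
 have d: "?d ~= 0" by simp
 have "cr (\<tau> * sqrt (real p) * bs (p - 1, q) (m, n)
   - \<rho> * sqrt (real q) * bs (p, q - 1) (m, n)) * ?d = rotated1 \<eta> ?v (p, q)"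
  by (simp add: rotated1_def create1_def create2_def v beam_splitter_eq \<tau>_def \<rho>_def algebra_simps)
 also have "... = cr (sqrt (real (Suc m)) * bs (p, q) (Suc m, n)) * ?d"
  by (simp add: s1 beam_splitter_eq algebra_simps)
 finally show ?A unfolding mult_cancel_right of_real_eq_iff using d by blast
 have "cr (\<rho> * sqrt (real p) * bs (p - 1, q) (m, n)
   + \<tau> * sqrt (real q) * bs (p, q - 1) (m, n)) * ?d = rotated2 \<eta> ?v (p, q)"
  by (simp add: rotated2_def create1_def create2_def v beam_splitter_eq \<tau>_def \<rho>_def algebra_simps)
 also have "... = cr (sqrt (real (Suc n)) * bs (p, q) (m, Suc n)) * ?d"
  by (simp add: s2 beam_splitter_eq algebra_simps)
 finally show ?B unfolding mult_cancel_right of_real_eq_iff using d by blast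
qed

text \<open>\<open>bs_rotated\<close> is a rotation of the two creation terms at the output; the
  inverse rotation isolates the first of them.\<close>

lemma bs_create1:
 "sqrt (real p) * bs (p - 1, q) (m, n) =
  \<tau> * sqrt (real (Suc m)) * bs (p, q) (Suc m, n) + \<rho> * sqrt (real (Suc n)) * bs (p, q) (m, Suc n)"
proof -
 define x y where "x = sqrt (real p) * bs (p - 1, q) (m, n)"
  and "y = sqrt (real q) * bs (p, q - 1) (m, n)"
 have "\<tau> * (\<tau> * x - \<rho> * y) + \<rho> * (\<rho> * x + \<tau> * y) = (\<tau>^2 + \<rho>^2) * x"
  by (simp add: algebra_simps power2_eq_square)
 then show ?thesis using bs_rotated[of p q m n] tr1 by (simp add: x_def y_def mult.assoc)
qed

lemma bs_create2:
 "sqrt (real q) * bs (p, q - 1) (m, n) =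
  - \<rho> * sqrt (real (Suc m)) * bs (p, q) (Suc m, n) + \<tau> * sqrt (real (Suc n)) * bs (p, q) (m, Suc n)"
proof -
 define x y where "x = sqrt (real p) * bs (p - 1, q) (m, n)"
  and "y = sqrt (real q) * bs (p, q - 1) (m, n)"
 have "- \<rho> * (\<tau> * x - \<rho> * y) + \<tau> * (\<rho> * x + \<tau> * y) = (\<tau>^2 + \<rho>^2) * y"
  by (simp add: algebra_simps power2_eq_square)
 then show ?thesis using bs_rotated[of p q m n] tr1 by (simp add: x_def y_def mult.assoc)
qed

lemma bs_00: "bs (0, 0) (0, 0) = 1"
 by (simp add: bs_def beam_splitter_def vacuum_def)

text \<open>Total photon number times the inner product of two columns is the sum of the inner products
 of the annihilated columns; this drives the induction.\<close>

lemma bs_orth_level: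
 assumes "m <= k" "m' <= k"
 shows "(\<Sum>p\<le>k. bs (p, k - p) (m, k - m) * bs (p, k - p) (m', k - m')) = of_bool (m = m')" using assms
proof (induction k arbitrary: m m')
 case 0
 then show ?case by (simp add: bs_00)
next
 case (Suc k)
 define n n' where "n = Suc k - m" and "n' = Suc k - m'"
 let ?S = "\<Sum>p\<le>Suc k. bs (p, Suc k - p) (m, n) * bs (p, Suc k - p) (m', n')"
 let ?I = "%m n m' n'. \<Sum>p\<le>k. bs (p, k - p) (m, n) * bs (p, k - p) (m', n')"
 have sq: "sqrt (real p) * (sqrt (real p) * x) = real p * x" for p x by (simp add: mult.assoc[symmetric])
 have 1: "(\<Sum>p\<le>Suc k. real p * (bs (p, Suc k - p) (m, n) * bs (p, Suc k - p) (m', n')))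
   = (\<Sum>p\<le>k. (sqrt (real (Suc p)) * bs (Suc p, k - p) (m, n))
    * (sqrt (real (Suc p)) * bs (Suc p, k - p) (m', n')))"
  by (subst sum.atMost_Suc_shift) (simp add: mult_ac sq del: of_nat_Suc)
 have 2: "(\<Sum>p\<le>Suc k. real (Suc k - p) * (bs (p, Suc k - p) (m, n) * bs (p, Suc k - p) (m', n')))
   = (\<Sum>p\<le>k. (sqrt (real (Suc (k - p))) * bs (p, Suc (k - p)) (m, n))
    * (sqrt (real (Suc (k - p))) * bs (p, Suc (k - p)) (m', n')))"
 proof -
  have "real (Suc k - p) * (bs (p, Suc k - p) (m, n) * bs (p, Suc k - p) (m', n'))
   = (sqrt (real (Suc (k - p))) * bs (p, Suc (k - p)) (m, n))
    * (sqrt (real (Suc (k - p))) * bs (p, Suc (k - p)) (m', n'))" if "p <= k" for p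
  proof -
   have "Suc k - p = Suc (k - p)" using that by simp
   then show ?thesis by (simp add: mult_ac sq del: of_nat_Suc)
  qed
  then show ?thesis by simp
 qed
 have "real (Suc k) * ?S =
   (\<Sum>p\<le>Suc k. real p * (bs (p, Suc k - p) (m, n) * bs (p, Suc k - p) (m', n')))
  + (\<Sum>p\<le>Suc k. real (Suc k - p) * (bs (p, Suc k - p) (m, n) * bs (p, Suc k - p) (m', n')))"
  unfolding sum.distrib[symmetric] sum_distrib_left by (rule sum.cong) (auto simp: of_nat_diff algebra_simps)
 also have "... = (\<tau>^2 + \<rho>^2) * (sqrt (real m) * sqrt (real m') * ?I (m - 1) n (m' - 1) n'
   + sqrt (real n) * sqrt (real n') * ?I m (n - 1) m' (n' - 1))" unfolding 1 2 bs_annihilate1 bs_annihilate2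
  unfolding sum.distrib[symmetric] sum_distrib_left by (rule sum.cong) (auto simp: algebra_simps power2_eq_square)
 also have "sqrt (real m) * sqrt (real m') * ?I (m - 1) n (m' - 1) n' = real m * of_bool (m = m')"
 proof (cases "m = 0 \<or> m' = 0")
  case False
  then have "n = k - (m - 1)" "n' = k - (m' - 1)" "m - 1 <= k" "m' - 1 <= k"
   using Suc.prems by (auto simp: n_def n'_def)
  then have "?I (m - 1) n (m' - 1) n' = of_bool (m - 1 = m' - 1)" using Suc.IH[of "m - 1" "m' - 1"] by simp
  then show ?thesis using False by auto
 qed auto
 also have "sqrt (real n) * sqrt (real n') * ?I m (n - 1) m' (n' - 1) = real n * of_bool (m = m')"
 proof (cases "n = 0 \<or> n' = 0")
  case False
  then have "n - 1 = k - m" "n' - 1 = k - m'" "m <= k" "m' <= k" using Suc.prems by (auto simp: n_def n'_def)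
  then have "?I m (n - 1) m' (n' - 1) = of_bool (m = m')" using Suc.IH[of "m" "m'"] by simp
  then show ?thesis using False by (auto simp: n_def n'_def)
 qed (use Suc.prems in \<open>auto simp: n_def n'_def\<close>)
 finally have "real (Suc k) * ?S = (real m + real n) * of_bool (m = m')"
  unfolding tr1 by (simp add: distrib_right del: sum.atMost_Suc)
 also have "real m + real n = real (Suc k)" using Suc.prems by (simp add: n_def of_nat_diff)
 finally have "?S = of_bool (m = m')"
  unfolding mult_cancel_left by (simp only: of_nat_eq_0_iff nat.distinct simp_thms)
 then show ?case by (simp only: n_def n'_def)
qed

lemma bs_orth:
 assumes "m + n <= T" "m' + n' <= T'" "T <= N"
 shows "(\<Sum>p\<le>N. \<Sum>q\<le>N. bs (p, q) (m, n) * bs (p, q) (m', n')) = of_bool (m = m' & n = n')"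
proof (cases "m + n = m' + n'")
 case False
 then have "bs (p, q) (m, n) * bs (p, q) (m', n') = 0" for p q
  using bs_support[of p q m n] bs_support[of p q m' n'] by (cases "p + q = m + n") auto
 then have "(\<Sum>p\<le>N. \<Sum>q\<le>N. bs (p, q) (m, n) * bs (p, q) (m', n')) = 0" by (intro sum.neutral ballI)
 then show ?thesis using False by auto
next
 case True
 let ?k = "m + n"
 have "(\<Sum>q\<le>N. bs (p, q) (m, n) * bs (p, q) (m', n'))
   = (if p <= ?k then bs (p, ?k - p) (m, n) * bs (p, ?k - p) (m', n') else 0)" for p
 proof -
  have "(\<Sum>q\<le>N. bs (p, q) (m, n) * bs (p, q) (m', n'))
   = (\<Sum>q\<le>N. if q = ?k - p then (if p <= ?k then bs (p, ?k - p) (m, n) * bs (p, ?k - p) (m', n') else 0) else 0)"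
   by (rule sum.cong) (auto simp: bs_support)
  also have "... = (if p <= ?k then bs (p, ?k - p) (m, n) * bs (p, ?k - p) (m', n') else 0)"
   using assms by (subst sum.delta) auto
  finally show ?thesis .
 qed
 then have "(\<Sum>p\<le>N. \<Sum>q\<le>N. bs (p, q) (m, n) * bs (p, q) (m', n')) =
  (\<Sum>p\<le>N. if p <= ?k then bs (p, ?k - p) (m, n) * bs (p, ?k - p) (m', n') else 0)" by simp
 also have "... = (\<Sum>p\<le>?k. bs (p, ?k - p) (m, n) * bs (p, ?k - p) (m', n'))"
  by (rule sum.mono_neutral_cong_right) (use assms in auto)
 also have "... = of_bool (m = m')"
  proof -
  have "?k - m = n" "?k - m' = n'" "m <= ?k" "m' <= ?k" using True by auto
  then show ?thesis using bs_orth_level[of m ?k m'] by presburger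
 qed
 finally show ?thesis using True by auto
qed

text \<open>With an empty first input the annihilation recursions have a single term with a positive
  coefficient. This positivity later allows division by the probabilities of the vacuum
  signal.\<close>

lemma bs_column_0_pos: "bs (p, q) (0, p + q) > 0"
proof (induction p)
 case 0
 show ?case
 proof (induction q)
  case 0
  show ?case by (simp add: bs_00)
 next
  case (Suc q)
  have "sqrt (real (Suc q)) * bs (0, Suc q) (0, Suc q) > 0"
   unfolding bs_annihilate2 using Suc tau_pos by (simp add: mult_pos_pos)
  then show ?case by (simp add: zero_less_mult_iff)
 qed
next
 case (Suc p)
 have "sqrt (real (Suc p)) * bs (Suc p, q) (0, Suc p + q) > 0"
  unfolding bs_annihilate1 using Suc rho_pos by (simp add: mult_pos_pos)
 then show ?case by (simp add: zero_less_mult_iff)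
qed

section \<open>Round-trip amplitudes\<close>

text \<open>The amplitude of finding \<open>b\<close>, \<open>e1\<close>, \<open>e2\<close> photons at the output when \<open>s\<close>, \<open>j\<close>, \<open>l\<close>
 photons enter in the signal and the two environments. Photon conservation forces Alice's mode to
 hold \<open>s + j - e1\<close> photons in between.\<close>

definition amp :: "nat => nat => nat => nat => nat => nat => real"
 where "amp s j l b e1 e2 =
  (if e1 <= s + j then bs (b, e2) (s + j - e1, l) * bs (s + j - e1, e1) (s, j) else 0)"

text \<open>Conservation leaves one term of the sum over Alice's photon number \<open>a\<close>. The
  free bound \<open>N\<close> lets both sides of a recursion be summed over the same range.\<close>

lemma amp_sum:
 assumes "s + j <= N"
 shows "amp s j l b e1 e2 = (\<Sum>a\<le>N. bs (b, e2) (a, l) * bs (a, e1) (s, j))"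
proof -
 have "(\<Sum>a\<le>N. bs (b, e2) (a, l) * bs (a, e1) (s, j))
  = (\<Sum>a\<le>N. if a = s + j - e1 then amp s j l b e1 e2 else 0)"
 proof (rule sum.cong)
  fix a
  show "bs (b, e2) (a, l) * bs (a, e1) (s, j) = (if a = s + j - e1 then amp s j l b e1 e2 else 0)"
   by (cases "a + e1 = s + j") (auto simp: amp_def bs_support)
 qed simp
 also have "... = amp s j l b e1 e2" using assms by (subst sum.delta) auto
 finally show ?thesis by simp
qed

lemma amp_support: "b + e1 + e2 ~= s + j + l ==> amp s j l b e1 e2 = 0"
 by (auto simp: amp_def bs_support)

lemmas sum_linear = sum_distrib_left sum_subtractf sum_negf sum.distrib

text \<open>Carries an annihilation in Alice's mode from the backward to the forward beam
  splitter.\<close>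

lemma amp_annihilate_aux:
 assumes "N = s + j"
 shows "(\<Sum>a\<le>N. sqrt (real a) * bs (b, e2) (a - 1, l) * bs (a, e1) (s, j))
   = \<tau> * sqrt (real s) * amp (s - 1) j l b e1 e2 + \<rho> * sqrt (real j) * amp s (j - 1) l b e1 e2"
proof -
 have "(\<Sum>a\<le>N. sqrt (real a) * bs (b, e2) (a - 1, l) * bs (a, e1) (s, j))
   = (\<Sum>a\<le>Suc N. sqrt (real a) * bs (b, e2) (a - 1, l) * bs (a, e1) (s, j))"
  by (rule sum.mono_neutral_left) (auto simp: assms bs_support)
 also have "... = (\<Sum>a\<le>N. bs (b, e2) (a, l) * (sqrt (real (Suc a)) * bs (Suc a, e1) (s, j)))"
  by (subst sum.atMost_Suc_shift) (simp add: mult_ac)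
 also have "... = \<tau> * sqrt (real s) * amp (s - 1) j l b e1 e2 + \<rho> * sqrt (real j) * amp s (j - 1) l b e1 e2"
  unfolding bs_annihilate1 by (simp add: amp_sum[where N = N] assms sum_linear algebra_simps)
 finally show ?thesis .
qed

lemma amp_annihilate_e1:
 "sqrt (real (Suc e1)) * amp s j l b (Suc e1) e2 =
  - \<rho> * sqrt (real s) * amp (s - 1) j l b e1 e2 + \<tau> * sqrt (real j) * amp s (j - 1) l b e1 e2"
proof -
 define N where "N = s + j"
 have "sqrt (real (Suc e1)) * amp s j l b (Suc e1) e2 =
  (\<Sum>a\<le>N. bs (b, e2) (a, l) * (sqrt (real (Suc e1)) * bs (a, Suc e1) (s, j)))"
  by (simp add: amp_sum[of s j N] N_def sum_distrib_left mult_ac del: sum.atMost_Suc)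
 also have "... = - \<rho> * sqrt (real s) * amp (s - 1) j l b e1 e2
   + \<tau> * sqrt (real j) * amp s (j - 1) l b e1 e2" unfolding bs_annihilate2
  by (simp add: amp_sum[where N = N] N_def sum_linear algebra_simps)
 finally show ?thesis .
qed

lemma amp_annihilate_e2:
 "sqrt (real (Suc e2)) * amp s j l b e1 (Suc e2) =
  - (\<rho> * \<tau>) * sqrt (real s) * amp (s - 1) j l b e1 e2
  - \<rho>\<^sup>2 * sqrt (real j) * amp s (j - 1) l b e1 e2 + \<tau> * sqrt (real l) * amp s j (l - 1) b e1 e2"
proof -
 define N where "N = s + j"
 have "sqrt (real (Suc e2)) * amp s j l b e1 (Suc e2) =
  (\<Sum>a\<le>N. (sqrt (real (Suc e2)) * bs (b, Suc e2) (a, l)) * bs (a, e1) (s, j))"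
  by (simp add: amp_sum[of s j N] N_def sum_distrib_left mult_ac del: sum.atMost_Suc)
 also have "... = - \<rho> * (\<Sum>a\<le>N. sqrt (real a) * bs (b, e2) (a - 1, l) * bs (a, e1) (s, j))
   + \<tau> * sqrt (real l) * amp s j (l - 1) b e1 e2" unfolding bs_annihilate2
  by (simp add: amp_sum[where N = N] N_def sum_linear algebra_simps)
 also note amp_annihilate_aux[OF N_def]
 finally show ?thesis by (simp add: algebra_simps power2_eq_square)
qed

lemma amp_annihilate_b:
 "sqrt (real (Suc b)) * amp s j l (Suc b) e1 e2 =
  \<eta> * sqrt (real s) * amp (s - 1) j l b e1 e2 + \<rho> * \<tau> * sqrt (real j) * amp s (j - 1) l b e1 e2
  + \<rho> * sqrt (real l) * amp s j (l - 1) b e1 e2"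
proof -
 define N where "N = s + j"
 have "sqrt (real (Suc b)) * amp s j l (Suc b) e1 e2 =
  (\<Sum>a\<le>N. (sqrt (real (Suc b)) * bs (Suc b, e2) (a, l)) * bs (a, e1) (s, j))"
  by (simp add: amp_sum[of s j N] N_def sum_distrib_left mult_ac del: sum.atMost_Suc)
 also have "... = \<tau> * (\<Sum>a\<le>N. sqrt (real a) * bs (b, e2) (a - 1, l) * bs (a, e1) (s, j))
   + \<rho> * sqrt (real l) * amp s j (l - 1) b e1 e2" unfolding bs_annihilate1
  by (simp add: amp_sum[where N = N] N_def sum_linear algebra_simps)
 also note amp_annihilate_aux[OF N_def]
 finally show ?thesis by (simp add: algebra_simps tau_sq)
qed

lemma amp_create_e1:
 "sqrt (real e1) * amp s j l b (e1 - 1) e2 =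
  - \<rho> * sqrt (real (Suc s)) * amp (Suc s) j l b e1 e2 + \<tau> * sqrt (real (Suc j)) * amp s (Suc j) l b e1 e2"
proof -
 define N where "N = Suc (s + j)"
 have "sqrt (real e1) * amp s j l b (e1 - 1) e2 =
  (\<Sum>a\<le>N. bs (b, e2) (a, l) * (sqrt (real e1) * bs (a, e1 - 1) (s, j)))"
  by (simp add: amp_sum[of s j N] N_def sum_distrib_left mult_ac del: sum.atMost_Suc)
 also have "... = - \<rho> * sqrt (real (Suc s)) * amp (Suc s) j l b e1 e2
  + \<tau> * sqrt (real (Suc j)) * amp s (Suc j) l b e1 e2" unfolding bs_create2
  by (simp add: amp_sum[where N = N] N_def sum_linear algebra_simps del: sum.atMost_Suc of_nat_Suc)
 finally show ?thesis .
qed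

lemma amp_create_aux:
 assumes "N = Suc (s + j)"
 shows "(\<Sum>a\<le>N. sqrt (real (Suc a)) * bs (b, e2) (Suc a, l) * bs (a, e1) (s, j))
   = \<tau> * sqrt (real (Suc s)) * amp (Suc s) j l b e1 e2 + \<rho> * sqrt (real (Suc j)) * amp s (Suc j) l b e1 e2"
proof -
 have "(\<Sum>a\<le>N. sqrt (real (Suc a)) * bs (b, e2) (Suc a, l) * bs (a, e1) (s, j))
   = (\<Sum>a\<le>Suc N. bs (b, e2) (a, l) * (sqrt (real a) * bs (a - 1, e1) (s, j)))"
  by (subst sum.atMost_Suc_shift) (simp add: mult_ac)
 also have "... = \<tau> * sqrt (real (Suc s)) * amp (Suc s) j l b e1 e2
   + \<rho> * sqrt (real (Suc j)) * amp s (Suc j) l b e1 e2" unfolding bs_create1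
  by (simp add: amp_sum[where N = "Suc N"] assms sum_linear algebra_simps del: sum.atMost_Suc of_nat_Suc)
 finally show ?thesis .
qed

lemma amp_create_e2:
 "sqrt (real e2) * amp s j l b e1 (e2 - 1) =
  - (\<rho> * \<tau>) * sqrt (real (Suc s)) * amp (Suc s) j l b e1 e2
  - \<rho>\<^sup>2 * sqrt (real (Suc j)) * amp s (Suc j) l b e1 e2
  + \<tau> * sqrt (real (Suc l)) * amp s j (Suc l) b e1 e2"
proof -
 define N where "N = Suc (s + j)"
 have "sqrt (real e2) * amp s j l b e1 (e2 - 1) =
  (\<Sum>a\<le>N. (sqrt (real e2) * bs (b, e2 - 1) (a, l)) * bs (a, e1) (s, j))"
  by (simp add: amp_sum[of s j N] N_def sum_distrib_left mult_ac del: sum.atMost_Suc)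
 also have "... = - \<rho> * (\<Sum>a\<le>N. sqrt (real (Suc a)) * bs (b, e2) (Suc a, l) * bs (a, e1) (s, j))
   + \<tau> * sqrt (real (Suc l)) * amp s j (Suc l) b e1 e2" unfolding bs_create2
  by (simp add: amp_sum[where N = N] N_def sum_linear algebra_simps del: sum.atMost_Suc of_nat_Suc)
 also note amp_create_aux[OF N_def]
 finally show ?thesis by (simp add: algebra_simps power2_eq_square)
qed

lemma amp_create_b:
 "sqrt (real b) * amp s j l (b - 1) e1 e2 =
  \<eta> * sqrt (real (Suc s)) * amp (Suc s) j l b e1 e2
  + \<rho> * \<tau> * sqrt (real (Suc j)) * amp s (Suc j) l b e1 e2
  + \<rho> * sqrt (real (Suc l)) * amp s j (Suc l) b e1 e2"
proof -
 define N where "N = Suc (s + j)"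
 have "sqrt (real b) * amp s j l (b - 1) e1 e2 =
  (\<Sum>a\<le>N. (sqrt (real b) * bs (b - 1, e2) (a, l)) * bs (a, e1) (s, j))"
  by (simp add: amp_sum[of s j N] N_def sum_distrib_left mult_ac del: sum.atMost_Suc)
 also have "... = \<tau> * (\<Sum>a\<le>N. sqrt (real (Suc a)) * bs (b, e2) (Suc a, l) * bs (a, e1) (s, j))
   + \<rho> * sqrt (real (Suc l)) * amp s j (Suc l) b e1 e2" unfolding bs_create1
  by (simp add: amp_sum[where N = N] N_def sum_linear algebra_simps del: sum.atMost_Suc of_nat_Suc)
 also note amp_create_aux[OF N_def]
 finally show ?thesis by (simp add: algebra_simps tau_sq)
qed

text \<open>Two orthogonality relations in succession: for fixed \<open>e1\<close> the backward beam
  splitter forces equal numbers at Alice and \<open>l = l'\<close>, then the forward one forces the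
  rest.\<close>

lemma amp_orth_sum:
 assumes "s + j + l <= N" "s' + j' + l' <= N"
 shows "(\<Sum>e1\<le>N. \<Sum>b\<le>N. \<Sum>e2\<le>N. amp s j l b e1 e2 * amp s' j' l' b e1 e2)
  = of_bool (s = s' & j = j' & l = l')"
proof -
 have "(\<Sum>b\<le>N. \<Sum>e2\<le>N. amp s j l b e1 e2 * amp s' j' l' b e1 e2)
  = (\<Sum>a\<le>N. bs (a, e1) (s, j) * bs (a, e1) (s', j')) * of_bool (l = l')" for e1
 proof -
  define f f' where "f = (%a. bs (a, e1) (s, j))" and "f' = (%a. bs (a, e1) (s', j'))"
  have "(\<Sum>b\<le>N. \<Sum>e2\<le>N. amp s j l b e1 e2 * amp s' j' l' b e1 e2)
   = (\<Sum>b\<le>N. \<Sum>e2\<le>N. (\<Sum>a\<le>N. bs (b, e2) (a, l) * f a) * (\<Sum>a'\<le>N. bs (b, e2) (a', l') * f' a'))"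
   using assms by (simp add: amp_sum[where N = N] f_def f'_def)
  also have "... = (\<Sum>b\<le>N. \<Sum>e2\<le>N. \<Sum>a\<le>N. \<Sum>a'\<le>N. f a * f' a' * (bs (b, e2) (a, l) * bs (b, e2) (a', l')))"
   unfolding sum_product by (simp add: mult_ac)
  also have "... = (\<Sum>a\<le>N. \<Sum>b\<le>N. \<Sum>e2\<le>N. \<Sum>a'\<le>N. f a * f' a' * (bs (b, e2) (a, l) * bs (b, e2) (a', l')))"
   by (rule sum_rotate[symmetric])
  also have "... = (\<Sum>a\<le>N. \<Sum>a'\<le>N. \<Sum>b\<le>N. \<Sum>e2\<le>N. f a * f' a' * (bs (b, e2) (a, l) * bs (b, e2) (a', l')))"
   by (intro sum.cong refl sum_rotate[symmetric])
  also have "... = (\<Sum>a\<le>N. \<Sum>a'\<le>N. f a * f' a' * of_bool (a = a' & l = l'))"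
  proof (intro sum.cong refl)
   fix a a'
   show "(\<Sum>b\<le>N. \<Sum>e2\<le>N. f a * f' a' * (bs (b, e2) (a, l) * bs (b, e2) (a', l')))
    = f a * f' a' * of_bool (a = a' & l = l')"
   proof (cases "f a = 0")
    case False
    then have "a + e1 = s + j" unfolding f_def using bs_support by blast
    then have "a + l <= N" using assms by simp
    then have "(\<Sum>b\<le>N. \<Sum>e2\<le>N. (bs (b, e2) (a, l) * bs (b, e2) (a', l'))) = of_bool (a = a' & l = l')"
     by (intro bs_orth) auto
    then show ?thesis by (simp only: sum_distrib_left[symmetric])
   qed simp
  qed
  also have "... = (\<Sum>a\<le>N. f a * f' a * of_bool (l = l'))"
  proof (rule sum.cong)
   fix a assume "a \<in> {..N}"
   have "(\<Sum>a'\<le>N. f a * f' a' * of_bool (a = a' & l = l'))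
     = (\<Sum>a'\<le>N. if a = a' then f a * f' a * of_bool (l = l') else 0)" by (rule sum.cong) auto
   also have "... = f a * f' a * of_bool (l = l')" using \<open>a \<in> {..N}\<close> by (subst sum.delta') auto
   finally show "(\<Sum>a'\<le>N. f a * f' a' * of_bool (a = a' & l = l')) = f a * f' a * of_bool (l = l')" .
  qed simp
  finally show ?thesis by (simp add: f_def f'_def sum_distrib_right)
 qed
 then have "(\<Sum>e1\<le>N. \<Sum>b\<le>N. \<Sum>e2\<le>N. amp s j l b e1 e2 * amp s' j' l' b e1 e2)
  = (\<Sum>e1\<le>N. \<Sum>a\<le>N. bs (a, e1) (s, j) * bs (a, e1) (s', j')) * of_bool (l = l')"
  by (simp add: sum_distrib_right)
 also have "(\<Sum>e1\<le>N. \<Sum>a\<le>N. bs (a, e1) (s, j) * bs (a, e1) (s', j'))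
   = (\<Sum>a\<le>N. \<Sum>e1\<le>N. bs (a, e1) (s, j) * bs (a, e1) (s', j'))" by (rule sum.swap)
 also have "... = of_bool (s = s' & j = j')" using assms by (intro bs_orth) auto
 finally show ?thesis by auto
qed

definition ampv :: "nat \<times> nat \<times> nat => nat \<times> nat \<times> nat => real"
 where "ampv = (%(s, j, l) (b, e1, e2). amp s j l b e1 e2)"

lemma amp_orth:
 "((%y. ampv z y * ampv z' y) has_sum of_bool (z = z')) UNIV"
proof -
 obtain s j l s' j' l' where z: "z = (s, j, l)" and z': "z' = (s', j', l')" by (metis prod_cases3)
 define N where "N = s + j + l + s' + j' + l'"
 define F where "F = {..N} \<times> {..N} \<times> {..N}"
 have "(\<Sum>y\<in>F. ampv z y * ampv z' y)
  = (\<Sum>b\<le>N. \<Sum>e1\<le>N. \<Sum>e2\<le>N. amp s j l b e1 e2 * amp s' j' l' b e1 e2)"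
  by (simp add: F_def sum.cartesian_product z z' ampv_def case_prod_beta)
 also have "... = (\<Sum>e1\<le>N. \<Sum>b\<le>N. \<Sum>e2\<le>N. amp s j l b e1 e2 * amp s' j' l' b e1 e2)"
  by (rule sum.swap)
 also have "... = of_bool (z = z')" by (subst amp_orth_sum) (auto simp: N_def z z')
 finally have "(\<Sum>y\<in>F. ampv z y * ampv z' y) = of_bool (z = z')" .
 moreover have "ampv z y * ampv z' y = 0" if "y \<notin> F" for y
 proof -
  obtain b e1 e2 where y: "y = (b, e1, e2)" by (metis prod_cases3)
  have "b + e1 + e2 ~= s + j + l" using that by (auto simp: F_def N_def y)
  then show ?thesis by (simp add: y z ampv_def amp_support)
 qed
 ultimately show ?thesis by (intro has_sum_finite_neutralI[where B = F]) (auto simp: F_def)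
qed

end

section \<open>Ensembles\<close>

lemma real_mult_summable:
 fixes f g :: "'a => real"
 assumes "(%x. (f x)\<^sup>2) summable_on A" "(%x. (g x)\<^sup>2) summable_on A"
 shows "(%x. f x * g x) summable_on A"
proof -
 have "(%x. \<bar>f x\<bar> * \<bar>g x\<bar>) summable_on A"
  using infsum_Cauchy_Schwarz(1)[OF has_sum_infsum has_sum_infsum] assms by blast
 then show ?thesis by (subst summable_on_iff_abs_summable_on_real) (simp add: abs_mult)
qed

text \<open>A quadratic form of the averaged matrix is an infinite sum of squared moduli.\<close>

lemma positive_mtx_ensemble:
 fixes \<psi> :: "'k => 'a => complex"
 assumes A: "!!x y. A x y = (\<Sum>\<^sub>\<infinity>k. \<psi> k x * cnj (\<psi> k y))"
  and sq: "!!x. (%k. (cmod (\<psi> k x))\<^sup>2) summable_on UNIV"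
 shows "positive_mtx A" unfolding positive_mtx_def
proof (intro allI impI)
 fix F :: "'a set" and v :: "'a => complex" assume F: "finite F"
 have s: "(%k. \<psi> k x * cnj (\<psi> k y)) summable_on UNIV" for x y using sq by (intro square_summable_mult) simp_all
 have s': "(%k. cnj (v x) * (\<psi> k x * cnj (\<psi> k y)) * v y) summable_on UNIV" for x y
  by (intro summable_on_cmult_left summable_on_cmult_right s)
 have "(\<Sum>x\<in>F. \<Sum>y\<in>F. cnj (v x) * A x y * v y)
  = (\<Sum>x\<in>F. \<Sum>y\<in>F. \<Sum>\<^sub>\<infinity>k. cnj (v x) * (\<psi> k x * cnj (\<psi> k y)) * v y)"
  using s by (simp only: A infsum_cmult_left' infsum_cmult_right')
 also have "... = (\<Sum>\<^sub>\<infinity>k. \<Sum>x\<in>F. \<Sum>y\<in>F. cnj (v x) * (\<psi> k x * cnj (\<psi> k y)) * v y)"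
  using F s' by (simp add: infsum_finite_sum summable_on_finite_sum)
 also have e: "(%k. \<Sum>x\<in>F. \<Sum>y\<in>F. cnj (v x) * (\<psi> k x * cnj (\<psi> k y)) * v y)
   = (%k. cr ((cmod (\<Sum>y\<in>F. cnj (\<psi> k y) * v y))\<^sup>2))"
 proof
  fix k
  have "(\<Sum>x\<in>F. \<Sum>y\<in>F. cnj (v x) * (\<psi> k x * cnj (\<psi> k y)) * v y)
   = cnj (\<Sum>y\<in>F. cnj (\<psi> k y) * v y) * (\<Sum>y\<in>F. cnj (\<psi> k y) * v y)"
   unfolding cnj_sum sum_product by (simp add: mult_ac)
  then show "(\<Sum>x\<in>F. \<Sum>y\<in>F. cnj (v x) * (\<psi> k x * cnj (\<psi> k y)) * v y)
   = cr ((cmod (\<Sum>y\<in>F. cnj (\<psi> k y) * v y))\<^sup>2)" by (simp only: complex_norm_square mult.commute)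
 qed
 also have "(\<Sum>\<^sub>\<infinity>k. cr ((cmod (\<Sum>y\<in>F. cnj (\<psi> k y) * v y))\<^sup>2)) \<in> \<real>\<^sub>\<ge>\<^sub>0"
 proof -
  have "(%k. \<Sum>x\<in>F. \<Sum>y\<in>F. cnj (v x) * (\<psi> k x * cnj (\<psi> k y)) * v y) summable_on UNIV"
   using F s' by (intro summable_on_finite_sum)
  then have "(%k. cr ((cmod (\<Sum>y\<in>F. cnj (\<psi> k y) * v y))\<^sup>2)) summable_on UNIV" unfolding e .
  then have "0 <= (\<Sum>\<^sub>\<infinity>k. cr ((cmod (\<Sum>y\<in>F. cnj (\<psi> k y) * v y))\<^sup>2))"
   by (rule infsum_nonneg_complex) (simp add: less_eq_complex_def del: of_real_power)
  then show ?thesis by (simp add: complex_nonneg_Reals_iff less_eq_complex_def)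
 qed
 finally show "(\<Sum>x\<in>F. \<Sum>y\<in>F. cnj (v x) * A x y * v y) \<in> \<real>\<^sub>\<ge>\<^sub>0" .
qed

section \<open>Thermal weights\<close>

definition th :: "real => nat => real"
 where "th N k = N ^ k / (N + 1) ^ (k + 1)"

lemma th_nonneg: "N >= 0 ==> th N k >= 0"
 by (simp add: th_def)

lemma th_pos: "N > 0 ==> th N k > 0"
 by (simp add: th_def)

lemma th_Suc: "N >= 0 ==> (N + 1) * th N (Suc k) = N * th N k"
 by (simp add: th_def divide_simps)

lemma th_eq: "N >= 0 ==> th N k = (N / (N + 1)) ^ k * (1 / (N + 1))"
 by (simp add: th_def power_divide)

lemma has_sum_th:
 assumes "N >= 0"
 shows "(th N has_sum 1) UNIV"
proof -
 let ?q = "N / (N + 1)"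
 have q: "0 <= ?q" "?q < 1" using assms by auto
 have "(%k. ?q ^ k * (1 / (N + 1))) sums (1 / (1 - ?q) * (1 / (N + 1)))"
  using q by (intro sums_mult2 geometric_sums) (simp only: real_norm_def abs_of_nonneg)
 also have "1 / (1 - ?q) * (1 / (N + 1)) = 1" using assms by (simp add: field_simps)
 finally have "(%k. th N k) sums 1" using assms by (simp add: th_eq)
 then show ?thesis using assms by (intro sums_nonneg_imp_has_sum) (auto simp: th_nonneg)
qed

text \<open>The recursion of the thermal weights turns weighted sums into shifted ones; all moments
 follow from it.\<close>

lemma has_sum_th_shift:
 assumes N: "N >= 0" and f: "((%k. th N k * f (Suc k)) has_sum s) UNIV" and f0: "f 0 = 0"
 shows "((%k. th N k * f k) has_sum (N / (N + 1) * s)) UNIV"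
proof -
 have "((%k. th N (Suc k) * f (Suc k)) has_sum (N / (N + 1) * s)) UNIV"
 proof (rule has_sum_eq_rule[OF has_sum_cmult_right[OF f, of "N / (N + 1)"]])
  show "N / (N + 1) * (th N k * f (Suc k)) = th N (Suc k) * f (Suc k)" for k
  proof -
   have "th N (Suc k) = N / (N + 1) * th N k" using th_Suc[OF N, of k] N by (simp add: field_simps)
   then show ?thesis by simp
  qed
 qed simp
 then have "((%k. th N k * f k) \<circ> Suc has_sum (N / (N + 1) * s)) UNIV" by (simp add: o_def)
 then have "((%k. th N k * f k) has_sum (N / (N + 1) * s)) (range Suc)" by (subst has_sum_reindex) auto
 then show ?thesis
 proof (rule has_sum_cong_neutral[THEN iffD1, rotated -1])
  show "th N x * f x = 0" if "x \<in> UNIV - range Suc" for x using that f0 by (cases x) auto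
 qed auto
qed

lemma summable_th_moments:
 assumes "N >= 0"
 shows "(%k. th N k * real k) summable_on UNIV" "(%k. th N k * (real k)\<^sup>2) summable_on UNIV"
proof -
 let ?q = "N / (N + 1)"
 have q: "0 <= ?q" "?q < 1" using assms by auto
 have s1: "summable (%k. real k * x ^ k)" if "0 <= x" "x < 1" for x :: real
 proof (rule summable_comparison_test')
  show "summable (%k. real (Suc k) * x ^ k)" using geometric_deriv_sums[of x] that by (simp add: sums_iff)
  show "norm (real k * x ^ k) <= real (Suc k) * x ^ k" for k using that by (simp add: mult_right_mono)
 qed
 have s2: "summable (%k. (real k)\<^sup>2 * x ^ k)" if "0 <= x" "x < 1" for x :: real
 proof -
  \<comment> \<open>With \<open>x ^ k\<close> split into two powers of the root, one factor
    \<open>k * ?s ^ k\<close> is bounded and the other is summable.\<close>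
  let ?s = "sqrt x"
  have s: "0 <= ?s" "?s < 1" using that by auto
  have "(%k. real k * ?s ^ k) \<longlonglongrightarrow> 0" using powser_times_n_limit_0[of ?s] s by simp
  then have "Bseq (%k. real k * ?s ^ k)" by (intro convergent_imp_Bseq convergentI)
  then obtain K where K: "!!k. norm (real k * ?s ^ k) <= K" unfolding Bseq_def by blast
  show ?thesis
  proof (rule summable_comparison_test')
   show "summable (%k. K * (real k * ?s ^ k))" by (intro summable_mult s1 s)
   fix k
   have "x ^ k = ?s ^ k * ?s ^ k" using that by (simp flip: power_mult_distrib)
   then have "norm ((real k)\<^sup>2 * x ^ k) = norm (real k * ?s ^ k) * (real k * ?s ^ k)"
    using s by (simp add: power2_eq_square)
   also have "... <= K * (real k * ?s ^ k)" using K s by (intro mult_right_mono) auto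
   finally show "norm ((real k)\<^sup>2 * x ^ k) <= K * (real k * ?s ^ k)" .
  qed
 qed
 show "(%k. th N k * real k) summable_on UNIV"
 proof (rule summable_nonneg_imp_summable_on)
  show "summable (%k. th N k * real k)"
   using summable_mult[OF s1[OF q], of "1 / (N + 1)"] assms by (simp add: th_eq mult_ac)
 qed (simp add: th_nonneg assms)
 show "(%k. th N k * (real k)\<^sup>2) summable_on UNIV"
 proof (rule summable_nonneg_imp_summable_on)
  show "summable (%k. th N k * (real k)\<^sup>2)"
   using summable_mult[OF s2[OF q], of "1 / (N + 1)"] assms by (simp add: th_eq mult_ac)
 qed (simp add: th_nonneg assms)
qed

text \<open>The shift expresses each moment by itself and the lower ones, which is a linear equation
  with a unique solution.\<close>

lemma has_sum_th_moments:
 assumes N: "N >= 0"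
 shows "((%k. th N k * real k) has_sum N) UNIV"
  "((%k. th N k * (real k)\<^sup>2) has_sum (2 * N^2 + N)) UNIV"
proof -
 define m1 where "m1 = (\<Sum>\<^sub>\<infinity>k. th N k * real k)"
 define m2 where "m2 = (\<Sum>\<^sub>\<infinity>k. th N k * (real k)\<^sup>2)"
 have h0: "(th N has_sum 1) UNIV" by (rule has_sum_th[OF N])
 have h1: "((%k. th N k * real k) has_sum m1) UNIV" unfolding m1_def by (intro has_sum_infsum summable_th_moments N)
 have h2: "((%k. th N k * (real k)\<^sup>2) has_sum m2) UNIV"
  unfolding m2_def by (intro has_sum_infsum summable_th_moments N)
 have "((%k. th N k * real (Suc k)) has_sum (m1 + 1)) UNIV"
  by (rule has_sum_eq_rule[OF has_sum_add[OF h1 h0]]) (auto simp: algebra_simps)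
 then have "((%k. th N k * real k) has_sum (N / (N + 1) * (m1 + 1))) UNIV" by (rule has_sum_th_shift[OF N]) simp
 then have "m1 = N / (N + 1) * (m1 + 1)" using h1 has_sum_unique by blast
 then have "m1 * (N + 1) = N * (m1 + 1)" using N by (simp add: field_simps)
 then have m1: "m1 = N" by (simp add: algebra_simps)
 have "((%k. th N k * (real (Suc k))\<^sup>2) has_sum (m2 + 2 * m1 + 1)) UNIV"
  by (rule has_sum_eq_rule[OF has_sum_add[OF has_sum_add[OF h2 has_sum_cmult_right[OF h1, of 2]] h0]])
   (auto simp: algebra_simps power2_eq_square)
 then have "((%k. th N k * (real k)\<^sup>2) has_sum (N / (N + 1) * (m2 + 2 * m1 + 1))) UNIV"
  by (rule has_sum_th_shift[OF N]) simp
 then have "m2 = N / (N + 1) * (m2 + 2 * m1 + 1)" using h2 has_sum_unique by blast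
 then have "m2 * (N + 1) = N * (m2 + 2 * m1 + 1)" using N by (simp add: field_simps)
 then have m2: "m2 = 2 * N^2 + N" unfolding m1 by (simp add: algebra_simps power2_eq_square)
 show "((%k. th N k * real k) has_sum N) UNIV" using h1 m1 by simp
 show "((%k. th N k * (real k)\<^sup>2) has_sum (2 * N^2 + N)) UNIV" using h2 m2 by simp
qed

section \<open>The round trip state\<close>

lemma cis_diff_mult: "cis (x * (a - b)) = cis (x * a) * cis (- (x * b))"
 by (simp add: cis_mult right_diff_distrib)

lemma conjugate_by_finite:
 assumes "finite A" "finite B"
  and "!!z z'. z \<notin> A ==> U x z * S z z' = 0" "!!z z'. z' \<notin> B ==> S z z' * cnj (U y z') = 0"
 shows "conjugate_by U S x y = (\<Sum>z\<in>A. \<Sum>z'\<in>B. U x z * S z z' * cnj (U y z'))"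
proof -
 have 1: "(U \<odot> S) x z' = (\<Sum>z\<in>A. U x z * S z z')" for z' unfolding mtx_mult_def using assms
  by (subst infsum_cong_neutral[of A UNIV _ "%z. U x z * S z z'"]) auto
 have 2: "(U \<odot> S) x z' * cnj (U y z') = 0" if "z' \<notin> B" for z' unfolding 1 sum_distrib_right
  by (intro sum.neutral ballI) (simp only: mult.assoc assms(4)[OF that] mult_zero_right)
 have "conjugate_by U S x y = (\<Sum>\<^sub>\<infinity>z'. (U \<odot> S) x z' * cnj (U y z'))"
  by (simp only: conjugate_by_def mtx_mult_def[of "U \<odot> S"] mtx_adjoint_def)
 also have "... = (\<Sum>z'\<in>B. (U \<odot> S) x z' * cnj (U y z'))"
  using assms(2) 2 by (subst infsum_cong_neutral[of B UNIV _ "%z'. (U \<odot> S) x z' * cnj (U y z')"]) auto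
 also have "... = (\<Sum>z'\<in>B. \<Sum>z\<in>A. U x z * S z z' * cnj (U y z'))" by (simp add: 1 sum_distrib_right)
 also have "... = (\<Sum>z\<in>A. \<Sum>z'\<in>B. U x z * S z z' * cnj (U y z'))" by (rule sum.swap)
 finally show ?thesis .
qed

locale roundtrip = lossy +
 fixes NB1 NB2 :: real
 assumes NB1_pos: "NB1 > 0" and NB2_pos: "NB2 > 0"
begin

text \<open>Signal and idler numbers agree in the resource state, so the idler entries fix the
  signal numbers. Conservation makes the remaining sum over the environment finite.\<close>

lemma forward_state:
 assumes NS: "NS >= 0" and T: "a + e1 <= T" "a' + e1' <= T"
 shows "conjugate_by (forward_channel \<eta>) (initial_state NB1 NB2 NS) (a, i, e1, l) (a', i', e1', l')
  = cr (sqrt (th NS i) * sqrt (th NS i') * of_bool (l = l') * th NB2 l *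
    (\<Sum>j\<le>T. th NB1 j * (bs (a, e1) (i, j) * bs (a', e1') (i', j))))"
proof -
 let ?U = "forward_channel \<eta>" and ?S = "initial_state NB1 NB2 NS"
 define A where "A = (%j. (i, i, j, l)) ` {..T}"
 define B where "B = (%j. (i', i', j, l')) ` {..T}"
 have "conjugate_by ?U ?S (a, i, e1, l) (a', i', e1', l')
  = (\<Sum>z\<in>A. \<Sum>z'\<in>B. ?U (a, i, e1, l) z * ?S z z' * cnj (?U (a', i', e1', l') z'))"
 proof (rule conjugate_by_finite)
  fix z z' assume "z \<notin> A"
  obtain s k c1 c2 where z: "z = (s, k, c1, c2)" by (metis prod_cases4)
  show "?U (a, i, e1, l) z * ?S z z' = 0"
  proof (cases "s = i & k = i & c2 = l")
   case True
   then have "c1 > T" using \<open>z \<notin> A\<close> by (auto simp: z A_def)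
   then show ?thesis using T True by (simp add: z forward_channel_def beam_splitter_eq bs_support)
  qed (auto simp: z forward_channel_def initial_state_def tmsv_def tmsv_vec_def split: prod.splits)
 next
  fix z z' assume "z' \<notin> B"
  obtain s k c1 c2 where z: "z' = (s, k, c1, c2)" by (metis prod_cases4)
  show "?S z z' * cnj (?U (a', i', e1', l') z') = 0"
  proof (cases "s = i' & k = i' & c2 = l'")
   case True
   then have "c1 > T" using \<open>z' \<notin> B\<close> by (auto simp: z B_def)
   then show ?thesis using T True by (simp add: z forward_channel_def beam_splitter_eq bs_support)
  qed (auto simp: z forward_channel_def initial_state_def tmsv_def tmsv_vec_def split: prod.splits)
 qed (auto simp: A_def B_def)
 also have "... = (\<Sum>j\<le>T. \<Sum>j'\<le>T. cr (sqrt (th NS i) * sqrt (th NS i') * of_bool (l = l') * th NB2 l *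
    (th NB1 j * (bs (a, e1) (i, j) * bs (a', e1') (i', j')))) * of_bool (j = j'))" unfolding A_def B_def
  by (subst sum.reindex, simp add: inj_on_def, subst sum.reindex, simp add: inj_on_def)
   (auto intro!: sum.cong simp: forward_channel_def initial_state_def tmsv_def tmsv_vec_def
    thermal_def beam_splitter_eq th_def mult_ac)
 also have "... = (\<Sum>j\<le>T. cr (sqrt (th NS i) * sqrt (th NS i') * of_bool (l = l') * th NB2 l *
    (th NB1 j * (bs (a, e1) (i, j) * bs (a', e1') (i', j)))))" by (intro sum.cong refl sum_of_bool_mult) auto
 finally show ?thesis by (simp only: of_real_sum sum_distrib_left)
qed

lemma phase_state:
 "conjugate_by (phase_shift \<theta>) S x y = cis (\<theta> * (real (fst x) - real (fst y))) * S x y"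
proof -
 have "conjugate_by (phase_shift \<theta>) S x y = (\<Sum>z\<in>{x}. \<Sum>z'\<in>{y}. phase_shift \<theta> x z * S z z' * cnj (phase_shift \<theta> y z'))"
  by (rule conjugate_by_finite) (auto simp: phase_shift_def)
 also have "... = (cis (\<theta> * real (fst x)) * cis (- (\<theta> * real (fst y)))) * S x y"
  by (simp add: phase_shift_def cis_cnj)
 finally show ?thesis by (simp add: cis_mult right_diff_distrib)
qed

text \<open>Alice's photon number is determined by conservation, so her phase leaves the sum as one
  factor.\<close>

lemma amp_phase_sum:
 assumes "b + e2 <= T"
 shows "(\<Sum>a\<le>T. cr (bs (b, e2) (a, l) * bs (a, e1) (i, j)) * cis (\<theta> * real a))
  = cr (amp i j l b e1 e2) * cis (\<theta> * (real i + real j - real e1))"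
proof -
 have "(\<Sum>a\<le>T. cr (bs (b, e2) (a, l) * bs (a, e1) (i, j)) * cis (\<theta> * real a))
  = (\<Sum>a\<le>T. if a = i + j - e1 then cr (amp i j l b e1 e2) * cis (\<theta> * (real i + real j - real e1)) else 0)"
 proof (rule sum.cong)
  fix a
  show "cr (bs (b, e2) (a, l) * bs (a, e1) (i, j)) * cis (\<theta> * real a)
   = (if a = i + j - e1 then cr (amp i j l b e1 e2) * cis (\<theta> * (real i + real j - real e1)) else 0)"
  proof (cases "a + e1 = i + j")
   case True
   then have "a = i + j - e1" "e1 <= i + j" by auto
   then show ?thesis by (auto simp: amp_def of_nat_diff)
  qed (auto simp: amp_def bs_support)
 qed simp
 also have "... = cr (amp i j l b e1 e2) * cis (\<theta> * (real i + real j - real e1))"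
 proof (cases "i + j - e1 <= T")
  case True
  then show ?thesis by (subst sum.delta) auto
 next
  case False
  then have "bs (b, e2) (i + j - e1, l) = 0" using assms by (intro bs_support) auto
  then show ?thesis using False by (subst sum.delta) (auto simp: amp_def)
 qed
 finally show ?thesis .
qed

text \<open>The thermal number \<open>j\<close> is the same in row and column and cancels from the
  phase, which therefore depends only on the idler and \<open>E1\<close> numbers.\<close>

lemma round_trip_eq:
 assumes NS: "NS >= 0" and T: "b + e1 + e2 <= T" "b' + e1' + e2' <= T"
 shows "round_trip_state \<eta> NB1 NB2 NS \<theta> (b, i, e1, e2) (b', i', e1', e2')
  = cis (\<theta> * ((real i - real e1) - (real i' - real e1'))) *
   cr (sqrt (th NS i) * sqrt (th NS i') *
   (\<Sum>j\<le>T. \<Sum>l\<le>T. th NB1 j * th NB2 l * (amp i j l b e1 e2 * amp i' j l b' e1' e2')))"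
proof -
 let ?U = "backward_channel \<eta>"
 define S where "S = conjugate_by (phase_shift \<theta>) (conjugate_by (forward_channel \<eta>) (initial_state NB1 NB2 NS))"
 define A where "A = (%(a, l). (a, i, e1, l)) ` ({..T} \<times> {..T})"
 define B where "B = (%(a, l). (a, i', e1', l)) ` ({..T} \<times> {..T})"
 \<comment> \<open>The bound required by \<open>forward_state\<close> for all \<open>a <= T\<close>,
   since \<open>a + e1\<close> may exceed \<open>T\<close>.\<close>
 define T' where "T' = T + e1 + e1'"
 define c where "c = sqrt (th NS i) * sqrt (th NS i')"
 define u where "u = (%a l j. cr (bs (b, e2) (a, l) * bs (a, e1) (i, j)) * cis (\<theta> * real a))"
 define v where "v = (%a l j. cr (bs (b', e2') (a, l) * bs (a, e1') (i', j)) * cis (\<theta> * real a))"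
 define q where "q = (%j l. cr (c * th NB1 j * th NB2 l))"
 define w where "w = cis (\<theta> * ((real i - real e1) - (real i' - real e1')))"
 have S: "cr (bs (b, e2) (a, l)) * S (a, i, e1, l) (a', i', e1', l') * cr (bs (b', e2') (a', l'))
   = (\<Sum>j\<le>T'. q j l * (u a l j * cnj (v a' l j))) * of_bool (l' = l)"
  if "a <= T" "a' <= T" for a a' l l' unfolding S_def phase_state using that
  by (subst forward_state[OF NS, where T = T'])
   (auto simp: T'_def c_def q_def u_def v_def sum_distrib_left sum_distrib_right cis_diff_mult cis_cnj mult_ac)
 have "round_trip_state \<eta> NB1 NB2 NS \<theta> (b, i, e1, e2) (b', i', e1', e2')
   = conjugate_by ?U S (b, i, e1, e2) (b', i', e1', e2')" by (simp add: round_trip_state_def S_def)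
 also have "... = (\<Sum>z\<in>A. \<Sum>z'\<in>B. ?U (b, i, e1, e2) z * S z z' * cnj (?U (b', i', e1', e2') z'))"
 proof (rule conjugate_by_finite)
  have bsn: "bs (p, q) (m, n) ~= 0 ==> p + q = m + n" for p q m n using bs_support by blast
  have supp: "z \<in> (%(a, l). (a, i, e1, l)) ` ({..T} \<times> {..T})"
   if "?U (b, i, e1, e2) z ~= 0" "b + e1 + e2 <= T" for b i e1 e2 z
   using that by (cases z) (auto simp: backward_channel_def beam_splitter_eq image_iff dest!: bsn split: if_splits)
  show "?U (b, i, e1, e2) z * S z z' = 0" if "z \<notin> A" for z z'
   using that supp[of b i e1 e2 z] T(1) unfolding A_def by fastforce
  show "S z z' * cnj (?U (b', i', e1', e2') z') = 0" if "z' \<notin> B" for z z'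
   using that supp[of b' i' e1' e2' z'] T(2) unfolding B_def by fastforce
 qed (auto simp: A_def B_def)
 also have "... = (\<Sum>(a, l)\<in>{..T}\<times>{..T}. \<Sum>(a', l')\<in>{..T}\<times>{..T}.
   cr (bs (b, e2) (a, l)) * S (a, i, e1, l) (a', i', e1', l') * cr (bs (b', e2') (a', l')))" unfolding A_def B_def
  by (subst sum.reindex, simp add: inj_on_def, subst sum.reindex, simp add: inj_on_def)
   (simp add: backward_channel_def beam_splitter_eq case_prod_beta)
 also have "... = (\<Sum>a\<le>T. \<Sum>l\<le>T. \<Sum>a'\<le>T. \<Sum>l'\<le>T.
   (\<Sum>j\<le>T'. q j l * (u a l j * cnj (v a' l j))) * of_bool (l' = l))"
  unfolding sum.cartesian_product[symmetric] by (intro sum.cong refl) (simp add: S)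
 also have "... = (\<Sum>a\<le>T. \<Sum>l\<le>T. \<Sum>a'\<le>T. \<Sum>j\<le>T'. q j l * (u a l j * cnj (v a' l j)))"
  by (intro sum.cong refl sum_of_bool_mult) auto
 also have "... = (\<Sum>l\<le>T. \<Sum>a\<le>T. \<Sum>j\<le>T'. \<Sum>a'\<le>T. q j l * (u a l j * cnj (v a' l j)))"
  by (subst sum.swap) (intro sum.cong refl sum.swap)
 also have "... = (\<Sum>l\<le>T. \<Sum>j\<le>T'. \<Sum>a\<le>T. \<Sum>a'\<le>T. q j l * (u a l j * cnj (v a' l j)))"
  by (intro sum.cong refl sum.swap)
 also have "... = (\<Sum>l\<le>T. \<Sum>j\<le>T'. q j l * ((\<Sum>a\<le>T. u a l j) * cnj (\<Sum>a\<le>T. v a l j)))"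
  unfolding cnj_sum sum_product by (simp only: sum_distrib_left)
 also have "... = (\<Sum>l\<le>T. \<Sum>j\<le>T'. w * cr (c * (th NB1 j * th NB2 l * (amp i j l b e1 e2 * amp i' j l b' e1' e2'))))"
 proof (intro sum.cong refl)
  fix l j
  have "cis (\<theta> * (real i + real j - real e1)) * cnj (cis (\<theta> * (real i' + real j - real e1'))) = w"
   by (simp add: w_def cis_cnj cis_mult algebra_simps)
  then show "q j l * ((\<Sum>a\<le>T. u a l j) * cnj (\<Sum>a\<le>T. v a l j))
   = w * cr (c * (th NB1 j * th NB2 l * (amp i j l b e1 e2 * amp i' j l b' e1' e2')))"
   unfolding q_def u_def v_def using T by (subst (1 2) amp_phase_sum) (auto simp: mult_ac)
 qed
 also have "... = (\<Sum>l\<le>T. \<Sum>j\<le>T. w * cr (c * (th NB1 j * th NB2 l * (amp i j l b e1 e2 * amp i' j l b' e1' e2'))))"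
  by (intro sum.cong refl sum.mono_neutral_right) (use T in \<open>auto simp: T'_def amp_support\<close>)
 also have "... = (\<Sum>j\<le>T. \<Sum>l\<le>T. w * cr (c * (th NB1 j * th NB2 l * (amp i j l b e1 e2 * amp i' j l b' e1' e2'))))"
  by (rule sum.swap)
 finally show ?thesis by (simp only: sum_distrib_left of_real_sum c_def w_def)
qed

end

lemma infsum_pair:
 fixes f :: "'a \<times> 'b => 'c::banach"
 assumes "f summable_on UNIV"
 shows "(\<Sum>\<^sub>\<infinity>x. \<Sum>\<^sub>\<infinity>y. f (x, y)) = infsum f UNIV"
proof -
 have "(%(x, y). f (x, y)) = f" by auto
 then show ?thesis using infsum_Sigma'_banach[of "%x y. f (x, y)" UNIV "%_. UNIV"] assms by simp
qed

context roundtrip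
begin

lemma amp_nonzero: "amp s j l b e1 e2 ~= 0 ==> b + e1 + e2 = s + j + l"
 using amp_support by blast

text \<open>Amplitude of the joint pure ensemble: the thermal environments are diagonal mixtures over the
 photon numbers \<open>j\<close>, \<open>l\<close>, and the idler number \<open>i\<close> equals that of the outgoing signal.\<close>

definition joint :: "real => nat => nat => nat => nat => nat => nat => real"
 where "joint NS i j l b e1 e2 = sqrt (th NS i * th NB1 j * th NB2 l) * amp i j l b e1 e2"

definition bob_amp :: "real => nat \<times> nat => (nat \<times> nat) \<times> (nat \<times> nat) => real"
 where "bob_amp NS = (%(b, i) ((e1, e2), (j, l)). joint NS i j l b e1 e2)"

definition eve_amp :: "real => nat \<times> nat => (nat \<times> nat) \<times> (nat \<times> nat) => real"
 where "eve_amp NS = (%(e1, e2) ((b, i), (j, l)). joint NS i j l b e1 e2)"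

lemma has_sum_joint:
 assumes NS: "NS >= 0"
 shows "((%((i, j, l), (b, e1, e2)). (joint NS i j l b e1 e2)\<^sup>2) has_sum 1) UNIV"
proof -
 define q where "q = (%(i, j, l). th NS i * th NB1 j * th NB2 l)"
 have q0: "q z >= 0" for z using NS NB1_pos NB2_pos by (auto simp: q_def th_nonneg split: prod.splits)
 have "((%(i, jl). th NS i * (%(j, l). th NB1 j * th NB2 l) jl) has_sum 1 * (1 * 1)) UNIV"
  using NS NB1_pos NB2_pos by (intro has_sum_product_UNIV has_sum_th) (auto simp: th_nonneg)
 then have qs: "(q has_sum 1) UNIV" by (rule has_sum_eq_rule) (auto simp: q_def)
 define f where "f = (%((i, j, l), (b, e1, e2)). (joint NS i j l b e1 e2)\<^sup>2)"
 have "(f has_sum 1) UNIV"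
 proof (rule has_sum_pair_nonneg[OF has_sum_eq_rule[OF has_sum_cmult_right[OF amp_orth]] qs])
  fix z y :: "nat \<times> nat \<times> nat"
  obtain i j l b e1 e2 where zy: "z = (i, j, l)" "y = (b, e1, e2)" by (metis prod_cases3)
  have "(sqrt (q z))\<^sup>2 = q z" using q0 by simp
  then show "q z * (ampv z y * ampv z y) = f (z, y)"
   by (simp add: zy joint_def q_def ampv_def f_def power_mult_distrib) (simp add: power2_eq_square)
 qed (auto simp: f_def split: prod.splits)
 then show ?thesis by (simp add: f_def)
qed

lemma has_sum_bob_amp: "NS >= 0 ==> ((%(x, k). (bob_amp NS x k)\<^sup>2) has_sum 1) UNIV"
 by (rule has_sum_bij[OF has_sum_joint, where j = "%((b, i), ((e1, e2), (j, l))). ((i, j, l), (b, e1, e2))"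
    and i = "%((i, j, l), (b, e1, e2)). ((b, i), ((e1, e2), (j, l)))"]) (auto simp: bob_amp_def)

lemma has_sum_eve_amp: "NS >= 0 ==> ((%(x, k). (eve_amp NS x k)\<^sup>2) has_sum 1) UNIV"
 by (rule has_sum_bij[OF has_sum_joint, where j = "%((e1, e2), ((b, i), (j, l))). ((i, j, l), (b, e1, e2))"
    and i = "%((i, j, l), (b, e1, e2)). ((e1, e2), ((b, i), (j, l)))"]) (auto simp: eve_amp_def)

text \<open>Bob's state at phase zero. It is real, and a phase only multiplies its entries by
  \<open>cis\<close> factors in the idler numbers.\<close>

definition bob_mtx :: "real => nat \<times> nat => nat \<times> nat => real"
 where "bob_mtx NS x y = (\<Sum>\<^sub>\<infinity>k. bob_amp NS x k * bob_amp NS y k)"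

definition eve_mtx :: "real => nat \<times> nat => nat \<times> nat => real"
 where "eve_mtx NS x y = (\<Sum>\<^sub>\<infinity>k. eve_amp NS x k * eve_amp NS y k)"

lemma summable_bob_amp: "NS >= 0 ==> (%k. (bob_amp NS x k)\<^sup>2) summable_on UNIV"
 using summable_on_SigmaD1[of "%x k. (bob_amp NS x k)\<^sup>2" UNIV "%_. UNIV" x]
  has_sum_imp_summable[OF has_sum_bob_amp[of NS]] by simp

lemma summable_eve_amp: "NS >= 0 ==> (%k. (eve_amp NS x k)\<^sup>2) summable_on UNIV"
 using summable_on_SigmaD1[of "%x k. (eve_amp NS x k)\<^sup>2" UNIV "%_. UNIV" x]
  has_sum_imp_summable[OF has_sum_eve_amp[of NS]] by simp

lemma summable_bob_amp_mult: "NS >= 0 ==> (%k. bob_amp NS x k * bob_amp NS y k) summable_on UNIV"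
 by (intro real_mult_summable summable_bob_amp)

lemma summable_eve_amp_mult: "NS >= 0 ==> (%k. eve_amp NS x k * eve_amp NS y k) summable_on UNIV"
 by (intro real_mult_summable summable_eve_amp)

lemma has_sum_bob_mtx: "NS >= 0 ==> ((%k. bob_amp NS x k * bob_amp NS y k) has_sum bob_mtx NS x y) UNIV"
 unfolding bob_mtx_def by (intro has_sum_infsum summable_bob_amp_mult)

lemma has_sum_eve_mtx: "NS >= 0 ==> ((%k. eve_amp NS x k * eve_amp NS y k) has_sum eve_mtx NS x y) UNIV"
 unfolding eve_mtx_def by (intro has_sum_infsum summable_eve_amp_mult)

lemma trace_bob_mtx: "NS >= 0 ==> ((%x. bob_mtx NS x x) has_sum 1) UNIV"
 by (rule has_sum_SigmaD[where B = "%_. UNIV" and f = "%(x, k). (bob_amp NS x k)\<^sup>2"])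
  (use has_sum_bob_amp has_sum_bob_mtx in \<open>auto simp: power2_eq_square\<close>)

lemma trace_eve_mtx: "NS >= 0 ==> ((%x. eve_mtx NS x x) has_sum 1) UNIV"
 by (rule has_sum_SigmaD[where B = "%_. UNIV" and f = "%(x, k). (eve_amp NS x k)\<^sup>2"])
  (use has_sum_eve_amp has_sum_eve_mtx in \<open>auto simp: power2_eq_square\<close>)

lemma bob_mtx_nonneg: "bob_mtx NS x x >= 0"
 unfolding bob_mtx_def by (rule infsum_nonneg) simp

lemma eve_mtx_nonneg: "eve_mtx NS x x >= 0"
 unfolding eve_mtx_def by (rule infsum_nonneg) simp

lemma bob_mtx_sym: "bob_mtx NS x y = bob_mtx NS y x"
 by (simp add: bob_mtx_def mult.commute)

text \<open>The numbers that are traced out are common to both amplitudes, so conservation fixes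
  \<open>b - i\<close>. These are the blocks of Bob's state.\<close>

lemma bob_mtx_support: "b + i' ~= b' + i ==> bob_mtx NS (b, i) (b', i') = 0"
 unfolding bob_mtx_def
proof (rule infsum_0)
 fix k :: "(nat \<times> nat) \<times> nat \<times> nat" assume n: "b + i' ~= b' + i"
 obtain e1 e2 j l where k: "k = ((e1, e2), (j, l))" by (metis prod.exhaust)
 have "amp i j l b e1 e2 = 0 \<or> amp i' j l b' e1 e2 = 0"
  using n amp_support[of b e1 e2 i j l] amp_support[of b' e1 e2 i' j l] by linarith
 then show "bob_amp NS (b, i) k * bob_amp NS (b', i') k = 0" by (auto simp: k bob_amp_def joint_def)
qed

text \<open>With all other numbers common to both amplitudes, only the total \<open>e1 + e2\<close>
  is fixed.\<close>

lemma eve_mtx_support: "e1 + e2 ~= e1' + e2' ==> eve_mtx NS (e1, e2) (e1', e2') = 0"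
 unfolding eve_mtx_def
proof (rule infsum_0)
 fix k :: "(nat \<times> nat) \<times> nat \<times> nat" assume n: "e1 + e2 ~= e1' + e2'"
 obtain b i j l where k: "k = ((b, i), (j, l))" by (metis prod.exhaust)
 have "amp i j l b e1 e2 = 0 \<or> amp i j l b e1' e2' = 0"
  using n amp_support[of b e1 e2 i j l] amp_support[of b e1' e2' i j l] by linarith
 then show "eve_amp NS (e1, e2) k * eve_amp NS (e1', e2') k = 0" by (auto simp: k eve_amp_def joint_def)
qed

lemma round_trip_infsum:
 assumes NS: "NS >= 0"
 shows "round_trip_state \<eta> NB1 NB2 NS \<theta> (b, i, e1, e2) (b', i', e1', e2')
  = (\<Sum>\<^sub>\<infinity>(j, l). cis (\<theta> * ((real i - real e1) - (real i' - real e1'))) *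
    cr (joint NS i j l b e1 e2 * joint NS i' j l b' e1' e2'))"
proof -
 define T where "T = b + e1 + e2 + b' + e1' + e2'"
 let ?c = "cis (\<theta> * ((real i - real e1) - (real i' - real e1')))"
 have eq: "joint NS i j l b e1 e2 * joint NS i' j l b' e1' e2'
  = sqrt (th NS i) * sqrt (th NS i') * (th NB1 j * th NB2 l * (amp i j l b e1 e2 * amp i' j l b' e1' e2'))" for j l
 proof -
  have a: "\<bar>th NB1 j\<bar> = th NB1 j" "\<bar>th NB2 l\<bar> = th NB2 l"
   using NB1_pos NB2_pos by (auto simp: th_nonneg)
  have "sqrt (th NB1 j) * sqrt (th NB1 j) = th NB1 j" "sqrt (th NB2 l) * sqrt (th NB2 l) = th NB2 l"
   using NB1_pos NB2_pos by (auto simp: th_nonneg)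
  then have "sqrt (th NB1 j) * (sqrt (th NB1 j) * x) = th NB1 j * x"
   "sqrt (th NB2 l) * (sqrt (th NB2 l) * x) = th NB2 l * x" for x by (simp_all only: mult.assoc[symmetric])
  then show ?thesis by (simp add: joint_def real_sqrt_mult mult_ac a)
 qed
 have "(\<Sum>\<^sub>\<infinity>(j, l). ?c * cr (joint NS i j l b e1 e2 * joint NS i' j l b' e1' e2'))
  = (\<Sum>(j, l)\<in>{..T} \<times> {..T}. ?c * cr (joint NS i j l b e1 e2 * joint NS i' j l b' e1' e2'))"
  by (subst infsum_cong_neutral[of "{..T} \<times> {..T}" UNIV _ "%(j, l). ?c * cr (joint NS i j l b e1 e2 * joint NS i' j l b' e1' e2')"])
   (auto simp: joint_def T_def dest!: amp_nonzero)
 also have "... = (\<Sum>j\<le>T. \<Sum>l\<le>T. ?c * cr (joint NS i j l b e1 e2 * joint NS i' j l b' e1' e2'))"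
  by (simp add: sum.cartesian_product)
 also have "... = ?c * cr (sqrt (th NS i) * sqrt (th NS i') *
   (\<Sum>j\<le>T. \<Sum>l\<le>T. th NB1 j * th NB2 l * (amp i j l b e1 e2 * amp i' j l b' e1' e2')))"
  unfolding eq by (simp only: sum_distrib_left of_real_sum)
 also have "... = round_trip_state \<eta> NB1 NB2 NS \<theta> (b, i, e1, e2) (b', i', e1', e2')"
  by (rule round_trip_eq[OF NS, symmetric]) (auto simp: T_def)
 finally show ?thesis ..
qed

lemma bob_state_eq:
 assumes NS: "NS >= 0"
 shows "bob_state \<eta> NB1 NB2 NS \<theta> x y = cis (\<theta> * (real (snd x) - real (snd y))) * cr (bob_mtx NS x y)"
proof -
 obtain b i b' i' where xy: "x = (b, i)" "y = (b', i')" by (metis prod.exhaust)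
 let ?f = "%k. cis (\<theta> * (real i - real i')) * cr (bob_amp NS x k * bob_amp NS y k)"
 have hs: "(?f has_sum (cis (\<theta> * (real i - real i')) * cr (bob_mtx NS x y))) UNIV"
  by (intro has_sum_cmult_right has_sum_of_real has_sum_bob_mtx NS)
 have "bob_state \<eta> NB1 NB2 NS \<theta> x y = (\<Sum>\<^sub>\<infinity>e. \<Sum>\<^sub>\<infinity>jl. ?f (e, jl))"
  unfolding bob_state_def xy prod.case
  by (rule infsum_cong) (auto simp: round_trip_infsum[OF NS] bob_amp_def algebra_simps intro!: infsum_cong split: prod.splits)
 also have "... = infsum ?f UNIV" by (rule infsum_pair[OF has_sum_imp_summable[OF hs]])
 also have "... = cis (\<theta> * (real i - real i')) * cr (bob_mtx NS x y)" using hs by (rule infsumI)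
 finally show ?thesis by (simp add: xy)
qed

lemma eve_state_eq:
 assumes NS: "NS >= 0"
 shows "eve_state \<eta> NB1 NB2 NS \<theta> x y = cis (\<theta> * (real (fst y) - real (fst x))) * cr (eve_mtx NS x y)"
proof -
 obtain e1 e2 e1' e2' where xy: "x = (e1, e2)" "y = (e1', e2')" by (metis prod.exhaust)
 let ?f = "%k. cis (\<theta> * (real e1' - real e1)) * cr (eve_amp NS x k * eve_amp NS y k)"
 have hs: "(?f has_sum (cis (\<theta> * (real e1' - real e1)) * cr (eve_mtx NS x y))) UNIV"
  by (intro has_sum_cmult_right has_sum_of_real has_sum_eve_mtx NS)
 have "eve_state \<eta> NB1 NB2 NS \<theta> x y = (\<Sum>\<^sub>\<infinity>e. \<Sum>\<^sub>\<infinity>jl. ?f (e, jl))"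
  unfolding eve_state_def xy prod.case
  by (rule infsum_cong) (auto simp: round_trip_infsum[OF NS] eve_amp_def algebra_simps intro!: infsum_cong split: prod.splits)
 also have "... = infsum ?f UNIV" by (rule infsum_pair[OF has_sum_imp_summable[OF hs]])
 also have "... = cis (\<theta> * (real e1' - real e1)) * cr (eve_mtx NS x y)" using hs by (rule infsumI)
 finally show ?thesis by (simp add: xy)
qed

lemma positive_bob_state:
 assumes NS: "NS >= 0"
 shows "positive_mtx (bob_state \<eta> NB1 NB2 NS \<theta>)"
proof (rule positive_mtx_ensemble[where \<psi> = "%k x. cis (\<theta> * real (snd x)) * cr (bob_amp NS x k)"])
 fix x y
 have "((%k. cis (\<theta> * (real (snd x) - real (snd y))) * cr (bob_amp NS x k * bob_amp NS y k)) has_sum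
  bob_state \<eta> NB1 NB2 NS \<theta> x y) UNIV"
  unfolding bob_state_eq[OF NS] by (intro has_sum_cmult_right has_sum_of_real has_sum_bob_mtx NS)
 then have "((%k. cis (\<theta> * real (snd x)) * cr (bob_amp NS x k) *
   cnj (cis (\<theta> * real (snd y)) * cr (bob_amp NS y k))) has_sum bob_state \<eta> NB1 NB2 NS \<theta> x y) UNIV"
  by (rule has_sum_eq_rule) (auto simp: cis_diff_mult cis_cnj mult_ac)
 then show "bob_state \<eta> NB1 NB2 NS \<theta> x y = (\<Sum>\<^sub>\<infinity>k. cis (\<theta> * real (snd x)) * cr (bob_amp NS x k) *
   cnj (cis (\<theta> * real (snd y)) * cr (bob_amp NS y k)))" by (simp add: infsumI)
next
 show "(%k. (cmod (cis (\<theta> * real (snd x)) * cr (bob_amp NS x k)))\<^sup>2) summable_on UNIV" for x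
  using summable_bob_amp[OF NS, of x] by (simp add: norm_mult)
qed

lemma positive_eve_state:
 assumes NS: "NS >= 0"
 shows "positive_mtx (eve_state \<eta> NB1 NB2 NS \<theta>)"
proof (rule positive_mtx_ensemble[where \<psi> = "%k x. cis (- (\<theta> * real (fst x))) * cr (eve_amp NS x k)"])
 fix x y
 have "((%k. cis (\<theta> * (real (fst y) - real (fst x))) * cr (eve_amp NS x k * eve_amp NS y k)) has_sum
  eve_state \<eta> NB1 NB2 NS \<theta> x y) UNIV"
  unfolding eve_state_eq[OF NS] by (intro has_sum_cmult_right has_sum_of_real has_sum_eve_mtx NS)
 then have "((%k. cis (- (\<theta> * real (fst x))) * cr (eve_amp NS x k) *
   cnj (cis (- (\<theta> * real (fst y))) * cr (eve_amp NS y k))) has_sum eve_state \<eta> NB1 NB2 NS \<theta> x y) UNIV"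
  by (rule has_sum_eq_rule) (auto simp: cis_diff_mult cis_cnj mult_ac)
 then show "eve_state \<eta> NB1 NB2 NS \<theta> x y = (\<Sum>\<^sub>\<infinity>k. cis (- (\<theta> * real (fst x))) * cr (eve_amp NS x k) *
   cnj (cis (- (\<theta> * real (fst y))) * cr (eve_amp NS y k)))" by (simp add: infsumI)
next
 show "(%k. (cmod (cis (- (\<theta> * real (fst x))) * cr (eve_amp NS x k)))\<^sup>2) summable_on UNIV" for x
  using summable_eve_amp[OF NS, of x] by (simp add: norm_mult)
qed

end

section \<open>Eve's photon statistics for a fixed signal number\<close>

lemma has_sum_shift:
 fixes f :: "nat \<times> 'a => real"
 assumes "((%(k, z). f (Suc k, z)) has_sum s) UNIV" "!!z. f (0, z) = 0"
 shows "(f has_sum s) UNIV"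
proof -
 let ?h = "%(k, z). (Suc k, z)"
 have "(f \<circ> ?h has_sum s) UNIV" by (rule has_sum_eq_rule[OF assms(1)]) auto
 then have "(f has_sum s) (range ?h)" by (subst has_sum_reindex) (auto simp: inj_on_def)
 then show ?thesis
 proof (rule has_sum_cong_neutral[THEN iffD1, rotated -1])
  show "f x = 0" if "x \<in> UNIV - range ?h" for x
  proof -
   obtain k z where x: "x = (k, z)" by force
   show ?thesis
   proof (cases k)
    case (Suc k')
    then have "x \<in> range ?h" by (auto simp: x image_iff)
    then show ?thesis using that by blast
   qed (simp add: x assms(2))
  qed
 qed auto
qed

lemma has_sum_shift_2:
 fixes f :: "'a \<times> nat \<times> 'b => real"
 assumes "((%(b, j, l). f (b, Suc j, l)) has_sum s) UNIV" "!!b l. f (b, 0, l) = 0"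
 shows "(f has_sum s) UNIV"
proof -
 have "((%(j, b, l). f (b, j, l)) has_sum s) UNIV"
 proof (rule has_sum_shift)
  show "((%(k, z). case (Suc k, z) of (j, b, l) => f (b, j, l)) has_sum s) UNIV"
   by (rule has_sum_bij[OF assms(1), where i = "%(b, j, l). (j, b, l)" and j = "%(j, b, l). (b, j, l)"]) auto
 qed (auto simp: assms(2))
 then show ?thesis by (rule has_sum_bij[where i = "%(j, b, l). (b, j, l)" and j = "%(b, j, l). (j, b, l)"]) auto
qed

lemma has_sum_shift_3:
 fixes f :: "'a \<times> 'b \<times> nat => real"
 assumes "((%(b, j, l). f (b, j, Suc l)) has_sum s) UNIV" "!!b j. f (b, j, 0) = 0"
 shows "(f has_sum s) UNIV"
proof -
 let ?h = "%(b, j, l). (b, l, j)"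
 have "((%(b, l, j). f (b, j, l)) has_sum s) UNIV"
 proof (rule has_sum_shift_2)
  show "((%(b, l, j). case (b, Suc l, j) of (b, l, j) => f (b, j, l)) has_sum s) UNIV"
   by (rule has_sum_bij[OF assms(1), where i = ?h and j = ?h]) auto
 qed (auto simp: assms(2))
 then show ?thesis by (rule has_sum_bij[where i = ?h and j = ?h]) auto
qed

context roundtrip
begin

text \<open>The coefficients \<open>\<eta>\<close>, \<open>- \<rho>\<close>,
  \<open>- (\<rho> * \<tau>)\<close> of the signal in the three output modes form a unit
  vector.\<close>

lemma signal_norm: "\<eta>^2 + \<rho>^2 * (1 + \<tau>^2) = 1"
proof -
 have r: "\<rho>^2 = 1 - \<eta>" and t: "\<tau>^2 = \<eta>" using rho_sq tau_sq by (auto simp: power2_eq_square)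
 show ?thesis unfolding r t by (simp add: power2_eq_square algebra_simps)
qed

text \<open>The mode transformation is orthogonal, so its transpose expresses annihilation at an
  input by annihilations at the outputs. The next five lemmas are the other inputs and the creation
  side.\<close>

lemma amp_annihilate_1: 
 "sqrt (real j) * amp s (j - 1) l b e1 e2 = \<rho> * \<tau> * (sqrt (real (Suc b)) * amp s j l (Suc b) e1 e2)
  + \<tau> * (sqrt (real (Suc e1)) * amp s j l b (Suc e1) e2) - \<rho>^2 * (sqrt (real (Suc e2)) * amp s j l b e1 (Suc e2))"
 (is "?J = _")
proof -
 let ?S = "sqrt (real s) * amp (s - 1) j l b e1 e2" and ?L = "sqrt (real l) * amp s j (l - 1) b e1 e2"
 have "\<rho> * \<tau> * (sqrt (real (Suc b)) * amp s j l (Suc b) e1 e2)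
  + \<tau> * (sqrt (real (Suc e1)) * amp s j l b (Suc e1) e2) - \<rho>^2 * (sqrt (real (Suc e2)) * amp s j l b e1 (Suc e2))
  = \<rho> * \<tau> * (\<eta> * ?S + \<rho> * \<tau> * ?J + \<rho> * ?L) + \<tau> * (- \<rho> * ?S + \<tau> * ?J) - \<rho>^2 * (- (\<rho> * \<tau>) * ?S - \<rho>^2 * ?J + \<tau> * ?L)"
  unfolding amp_annihilate_b amp_annihilate_e1 amp_annihilate_e2 by (simp add: algebra_simps)
 also have "... = (\<rho>^2 * (\<tau>^2 + \<rho>^2) + \<tau>^2) * ?J + \<rho> * \<tau> * (\<eta> - 1 + \<rho>^2) * ?S"
  by (simp add: algebra_simps power2_eq_square)
 also have "... = ?J" using tr1 rho_sq by (simp add: power2_eq_square algebra_simps)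
 finally show ?thesis by simp
qed

lemma amp_annihilate_2: 
 "sqrt (real l) * amp s j (l - 1) b e1 e2 = \<rho> * (sqrt (real (Suc b)) * amp s j l (Suc b) e1 e2)
  + \<tau> * (sqrt (real (Suc e2)) * amp s j l b e1 (Suc e2))"
 (is "?L = _")
proof -
 let ?S = "sqrt (real s) * amp (s - 1) j l b e1 e2" and ?J = "sqrt (real j) * amp s (j - 1) l b e1 e2"
 have "\<rho> * (sqrt (real (Suc b)) * amp s j l (Suc b) e1 e2)
  + \<tau> * (sqrt (real (Suc e2)) * amp s j l b e1 (Suc e2))
  = \<rho> * (\<eta> * ?S + \<rho> * \<tau> * ?J + \<rho> * ?L) + \<tau> * (- (\<rho> * \<tau>) * ?S - \<rho>^2 * ?J + \<tau> * ?L)"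
  unfolding amp_annihilate_b amp_annihilate_e1 amp_annihilate_e2 by (simp add: algebra_simps)
 also have "... = (\<tau>^2 + \<rho>^2) * ?L + \<rho> * (\<eta> - \<tau>\<^sup>2) * ?S"
  by (simp add: algebra_simps power2_eq_square)
 also have "... = ?L" using tr1 tau_sq by (simp add: power2_eq_square)
 finally show ?thesis by simp
qed

lemma amp_annihilate_s: 
 "sqrt (real s) * amp (s - 1) j l b e1 e2 = \<eta> * (sqrt (real (Suc b)) * amp s j l (Suc b) e1 e2)
  - \<rho> * (sqrt (real (Suc e1)) * amp s j l b (Suc e1) e2) - \<rho> * \<tau> * (sqrt (real (Suc e2)) * amp s j l b e1 (Suc e2))"
 (is "?S = _")
proof -
 let ?L = "sqrt (real l) * amp s j (l - 1) b e1 e2" and ?J = "sqrt (real j) * amp s (j - 1) l b e1 e2"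
 have "\<eta> * (sqrt (real (Suc b)) * amp s j l (Suc b) e1 e2)
  - \<rho> * (sqrt (real (Suc e1)) * amp s j l b (Suc e1) e2) - \<rho> * \<tau> * (sqrt (real (Suc e2)) * amp s j l b e1 (Suc e2))
  = \<eta> * (\<eta> * ?S + \<rho> * \<tau> * ?J + \<rho> * ?L) - \<rho> * (- \<rho> * ?S + \<tau> * ?J) - \<rho> * \<tau> * (- (\<rho> * \<tau>) * ?S - \<rho>^2 * ?J + \<tau> * ?L)"
  unfolding amp_annihilate_b amp_annihilate_e1 amp_annihilate_e2 by (simp add: algebra_simps)
 also have "... = (\<eta>^2 + \<rho>^2 * (1 + \<tau>^2)) * ?S + \<rho> * (\<eta> - \<tau>\<^sup>2) * ?L + \<rho> * \<tau> * (\<eta> - 1 + \<rho>^2) * ?J"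
  by (simp add: algebra_simps power2_eq_square)
 also note signal_norm
 finally show ?thesis using tau_sq rho_sq by (simp add: power2_eq_square)
qed

lemma amp_create_s:
 "sqrt (real (Suc s)) * amp (Suc s) j l b e1 e2 = \<eta> * (sqrt (real b) * amp s j l (b - 1) e1 e2)
  - \<rho> * (sqrt (real e1) * amp s j l b (e1 - 1) e2) - \<rho> * \<tau> * (sqrt (real e2) * amp s j l b e1 (e2 - 1))"
 (is "?S = _")
proof -
 let ?L = "sqrt (real (Suc l)) * amp s j (Suc l) b e1 e2" and ?J = "sqrt (real (Suc j)) * amp s (Suc j) l b e1 e2"
 have "\<eta> * (sqrt (real b) * amp s j l (b - 1) e1 e2)
  - \<rho> * (sqrt (real e1) * amp s j l b (e1 - 1) e2) - \<rho> * \<tau> * (sqrt (real e2) * amp s j l b e1 (e2 - 1))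
  = \<eta> * (\<eta> * ?S + \<rho> * \<tau> * ?J + \<rho> * ?L) - \<rho> * (- \<rho> * ?S + \<tau> * ?J) - \<rho> * \<tau> * (- (\<rho> * \<tau>) * ?S - \<rho>^2 * ?J + \<tau> * ?L)"
  unfolding amp_create_b amp_create_e1 amp_create_e2 by (simp add: algebra_simps del: of_nat_Suc)
 also have "... = (\<eta>^2 + \<rho>^2 * (1 + \<tau>^2)) * ?S + \<rho> * (\<eta> - \<tau>\<^sup>2) * ?L + \<rho> * \<tau> * (\<eta> - 1 + \<rho>^2) * ?J"
  by (simp add: algebra_simps power2_eq_square del: of_nat_Suc)
 also note signal_norm
 finally show ?thesis using tau_sq rho_sq by (simp add: power2_eq_square)
qed

lemma amp_create_1:
 "sqrt (real (Suc j)) * amp s (Suc j) l b e1 e2 = \<rho> * \<tau> * (sqrt (real b) * amp s j l (b - 1) e1 e2)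
  + \<tau> * (sqrt (real e1) * amp s j l b (e1 - 1) e2) - \<rho>^2 * (sqrt (real e2) * amp s j l b e1 (e2 - 1))"
 (is "?J = _")
proof -
 let ?L = "sqrt (real (Suc l)) * amp s j (Suc l) b e1 e2" and ?S = "sqrt (real (Suc s)) * amp (Suc s) j l b e1 e2"
 have "\<rho> * \<tau> * (sqrt (real b) * amp s j l (b - 1) e1 e2)
  + \<tau> * (sqrt (real e1) * amp s j l b (e1 - 1) e2) - \<rho>^2 * (sqrt (real e2) * amp s j l b e1 (e2 - 1))
  = \<rho> * \<tau> * (\<eta> * ?S + \<rho> * \<tau> * ?J + \<rho> * ?L) + \<tau> * (- \<rho> * ?S + \<tau> * ?J) - \<rho>^2 * (- (\<rho> * \<tau>) * ?S - \<rho>^2 * ?J + \<tau> * ?L)"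
  unfolding amp_create_b amp_create_e1 amp_create_e2 by (simp add: algebra_simps del: of_nat_Suc)
 also have "... = (\<rho>^2 * (\<tau>^2 + \<rho>^2) + \<tau>^2) * ?J + \<rho> * \<tau> * (\<eta> - 1 + \<rho>^2) * ?S"
  by (simp add: algebra_simps power2_eq_square del: of_nat_Suc)
 also have "... = ?J" using tr1 rho_sq by (simp add: power2_eq_square algebra_simps del: of_nat_Suc)
 finally show ?thesis by simp
qed

lemma amp_create_2:
 "sqrt (real (Suc l)) * amp s j (Suc l) b e1 e2 = \<rho> * (sqrt (real b) * amp s j l (b - 1) e1 e2)
  + \<tau> * (sqrt (real e2) * amp s j l b e1 (e2 - 1))"
 (is "?L = _")
proof -
 let ?S = "sqrt (real (Suc s)) * amp (Suc s) j l b e1 e2" and ?J = "sqrt (real (Suc j)) * amp s (Suc j) l b e1 e2"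
 have "\<rho> * (sqrt (real b) * amp s j l (b - 1) e1 e2) + \<tau> * (sqrt (real e2) * amp s j l b e1 (e2 - 1))
  = \<rho> * (\<eta> * ?S + \<rho> * \<tau> * ?J + \<rho> * ?L) + \<tau> * (- (\<rho> * \<tau>) * ?S - \<rho>^2 * ?J + \<tau> * ?L)"
  unfolding amp_create_b amp_create_e1 amp_create_e2 by (simp add: algebra_simps del: of_nat_Suc)
 also have "... = (\<tau>^2 + \<rho>^2) * ?L + \<rho> * (\<eta> - \<tau>\<^sup>2) * ?S"
  by (simp add: algebra_simps power2_eq_square del: of_nat_Suc)
 also have "... = ?L" using tr1 tau_sq by (simp add: power2_eq_square del: of_nat_Suc)
 finally show ?thesis by simp
qed

section \<open>Eve's state for a fixed number of signal photons and its linear relations\<close>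

definition wt :: "nat => nat => real"
 where "wt j l = th NB1 j * th NB2 l"

lemma wt_nonneg: "wt j l >= 0"
 using NB1_pos NB2_pos by (simp add: wt_def th_nonneg)

lemma wt_Suc: "(NB1 + 1) * wt (Suc j) l = NB1 * wt j l" "(NB2 + 1) * wt j (Suc l) = NB2 * wt j l"
proof -
 have "(NB1 + 1) * wt (Suc j) l = ((NB1 + 1) * th NB1 (Suc j)) * th NB2 l"
  "(NB2 + 1) * wt j (Suc l) = th NB1 j * ((NB2 + 1) * th NB2 (Suc l))" by (simp_all add: wt_def mult_ac)
 then show "(NB1 + 1) * wt (Suc j) l = NB1 * wt j l" "(NB2 + 1) * wt j (Suc l) = NB2 * wt j l"
  using th_Suc[of NB1 j] th_Suc[of NB2 l] NB1_pos NB2_pos by (simp_all add: wt_def mult_ac)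
qed

lemma has_sum_wt: "((%(j, l). wt j l) has_sum 1) UNIV"
 using has_sum_product_UNIV[OF has_sum_th[of NB1] has_sum_th[of NB2]] NB1_pos NB2_pos by (simp add: wt_def th_nonneg)

definition eamp :: "nat => nat \<times> nat => nat \<times> nat \<times> nat => real"
 where "eamp s = (%(e1, e2) (b, j, l). sqrt (wt j l) * amp s j l b e1 e2)"

text \<open>Eve's state at phase zero, conditioned on exactly \<open>s\<close> signal
  photons.\<close>

definition sig :: "nat => nat \<times> nat => nat \<times> nat => real"
 where "sig s x y = (\<Sum>\<^sub>\<infinity>k. eamp s x k * eamp s y k)"

lemma has_sum_eamp: "((%(x, k). (eamp s x k)\<^sup>2) has_sum 1) UNIV"
proof -
 define f where "f = (%((j, l), (b, e1, e2)). (eamp s (e1, e2) (b, j, l))\<^sup>2)"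
 have "(f has_sum 1) UNIV"
 proof (rule has_sum_pair_nonneg[OF _ has_sum_wt])
  fix z :: "nat \<times> nat"
  obtain j l where z: "z = (j, l)" by force
  show "((%y. f (z, y)) has_sum (case z of (j, l) => wt j l)) UNIV"
   by (rule has_sum_eq_rule[OF has_sum_cmult_right[OF amp_orth[of "(s, j, l)" "(s, j, l)"], of "wt j l"]])
    (auto simp: z f_def eamp_def ampv_def power_mult_distrib wt_nonneg power2_eq_square[of "amp _ _ _ _ _ _"])
 qed (auto simp: f_def split: prod.splits)
 then show ?thesis by (rule has_sum_bij[where i = "%((j, l), (b, e1, e2)). ((e1, e2), (b, j, l))"
    and j = "%((e1, e2), (b, j, l)). ((j, l), (b, e1, e2))"]) (auto simp: f_def)
qed

lemma summable_eamp: "(%k. (eamp s x k)\<^sup>2) summable_on UNIV"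
 using summable_on_SigmaD1[of "%x k. (eamp s x k)\<^sup>2" UNIV "%_. UNIV" x]
  has_sum_imp_summable[OF has_sum_eamp] by simp

lemma has_sum_sig: "((%k. eamp s x k * eamp s y k) has_sum sig s x y) UNIV"
 unfolding sig_def by (intro has_sum_infsum real_mult_summable summable_eamp)

lemma sig_sym: "sig s x y = sig s y x"
 by (simp add: sig_def mult.commute)

lemma sig_nonneg: "sig s x x >= 0"
 unfolding sig_def by (rule infsum_nonneg) simp

lemma trace_sig: "((%x. sig s x x) has_sum 1) UNIV"
 by (rule has_sum_SigmaD[where B = "%_. UNIV" and f = "%(x, k). (eamp s x k)\<^sup>2"])
  (use has_sum_eamp has_sum_sig in \<open>auto simp: power2_eq_square\<close>)

lemma eamp_annihilate_1:
 "eamp 0 (Suc e1, e2) (b, j, l) * sqrt (real (Suc e1)) = \<tau> * (sqrt (wt j l) * (sqrt (real j) * amp 0 (j - 1) l b e1 e2))"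
 using amp_annihilate_e1[of e1 0 j l b e2] by (simp add: eamp_def mult_ac)

lemma eamp_annihilate_2:
 "eamp 0 (e1, Suc e2) (b, j, l) * sqrt (real (Suc e2)) = sqrt (wt j l) * 
  (- \<rho>\<^sup>2 * (sqrt (real j) * amp 0 (j - 1) l b e1 e2) + \<tau> * (sqrt (real l) * amp 0 j (l - 1) b e1 e2))"
 using amp_annihilate_e2[of e2 0 j l b e1] by (simp add: eamp_def mult_ac)

text \<open>\<open>left1\<close> and \<open>left2\<close> are the entries of the annihilation
  operators of Eve's two modes times her vacuum-signal state \<open>sig 0\<close>;
  \<open>right1\<close> and \<open>right2\<close> are those of the products in the opposite
  order.\<close>

definition left1 :: "nat \<times> nat => nat \<times> nat => real"
 where "left1 x y = sqrt (real (Suc (fst x))) * sig 0 (Suc (fst x), snd x) y"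
definition left2 :: "nat \<times> nat => nat \<times> nat => real"
 where "left2 x y = sqrt (real (Suc (snd x))) * sig 0 (fst x, Suc (snd x)) y"
definition right1 :: "nat \<times> nat => nat \<times> nat => real"
 where "right1 x y = sqrt (real (fst y)) * sig 0 x (fst y - 1, snd y)"
definition right2 :: "nat \<times> nat => nat \<times> nat => real"
 where "right2 x y = sqrt (real (snd y)) * sig 0 x (fst y, snd y - 1)"

text \<open>Amplitudes of the vacuum signal after annihilating a photon in the first environment, in
  the second environment, or in Bob's output.\<close>

definition in1 :: "nat \<times> nat => nat \<times> nat \<times> nat => real"
 where "in1 = (%(e1, e2) (b, j, l). sqrt (wt j l) * (sqrt (real j) * amp 0 (j - 1) l b e1 e2))"
definition in2 :: "nat \<times> nat => nat \<times> nat \<times> nat => real"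
 where "in2 = (%(e1, e2) (b, j, l). sqrt (wt j l) * (sqrt (real l) * amp 0 j (l - 1) b e1 e2))"
definition outb :: "nat \<times> nat => nat \<times> nat \<times> nat => real"
 where "outb = (%(e1, e2) (b, j, l). sqrt (wt j l) * (sqrt (real (Suc b)) * amp 0 j l (Suc b) e1 e2))"

lemma in1_eq: "in1 (e1, e2) k = eamp 0 (Suc e1, e2) k * sqrt (real (Suc e1)) / \<tau>"
proof -
 obtain b j l where k: "k = (b, j, l)" by (metis prod_cases3)
 show ?thesis using eamp_annihilate_1[of e1 e2 b j l] tau_pos by (simp add: in1_def k del: of_nat_Suc)
qed

lemma in2_eq: "in2 (e1, e2) k = (eamp 0 (e1, Suc e2) k * sqrt (real (Suc e2)) + \<rho>^2 * in1 (e1, e2) k) / \<tau>"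
proof -
 obtain b j l where k: "k = (b, j, l)" by (metis prod_cases3)
 show ?thesis using eamp_annihilate_2[of e1 e2 b j l] tau_pos
  by (simp add: in1_def in2_def k algebra_simps del: of_nat_Suc)
qed

text \<open>Annihilating a signal photon that was never sent gives zero. This linear relation
  between the three output annihilations eliminates Bob's mode.\<close>

lemma outb_eq: "outb (e1, e2) k = (\<rho> * (eamp 0 (Suc e1, e2) k * sqrt (real (Suc e1)))
  + \<rho> * \<tau> * (eamp 0 (e1, Suc e2) k * sqrt (real (Suc e2)))) / \<eta>"
proof -
 obtain b j l where k: "k = (b, j, l)" by (metis prod_cases3)
 have "\<eta> * (sqrt (real (Suc b)) * amp 0 j l (Suc b) e1 e2) =
  \<rho> * (sqrt (real (Suc e1)) * amp 0 j l b (Suc e1) e2) + \<rho> * \<tau> * (sqrt (real (Suc e2)) * amp 0 j l b e1 (Suc e2))"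
  using amp_annihilate_s[of 0 j l b e1 e2] by simp
 from arg_cong[OF this, of "%u. sqrt (wt j l) * u"]
 show ?thesis using eta_pos by (simp add: k outb_def eamp_def field_simps)
qed

lemma in1_annihilate: "in1 (e1, e2) k = \<rho> * \<tau> * outb (e1, e2) k + \<tau> * (eamp 0 (Suc e1, e2) k * sqrt (real (Suc e1)))
  - \<rho>\<^sup>2 * (eamp 0 (e1, Suc e2) k * sqrt (real (Suc e2)))"
proof -
 obtain b j l where k: "k = (b, j, l)" by (metis prod_cases3)
 show ?thesis using arg_cong[OF amp_annihilate_1[of j 0 l b e1 e2], of "%u. sqrt (wt j l) * u"]
  by (simp add: k in1_def outb_def eamp_def algebra_simps)
qed

lemma in2_annihilate: "in2 (e1, e2) k = \<rho> * outb (e1, e2) k + \<tau> * (eamp 0 (e1, Suc e2) k * sqrt (real (Suc e2)))"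
proof -
 obtain b j l where k: "k = (b, j, l)" by (metis prod_cases3)
 show ?thesis using arg_cong[OF amp_annihilate_2[of l 0 j b e1 e2], of "%u. sqrt (wt j l) * u"]
  by (simp add: k in2_def outb_def eamp_def algebra_simps)
qed

lemma has_sum_left:
 "((%k. eamp 0 (Suc e1, e2) k * sqrt (real (Suc e1)) * eamp 0 y k) has_sum left1 (e1, e2) y) UNIV"
 "((%k. eamp 0 (e1, Suc e2) k * sqrt (real (Suc e2)) * eamp 0 y k) has_sum left2 (e1, e2) y) UNIV"
 unfolding left1_def left2_def by (rule has_sum_eq_rule[OF has_sum_cmult_right[OF has_sum_sig]], simp_all)+

lemma has_sum_right:
 "((%k. eamp 0 x k * (sqrt (real e1) * eamp 0 (e1 - 1, e2) k)) has_sum right1 x (e1, e2)) UNIV"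
 "((%k. eamp 0 x k * (sqrt (real e2) * eamp 0 (e1, e2 - 1) k)) has_sum right2 x (e1, e2)) UNIV"
 unfolding right1_def right2_def by (rule has_sum_eq_rule[OF has_sum_cmult_right[OF has_sum_sig]], simp_all)+

definition cross_b :: "nat \<times> nat => nat \<times> nat => real"
 where "cross_b x y = (\<rho> * left1 x y + \<rho> * \<tau> * left2 x y) / \<eta>"

lemma has_sum_cross_b: "((%k. outb x k * eamp 0 y k) has_sum cross_b x y) UNIV"
proof -
 obtain e1 e2 where x: "x = (e1, e2)" by force
 show ?thesis unfolding x cross_b_def
  by (rule has_sum_eq_rule[OF has_sum_cmult_right[OF has_sum_add[OF has_sum_cmult_right[OF has_sum_left(1), of \<rho>]
      has_sum_cmult_right[OF has_sum_left(2), of "\<rho> * \<tau>"]], of "1 / \<eta>"]])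
   (auto simp: outb_eq field_simps)
qed

text \<open>Shifting Bob's number turns the annihilation at \<open>x\<close> into a creation at
  \<open>y\<close>. Hence the sums before and after an environment shift contain the same Bob
  term.\<close>

lemma has_sum_cross_b': "((%(b, j, l). eamp 0 x (b, j, l) * (sqrt (real b) * eamp 0 y (b - 1, j, l))) has_sum cross_b x y) UNIV"
proof (rule has_sum_shift)
 obtain e1 e2 e1' e2' where xy: "x = (e1, e2)" "y = (e1', e2')" by (metis prod.exhaust)
 show "((%(k, z). case (Suc k, z) of (b, j, l) => eamp 0 x (b, j, l) * (sqrt (real b) * eamp 0 y (b - 1, j, l)))
  has_sum cross_b x y) UNIV"
  by (rule has_sum_eq_rule[OF has_sum_cross_b]) (auto simp: outb_def eamp_def xy split: prod.splits)
qed auto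


lemma has_sum_in1: "((%k. in1 x k * eamp 0 y k) has_sum (\<rho> * \<tau> * cross_b x y + \<tau> * left1 x y - \<rho>^2 * left2 x y)) UNIV"
proof -
 obtain e1 e2 where x: "x = (e1, e2)" by force
 show ?thesis unfolding x
  by (rule has_sum_eq_rule[OF has_sum_add[OF has_sum_add[OF has_sum_cmult_right[OF has_sum_cross_b, of "\<rho> * \<tau>"]
      has_sum_cmult_right[OF has_sum_left(1), of \<tau>]] has_sum_cmult_right[OF has_sum_left(2), of "- \<rho>\<^sup>2"]]])
   (auto simp: in1_annihilate algebra_simps)
qed

lemma has_sum_in2: "((%k. in2 x k * eamp 0 y k) has_sum (\<rho> * cross_b x y + \<tau> * left2 x y)) UNIV"
proof -
 obtain e1 e2 where x: "x = (e1, e2)" by force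
 show ?thesis unfolding x
  by (rule has_sum_eq_rule[OF has_sum_add[OF has_sum_cmult_right[OF has_sum_cross_b, of "\<rho>"]
      has_sum_cmult_right[OF has_sum_left(2), of \<tau>]]]) (auto simp: in2_annihilate algebra_simps)
qed

text \<open>The same sums after shifting the photon number of the environment, where the thermal weight
 contributes a factor and the annihilated amplitude becomes a created one.\<close>

lemma has_sum_in1': "((%k. in1 x k * eamp 0 y k) has_sum (NB1 / (NB1 + 1) *
  (\<rho> * \<tau> * cross_b x y + \<tau> * right1 x y - \<rho>^2 * right2 x y))) UNIV"
proof (rule has_sum_shift_2)
 obtain e1 e2 e1' e2' where xy: "x = (e1, e2)" "y = (e1', e2')" by (metis prod.exhaust)
 define q where "q = NB1 / (NB1 + 1)"
 have wq: "wt (Suc j) l = q * wt j l" for j l using wt_Suc(1)[of j l] NB1_pos by (simp add: q_def field_simps)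
 have q0: "q >= 0" using NB1_pos by (simp add: q_def)
 have "((%k. q * (\<rho> * \<tau> * (case k of (b, j, l) => eamp 0 x (b, j, l) * (sqrt (real b) * eamp 0 y (b - 1, j, l)))
   + \<tau> * (eamp 0 x k * (sqrt (real e1') * eamp 0 (e1' - 1, e2') k))
   + (- \<rho>\<^sup>2) * (eamp 0 x k * (sqrt (real e2') * eamp 0 (e1', e2' - 1) k)))) has_sum
   (q * (\<rho> * \<tau> * cross_b x y + \<tau> * right1 x y + (- \<rho>\<^sup>2) * right2 x y))) UNIV"
  unfolding xy(2) by (intro has_sum_cmult_right has_sum_add has_sum_cross_b' has_sum_right)
 then show "((%(b, j, l). in1 x (b, Suc j, l) * eamp 0 y (b, Suc j, l)) has_sum (NB1 / (NB1 + 1) *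
  (\<rho> * \<tau> * cross_b x y + \<tau> * right1 x y - \<rho>^2 * right2 x y))) UNIV" unfolding q_def[symmetric]
 proof (rule has_sum_eq_rule, goal_cases)
  case (1 k)
  obtain b j l where k: "k = (b, j, l)" by (metis prod_cases3)
  have s: "sqrt (wt j l) * (sqrt (wt j l) * z) = wt j l * z" for j l z
   using wt_nonneg[of j l] by (simp add: mult.assoc[symmetric])
  have "in1 x (b, Suc j, l) * eamp 0 y (b, Suc j, l) =
    q * wt j l * (amp 0 j l b e1 e2 * (sqrt (real (Suc j)) * amp 0 (Suc j) l b e1' e2'))"
   by (simp add: xy in1_def eamp_def mult_ac s wq q0 wt_nonneg abs_mult del: of_nat_Suc)
  then show ?case unfolding k amp_create_1 by (simp add: xy eamp_def algebra_simps s)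
 qed simp
qed (cases x, auto simp: in1_def)

lemma has_sum_in2': "((%k. in2 x k * eamp 0 y k) has_sum (NB2 / (NB2 + 1) *
  (\<rho> * cross_b x y + \<tau> * right2 x y))) UNIV"
proof (rule has_sum_shift_3)
 obtain e1 e2 e1' e2' where xy: "x = (e1, e2)" "y = (e1', e2')" by (metis prod.exhaust)
 define q where "q = NB2 / (NB2 + 1)"
 have wq: "wt j (Suc l) = q * wt j l" for j l using wt_Suc(2)[of j l] NB2_pos by (simp add: q_def field_simps)
 have q0: "q >= 0" using NB2_pos by (simp add: q_def)
 have "((%k. q * (\<rho> * (case k of (b, j, l) => eamp 0 x (b, j, l) * (sqrt (real b) * eamp 0 y (b - 1, j, l)))
   + \<tau> * (eamp 0 x k * (sqrt (real e2') * eamp 0 (e1', e2' - 1) k)))) has_sum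
   (q * (\<rho> * cross_b x y + \<tau> * right2 x y))) UNIV"
  unfolding xy(2) by (intro has_sum_cmult_right has_sum_add has_sum_cross_b' has_sum_right)
 then show "((%(b, j, l). in2 x (b, j, Suc l) * eamp 0 y (b, j, Suc l)) has_sum (NB2 / (NB2 + 1) *
  (\<rho> * cross_b x y + \<tau> * right2 x y))) UNIV" unfolding q_def[symmetric]
 proof (rule has_sum_eq_rule, goal_cases)
  case (1 k)
  obtain b j l where k: "k = (b, j, l)" by (metis prod_cases3)
  have s: "sqrt (wt j l) * (sqrt (wt j l) * z) = wt j l * z" for j l z
   using wt_nonneg[of j l] by (simp add: mult.assoc[symmetric])
  have "in2 x (b, j, Suc l) * eamp 0 y (b, j, Suc l) =
    q * wt j l * (amp 0 j l b e1 e2 * (sqrt (real (Suc l)) * amp 0 j (Suc l) b e1' e2'))"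
   by (simp add: xy in2_def eamp_def mult_ac s wq q0 wt_nonneg abs_mult del: of_nat_Suc)
  then show ?case unfolding k amp_create_2 by (simp add: xy eamp_def algebra_simps s)
 qed simp
qed (cases x, auto simp: in2_def)

text \<open>\<open>has_sum_in1\<close> and \<open>has_sum_in1'\<close> evaluate one sum in two ways,
  and Bob's term cancels. Together with \<open>left2_eq\<close> the vector of left products is a
  fixed matrix times the vector of commutators \<open>right - left\<close>; the matrix holds the
  mean photon numbers and correlations of Eve's modes.\<close>

lemma left1_eq: "left1 x y = \<tau> * NB1 * (\<tau> * (right1 x y - left1 x y) - \<rho>^2 * (right2 x y - left2 x y))"
proof -
 obtain e1 e2 where x: "x = (e1, e2)" by force
 define c where "c = \<rho> * \<tau> * cross_b x y + \<tau> * left1 x y - \<rho>^2 * left2 x y"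
 have "c = NB1 / (NB1 + 1) * (c + \<tau> * (right1 x y - left1 x y) - \<rho>^2 * (right2 x y - left2 x y))"
  using has_sum_unique[OF has_sum_in1 has_sum_in1', of x y] by (simp add: c_def algebra_simps)
 then have "c * (NB1 + 1) = NB1 * (c + \<tau> * (right1 x y - left1 x y) - \<rho>^2 * (right2 x y - left2 x y))"
  using NB1_pos by (simp add: field_simps)
 then have c: "c = NB1 * (\<tau> * (right1 x y - left1 x y) - \<rho>^2 * (right2 x y - left2 x y))"
  by (simp add: algebra_simps)
 have "((%k. \<tau> * (in1 x k * eamp 0 y k)) has_sum \<tau> * c) UNIV"
  unfolding c_def by (intro has_sum_cmult_right has_sum_in1)
 then have "((%k. eamp 0 (Suc e1, e2) k * sqrt (real (Suc e1)) * eamp 0 y k) has_sum \<tau> * c) UNIV"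
  by (rule has_sum_eq_rule) (use tau_pos in \<open>auto simp: x in1_eq\<close>)
 then have "left1 x y = \<tau> * c" using has_sum_unique[OF has_sum_left(1)] x by blast
 then show ?thesis by (simp add: c mult.assoc)
qed

lemma left2_eq: "left2 x y = - \<rho>\<^sup>2 * NB1 * (\<tau> * (right1 x y - left1 x y) - \<rho>^2 * (right2 x y - left2 x y))
  + \<eta> * NB2 * (right2 x y - left2 x y)"
proof -
 obtain e1 e2 where x: "x = (e1, e2)" by force
 define c where "c = \<rho> * cross_b x y + \<tau> * left2 x y"
 have "\<rho> * cross_b x y + \<tau> * right2 x y = c + \<tau> * (right2 x y - left2 x y)"
  by (simp add: c_def algebra_simps)
 then have "c = NB2 / (NB2 + 1) * (c + \<tau> * (right2 x y - left2 x y))"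
  using has_sum_unique[OF has_sum_in2 has_sum_in2', of x y] unfolding c_def by simp
 then have "c * (NB2 + 1) = NB2 * (c + \<tau> * (right2 x y - left2 x y))" using NB2_pos by (simp add: field_simps)
 then have c: "c = NB2 * (\<tau> * (right2 x y - left2 x y))" by (simp add: algebra_simps)
 have "((%k. \<tau> * (in2 x k * eamp 0 y k) + (- (\<rho>^2 / \<tau>)) * (eamp 0 (Suc e1, e2) k * sqrt (real (Suc e1)) * eamp 0 y k)) has_sum
   (\<tau> * c + (- (\<rho>^2 / \<tau>)) * left1 x y)) UNIV"
  unfolding c_def x by (intro has_sum_add has_sum_cmult_right has_sum_in2 has_sum_left)
 then have "((%k. eamp 0 (e1, Suc e2) k * sqrt (real (Suc e2)) * eamp 0 y k) has_sum (\<tau> * c + (- (\<rho>^2 / \<tau>)) * left1 x y)) UNIV"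
  by (rule has_sum_eq_rule) (use tau_pos in \<open>auto simp: x in1_eq in2_eq field_simps\<close>)
 then have "left2 x y = \<tau> * c + (- (\<rho>^2 / \<tau>)) * left1 x y"
  using has_sum_unique[OF has_sum_left(2)] x by blast
 moreover have "(\<rho>^2 / \<tau>) * left1 x y = \<rho>^2 * NB1 * (\<tau> * (right1 x y - left1 x y) - \<rho>^2 * (right2 x y - left2 x y))"
  by (subst left1_eq) (use tau_pos in \<open>simp add: field_simps\<close>)
 moreover have "\<tau> * c = (\<tau> * \<tau>) * NB2 * (right2 x y - left2 x y)" by (simp add: c)
 then have "\<tau> * c = \<eta> * NB2 * (right2 x y - left2 x y)" unfolding tau_sq .
 ultimately show ?thesis by simp
qed

end

section \<open>The symmetric logarithmic derivative\<close>

text \<open>For a symmetric \<open>2 \<times> 2\<close> matrix \<open>\<Sigma>\<close> with entries \<open>a\<close>, \<open>s\<close>, \<open>c\<close>, the equation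
 \<open>\<Sigma> G \<Sigma> + (\<Sigma> G + G \<Sigma>) / 2 = V\<close> becomes \<open>S G S - G / 4 = V\<close> for \<open>S = \<Sigma> + 1 / 2\<close>; its solution is
 a combination of \<open>V\<close>, \<open>S V + V S\<close> and \<open>S V S\<close>, found by comparing eigenvalues.\<close>

lemma lyapunov_solution:
 fixes a s c V11 V12 V22 :: real
 assumes pos: "a * c - s^2 > 0" "a > 0" "c > 0"
 defines "d \<equiv> (a + 1/2) * (c + 1/2) - s^2" and "t \<equiv> a + c + 1"
 defines "P \<equiv> (a * c - s^2) * (1 + a + c + (a * c - s^2))"
 shows "\<exists>G11 G12 G22.
  a\<^sup>2 * G11 + 2 * a * s * G12 + s^2 * G22 + a * G11 + s * G12 = V11 &
  a * s * G11 + (a * c + s^2) * G12 + s * c * G22 + (a * G12 + c * G12 + s * G11 + s * G22) / 2 = V12 &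
  s\<^sup>2 * G11 + 2 * s * c * G12 + c^2 * G22 + c * G22 + s * G12 = V22 &
  (V11 * G11 + 2 * V12 * G12 + V22 * G22) * (P * (d - 1/4)) =
   (P - d * (d + 1/4) + t^2 * d) * (V11^2 + 2 * V12^2 + V22^2)
   - 2 * t * d * ((a + 1/2) * (V11^2 + V12^2) + (c + 1/2) * (V22^2 + V12^2) + 2 * s * V12 * (V11 + V22))
   + (d + 1/4) * (((a + 1/2) * V11 + s * V12)\<^sup>2 + 2 * ((a + 1/2) * V12 + s * V22) * (s * V11 + (c + 1/2) * V12)
     + (s * V12 + (c + 1/2) * V22)\<^sup>2)"
proof -
 define x z where "x = a + 1/2" and "z = c + 1/2"
 define A B C where "A = P - d * (d + 1/4) + t^2 * d" and "B = - (t * d)" and "C = d + 1/4"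
 \<comment> \<open>If \<open>p\<close> and \<open>q\<close> are the eigenvalues of \<open>S\<close>,
   then \<open>d = p * q\<close>, and \<open>P\<close> is the product of \<open>p^2 - 1/4\<close>
   and \<open>q^2 - 1/4\<close>. So \<open>Z\<close> is the product of all eigenvalues of the map
   from \<open>G\<close> to \<open>S G S - G / 4\<close> on symmetric matrices.\<close>
 define Z where "Z = P * (d - 1/4)"
 have d: "d = x * z - s^2" and t: "t = x + z" by (simp_all add: d_def t_def x_def z_def)
 have P: "P = d^2 - (t^2 - 2 * d) / 4 + 1 / 16"
  unfolding P_def d_def t_def by (simp add: power2_eq_square algebra_simps)
 have "d - 1/4 = (a * c - s^2) + (a + c) / 2" by (simp add: d_def algebra_simps)
 then have d14: "d - 1/4 > 0" using pos by (simp add: add_pos_pos)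
 have P0: "P > 0" unfolding P_def using pos by (intro mult_pos_pos) auto
 have Z: "Z ~= 0" using d14 P0 by (simp add: Z_def)
 define N11 where "N11 = A * V11 + 2 * B * (x * V11 + s * V12) + C * (x^2 * V11 + 2 * x * s * V12 + s^2 * V22)"
 define N12 where "N12 = A * V12 + B * (t * V12 + s * (V11 + V22)) + C * (x * s * V11 + (x * z + s^2) * V12 + s * z * V22)"
 define N22 where "N22 = A * V22 + 2 * B * (z * V22 + s * V12) + C * (s^2 * V11 + 2 * z * s * V12 + z^2 * V22)"
 have e11: "x^2 * N11 + 2 * x * s * N12 + s^2 * N22 - N11 / 4 = Z * V11"
  unfolding N11_def N12_def N22_def A_def B_def C_def Z_def P d t by (simp add: power2_eq_square field_simps)
 have e12: "x * s * N11 + (x * z + s^2) * N12 + s * z * N22 - N12 / 4 = Z * V12"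
  unfolding N11_def N12_def N22_def A_def B_def C_def Z_def P d t by (simp add: power2_eq_square field_simps)
 have e22: "s^2 * N11 + 2 * z * s * N12 + z^2 * N22 - N22 / 4 = Z * V22"
  unfolding N11_def N12_def N22_def A_def B_def C_def Z_def P d t by (simp add: power2_eq_square field_simps)
 define G11 G12 G22 where "G11 = N11 / Z" and "G12 = N12 / Z" and "G22 = N22 / Z"
 have G: "N11 = Z * G11" "N12 = Z * G12" "N22 = Z * G22" using Z by (simp_all add: G11_def G12_def G22_def)
 have can: "u = v" if "Z * u = Z * v" for u v using that Z by simp
 have "x^2 * G11 + 2 * x * s * G12 + s^2 * G22 - G11 / 4 = V11"
  by (rule can) (use e11 in \<open>simp add: G algebra_simps\<close>)
 then have 1: "a^2 * G11 + 2 * a * s * G12 + s^2 * G22 + a * G11 + s * G12 = V11"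
  by (simp add: x_def power2_eq_square algebra_simps)
 have "x * s * G11 + (x * z + s^2) * G12 + s * z * G22 - G12 / 4 = V12"
  by (rule can) (use e12 in \<open>simp add: G algebra_simps\<close>)
 then have 2: "a * s * G11 + (a * c + s^2) * G12 + s * c * G22 + (a * G12 + c * G12 + s * G11 + s * G22) / 2 = V12"
  by (simp add: x_def z_def power2_eq_square field_simps)
 have "s^2 * G11 + 2 * z * s * G12 + z^2 * G22 - G22 / 4 = V22"
  by (rule can) (use e22 in \<open>simp add: G algebra_simps\<close>)
 then have 3: "s^2 * G11 + 2 * s * c * G12 + c^2 * G22 + c * G22 + s * G12 = V22"
  by (simp add: z_def power2_eq_square algebra_simps)
 have "(V11 * G11 + 2 * V12 * G12 + V22 * G22) * Z = V11 * N11 + 2 * V12 * N12 + V22 * N22"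
  by (simp add: G algebra_simps)
 also have "... = A * (V11^2 + 2 * V12^2 + V22^2)
   + 2 * B * (x * (V11^2 + V12^2) + z * (V22^2 + V12^2) + 2 * s * V12 * (V11 + V22))
   + C * ((x * V11 + s * V12)\<^sup>2 + 2 * (x * V12 + s * V22) * (s * V11 + z * V12) + (s * V12 + z * V22)\<^sup>2)"
  unfolding N11_def N12_def N22_def t by (simp add: power2_eq_square algebra_simps)
 finally show ?thesis
  using 1 2 3 unfolding A_def B_def C_def Z_def x_def z_def by (intro exI[of _ G11] exI[of _ G12] exI[of _ G22]) auto
qed

text \<open>The diagonal identities between the three kinds of photon statistics determine the derivative
 of Eve's statistics as the action of the symmetric logarithmic derivative.\<close>

lemma derivative_as_SLD:
 fixes a s c f :: real
 assumes h: "h11 = (k11 - h11) * a + (k12 - h12) * s" "h12 = (k11 - h11) * s + (k12 - h12) * c"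
   "h21 = (k12 - h21) * a + (k22 - h22) * s" "h22 = (k12 - h21) * s + (k22 - h22) * c"
  and g: "g11 = a * (f + h11 - g11) + s * (h21 - g12)" "g12 = s * (f + h11 - g11) + c * (h21 - g12)"
   "g12 = a * (h12 - g12) + s * (f + h22 - g22)" "g22 = s * (h12 - g12) + c * (f + h22 - g22)"
  and G: "a^2 * G11 + 2 * a * s * G12 + s^2 * G22 + a * G11 + s * G12 = V11"
   "a * s * G11 + (a * c + s^2) * G12 + s * c * G22 + (a * G12 + c * G12 + s * G11 + s * G22) / 2 = V12"
   "s^2 * G11 + 2 * s * c * G12 + c^2 * G22 + c * G22 + s * G12 = V22"
 shows "V11 * (g11 + k11 - 2 * h11 - f) + 2 * V12 * (g12 + k12 - h12 - h21) + V22 * (g22 + k22 - 2 * h22 - f)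
  = G11 * h11 + G12 * (h12 + h21) + G22 * h22 - (G11 * a + 2 * G12 * s + G22 * c) * f"
proof -
 define X11 X12 X22 where "X11 = g11 + k11 - 2 * h11 - f" and "X12 = g12 + k12 - h12 - h21" and "X22 = g22 + k22 - 2 * h22 - f"
 \<comment> \<open>The eight hypotheses on \<open>h\<close> and \<open>g\<close>, written as
   expressions that vanish; the claim is a combination of them with coefficients from
   \<open>G\<close>.\<close>
 define H11 H12 H21 H22 where "H11 = (k11 - h11) * a + (k12 - h12) * s - h11"
  and "H12 = (k11 - h11) * s + (k12 - h12) * c - h12"
  and "H21 = (k12 - h21) * a + (k22 - h22) * s - h21" and "H22 = (k12 - h21) * s + (k22 - h22) * c - h22"
 define J11 J21 J12 J22 where "J11 = a * (f + h11 - g11) + s * (h21 - g12) - g11"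
  and "J21 = s * (f + h11 - g11) + c * (h21 - g12) - g12"
  and "J12 = a * (h12 - g12) + s * (f + h22 - g22) - g12" and "J22 = s * (h12 - g12) + c * (f + h22 - g22) - g22"
 have z: "H11 = 0" "H12 = 0" "H21 = 0" "H22 = 0" "J11 = 0" "J12 = 0" "J21 = 0" "J22 = 0"
  unfolding H11_def H12_def H21_def H22_def J11_def J12_def J21_def J22_def using h g by linarith+
 have m11: "a^2 * X11 + 2 * a * s * X12 + s^2 * X22 + a * X11 + s * X12 - (h11 - a * f)
  = (a * H11 + s * H21) - (J11 * a + J12 * s) + H11" unfolding X11_def X12_def X22_def H11_def H21_def J11_def J12_def
  by (simp add: power2_eq_square algebra_simps)
 have m22: "s^2 * X11 + 2 * s * c * X12 + c^2 * X22 + c * X22 + s * X12 - (h22 - c * f)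
  = (s * H12 + c * H22) - (J21 * s + J22 * c) + H22" unfolding X11_def X12_def X22_def H12_def H22_def J21_def J22_def
  by (simp add: power2_eq_square algebra_simps)
 have m12: "2 * (a * s * X11 + (a * c + s^2) * X12 + s * c * X22) + (a * X12 + c * X12 + s * X11 + s * X22) - (h12 + h21 - 2 * s * f)
  = (a * H12 + s * H22) + (s * H11 + c * H21) - (J11 * s + J12 * c) - (J21 * a + J22 * s) + H12 + H21"
  unfolding X11_def X12_def X22_def H11_def H12_def H21_def H22_def J11_def J12_def J21_def J22_def
  by (simp add: power2_eq_square algebra_simps)
 have "V11 * X11 + 2 * V12 * X12 + V22 * X22 = G11 * (a^2 * X11 + 2 * a * s * X12 + s^2 * X22 + a * X11 + s * X12)
  + G12 * (2 * (a * s * X11 + (a * c + s^2) * X12 + s * c * X22) + (a * X12 + c * X12 + s * X11 + s * X22))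
  + G22 * (s^2 * X11 + 2 * s * c * X12 + c^2 * X22 + c * X22 + s * X12)"
  unfolding G[symmetric] by (simp add: algebra_simps)
 also have "... = G11 * (h11 - a * f) + G12 * (h12 + h21 - 2 * s * f) + G22 * (h22 - c * f)"
  using m11 m12 m22 unfolding z by simp
 finally show ?thesis by (simp add: X11_def X12_def X22_def algebra_simps)
qed

text \<open>The left side is the variance as it arises from the inputs in
  \<open>has_sum_sld_amp\<close>, the right side the pairing of \<open>V\<close> with
  \<open>G\<close> that \<open>lyapunov_solution\<close> evaluates. With \<open>V\<close> written in
  terms of \<open>G\<close> this is a polynomial identity.\<close>

lemma SLD_variance:
 fixes G11 G12 G22 B1 B2 \<tau> \<rho> :: real
 assumes tr: "\<rho>^2 = 1 - \<tau>^2"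
 defines "a \<equiv> \<tau>\<^sup>2 * B1" and "s \<equiv> - (\<tau> * \<rho>^2 * B1)" and "c \<equiv> \<rho>\<^sup>2 * \<rho>^2 * B1 + \<tau>^2 * B2"
 assumes G: "a^2 * G11 + 2 * a * s * G12 + s^2 * G22 + a * G11 + s * G12 = V11"
   "a * s * G11 + (a * c + s^2) * G12 + s * c * G22 + (a * G12 + c * G12 + s * G11 + s * G22) / 2 = V12"
   "s^2 * G11 + 2 * s * c * G12 + c^2 * G22 + c * G22 + s * G12 = V22"
 shows "(\<tau>^2 * G11 - 2 * \<tau> * \<rho>^2 * G12 + \<rho>^2 * \<rho>^2 * G22)\<^sup>2 * (B1 * (B1 + 1)) + (\<tau>^2 * G22)\<^sup>2 * (B2 * (B2 + 1))
  + (\<tau> * (\<tau> * G12 - \<rho>^2 * G22))\<^sup>2 * (2 * B1 * B2 + B1 + B2)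
  + \<rho>^2 * (\<tau> * G11 - \<rho>^2 * G12 + \<tau> * (\<tau> * G12 - \<rho>^2 * G22))\<^sup>2 * B1 + \<rho>^2 * (\<tau> * (G12 + \<tau> * G22))\<^sup>2 * B2
  = V11 * G11 + 2 * V12 * G12 + V22 * G22" unfolding G[symmetric] a_def s_def c_def tr
 by (simp add: power2_eq_square field_simps)


section \<open>The chi-square distance of Eve's photon statistics\<close>

context roundtrip
begin

lemma has_sum_wt_poly:
 "((%(j, l). wt j l * (k0 + k1 * real j + k2 * real l + k3 * (real j)\<^sup>2 + k4 * (real l)\<^sup>2 + k5 * (real j * real l)))
  has_sum (k0 + k1 * NB1 + k2 * NB2 + k3 * (2 * NB1^2 + NB1) + k4 * (2 * NB2^2 + NB2) + k5 * (NB1 * NB2))) UNIV"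
proof -
 have nn: "NB1 >= 0" "NB2 >= 0" using NB1_pos NB2_pos by auto
 note s1 = has_sum_th[OF nn(1)] has_sum_th_moments[OF nn(1)]
 note s2 = has_sum_th[OF nn(2)] has_sum_th_moments[OF nn(2)]
 have p: "((%(j, l). th NB1 j * th NB2 l) has_sum 1 * 1) UNIV"
  "((%(j, l). (th NB1 j * real j) * th NB2 l) has_sum NB1 * 1) UNIV"
  "((%(j, l). th NB1 j * (th NB2 l * real l)) has_sum 1 * NB2) UNIV"
  "((%(j, l). (th NB1 j * (real j)\<^sup>2) * th NB2 l) has_sum (2 * NB1^2 + NB1) * 1) UNIV"
  "((%(j, l). th NB1 j * (th NB2 l * (real l)\<^sup>2)) has_sum 1 * (2 * NB2^2 + NB2)) UNIV"
  "((%(j, l). (th NB1 j * real j) * (th NB2 l * real l)) has_sum NB1 * NB2) UNIV"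
  using has_sum_product_UNIV[OF s1(1) s2(1)] has_sum_product_UNIV[OF s1(2) s2(1)] has_sum_product_UNIV[OF s1(1) s2(2)]
   has_sum_product_UNIV[OF s1(3) s2(1)] has_sum_product_UNIV[OF s1(1) s2(3)] has_sum_product_UNIV[OF s1(2) s2(2)]
  by (simp_all add: th_nonneg nn)
 show ?thesis by (rule has_sum_eq_rule[OF has_sum_add[OF has_sum_add[OF has_sum_add[OF has_sum_add[OF has_sum_add[OF
   has_sum_cmult_right[OF p(1), of k0] has_sum_cmult_right[OF p(2), of k1]] has_sum_cmult_right[OF p(3), of k2]]
   has_sum_cmult_right[OF p(4), of k3]] has_sum_cmult_right[OF p(5), of k4]] has_sum_cmult_right[OF p(6), of k5]]])
   (auto simp: wt_def algebra_simps)
qed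

text \<open>Pythagoras for the orthonormal family \<open>ampv\<close>. Indices with coefficient zero
  may coincide, which happens where truncated subtraction meets 0.\<close>

lemma combination_norm:
 assumes "finite I" and "!!a b. a \<in> I ==> b \<in> I ==> a ~= b ==> c a ~= 0 ==> c b ~= 0 ==> z a ~= z b"
 shows "((%y. (\<Sum>a\<in>I. c a * ampv (z a) y)\<^sup>2) has_sum (\<Sum>a\<in>I. (c a)\<^sup>2)) UNIV"
proof -
 have "((%y. \<Sum>a\<in>I. \<Sum>b\<in>I. c a * c b * (ampv (z a) y * ampv (z b) y)) has_sum
  (\<Sum>a\<in>I. \<Sum>b\<in>I. c a * c b * of_bool (z a = z b))) UNIV"
  by (intro has_sum_finite_sum assms(1) has_sum_cmult_right amp_orth)
 then show ?thesis
 proof (rule has_sum_eq_rule)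
  show "(\<Sum>a\<in>I. \<Sum>b\<in>I. c a * c b * (ampv (z a) y * ampv (z b) y)) = (\<Sum>a\<in>I. c a * ampv (z a) y)\<^sup>2" for y
   by (simp add: power2_eq_square sum_product mult_ac)
  show "(\<Sum>a\<in>I. \<Sum>b\<in>I. c a * c b * of_bool (z a = z b)) = (\<Sum>a\<in>I. (c a)\<^sup>2)"
  proof (rule sum.cong)
   fix a assume a: "a \<in> I"
   have "(\<Sum>b\<in>I. c a * c b * of_bool (z a = z b)) = (\<Sum>b\<in>I. c a * c b * of_bool (b = a))"
    using assms(2)[OF a] by (intro sum.cong) auto
   also have "... = (c a)\<^sup>2" using assms(1) a by (simp add: sum_of_bool_mult power2_eq_square)
   finally show "(\<Sum>b\<in>I. c a * c b * of_bool (z a = z b)) = (c a)\<^sup>2" .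
  qed simp
 qed
qed

text \<open>A number operator of Eve, carried to the inputs by one annihilation and one creation.
  The creation may put its photon into the signal mode, hence \<open>amp 1\<close>. The next three
  lemmas treat the other products.\<close>

lemma quad11: "real e1 * amp 0 j l b e1 e2 =
  \<tau> * sqrt (real j) * (\<tau> * sqrt (real j) * amp 0 j l b e1 e2 - \<rho> * amp 1 (j - 1) l b e1 e2)"
proof -
 have "real e1 * amp 0 j l b e1 e2 = \<tau> * sqrt (real j) * (sqrt (real e1) * amp 0 (j - 1) l b (e1 - 1) e2)"
 proof (cases e1)
  case (Suc m)
  have "real e1 * amp 0 j l b e1 e2 = sqrt (real (Suc m)) * (sqrt (real (Suc m)) * amp 0 j l b (Suc m) e2)"
   unfolding Suc by simp
  then show ?thesis unfolding amp_annihilate_e1 by (simp add: Suc)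
 qed simp
 then show ?thesis unfolding amp_create_e1 by (cases j) (auto simp: algebra_simps)
qed

lemma quad21: "sqrt (real e2) * (sqrt (real (Suc e1)) * amp 0 j l b (Suc e1) (e2 - 1)) =
  \<tau> * sqrt (real j) * (- (\<rho> * \<tau>) * amp 1 (j - 1) l b e1 e2 - \<rho>^2 * sqrt (real j) * amp 0 j l b e1 e2
   + \<tau> * sqrt (real (Suc l)) * amp 0 (j - 1) (Suc l) b e1 e2)"
proof -
 have "sqrt (real e2) * (sqrt (real (Suc e1)) * amp 0 j l b (Suc e1) (e2 - 1))
  = \<tau> * sqrt (real j) * (sqrt (real e2) * amp 0 (j - 1) l b e1 (e2 - 1))" unfolding amp_annihilate_e1 by simp
 then show ?thesis unfolding amp_create_e2 by (cases j) (auto simp: algebra_simps)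
qed

lemma quad12: "sqrt (real e1) * (sqrt (real (Suc e2)) * amp 0 j l b (e1 - 1) (Suc e2)) =
  - \<rho>\<^sup>2 * sqrt (real j) * (\<tau> * sqrt (real j) * amp 0 j l b e1 e2 - \<rho> * amp 1 (j - 1) l b e1 e2)
  + \<tau> * sqrt (real l) * (\<tau> * sqrt (real (Suc j)) * amp 0 (Suc j) (l - 1) b e1 e2 - \<rho> * amp 1 j (l - 1) b e1 e2)"
proof -
 have "sqrt (real e1) * (sqrt (real (Suc e2)) * amp 0 j l b (e1 - 1) (Suc e2))
  = - \<rho>\<^sup>2 * sqrt (real j) * (sqrt (real e1) * amp 0 (j - 1) l b (e1 - 1) e2)
   + \<tau> * sqrt (real l) * (sqrt (real e1) * amp 0 j (l - 1) b (e1 - 1) e2)"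
  unfolding amp_annihilate_e2 by (simp add: algebra_simps)
 then show ?thesis unfolding amp_create_e1 by (cases j) (auto simp: algebra_simps)
qed

lemma quad22: "real e2 * amp 0 j l b e1 e2 =
  - \<rho>\<^sup>2 * sqrt (real j) * (- (\<rho> * \<tau>) * amp 1 (j - 1) l b e1 e2 - \<rho>^2 * sqrt (real j) * amp 0 j l b e1 e2
   + \<tau> * sqrt (real (Suc l)) * amp 0 (j - 1) (Suc l) b e1 e2)
  + \<tau> * sqrt (real l) * (- (\<rho> * \<tau>) * amp 1 j (l - 1) b e1 e2 - \<rho>^2 * sqrt (real (Suc j)) * amp 0 (Suc j) (l - 1) b e1 e2
   + \<tau> * sqrt (real l) * amp 0 j l b e1 e2)"
proof -
 have "real e2 * amp 0 j l b e1 e2 = - \<rho>\<^sup>2 * sqrt (real j) * (sqrt (real e2) * amp 0 (j - 1) l b e1 (e2 - 1))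
   + \<tau> * sqrt (real l) * (sqrt (real e2) * amp 0 j (l - 1) b e1 (e2 - 1))"
 proof (cases e2)
  case (Suc m)
  have "real e2 * amp 0 j l b e1 e2 = sqrt (real (Suc m)) * (sqrt (real (Suc m)) * amp 0 j l b e1 (Suc m))"
   unfolding Suc by simp
  then show ?thesis unfolding amp_annihilate_e2 by (simp add: Suc algebra_simps del: of_nat_Suc)
 qed simp
 then show ?thesis unfolding amp_create_e2 by (cases j; cases l) (auto simp: algebra_simps)
qed

text \<open>The observable \<open>G0\<close> plus the quadratic form of \<open>G\<close> in Eve's
  mode operators, applied to the amplitudes of the vacuum signal.\<close>

definition sld_amp :: "real => real => real => real => nat \<times> nat => nat \<times> nat \<times> nat => real"
 where "sld_amp G0 G11 G12 G22 = (%(e1, e2) k.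
  (G0 + G11 * real e1 + G22 * real e2) * eamp 0 (e1, e2) k
  + G12 * (sqrt (real e1) * sqrt (real (Suc e2)) * eamp 0 (e1 - 1, Suc e2) k
   + sqrt (real e2) * sqrt (real (Suc e1)) * eamp 0 (Suc e1, e2 - 1) k))"

lemma has_sum_sld_amp:
 defines "W11 \<equiv> %G11 G12 G22. \<tau>\<^sup>2 * G11 - 2 * \<tau> * \<rho>^2 * G12 + \<rho>^2 * \<rho>^2 * G22"
 shows "((%(x, k). (sld_amp (- (W11 G11 G12 G22 * NB1 + \<tau>^2 * G22 * NB2)) G11 G12 G22 x k)\<^sup>2) has_sum
  ((W11 G11 G12 G22)\<^sup>2 * (NB1 * (NB1 + 1)) + (\<tau>^2 * G22)\<^sup>2 * (NB2 * (NB2 + 1))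
  + (\<tau> * (\<tau> * G12 - \<rho>^2 * G22))\<^sup>2 * (2 * NB1 * NB2 + NB1 + NB2)
  + \<rho>^2 * (\<tau> * G11 - \<rho>^2 * G12 + \<tau> * (\<tau> * G12 - \<rho>^2 * G22))\<^sup>2 * NB1 + \<rho>^2 * (\<tau> * (G12 + \<tau> * G22))\<^sup>2 * NB2)) UNIV"
  (is "(_ has_sum ?F) UNIV")
proof -
 \<comment> \<open>\<open>A\<close> and \<open>B\<close> multiply the two environment numbers,
   \<open>C\<close> belongs to an exchange of a photon between the environments, \<open>D\<close>
   and \<open>E\<close> to its transfer into the signal mode; \<open>G0\<close> removes the
   mean.\<close>
 define A where "A = W11 G11 G12 G22"
 define B where "B = \<tau>^2 * G22"
 define C where "C = \<tau> * (\<tau> * G12 - \<rho>^2 * G22)"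
 define D where "D = - \<rho> * (\<tau> * G11 - \<rho>^2 * G12 + \<tau> * (\<tau> * G12 - \<rho>^2 * G22))"
 define E where "E = - \<rho> * (\<tau> * (G12 + \<tau> * G22))"
 define G0 where "G0 = - (A * NB1 + B * NB2)"
 define c where "c = (%j l a. if a = (0::nat) then G0 + A * real j + B * real l
  else if a = 1 then C * sqrt (real l) * sqrt (real (Suc j))
  else if a = 2 then C * sqrt (real j) * sqrt (real (Suc l))
  else if a = 3 then D * sqrt (real j) else E * sqrt (real l))"
 define z where "z = (%j l a. if a = (0::nat) then (0, j, l) else if a = 1 then (0, Suc j, l - 1)
  else if a = 2 then (0, j - 1, Suc l) else if a = 3 then (1, j - 1, l) else (1::nat, j::nat, l - 1 :: nat))"
 define I where "I = {0, 1, 2, 3, 4::nat}"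
 define Q where "Q = (%j l. \<Sum>a\<in>I. (c j l a)\<^sup>2)"
 have sld: "sld_amp G0 G11 G12 G22 (e1, e2) (b, j, l) = sqrt (wt j l) * (\<Sum>a\<in>I. c j l a * ampv (z j l a) (b, e1, e2))" for b j l e1 e2
 proof -
  have s: "sqrt (real n) * (sqrt (real n) * w) = real n * w" for n w by (simp add: mult.assoc[symmetric])
  have "sld_amp G0 G11 G12 G22 (e1, e2) (b, j, l) = sqrt (wt j l) * (G0 * amp 0 j l b e1 e2
   + G11 * (real e1 * amp 0 j l b e1 e2) + G22 * (real e2 * amp 0 j l b e1 e2)
   + G12 * (sqrt (real e1) * (sqrt (real (Suc e2)) * amp 0 j l b (e1 - 1) (Suc e2)))
   + G12 * (sqrt (real e2) * (sqrt (real (Suc e1)) * amp 0 j l b (Suc e1) (e2 - 1))))"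
   by (simp add: sld_amp_def eamp_def algebra_simps)
  also have "... = sqrt (wt j l) * ((G0 + A * real j + B * real l) * amp 0 j l b e1 e2
   + C * sqrt (real l) * sqrt (real (Suc j)) * amp 0 (Suc j) (l - 1) b e1 e2
   + C * sqrt (real j) * sqrt (real (Suc l)) * amp 0 (j - 1) (Suc l) b e1 e2
   + D * sqrt (real j) * amp 1 (j - 1) l b e1 e2 + E * sqrt (real l) * amp 1 j (l - 1) b e1 e2)"
   unfolding quad11 quad12 quad21 quad22 A_def B_def C_def D_def E_def W11_def
   by (simp add: algebra_simps power2_eq_square s del: of_nat_Suc)
  also have "... = sqrt (wt j l) * (\<Sum>a\<in>I. c j l a * ampv (z j l a) (b, e1, e2))"
   by (simp add: I_def c_def z_def ampv_def algebra_simps del: of_nat_Suc)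
  finally show ?thesis .
 qed
 define f where "f = (%((j, l), (b, e1, e2)). (sld_amp G0 G11 G12 G22 (e1, e2) (b, j, l))\<^sup>2)"
 define q where "q = (%(j, l). wt j l * Q j l)"
 have Qeq: "Q j l = G0^2 + (2 * G0 * A + C^2 + D^2) * real j + (2 * G0 * B + C^2 + E^2) * real l
   + A^2 * (real j)\<^sup>2 + B^2 * (real l)\<^sup>2 + (2 * A * B + 2 * C^2) * (real j * real l)" for j l
  by (simp add: Q_def I_def c_def power_mult_distrib) (simp add: power2_eq_square algebra_simps)
 have qs: "(q has_sum ?F) UNIV" unfolding q_def Qeq
 proof (rule has_sum_eq_rule[OF has_sum_wt_poly])
  show "G0^2 + (2 * G0 * A + C^2 + D^2) * NB1 + (2 * G0 * B + C^2 + E^2) * NB2 + A^2 * (2 * NB1^2 + NB1)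
   + B^2 * (2 * NB2^2 + NB2) + (2 * A * B + 2 * C^2) * (NB1 * NB2) = ?F"
   unfolding A_def B_def C_def D_def E_def G0_def
   by (simp add: power_mult_distrib) (simp add: power2_eq_square power4_eq_xxxx algebra_simps)
 qed simp
 have row: "((%y. f (w, y)) has_sum q w) UNIV" for w
 proof -
  obtain j l where w: "w = (j, l)" by force
  have "((%y. (\<Sum>a\<in>I. c j l a * ampv (z j l a) y)\<^sup>2) has_sum Q j l) UNIV"
   unfolding Q_def by (rule combination_norm) (auto simp: I_def c_def z_def split: if_splits)
  from has_sum_cmult_right[OF this, of "wt j l"] show ?thesis by (rule has_sum_eq_rule)
    (use wt_nonneg[of j l] in \<open>auto simp: f_def q_def w sld power_mult_distrib\<close>)
 qed
 have "(f has_sum ?F) UNIV" by (rule has_sum_pair_nonneg[OF row qs]) (auto simp: f_def split: prod.splits)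
 then have "((%(x, k). (sld_amp G0 G11 G12 G22 x k)\<^sup>2) has_sum ?F) UNIV"
  by (rule has_sum_bij[where i = "%((j, l), (b, e1, e2)). ((e1, e2), (b, j, l))"
    and j = "%((e1, e2), (b, j, l)). ((j, l), (b, e1, e2))"]) (auto simp: f_def)
 then show ?thesis by (simp add: G0_def A_def B_def)
qed

end

section \<open>The effect of one signal photon on Eve's diagonal\<close>

context roundtrip
begin

text \<open>One signal photon amounts to one application of \<open>amp_create_s\<close>. Squaring it
  yields terms with two creations (\<open>k\<close>), two annihilations (\<open>g\<close>) and one
  of each (\<open>h\<close>). The remaining identities are \<open>left1_eq\<close> and
  \<open>left2_eq\<close> times square roots of photon numbers.\<close>

lemma sig1_diag:
 fixes e1 e2 :: nat
 defines "m \<equiv> (e1, e2)"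
 defines "h11 \<equiv> real e1 * sig 0 m m" and "h12 \<equiv> sqrt (real e1) * left2 (e1 - 1, e2) m"
  and "h21 \<equiv> sqrt (real e2) * left1 (e1, e2 - 1) m" and "h22 \<equiv> real e2 * sig 0 m m"
  and "k11 \<equiv> sqrt (real e1) * right1 (e1 - 1, e2) m" and "k12 \<equiv> sqrt (real e1) * right2 (e1 - 1, e2) m"
  and "k22 \<equiv> sqrt (real e2) * right2 (e1, e2 - 1) m"
  and "g11 \<equiv> sqrt (real (Suc e1)) * left1 m (Suc e1, e2)" and "g12 \<equiv> sqrt (real (Suc e2)) * left1 m (e1, Suc e2)"
  and "g22 \<equiv> sqrt (real (Suc e2)) * left2 m (e1, Suc e2)"
 shows "sig 1 m m - sig 0 m m = \<rho>^2 * (g11 + k11 - 2 * h11 - sig 0 m m)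
  + 2 * (\<rho>^2 * \<tau>) * (g12 + k12 - h12 - h21) + (\<rho>^2 * \<tau>^2) * (g22 + k22 - 2 * h22 - sig 0 m m)"
  (is ?A)
  and "h11 = (k11 - h11) * (\<tau>^2 * NB1) + (k12 - h12) * (- (\<tau> * \<rho>^2 * NB1))" (is ?h11)
  "h12 = (k11 - h11) * (- (\<tau> * \<rho>^2 * NB1)) + (k12 - h12) * (\<rho>^2 * \<rho>^2 * NB1 + \<tau>^2 * NB2)" (is ?h12)
  "h21 = (k12 - h21) * (\<tau>^2 * NB1) + (k22 - h22) * (- (\<tau> * \<rho>^2 * NB1))" (is ?h21)
  "h22 = (k12 - h21) * (- (\<tau> * \<rho>^2 * NB1)) + (k22 - h22) * (\<rho>^2 * \<rho>^2 * NB1 + \<tau>^2 * NB2)" (is ?h22)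
  "g11 = (\<tau>^2 * NB1) * (sig 0 m m + h11 - g11) + (- (\<tau> * \<rho>^2 * NB1)) * (h21 - g12)" (is ?g11)
  "g12 = (- (\<tau> * \<rho>^2 * NB1)) * (sig 0 m m + h11 - g11) + (\<rho>^2 * \<rho>^2 * NB1 + \<tau>^2 * NB2) * (h21 - g12)" (is ?g12)
  "g12 = (\<tau>^2 * NB1) * (h12 - g12) + (- (\<tau> * \<rho>^2 * NB1)) * (sig 0 m m + h22 - g22)" (is ?g21)
  "g22 = (- (\<tau> * \<rho>^2 * NB1)) * (h12 - g12) + (\<rho>^2 * \<rho>^2 * NB1 + \<tau>^2 * NB2) * (sig 0 m m + h22 - g22)" (is ?g22)
proof -
 have t2: "\<tau>^2 = \<eta>" using tau_sq by (simp add: power2_eq_square)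
 have sq: "sqrt (real n) * (sqrt (real n) * w) = real n * w" for n w by (simp add: mult.assoc[symmetric])
 have sq': "sqrt (real (Suc n)) * w * (sqrt (real (Suc n)) * w) = real n * w^2 + w * w" for n w
 proof -
  have "sqrt (real (Suc n)) * w * (sqrt (real (Suc n)) * w) = real (Suc n) * (w * w)"
   using sq[of "Suc n" "w * w"] by (simp only: mult_ac)
  then show ?thesis by (simp add: power2_eq_square algebra_simps)
 qed
 have l1: "left1 x y = (\<tau>^2 * NB1) * (right1 x y - left1 x y) + (- (\<tau> * \<rho>^2 * NB1)) * (right2 x y - left2 x y)" for x y
  using left1_eq[of x y] by (simp add: power2_eq_square algebra_simps)
 have l2: "left2 x y = (- (\<tau> * \<rho>^2 * NB1)) * (right1 x y - left1 x y) + (\<rho>^2 * \<rho>^2 * NB1 + \<tau>^2 * NB2) * (right2 x y - left2 x y)" for x y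
  using left2_eq[of x y] unfolding t2 by (simp add: power2_eq_square algebra_simps)
 have h11: "h11 = sqrt (real e1) * left1 (e1 - 1, e2) m"
  by (cases e1) (simp_all add: h11_def left1_def m_def sq del: of_nat_Suc)
 have h22: "h22 = sqrt (real e2) * left2 (e1, e2 - 1) m"
  by (cases e2) (simp_all add: h22_def left2_def m_def sq del: of_nat_Suc)
 have k21: "k12 = sqrt (real e2) * right1 (e1, e2 - 1) m"
  by (simp add: k12_def right1_def right2_def m_def sig_sym[of 0 "(e1, e2 - Suc 0)"])
 have lin: "q * u = x * (q * v - q * w) + y * (q * r - q * z)" if "u = x * (v - w) + y * (r - z)" for q u x v w y r z :: real
  unfolding that by (simp add: algebra_simps)
 have lin': "q * u = (q * v - q * w) * x + (q * r - q * z) * y" if "u = x * (v - w) + y * (r - z)" for q u x v w y r z :: real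
  unfolding that by (simp add: algebra_simps)
 show ?h11 unfolding h11 h12_def k11_def k12_def by (rule lin'[OF l1])
 show ?h12 unfolding h11 h12_def k11_def k12_def by (rule lin'[OF l2])
 show ?h21 unfolding h22 h21_def k22_def k21 by (rule lin'[OF l1])
 show ?h22 unfolding h22 h21_def k22_def k21 by (rule lin'[OF l2])
 have g21: "g12 = sqrt (real (Suc e1)) * left2 m (Suc e1, e2)"
  by (simp add: g12_def left1_def left2_def m_def sig_sym[of 0 "(Suc e1, e2)"])
 have r11: "sig 0 m m + h11 = sqrt (real (Suc e1)) * right1 m (Suc e1, e2)"
  by (simp add: right1_def h11_def sq m_def del: of_nat_Suc) (simp add: algebra_simps)
 have r22: "sig 0 m m + h22 = sqrt (real (Suc e2)) * right2 m (e1, Suc e2)"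
  by (simp add: right2_def h22_def sq m_def del: of_nat_Suc) (simp add: algebra_simps)
 have r21: "h21 = sqrt (real (Suc e1)) * right2 m (Suc e1, e2)"
  by (simp add: h21_def left1_def right2_def m_def sig_sym[of 0 "(e1, e2)"])
 have r12: "h12 = sqrt (real (Suc e2)) * right1 m (e1, Suc e2)"
  by (simp add: h12_def left2_def right1_def m_def sig_sym[of 0 "(e1, e2)"])
 show ?g11 unfolding g11_def g21 r11 r21 by (rule lin[OF l1])
 show ?g12 unfolding g11_def g21 r11 r21 by (rule lin[OF l2])
 show ?g21 unfolding g12_def g22_def r22 r12 by (rule lin[OF l1])
 show ?g22 unfolding g12_def g22_def r22 r12 by (rule lin[OF l2])

 define c1 where "c1 = (%k. sqrt (real e1) * eamp 0 (e1 - 1, e2) k)"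
 define c2 where "c2 = (%k. sqrt (real e2) * eamp 0 (e1, e2 - 1) k)"
 define bb where "bb = (%(b, j, l). sqrt (real b) * eamp 0 m (b - 1, j, l))"
 \<comment> \<open>Bob's creation term \<open>bb\<close> is not accessible to Eve; its norm and
   overlaps are next expressed through \<open>outb_eq\<close> and
   \<open>has_sum_cross_b'\<close>.\<close>
 have e1amp: "eamp 1 m k = \<eta> * bb k - \<rho> * c1 k - \<rho> * \<tau> * c2 k" for k
 proof -
  obtain b j l where k: "k = (b, j, l)" by (metis prod_cases3)
  have "amp (Suc 0) j l b e1 e2 = \<eta> * (sqrt (real b) * amp 0 j l (b - 1) e1 e2)
   - \<rho> * (sqrt (real e1) * amp 0 j l b (e1 - 1) e2) - \<rho> * \<tau> * (sqrt (real e2) * amp 0 j l b e1 (e2 - 1))"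
   using amp_create_s[of 0 j l b e1 e2] by simp
  from arg_cong[OF this, of "%u. sqrt (wt j l) * u"]
  show ?thesis unfolding k by (simp add: eamp_def bb_def c1_def c2_def m_def algebra_simps)
 qed
 have c11: "((%k. c1 k * c1 k) has_sum k11) UNIV"
  by (rule has_sum_eq_rule[OF has_sum_cmult_right[OF has_sum_right(1)[of "(e1 - 1, e2)" e1 e2], of "sqrt (real e1)"]])
   (auto simp: c1_def k11_def m_def)
 have c12: "((%k. c1 k * c2 k) has_sum k12) UNIV"
  by (rule has_sum_eq_rule[OF has_sum_cmult_right[OF has_sum_right(2)[of "(e1 - 1, e2)" e2 e1], of "sqrt (real e1)"]])
   (auto simp: c1_def c2_def k12_def m_def)
 have c22: "((%k. c2 k * c2 k) has_sum k22) UNIV"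
  by (rule has_sum_eq_rule[OF has_sum_cmult_right[OF has_sum_right(2)[of "(e1, e2 - 1)" e2 e1], of "sqrt (real e2)"]])
   (auto simp: c2_def k22_def m_def)
 have b1: "((%k. bb k * c1 k) has_sum (\<rho> * h11 + \<rho> * \<tau> * h12) / \<eta>) UNIV"
  by (rule has_sum_eq_rule[OF has_sum_cmult_right[OF has_sum_cross_b'[of "(e1 - 1, e2)" m], of "sqrt (real e1)"]])
   (auto simp: c1_def bb_def h11 h12_def cross_b_def field_simps split: prod.splits)
 have b2: "((%k. bb k * c2 k) has_sum (\<rho> * h21 + \<rho> * \<tau> * h22) / \<eta>) UNIV"
  by (rule has_sum_eq_rule[OF has_sum_cmult_right[OF has_sum_cross_b'[of "(e1, e2 - 1)" m], of "sqrt (real e2)"]])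
   (auto simp: c2_def bb_def h22 h21_def cross_b_def field_simps split: prod.splits)
 let ?u = "%k. eamp 0 (Suc e1, e2) k * sqrt (real (Suc e1))" and ?v = "%k. eamp 0 (e1, Suc e2) k * sqrt (real (Suc e2))"
 have uu: "((%k. ?u k * ?u k) has_sum g11) UNIV" 
  by (rule has_sum_eq_rule[OF has_sum_cmult_right[OF has_sum_left(1)[of e1 e2 "(Suc e1, e2)"], of "sqrt (real (Suc e1))"]])
   (auto simp: g11_def m_def)
 have uv: "((%k. ?u k * ?v k) has_sum g12) UNIV" 
  by (rule has_sum_eq_rule[OF has_sum_cmult_right[OF has_sum_left(1)[of e1 e2 "(e1, Suc e2)"], of "sqrt (real (Suc e2))"]])
   (auto simp: g12_def m_def)
 have vv: "((%k. ?v k * ?v k) has_sum g22) UNIV" 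
  by (rule has_sum_eq_rule[OF has_sum_cmult_right[OF has_sum_left(2)[of e1 e2 "(e1, Suc e2)"], of "sqrt (real (Suc e2))"]])
   (auto simp: g22_def m_def)
 \<comment> \<open>Bob's mean photon number weighted by Eve's outcome \<open>m\<close>, computed as
   a squared norm of annihilated amplitudes. Creation instead of annihilation adds
   \<open>sig 0 m m\<close>.\<close>
 define oc where "oc = (\<rho>^2 * g11 + 2 * (\<rho>^2 * \<tau>) * g12 + \<rho>^2 * \<tau>^2 * g22) / \<eta>^2"
 have oo: "((%k. (outb m k)\<^sup>2) has_sum oc) UNIV"
 proof (rule has_sum_eq_rule[OF has_sum_cmult_right[OF has_sum_add[OF has_sum_add[OF has_sum_cmult_right[OF uu, of "\<rho>^2"]
   has_sum_cmult_right[OF uv, of "2 * (\<rho>^2 * \<tau>)"]] has_sum_cmult_right[OF vv, of "\<rho>^2 * \<tau>^2"]], of "1 / \<eta>^2"]])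
  fix k
  define u v where "u = ?u k" and "v = ?v k"
  show "1 / \<eta>^2 * (\<rho>^2 * (?u k * ?u k) + 2 * (\<rho>^2 * \<tau>) * (?u k * ?v k) + \<rho>^2 * \<tau>^2 * (?v k * ?v k)) = (outb m k)\<^sup>2"
   unfolding m_def outb_eq u_def[symmetric] v_def[symmetric]
   by (simp add: power_divide) (simp add: power2_eq_square algebra_simps)
 qed (simp add: oc_def)
 have bA: "((%(b, j, l). real b * (eamp 0 m (b, j, l))\<^sup>2) has_sum oc) UNIV"
 proof (rule has_sum_shift)
  show "((%(k, z). case (Suc k, z) of (b, j, l) => real b * (eamp 0 m (b, j, l))\<^sup>2) has_sum oc) UNIV"
   by (rule has_sum_eq_rule[OF oo]) (auto simp: outb_def eamp_def m_def power_mult_distrib split: prod.splits)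
 qed auto
 have bb: "((%k. bb k * bb k) has_sum oc + sig 0 m m) UNIV"
 proof (rule has_sum_shift)
  show "((%(k, z). bb (Suc k, z) * bb (Suc k, z)) has_sum oc + sig 0 m m) UNIV"
   by (rule has_sum_eq_rule[OF has_sum_add[OF bA has_sum_sig[of 0 m m]]])
    (auto simp: bb_def sq' simp del: of_nat_Suc split: prod.splits)
 qed (auto simp: bb_def)
 have e1sq: "eamp 1 m k * eamp 1 m k = \<eta>^2 * (bb k * bb k) + \<rho>^2 * (c1 k * c1 k) + (\<rho>^2 * \<tau>^2) * (c2 k * c2 k)
    + (- 2 * \<eta> * \<rho>) * (bb k * c1 k) + (- 2 * \<eta> * \<rho> * \<tau>) * (bb k * c2 k) + (2 * \<rho>^2 * \<tau>) * (c1 k * c2 k)" for k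
  unfolding e1amp by (simp add: power2_eq_square algebra_simps)
 have "((%k. eamp 1 m k * eamp 1 m k) has_sum
   (\<eta>^2 * (oc + sig 0 m m) + \<rho>^2 * k11 + (\<rho>^2 * \<tau>^2) * k22
    + (- 2 * \<eta> * \<rho>) * ((\<rho> * h11 + \<rho> * \<tau> * h12) / \<eta>) + (- 2 * \<eta> * \<rho> * \<tau>) * ((\<rho> * h21 + \<rho> * \<tau> * h22) / \<eta>)
    + (2 * \<rho>^2 * \<tau>) * k12)) UNIV"
  unfolding e1sq by (intro has_sum_add has_sum_cmult_right bb c11 c22 b1 b2 c12)
 note x = has_sum_unique[OF has_sum_sig this]
 have f1: "sig 1 m m = \<rho>^2 * g11 + 2 * (\<rho>^2 * \<tau>) * g12 + \<rho>^2 * \<tau>^2 * g22 + \<eta>^2 * sig 0 m m + \<rho>^2 * k11 + (\<rho>^2 * \<tau>^2) * k22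
    - 2 * \<rho> * (\<rho> * h11 + \<rho> * \<tau> * h12) - 2 * \<rho> * \<tau> * (\<rho> * h21 + \<rho> * \<tau> * h22) + (2 * \<rho>^2 * \<tau>) * k12"
 proof -
  have "\<eta>^2 * (X / \<eta>^2 + Y) = X + \<eta>^2 * Y" "(- 2 * \<eta> * \<rho>) * (X / \<eta>) = - 2 * \<rho> * X"
   "(- 2 * \<eta> * \<rho> * \<tau>) * (X / \<eta>) = - 2 * \<rho> * \<tau> * X" for X Y
   using eta_pos by (auto simp: field_simps)
  then show ?thesis unfolding x oc_def by simp
 qed
 have e2: "\<eta>^2 = 1 - \<rho>^2 * (1 + \<tau>^2)" using signal_norm by simp
 show ?A unfolding f1 e2 by (simp add: power2_eq_square algebra_simps)
qed

text \<open>Evaluates the right side of \<open>lyapunov_solution\<close> for the direction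
  \<open>(1, \<tau>)\<close> in which a signal photon enters Eve's modes; this is where the rational
  function in \<open>covert_const\<close> comes from.\<close>

lemma covert_const_eq:
 fixes a s c V11 V12 V22 :: real
 defines "a \<equiv> \<tau>\<^sup>2 * NB1" and "s \<equiv> - (\<tau> * \<rho>^2 * NB1)" and "c \<equiv> \<rho>\<^sup>2 * \<rho>^2 * NB1 + \<tau>^2 * NB2"
  and "V11 \<equiv> \<rho>\<^sup>2" and "V12 \<equiv> \<rho>\<^sup>2 * \<tau>" and "V22 \<equiv> \<rho>\<^sup>2 * \<tau>^2"
 defines "d \<equiv> (a + 1/2) * (c + 1/2) - s^2" and "t \<equiv> a + c + 1"
 defines "P \<equiv> (a * c - s^2) * (1 + a + c + (a * c - s^2))"
 shows "4 * covert_const \<eta> NB1 NB2 * (P * (d - 1/4)) =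
   (P - d * (d + 1/4) + t^2 * d) * (V11^2 + 2 * V12^2 + V22^2)
   - 2 * t * d * ((a + 1/2) * (V11^2 + V12^2) + (c + 1/2) * (V22^2 + V12^2) + 2 * s * V12 * (V11 + V22))
   + (d + 1/4) * (((a + 1/2) * V11 + s * V12)\<^sup>2 + 2 * ((a + 1/2) * V12 + s * V22) * (s * V11 + (c + 1/2) * V12)
     + (s * V12 + (c + 1/2) * V22)\<^sup>2)" (is "_ = ?R")
  and "a * c - s^2 > 0" "a > 0" "c > 0" "P * (d - 1/4) > 0"
proof -
 have t2: "\<tau>^2 = \<eta>" and r2: "\<rho>^2 = 1 - \<eta>" using tau_sq rho_sq by (auto simp: power2_eq_square)
 define T1 where "T1 = NB1 * (1 - \<eta> + \<eta>^2) + \<eta> * NB2"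
 define D where "D = \<eta>^2 * NB1 * NB2"
 \<comment> \<open>\<open>T1\<close> and \<open>D\<close> are trace and determinant of the matrix
   with entries \<open>a\<close>, \<open>s\<close>, \<open>c\<close>. The matrix \<open>V\<close>
   has rank one, so expressions quadratic in it factor through its trace \<open>u\<close> and its
   pairing \<open>w\<close> with that matrix.\<close>
 define u w where "u = 1 - \<eta>^2" and "w = (1 - \<eta>) * \<eta>^2 * (\<eta> * NB1 + NB2)"
 define num where "num = NB1 ^ 3 * (2 * \<eta>^2 * NB2 + \<eta>^2 - \<eta> + 1)
   + NB1^2 * (4 * \<eta> ^ 3 * NB2^2 + \<eta> * (4 * \<eta>^2 + 3) * NB2 + 1)
   + NB1 * NB2 * \<eta> * (2 * \<eta> ^ 3 * NB2^2 + \<eta> * (3 * \<eta>^2 + \<eta> + 3) * NB2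
     + \<eta> ^ 3 + 2 * \<eta>^2 + \<eta> + 2) + \<eta>^2 * NB2^2 * (\<eta> * NB2 + 1)"
 have s2: "s^2 = \<eta> * (1 - \<eta>)\<^sup>2 * NB1^2" unfolding s_def by (simp add: power_mult_distrib t2 r2)
 have "s * V12 = - (\<tau>^2 * (\<rho>^2)\<^sup>2 * NB1)" "V12^2 = \<tau>^2 * (\<rho>^2)\<^sup>2"
  by (simp_all add: s_def V12_def power_mult_distrib) (simp_all add: power2_eq_square)
 then have sV: "s * V12 = - (\<eta> * (1 - \<eta>)\<^sup>2 * NB1)" "V12^2 = \<eta> * (1 - \<eta>)\<^sup>2"
  unfolding t2 r2 by simp_all
 have ac: "a * c - s^2 = D" unfolding s2 unfolding a_def c_def t2 r2 D_def by (simp add: power2_eq_square algebra_simps)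
 have tt: "t = 1 + T1" unfolding t_def a_def c_def t2 r2 T1_def by (simp add: power2_eq_square algebra_simps)
 have dd: "d = D + T1 / 2 + 1/4"
 proof -
  have "d = (a * c - s^2) + t / 2 - 1/4" by (simp add: d_def t_def algebra_simps)
  then show ?thesis by (simp add: ac tt field_simps)
 qed
 have PP: "P = D * (1 + T1 + D)"
 proof -
  have "1 + a + c = t" by (simp add: t_def)
  then show ?thesis unfolding P_def ac tt by simp
 qed
 show "a * c - s^2 > 0" unfolding ac D_def using eta_pos NB1_pos NB2_pos by simp
 show "a > 0" unfolding a_def t2 using eta_pos NB1_pos by simp
 show "c > 0" unfolding c_def t2 using eta_pos NB1_pos NB2_pos by (intro add_nonneg_pos) auto
 have D0: "D > 0" unfolding D_def using eta_pos NB1_pos NB2_pos by simp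
 have T10: "T1 > 0" unfolding T1_def using eta_pos eta_less_1 NB1_pos NB2_pos by (intro add_nonneg_pos mult_nonneg_nonneg) auto
 show "P * (d - 1/4) > 0" unfolding PP dd using D0 T10 by (intro mult_pos_pos) auto
 have cc: "covert_const \<eta> NB1 NB2 = num * ((1 - \<eta>)\<^sup>2 / (T1 + 2 * D)) * (1 / (4 * D * (D + T1 + 1)))"
  unfolding covert_const_def num_def T1_def D_def by (simp add: algebra_simps)
 have L: "4 * covert_const \<eta> NB1 NB2 * (P * (d - 1/4)) = num * (1 - \<eta>)\<^sup>2 / 2"
 proof -
  define z y where "z = T1 + 2 * D" and "y = D + T1 + 1"
  have 0: "z ~= 0" "y ~= 0" "D ~= 0" using D0 T10 by (auto simp: z_def y_def)
  have P': "P * (d - 1/4) = D * y * (z / 2)" unfolding PP dd z_def y_def by (simp add: algebra_simps)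
  show ?thesis unfolding cc P' z_def[symmetric] y_def[symmetric] using 0 by (simp add: field_simps)
 qed
 have R1: "V11^2 + 2 * V12^2 + V22^2 = u^2"
  unfolding sV unfolding V11_def V22_def t2 r2 u_def by (simp add: power2_eq_square algebra_simps)
 have e1: "(a + 1/2) * (V11^2 + V12^2) + (c + 1/2) * (V22^2 + V12^2) + 2 * s * V12 * (V11 + V22) 
  = (a + 1/2) * (V11^2 + V12^2) + (c + 1/2) * (V22^2 + V12^2) + 2 * (s * V12) * (V11 + V22)" by simp
 have R2: "(a + 1/2) * (V11^2 + V12^2) + (c + 1/2) * (V22^2 + V12^2) + 2 * s * V12 * (V11 + V22) = u * (w + u / 2)"
  unfolding e1 unfolding sV unfolding V11_def V22_def a_def c_def t2 r2 u_def w_def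
  by (simp add: power2_eq_square field_simps)
 define p q where "p = \<eta>^2 * NB1 + 1/2" and "q = \<eta> * NB2 - \<eta> * (1 - \<eta>) * NB1 + 1/2"
 have st: "s = - (\<tau> * ((1 - \<eta>) * NB1))" "V12 = (1 - \<eta>) * \<tau>" unfolding s_def V12_def r2 by simp_all
 have p: "(a + 1/2) + s * \<tau> = p" and q: "s + (c + 1/2) * \<tau> = \<tau> * q"
 proof -
  have "s * \<tau> = - (\<tau>^2 * ((1 - \<eta>) * NB1))" unfolding st by (simp add: power2_eq_square)
  then show "(a + 1/2) + s * \<tau> = p" unfolding a_def t2 p_def by (simp add: power2_eq_square algebra_simps)
  have "s + (c + 1/2) * \<tau> = \<tau> * (c + 1/2 - (1 - \<eta>) * NB1)" unfolding st by (simp add: algebra_simps)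
  also have "c + 1/2 - (1 - \<eta>) * NB1 = q" unfolding c_def t2 r2 q_def by (simp add: power2_eq_square algebra_simps)
  finally show "s + (c + 1/2) * \<tau> = \<tau> * q" .
 qed
 have A: "(a + 1/2) * V11 + s * V12 = (1 - \<eta>) * ((a + 1/2) + s * \<tau>)" "(a + 1/2) * V12 + s * V22 = (1 - \<eta>) * \<tau> * ((a + 1/2) + s * \<tau>)"
  "s * V11 + (c + 1/2) * V12 = (1 - \<eta>) * (s + (c + 1/2) * \<tau>)" "s * V12 + (c + 1/2) * V22 = (1 - \<eta>) * \<tau> * (s + (c + 1/2) * \<tau>)"
  unfolding V11_def V12_def V22_def r2 by (simp_all add: power2_eq_square field_simps)
 have R3: "((a + 1/2) * V11 + s * V12)\<^sup>2 + 2 * ((a + 1/2) * V12 + s * V22) * (s * V11 + (c + 1/2) * V12)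
     + (s * V12 + (c + 1/2) * V22)\<^sup>2 = (w + u / 2)\<^sup>2"
 proof -
  have "((1 - \<eta>) * p)\<^sup>2 + 2 * ((1 - \<eta>) * \<tau> * p) * ((1 - \<eta>) * (\<tau> * q)) + ((1 - \<eta>) * \<tau> * (\<tau> * q))\<^sup>2 = ((1 - \<eta>) * (p + \<tau>^2 * q))\<^sup>2"
   by (simp add: power2_eq_square algebra_simps)
  also have "(1 - \<eta>) * (p + \<tau>^2 * q) = w + u / 2"
   unfolding t2 p_def q_def w_def u_def by (simp add: power2_eq_square field_simps)
  finally show ?thesis unfolding A p q .
 qed
 have "2 * (D * (1 + T1 + D) - (D + T1 / 2 + 1/4) * (D + T1 / 2 + 1/4 + 1/4) + (1 + T1)\<^sup>2 * (D + T1 / 2 + 1/4)) * u^2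
  - 4 * (1 + T1) * (D + T1 / 2 + 1/4) * (u * (w + u / 2))
  + 2 * (D + T1 / 2 + 1/4 + 1/4) * (w + u / 2)\<^sup>2 = num * (1 - \<eta>)\<^sup>2"
  unfolding num_def T1_def D_def u_def w_def by (simp add: power2_eq_square power3_eq_cube field_simps)
 then show "4 * covert_const \<eta> NB1 NB2 * (P * (d - 1/4)) = ?R"
  unfolding L R1 R2 R3 unfolding PP tt dd by (simp add: algebra_simps)
qed

text \<open>At each outcome \<open>m\<close> the change of the diagonal is the inner product of the
  vacuum amplitude with \<open>sld_amp\<close>. The Cauchy-Schwarz inequality bounds it, and the
  second factors sum to the variance: the classical information of photon counting is at most the
  quantum one.\<close>

lemma chi_square_bound:
 "\<exists>y. (y has_sum 4 * covert_const \<eta> NB1 NB2) UNIV & (\<forall>m. y m >= 0 & (sig 1 m m - sig 0 m m)\<^sup>2 <= sig 0 m m * y m)"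
proof -
 define a s c where "a = \<tau>^2 * NB1" and "s = - (\<tau> * \<rho>^2 * NB1)" and "c = \<rho>^2 * \<rho>^2 * NB1 + \<tau>^2 * NB2"
 note abc = a_def s_def c_def
 note cc = covert_const_eq[folded abc]
 obtain G11 G12 G22 where G: "a^2 * G11 + 2 * a * s * G12 + s^2 * G22 + a * G11 + s * G12 = \<rho>^2"
  "a * s * G11 + (a * c + s^2) * G12 + s * c * G22 + (a * G12 + c * G12 + s * G11 + s * G22) / 2 = \<rho>^2 * \<tau>"
  "s^2 * G11 + 2 * s * c * G12 + c^2 * G22 + c * G22 + s * G12 = \<rho>^2 * \<tau>^2"
  and GV: "(\<rho>^2 * G11 + 2 * (\<rho>^2 * \<tau>) * G12 + \<rho>^2 * \<tau>^2 * G22) = 4 * covert_const \<eta> NB1 NB2"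
  using lyapunov_solution[OF cc(2-4), of "\<rho>^2" "\<rho>^2 * \<tau>" "\<rho>^2 * \<tau>^2", folded cc(1)]
  unfolding mult_cancel_right using cc(5) by (metis less_irrefl)
 define W11 where "W11 = \<tau>^2 * G11 - 2 * \<tau> * \<rho>^2 * G12 + \<rho>^2 * \<rho>^2 * G22"
 define Y where "Y = sld_amp (- (W11 * NB1 + \<tau>^2 * G22 * NB2)) G11 G12 G22"
 have tr: "\<rho>^2 = 1 - \<tau>^2" using tr1 by (simp add: power2_eq_square)
 have "((%(x, k). (Y x k)\<^sup>2) has_sum 4 * covert_const \<eta> NB1 NB2) UNIV"
  unfolding Y_def W11_def GV[symmetric]
  using has_sum_sld_amp[of G11 G12 G22] unfolding SLD_variance[OF tr G[unfolded abc]] .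
 note total = this
 have Yx: "(%k. (Y x k)\<^sup>2) summable_on UNIV" for x
  using summable_on_SigmaD1[of "%x k. (Y x k)\<^sup>2" UNIV "%_. UNIV" x] has_sum_imp_summable[OF total] by simp
 define y where "y = (%x. \<Sum>\<^sub>\<infinity>k. (Y x k)\<^sup>2)"
 have "(y has_sum 4 * covert_const \<eta> NB1 NB2) UNIV"
  by (rule has_sum_SigmaD[where B = "%_. UNIV" and f = "%(x, k). (Y x k)\<^sup>2"])
   (use total Yx in \<open>auto simp: y_def\<close>)
 moreover have "y m >= 0" for m by (simp add: y_def infsum_nonneg)
 moreover have "(sig 1 m m - sig 0 m m)\<^sup>2 <= sig 0 m m * y m" for m
 proof -
  obtain e1 e2 where m: "m = (e1, e2)" by force
  have "((%k. eamp 0 (e1, e2) k * Y (e1, e2) k) has_sum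
   ((- (W11 * NB1 + \<tau>^2 * G22 * NB2) + G11 * real e1 + G22 * real e2) * sig 0 (e1, e2) (e1, e2)
    + (G12 * sqrt (real e1)) * left2 (e1 - 1, e2) (e1, e2) + (G12 * sqrt (real e2)) * left1 (e1, e2 - 1) (e1, e2))) UNIV"
   by (rule has_sum_eq_rule[OF has_sum_add[OF has_sum_add[OF has_sum_cmult_right[OF has_sum_sig[of 0 "(e1, e2)" "(e1, e2)"],
      of "- (W11 * NB1 + \<tau>^2 * G22 * NB2) + G11 * real e1 + G22 * real e2"]
     has_sum_cmult_right[OF has_sum_left(2)[of "e1 - 1" e2 "(e1, e2)"], of "G12 * sqrt (real e1)"]]
     has_sum_cmult_right[OF has_sum_left(1)[of e1 "e2 - 1" "(e1, e2)"], of "G12 * sqrt (real e2)"]]])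
    (auto simp: Y_def sld_amp_def algebra_simps simp del: of_nat_Suc)
  also have "(- (W11 * NB1 + \<tau>^2 * G22 * NB2) + G11 * real e1 + G22 * real e2) * sig 0 (e1, e2) (e1, e2)
    + (G12 * sqrt (real e1)) * left2 (e1 - 1, e2) (e1, e2) + (G12 * sqrt (real e2)) * left1 (e1, e2 - 1) (e1, e2)
   = sig 1 m m - sig 0 m m"
  proof -
   note d = sig1_diag[where ?e1.0 = e1 and ?e2.0 = e2, folded abc]
   have W: "G11 * a + 2 * G12 * s + G22 * c = W11 * NB1 + \<tau>^2 * G22 * NB2"
    by (simp add: W11_def a_def s_def c_def algebra_simps)
   show ?thesis unfolding m d(1) derivative_as_SLD[OF d(2-9) G] W by (simp add: algebra_simps)
  qed
  finally have hs: "((%k. eamp 0 m k * Y m k) has_sum (sig 1 m m - sig 0 m m)) UNIV" by (simp add: m)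
  have a: "((%k. (eamp 0 m k)\<^sup>2) has_sum sig 0 m m) UNIV" and b: "((%k. (Y m k)\<^sup>2) has_sum y m) UNIV"
   using has_sum_sig[of 0 m m] Yx[of m] by (auto simp: y_def power2_eq_square)
  have "\<bar>sig 1 m m - sig 0 m m\<bar> <= (\<Sum>\<^sub>\<infinity>k. \<bar>eamp 0 m k\<bar> * \<bar>Y m k\<bar>)"
   using norm_infsum_bound[of "%k. eamp 0 m k * Y m k" UNIV] infsum_Cauchy_Schwarz(1)[OF a b]
   by (simp add: infsumI[OF hs] abs_mult)
  also note infsum_Cauchy_Schwarz(2)[OF a b]
  finally have "\<bar>sig 1 m m - sig 0 m m\<bar>\<^sup>2 <= (sqrt (sig 0 m m) * sqrt (y m))\<^sup>2" by (rule power_mono) simp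
  then show ?thesis using sig_nonneg[of 0 m] by (simp add: power_mult_distrib y_def infsum_nonneg)
 qed
 ultimately show ?thesis by blast
qed

end

section \<open>Affinity of a thermal mixture with its vacuum component\<close>

lemma th_0_1_2: "th N 0 = 1 / (1 + N)" "th N 1 = N / (1 + N)\<^sup>2" "th N 2 = N^2 / (1 + N) ^ 3"
 by (simp_all add: th_def power2_eq_square power3_eq_cube eval_nat_numeral add.commute)

lemma has_sum_diff:
 fixes f g :: "'a => real"
 assumes "(f has_sum s) A" "(g has_sum t) A"
 shows "((%x. f x - g x) has_sum (s - t)) A"
 using has_sum_add[OF assms(1) has_sum_cmult_right[OF assms(2), of "- 1"]] by simp

lemma has_sum_diff_finite:
 fixes f :: "'a => real"
 assumes "(f has_sum s) UNIV" "finite A"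
 shows "((%x. if x \<in> A then 0 else f x) has_sum (s - sum f A)) UNIV"
proof -
 have "((%x. if x \<in> A then f x else 0) has_sum sum f A) UNIV"
  by (rule has_sum_finite_neutralI) (use assms(2) in \<open>auto intro!: sum.cong\<close>)
 from has_sum_add[OF assms(1) has_sum_cmult_right[OF this, of "-1"]]
 show ?thesis by (rule has_sum_eq_rule) auto
qed

lemma sqrt_add_diff_sq:
 fixes h r f :: real
 assumes "h >= 0" "r >= 0" "f > 0"
 shows "(sqrt (h + r) - sqrt f)\<^sup>2 <= 2 * r + 2 * (h - f)\<^sup>2 / f"
proof -
 have sq2: "(u + v)\<^sup>2 <= 2 * u^2 + 2 * v^2" for u v :: real
  using zero_le_power2[of "u - v"] by (simp add: power2_eq_square algebra_simps)
 have a: "\<bar>sqrt (h + r) - sqrt h\<bar> <= sqrt r" using sqrt_add_le_add_sqrt[OF assms(1,2)] assms by simp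
 have "\<bar>sqrt h - sqrt f\<bar> * sqrt f <= \<bar>sqrt h - sqrt f\<bar> * (sqrt h + sqrt f)"
  using assms by (intro mult_left_mono) auto
 also have "... = \<bar>(sqrt h - sqrt f) * (sqrt h + sqrt f)\<bar>" using assms by (simp add: abs_mult)
 also have "(sqrt h - sqrt f) * (sqrt h + sqrt f) = h - f" using assms by (simp add: algebra_simps)
 finally have "(\<bar>sqrt h - sqrt f\<bar> * sqrt f)\<^sup>2 <= \<bar>h - f\<bar>\<^sup>2" using assms by (intro power_mono) auto
 then have b: "(sqrt h - sqrt f)\<^sup>2 <= (h - f)\<^sup>2 / f" using assms by (simp add: power_mult_distrib field_simps)
 have "(sqrt (h + r) - sqrt f)\<^sup>2 = ((sqrt (h + r) - sqrt h) + (sqrt h - sqrt f))\<^sup>2" by simp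
 also have "... <= 2 * (sqrt (h + r) - sqrt h)\<^sup>2 + 2 * (sqrt h - sqrt f)\<^sup>2" by (rule sq2)
 also have "(sqrt (h + r) - sqrt h)\<^sup>2 <= r" using power_mono[OF a, of 2] assms by simp
 finally show ?thesis using b by simp
qed

text \<open>\<open>1 - affinity\<close> is half the squared distance of the roots. Pointwise
  \<open>p N - f 0\<close> is about \<open>N * (f 1 - f 0)\<close>, so this distance squared is at
  most about \<open>N^2 * X / 4\<close>, whence the threshold \<open>X / 8\<close>. The limit is
  exchanged with the sum by a uniform tail bound off a finite set.\<close>

lemma thermal_mixture_affinity:
 fixes f :: "nat => 'm => real" and y :: "'m => real" and p :: "real => 'm => real"
 assumes f: "!!k m. f k m >= 0" "!!k. (f k has_sum 1) UNIV" "!!m. f 0 m > 0"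
  and y: "(y has_sum X) UNIV" "!!m. y m >= 0" "!!m. (f 1 m - f 0 m)\<^sup>2 <= f 0 m * y m"
  and p: "!!N m. N > 0 ==> ((%k. th N k * f k m) has_sum p N m) UNIV" "!!N. N > 0 ==> (p N has_sum 1) UNIV"
  and c: "c > X / 8"
 shows "\<exists>N0>0. \<forall>N. 0 < N & N < N0 --> 1 - (\<Sum>\<^sub>\<infinity>m. sqrt (p N m * f 0 m)) <= c * N^2"
proof -
 \<comment> \<open>The contributions of at least two photons; \<open>r3\<close> below keeps those of
   at least three. Two photons already have weight of order \<open>N^2\<close> and must be treated
   as part of the tail.\<close>
 define r where "r N m = p N m - th N 0 * f 0 m - th N 1 * f 1 m" for N m
 define r3 where "r3 N m = r N m - th N 2 * f 2 m" for N m
 have r3: "r3 N m >= 0" if N: "N > 0" for N m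
 proof -
  have "((%k. if k \<in> {0, 1, 2} then 0 else th N k * f k m) has_sum r3 N m) UNIV"
   by (rule has_sum_eq_rule[OF has_sum_diff_finite[OF p(1)[OF N], of "{0, 1, 2}"]]) (auto simp: r3_def r_def)
  then show ?thesis by (rule has_sum_nonneg) (use N f(1) in \<open>auto simp: th_nonneg\<close>)
 qed
 have r0: "r N m >= 0" if N: "N > 0" for N m
  using r3[OF N, of m] N f(1)[of 2 m] by (auto simp: r3_def th_nonneg intro: order_trans[rotated])
 have rs: "(r N has_sum (1 - th N 0 - th N 1)) UNIV" if N: "N > 0" for N
  unfolding r_def using has_sum_diff[OF has_sum_diff[OF p(2)[OF N] has_sum_cmult_right[OF f(2)[of 0], of "th N 0"]]
   has_sum_cmult_right[OF f(2)[of 1], of "th N 1"]] by simp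
 have r3s: "(r3 N has_sum (1 - th N 0 - th N 1 - th N 2)) UNIV" if N: "N > 0" for N
  unfolding r3_def using has_sum_diff[OF rs[OF N] has_sum_cmult_right[OF f(2)[of 2], of "th N 2"]] by simp
 have t2: "1 - th N 0 - th N 1 <= N^2" and t3: "1 - th N 0 - th N 1 - th N 2 <= N ^ 3" and th2: "th N 2 <= N^2" if N: "N > 0" for N
 proof -
  have z: "1 - 1 / z - (z - 1) / z^2 = (z - 1)\<^sup>2 / z^2"
   "1 - 1 / z - (z - 1) / z^2 - (z - 1)\<^sup>2 / z ^ 3 = (z - 1) ^ 3 / z ^ 3" if "z > 0" for z :: real
   using that by (simp_all add: field_simps power2_eq_square power3_eq_cube)
  have "1 - th N 0 - th N 1 = N^2 / (1 + N)\<^sup>2" using z(1)[of "1 + N"] N unfolding th_0_1_2 by simp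
  also have "... <= N^2 / 1" using N by (intro divide_left_mono) auto
  finally show "1 - th N 0 - th N 1 <= N^2" by simp
  have "1 - th N 0 - th N 1 - th N 2 = N ^ 3 / (1 + N) ^ 3" using z(2)[of "1 + N"] N unfolding th_0_1_2 by simp
  also have "... <= N ^ 3 / 1" using N by (intro divide_left_mono) auto
  finally show "1 - th N 0 - th N 1 - th N 2 <= N ^ 3" by simp
  have "th N 2 <= N^2 / 1" unfolding th_0_1_2 using N by (intro divide_left_mono) auto
  then show "th N 2 <= N^2" by simp
 qed
 have r2: "r N m <= N^2" if N: "N > 0" for N m
  using finite_sum_le_has_sum[OF rs[OF N], of "{m}"] r0[OF N] t2[OF N] by simp
 define h where "h N m = th N 0 * f 0 m + th N 1 * f 1 m" for N m
 have ph: "p N m = h N m + r N m" for N m by (simp add: h_def r_def)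
 have h0: "h N m >= 0" if "N > 0" for N m using that f(1) by (simp add: h_def th_nonneg)
 have hf: "h N m - f 0 m = N / (1 + N)\<^sup>2 * (f 1 m - f 0 m) - (N / (1 + N))\<^sup>2 * f 0 m" if N: "N > 0" for N m
 proof -
  have z: "1 / z * a + (z - 1) / z^2 * b - a = (z - 1) / z^2 * (b - a) - ((z - 1) / z)\<^sup>2 * a" if "z > 0" for z a b :: real
   using that by (simp add: field_simps power2_eq_square)
  show ?thesis using z[of "1 + N" "f 0 m" "f 1 m"] N unfolding h_def th_0_1_2 by simp
 qed
 define dd where "dd N m = (sqrt (p N m) - sqrt (f 0 m))\<^sup>2" for N m
 have sq2: "(u - v)\<^sup>2 <= 2 * u^2 + 2 * v^2" for u v :: real
  using zero_le_power2[of "u + v"] by (simp add: power2_eq_square algebra_simps)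
 \<comment> \<open>Off a finite set only \<open>f 2\<close> and \<open>y\<close> carry the order
   \<open>N^2\<close>, and both are summable.\<close>
 have tail: "dd N m <= 2 * (N^2 * f 2 m) + 2 * r3 N m + 4 * N^2 * y m + 4 * N ^ 4 * f 0 m" if N: "N > 0" for N m
 proof -
  have "(h N m - f 0 m)\<^sup>2 <= 2 * (N / (1 + N)\<^sup>2 * (f 1 m - f 0 m))\<^sup>2 + 2 * ((N / (1 + N))\<^sup>2 * f 0 m)\<^sup>2"
   unfolding hf[OF N] by (rule sq2)
  also have "(N / (1 + N)\<^sup>2 * (f 1 m - f 0 m))\<^sup>2 <= N^2 * (f 0 m * y m)"
  proof -
   have "(N / (1 + N)\<^sup>2)\<^sup>2 <= (N / 1)\<^sup>2" using N by (intro power_mono divide_left_mono) auto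
   then show ?thesis unfolding power_mult_distrib using y(3) by (intro mult_mono) auto
  qed
  also have "((N / (1 + N))\<^sup>2 * f 0 m)\<^sup>2 <= N ^ 4 * (f 0 m)\<^sup>2"
  proof -
   have "(N / (1 + N)) ^ 4 <= (N / 1) ^ 4" using N by (intro power_mono divide_left_mono) auto
   moreover have "((N / (1 + N))\<^sup>2)\<^sup>2 = (N / (1 + N)) ^ 4" by (simp only: power_mult[symmetric]) simp
   ultimately show ?thesis unfolding power_mult_distrib[of _ "f 0 m"] by (intro mult_right_mono) auto
  qed
  finally have "2 * (h N m - f 0 m)\<^sup>2 / f 0 m <= 2 * (2 * (N^2 * (f 0 m * y m)) + 2 * (N ^ 4 * (f 0 m)\<^sup>2)) / f 0 m"
   using f(3)[of m] by (intro divide_right_mono mult_left_mono) auto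
  also have "... = 4 * N^2 * y m + 4 * N ^ 4 * f 0 m" using f(3)[of m] by (simp add: field_simps power2_eq_square)
  finally have "dd N m <= 2 * r N m + (4 * N^2 * y m + 4 * N ^ 4 * f 0 m)"
   using sqrt_add_diff_sq[OF h0[OF N, of m] r0[OF N, of m] f(3)[of m]] unfolding dd_def ph by linarith
  moreover have "r N m <= N^2 * f 2 m + r3 N m" using th2[OF N] f(1)[of 2 m] by (auto simp: r3_def mult_right_mono)
  ultimately show ?thesis by linarith
 qed
 have lim: "((%N. dd N m / N^2) \<longlongrightarrow> (f 1 m - f 0 m)\<^sup>2 / (4 * f 0 m)) (at_right 0)" for m
 proof -
  have pos: "eventually (%N. N > 0) (at_right (0::real))" by (simp add: eventually_at_right_less)
  have hl: "((%N. (h N m - f 0 m) / N) \<longlongrightarrow> f 1 m - f 0 m) (at_right 0)"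
  proof (rule Lim_transform_eventually)
   show "eventually (%N. 1 / (1 + N)\<^sup>2 * (f 1 m - f 0 m) - N / (1 + N)\<^sup>2 * f 0 m = (h N m - f 0 m) / N) (at_right 0)"
    using pos
   proof eventually_elim
    case (elim N)
    have "1 / z^2 * b - N / z^2 * a = (N / z^2 * b - (N / z)\<^sup>2 * a) / N" for z a b
     using elim by (simp add: diff_divide_distrib power2_eq_square)
    then show ?case using elim by (simp only: hf)
   qed
   show "((%N. 1 / (1 + N)\<^sup>2 * (f 1 m - f 0 m) - N / (1 + N)\<^sup>2 * f 0 m) \<longlongrightarrow> f 1 m - f 0 m) (at_right 0)"
    by (rule tendsto_eq_intros refl | simp)+
  qed
  have rl: "((%N. r N m / N) \<longlongrightarrow> 0) (at_right 0)"
  proof (rule tendsto_sandwich)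
   show "eventually (%N. 0 <= r N m / N) (at_right 0)" using pos by eventually_elim (simp add: r0)
   show "eventually (%N. r N m / N <= N) (at_right 0)" using pos
    by eventually_elim (use r2[of _ m] in \<open>simp add: field_simps power2_eq_square\<close>)
  qed (auto intro: tendsto_ident_at)
  have pl: "((%N. (p N m - f 0 m) / N) \<longlongrightarrow> f 1 m - f 0 m) (at_right 0)"
   using tendsto_add[OF hl rl] by (simp add: ph add_divide_distrib diff_divide_distrib algebra_simps)
  have id: "((%N. N) \<longlongrightarrow> 0) (at_right (0::real))" by (rule tendsto_ident_at)
  have "((%N. (p N m - f 0 m) / N * N + f 0 m) \<longlongrightarrow> (f 1 m - f 0 m) * 0 + f 0 m) (at_right 0)"
   by (intro tendsto_intros pl id)
  then have "((%N. (p N m - f 0 m) / N * N + f 0 m) \<longlongrightarrow> f 0 m) (at_right 0)" by simp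
  then have p0: "((%N. p N m) \<longlongrightarrow> f 0 m) (at_right 0)"
   by (rule Lim_transform_eventually) (rule eventually_mono[OF pos], simp)
  have "((%N. ((p N m - f 0 m) / N)\<^sup>2 / (sqrt (p N m) + sqrt (f 0 m))\<^sup>2) \<longlongrightarrow>
   (f 1 m - f 0 m)\<^sup>2 / (sqrt (f 0 m) + sqrt (f 0 m))\<^sup>2) (at_right 0)"
   using f(3)[of m] by (intro tendsto_intros pl p0) auto
  moreover have "(sqrt (f 0 m) + sqrt (f 0 m))\<^sup>2 = 4 * f 0 m" using f(3)[of m] by (simp add: power2_eq_square algebra_simps)
  ultimately have l: "((%N. ((p N m - f 0 m) / N)\<^sup>2 / (sqrt (p N m) + sqrt (f 0 m))\<^sup>2) \<longlongrightarrow>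
   (f 1 m - f 0 m)\<^sup>2 / (4 * f 0 m)) (at_right 0)" by simp
  have e: "((p N m - f 0 m) / N)\<^sup>2 / (sqrt (p N m) + sqrt (f 0 m))\<^sup>2 = dd N m / N^2" if N: "N > 0" for N
  proof -
   have pn: "p N m >= 0" using h0[OF N, of m] r0[OF N, of m] by (simp add: ph)
   then have "p N m - f 0 m = (sqrt (p N m) - sqrt (f 0 m)) * (sqrt (p N m) + sqrt (f 0 m))"
    using f(3)[of m] by (simp add: algebra_simps)
   moreover have "sqrt (p N m) + sqrt (f 0 m) > 0" using pn f(3)[of m] by (intro add_nonneg_pos) auto
   ultimately show ?thesis using N by (simp add: dd_def power_mult_distrib power_divide)
  qed
  show ?thesis by (rule Lim_transform_eventually[OF l eventually_mono[OF pos e]])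
 qed
 define \<epsilon> where "\<epsilon> = c - X / 8"
 have \<epsilon>: "\<epsilon> > 0" using c by (simp add: \<epsilon>_def)
 \<comment> \<open>A finite set outside which a summable function contributes at most
   \<open>\<epsilon> / 8\<close>; it is used for \<open>f 2\<close> and for
   \<open>y\<close>.\<close>
 have close: "\<exists>S. finite S & (\<forall>F. finite F --> F \<inter> S = {} --> sum g F <= \<epsilon> / 8)"
  if g: "(g has_sum s) UNIV" "!!m. g m >= 0" for g :: "'m => real" and s
 proof -
  have "eventually (%F. sum g F > s - \<epsilon> / 8) (finite_subsets_at_top UNIV)"
   using g(1) \<epsilon> unfolding has_sum_def by (intro order_tendstoD(1)) auto
  then obtain S where S: "finite S" "sum g S > s - \<epsilon> / 8" unfolding eventually_finite_subsets_at_top by auto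
  have "sum g F <= \<epsilon> / 8" if F: "finite F" "F \<inter> S = {}" for F
  proof -
   have "sum g F + sum g S = sum g (F \<union> S)" using F S by (simp add: sum.union_disjoint)
   also have "... <= s" using finite_sum_le_has_sum[OF g(1), of "F \<union> S"] g(2) F S by auto
   finally show ?thesis using S by simp
  qed
  then show ?thesis using S by auto
 qed
 obtain S1 where S1: "finite S1" "!!F. finite F ==> F \<inter> S1 = {} ==> sum (f 2) F <= \<epsilon> / 8" using close[OF f(2)[of 2] f(1)] by blast
 obtain S2 where S2: "finite S2" "!!F. finite F ==> F \<inter> S2 = {} ==> sum y F <= \<epsilon> / 8" using close[OF y(1,2)] by blast
 define S where "S = S1 \<union> S2"
 have S: "finite S" using S1 S2 by (simp add: S_def)
 have sumlim: "((%N. \<Sum>m\<in>S. dd N m / N^2) \<longlongrightarrow> (\<Sum>m\<in>S. (f 1 m - f 0 m)\<^sup>2 / (4 * f 0 m))) (at_right 0)"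
  by (intro tendsto_sum lim)
 have "(\<Sum>m\<in>S. (f 1 m - f 0 m)\<^sup>2 / (4 * f 0 m)) <= (\<Sum>m\<in>S. y m / 4)"
  using y(3) f(3) by (intro sum_mono) (simp add: field_simps)
 also have "... = sum y S / 4" by (simp add: sum_divide_distrib)
 also have "... <= X / 4" using finite_sum_le_has_sum[OF y(1), of S] y(2) S by simp
 finally have "eventually (%N. (\<Sum>m\<in>S. dd N m / N^2) < X / 4 + \<epsilon>) (at_right 0)"
  using \<epsilon> by (intro order_tendstoD(2)[OF sumlim]) auto
 moreover have "eventually (%N. 2 * N + 4 * N^2 < \<epsilon> / 4) (at_right (0::real))"
 proof (rule order_tendstoD(2))
  show "((%N. 2 * N + 4 * N^2) \<longlongrightarrow> 0) (at_right (0::real))" by (rule tendsto_eq_intros refl | simp)+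
 qed (use \<epsilon> in simp)
 ultimately have "eventually (%N. N > 0 --> 1 - (\<Sum>\<^sub>\<infinity>m. sqrt (p N m * f 0 m)) <= c * N^2) (at_right (0::real))"
 proof eventually_elim
  case (elim N)
  show ?case
  proof
   assume N: "N > 0"
   have pn: "p N m >= 0" for m using h0[OF N, of m] r0[OF N, of m] by (simp add: ph)
   have sm: "(%m. sqrt (p N m * f 0 m)) summable_on UNIV"
    using infsum_Cauchy_Schwarz(1)[of "%m. sqrt (p N m)" UNIV 1 "%m. sqrt (f 0 m)" 1] p(2)[OF N] f(2)[of 0] pn f(1)
    by (simp add: real_sqrt_mult)
   define \<beta> where "\<beta> = (\<Sum>\<^sub>\<infinity>m. sqrt (p N m * f 0 m))"
   have B: "((%m. sqrt (p N m * f 0 m)) has_sum \<beta>) UNIV" unfolding \<beta>_def using sm by simp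
   have "((%m. p N m + f 0 m + (- 2) * sqrt (p N m * f 0 m)) has_sum (1 + 1 + (- 2) * \<beta>)) UNIV"
    by (intro has_sum_add p(2) N f(2) has_sum_cmult_right B)
   then have D: "(dd N has_sum (2 - 2 * \<beta>)) UNIV"
    by (rule has_sum_eq_rule) (use pn f(1) in \<open>auto simp: dd_def power2_eq_square algebra_simps real_sqrt_mult\<close>)
   have "2 - 2 * \<beta> <= (X / 4 + 2 * \<epsilon>) * N^2"
   proof (rule has_sum_le_finite_sums[OF D])
    fix F :: "'m set" assume F: "finite F" "F \<subseteq> UNIV"
    have "sum (dd N) F <= sum (dd N) (S \<union> (F - S))" using S F by (intro sum_mono2) (auto simp: dd_def)
    also have "... = sum (dd N) S + sum (dd N) (F - S)" using S F by (intro sum.union_disjoint) auto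
    also have "sum (dd N) S <= (X / 4 + \<epsilon>) * N^2"
    proof -
     have "sum (dd N) S = (\<Sum>m\<in>S. dd N m / N^2) * N^2" using N by (simp add: sum_distrib_right)
     also have "... <= (X / 4 + \<epsilon>) * N^2" using elim(1) by (intro mult_right_mono) auto
     finally show ?thesis .
    qed
    also have "sum (dd N) (F - S) <= (\<Sum>m\<in>F - S. 2 * (N^2 * f 2 m) + 2 * r3 N m + 4 * N^2 * y m + 4 * N ^ 4 * f 0 m)"
     by (intro sum_mono tail N)
    also have "... = 2 * (N^2 * sum (f 2) (F - S)) + 2 * sum (r3 N) (F - S) + 4 * N^2 * sum y (F - S) + 4 * N ^ 4 * sum (f 0) (F - S)"
     by (simp add: sum.distrib sum_distrib_left)
    also have "... <= 2 * (N^2 * (\<epsilon> / 8)) + 2 * N ^ 3 + 4 * N^2 * (\<epsilon> / 8) + 4 * N ^ 4 * 1"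
    proof (intro add_mono mult_left_mono)
     show "sum (f 2) (F - S) <= \<epsilon> / 8" using F by (intro S1(2)) (auto simp: S_def)
     show "sum y (F - S) <= \<epsilon> / 8" using F by (intro S2(2)) (auto simp: S_def)
     show "sum (r3 N) (F - S) <= N ^ 3"
      using finite_sum_le_has_sum[OF r3s[OF N], of "F - S"] r3[OF N] t3[OF N] F by auto
     show "sum (f 0) (F - S) <= 1" using finite_sum_le_has_sum[OF f(2)[of 0], of "F - S"] f(1) F by auto
    qed (use N in auto)
    also have "... = N^2 * (3 * \<epsilon> / 4 + (2 * N + 4 * N^2))"
     by (simp add: power2_eq_square power3_eq_cube power4_eq_xxxx algebra_simps)
    also have "... <= N^2 * \<epsilon>" using elim(2) by (intro mult_left_mono) auto
    finally show "sum (dd N) F <= (X / 4 + 2 * \<epsilon>) * N^2" by (simp add: algebra_simps)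
   qed
   then show "1 - (\<Sum>\<^sub>\<infinity>m. sqrt (p N m * f 0 m)) <= c * N^2"
    unfolding \<beta>_def[symmetric] \<epsilon>_def by (simp add: algebra_simps)
  qed
 qed
 then show ?thesis unfolding eventually_at_right_field by auto
qed

section \<open>Affinity of Eve's single-use statistics\<close>

context roundtrip
begin

lemma sig_0_pos: "sig 0 m m > 0"
proof -
 obtain e1 e2 where m: "m = (e1, e2)" by force
 have "amp 0 e1 e2 0 e1 e2 > 0" using bs_column_0_pos[of 0 e1] bs_column_0_pos[of 0 e2] by (simp add: amp_def)
 then have "eamp 0 m (0, e1, e2) > 0" unfolding m eamp_def wt_def using NB1_pos NB2_pos by (simp add: th_pos)
 then have "0 < (\<Sum>k\<in>{(0, e1, e2)}. eamp 0 m k * eamp 0 m k)" by simp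
 also have "... <= sig 0 m m" by (rule finite_sum_le_has_sum[OF has_sum_sig]) auto
 finally show ?thesis .
qed

lemma has_sum_eve_mtx_sig:
 assumes NS: "NS >= 0"
 shows "((%s. th NS s * sig s m m) has_sum eve_mtx NS m m) UNIV"
proof -
 obtain e1 e2 where m: "m = (e1, e2)" by force
 have "((%(s, (b, j, l)). th NS s * (eamp s m (b, j, l) * eamp s m (b, j, l))) has_sum eve_mtx NS m m) UNIV"
 proof (rule has_sum_bij[OF has_sum_eve_mtx[OF NS, of m m]])
  show "(%((b, s), (j, l)). (s, b, j, l)) ((%(s, b, j, l). ((b, s), (j, l))) a) = a" for a :: "nat \<times> nat \<times> nat \<times> nat"
   by (auto split: prod.splits)
  show "(%(s, b, j, l). ((b, s), (j, l))) ((%((b, s), (j, l)). (s, b, j, l)) b) = b" for b :: "(nat \<times> nat) \<times> nat \<times> nat"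
   by (auto split: prod.splits)
  show "eve_amp NS m ((%(s, b, j, l). ((b, s), (j, l))) a) * eve_amp NS m ((%(s, b, j, l). ((b, s), (j, l))) a) =
   (case a of (s, b, j, l) => th NS s * (eamp s m (b, j, l) * eamp s m (b, j, l)))" for a :: "nat \<times> nat \<times> nat \<times> nat"
  proof -
   obtain s b j l where a: "a = (s, b, j, l)" by (metis prod_cases4)
   have "0 <= th NS s" "0 <= th NB1 j" "0 <= th NB2 l" using NS NB1_pos NB2_pos by (auto simp: th_nonneg)
   then show ?thesis by (simp add: a m eve_amp_def joint_def eamp_def wt_def real_sqrt_mult)
  qed
 qed
 then show ?thesis
  by (intro has_sum_SigmaD[where B = "%_. UNIV" and f = "%(s, k). th NS s * (eamp s m k * eamp s m k)"])
   (auto intro!: has_sum_cmult_right has_sum_sig simp: case_prod_unfold)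
qed

lemma eve_mtx_0: "eve_mtx 0 m m = sig 0 m m"
proof -
 have "((%s. th 0 s * sig s m m) has_sum sig 0 m m) UNIV"
  by (rule has_sum_finite_neutralI[where B = "{0}"]) (auto simp: th_def)
 from has_sum_unique[OF has_sum_eve_mtx_sig this] show ?thesis by simp
qed

text \<open>\<open>thermal_mixture_affinity\<close> with \<open>X = 4 * covert_const\<close>, so
  that the threshold \<open>X / 8\<close> is \<open>covert_const / 2\<close>.\<close>

lemma eve_affinity:
 assumes c: "c > covert_const \<eta> NB1 NB2 / 2"
 shows "\<exists>N0>0. \<forall>N. 0 < N & N < N0 --> 1 - (\<Sum>\<^sub>\<infinity>m. sqrt (eve_mtx N m m * eve_mtx 0 m m)) <= c * N^2"
proof -
 obtain y where y: "(y has_sum 4 * covert_const \<eta> NB1 NB2) UNIV"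
  "!!m. y m >= 0" "!!m. (sig 1 m m - sig 0 m m)\<^sup>2 <= sig 0 m m * y m" using chi_square_bound by blast
 show ?thesis unfolding eve_mtx_0
  by (rule thermal_mixture_affinity[where f = "%k m. sig k m m" and y = y and X = "4 * covert_const \<eta> NB1 NB2"])
   (use y c sig_0_pos in \<open>auto intro: sig_nonneg trace_sig trace_eve_mtx has_sum_eve_mtx_sig\<close>)
qed

end

section \<open>Random codebooks\<close>

lemma sum_PiE_marginal:
 fixes g :: "'b => 'c :: comm_semiring_1"
 assumes "finite I" "finite A" "w \<in> I"
 shows "(\<Sum>c\<in>PiE I (%_. A). g (c w)) = of_nat (card A ^ (card I - 1)) * (\<Sum>a\<in>A. g a)"
proof -
 have "(\<Sum>c\<in>PiE I (%_. A). g (c w)) = (\<Sum>c\<in>PiE I (%_. A). \<Prod>v\<in>I. if v = w then g (c v) else 1)"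
  using assms by (simp add: prod.delta)
 also have "... = (\<Prod>v\<in>I. \<Sum>a\<in>A. if v = w then g a else 1)"
  by (rule prod_sum_PiE[symmetric]) (use assms in auto)
 also have "... = (\<Sum>a\<in>A. g a) * (\<Prod>v\<in>I - {w}. \<Sum>a\<in>A. if v = w then g a else 1)"
  using assms by (subst prod.remove[of I w]) auto
 also have "(\<Prod>v\<in>I - {w}. \<Sum>a\<in>A. if v = w then g a else 1) = (\<Prod>v\<in>I - {w}. of_nat (card A))"
  by (intro prod.cong) auto
 also have "... = of_nat (card A ^ (card I - 1))" using assms by simp
 finally show ?thesis by (simp add: mult.commute)
qed

lemma sum_PiE_marginal_pair:
 fixes g h :: "'b => 'c :: comm_semiring_1"
 assumes "finite I" "finite A" "w \<in> I" "w' \<in> I" "w ~= w'"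
 shows "(\<Sum>c\<in>PiE I (%_. A). g (c w) * h (c w')) = of_nat (card A ^ (card I - 2)) * ((\<Sum>a\<in>A. g a) * (\<Sum>a\<in>A. h a))"
proof -
 let ?f = "%v a. if v = w then g a else if v = w' then h a else 1"
 have "(\<Prod>v\<in>I. ?f v (c v)) = g (c w) * h (c w')" for c
 proof -
  have "(\<Prod>v\<in>I. ?f v (c v)) = (\<Prod>v\<in>{w, w'}. ?f v (c v))"
   by (rule prod.mono_neutral_right) (use assms in auto)
  then show ?thesis using assms by simp
 qed
 then have "(\<Sum>c\<in>PiE I (%_. A). g (c w) * h (c w')) = (\<Sum>c\<in>PiE I (%_. A). \<Prod>v\<in>I. ?f v (c v))"
  by simp
 also have "... = (\<Prod>v\<in>I. \<Sum>a\<in>A. ?f v a)" by (rule prod_sum_PiE[symmetric]) (use assms in auto)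
 also have "... = (\<Sum>a\<in>A. g a) * ((\<Sum>a\<in>A. h a) * (\<Prod>v\<in>I - {w} - {w'}. \<Sum>a\<in>A. ?f v a))"
  using assms by (subst prod.remove[of I w], simp, simp, subst prod.remove[of "I - {w}" w']) auto
 also have "(\<Prod>v\<in>I - {w} - {w'}. \<Sum>a\<in>A. ?f v a) = (\<Prod>v\<in>I - {w} - {w'}. of_nat (card A))"
  by (intro prod.cong) auto
 also have "... = of_nat (card A ^ (card I - 2))" using assms by (simp add: numeral_2_eq_2)
 finally show ?thesis by (simp add: ac_simps)
qed

lemma sum_roots_of_unity:
 fixes d :: int
 assumes Q: "Q > 0"
 shows "(\<Sum>q<Q. cis (2 * pi * real q / real Q * of_int d)) = of_nat Q * of_bool (int Q dvd d)"
proof -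
 define z where "z = cis (2 * pi * of_int d / real Q)"
 have zq: "cis (2 * pi * real q / real Q * of_int d) = z ^ q" for q
  unfolding z_def Complex.DeMoivre by (simp add: field_simps)
 show ?thesis
 proof (cases "int Q dvd d")
  case True
  then obtain e where e: "d = int Q * e" by (elim dvdE)
  have "2 * pi * real_of_int d / real Q = 2 * pi * of_int e" using Q by (simp add: e)
  then have "z = cis (2 * pi * of_int e)" by (simp only: z_def)
  also have "... = 1" by (rule cis_multiple_2pi) simp
  finally show ?thesis using True unfolding zq by simp
 next
  case False
  have "z ~= 1"
  proof
   assume "z = 1"
   then have "cos (2 * pi * of_int d / real Q) = 1" by (simp add: z_def complex_eq_iff)
   then obtain n :: int where "2 * pi * of_int d / real Q = of_int n * 2 * pi" using cos_one_2pi_int by blast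
   then have "of_int d = of_int n * real Q" using Q by (simp add: field_simps)
   then have "d = n * int Q" by (metis of_int_eq_iff of_int_mult of_int_of_nat_eq)
   then show False using False by simp
  qed
  moreover have "z ^ Q = 1" using Q by (simp add: z_def Complex.DeMoivre)
  ultimately show ?thesis using False unfolding zq by (simp add: sum_gp_strict)
 qed
qed

lemma integral_cis:
 assumes "d ~= 0"
 shows "integral {0..2 * pi} (%\<theta>. cis (\<theta> * of_int d)) = 0"
proof -
 let ?F = "%\<theta>. cis (\<theta> * of_int d) / (\<i> * of_int d)"
 have "((%\<theta>. cis (\<theta> * of_int d)) has_integral ?F (2 * pi) - ?F 0) {0..2 * pi}"
 proof (rule fundamental_theorem_of_calculus)
  fix \<theta> :: real
  show "(?F has_vector_derivative cis (\<theta> * of_int d)) (at \<theta> within {0..2 * pi})" unfolding cis_conv_exp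
   using assms by (auto intro!: derivative_eq_intros has_vector_derivative_real_field simp: scaleR_conv_of_real field_simps)
 qed simp
 moreover have "cis (2 * pi * of_int d) = 1" by (rule cis_multiple_2pi) simp
 ultimately show ?thesis by (simp add: integral_unique)
qed

lemma positive_mtx_mixture:
 fixes B :: "'i => 'a mtx"
 assumes "finite A" "!!a. a \<in> A ==> positive_mtx (B a)" "c >= 0"
 shows "positive_mtx (%x y. cr c * (\<Sum>a\<in>A. B a x y))" unfolding positive_mtx_def
proof (intro allI impI)
 fix F :: "'a set" and v :: "'a => complex" assume F: "finite F"
 let ?q = "%a. \<Sum>x\<in>F. \<Sum>y\<in>F. cnj (v x) * B a x y * v y"
 have "(\<Sum>x\<in>F. \<Sum>y\<in>F. cnj (v x) * (cr c * (\<Sum>a\<in>A. B a x y)) * v y)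
  = (\<Sum>x\<in>F. \<Sum>y\<in>F. \<Sum>a\<in>A. cr c * (cnj (v x) * B a x y * v y))"
  by (simp add: sum_distrib_left sum_distrib_right mult_ac)
 also have "... = (\<Sum>a\<in>A. \<Sum>x\<in>F. \<Sum>y\<in>F. cr c * (cnj (v x) * B a x y * v y))"
  by (rule sum_rotate[symmetric])
 also have "... = cr c * (\<Sum>a\<in>A. ?q a)" by (simp add: sum_distrib_left)
 also have "... \<in> \<real>\<^sub>\<ge>\<^sub>0"
 proof (rule nonneg_Reals_mult_I)
  have q: "?q a \<in> \<real>\<^sub>\<ge>\<^sub>0" if "a \<in> A" for a using assms(2)[OF that] F by (simp add: positive_mtx_def)
  show "(\<Sum>a\<in>A. ?q a) \<in> \<real>\<^sub>\<ge>\<^sub>0"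
   using assms(1) q by (induction A rule: finite_induct) (auto intro: nonneg_Reals_add_I)
 qed (use assms(3) in simp)
 finally show "(\<Sum>x\<in>F. \<Sum>y\<in>F. cnj (v x) * (cr c * (\<Sum>a\<in>A. B a x y)) * v y) \<in> \<real>\<^sub>\<ge>\<^sub>0" .
qed

lemma positive_mtx_diagonal:
 assumes "!!x. d x >= 0"
 shows "positive_mtx (%x y. of_bool (x = y) * cr (d x))" unfolding positive_mtx_def
proof (intro allI impI)
 fix F :: "'a set" and v :: "'a => complex" assume F: "finite F"
 have "(\<Sum>x\<in>F. \<Sum>y\<in>F. cnj (v x) * (of_bool (x = y) * cr (d x)) * v y)
  = (\<Sum>x\<in>F. \<Sum>y\<in>F. (if y = x then cnj (v x) * cr (d x) * v x else 0))" by (intro sum.cong) auto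
 also have "... = (\<Sum>x\<in>F. cr (d x * (cmod (v x))\<^sup>2))"
  using F by (simp add: complex_norm_square mult_ac del: of_real_power)
 also have "... = cr (\<Sum>x\<in>F. d x * (cmod (v x))\<^sup>2)" by simp
 also have "... \<in> \<real>\<^sub>\<ge>\<^sub>0" using assms by (simp add: sum_nonneg del: of_real_sum)
 finally show "(\<Sum>x\<in>F. \<Sum>y\<in>F. cnj (v x) * (of_bool (x = y) * cr (d x)) * v y) \<in> \<real>\<^sub>\<ge>\<^sub>0" .
qed

section \<open>Eve's state averaged over phases and codebooks\<close>

context roundtrip
begin

definition eve_avg :: "nat => real => (nat \<times> nat) mtx"
 where "eve_avg Q NS x y = of_bool (int Q dvd int (fst y) - int (fst x)) * cr (eve_mtx NS x y)"

lemma sum_eve_state: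
 assumes NS: "NS >= 0" and Q: "Q > 0"
 shows "(\<Sum>q<Q. eve_state \<eta> NB1 NB2 NS (2 * pi * real q / real Q) x y) = of_nat Q * eve_avg Q NS x y"
 using sum_roots_of_unity[OF Q, of "int (fst y) - int (fst x)"]
 by (simp add: eve_state_eq[OF NS] eve_avg_def sum_distrib_right[symmetric])

lemma positive_eve_avg:
 assumes NS: "NS >= 0" and Q: "Q > 0"
 shows "positive_mtx (eve_avg Q NS)"
proof -
 have "eve_avg Q NS = (%x y. cr (1 / real Q) * (\<Sum>q<Q. eve_state \<eta> NB1 NB2 NS (2 * pi * real q / real Q) x y))"
  using Q by (simp add: sum_eve_state[OF NS Q] fun_eq_iff)
 moreover have "positive_mtx (%x y. cr (1 / real Q) * (\<Sum>q<Q. eve_state \<eta> NB1 NB2 NS (2 * pi * real q / real Q) x y))"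
  by (rule positive_mtx_mixture) (auto intro: positive_eve_state NS)
 ultimately show ?thesis by simp
qed

text \<open>The integral removes entries with different \<open>e1\<close>; conservation of
  \<open>e1 + e2\<close> then leaves only the diagonal.\<close>

lemma no_comm_state_eq: "no_comm_state \<eta> NB1 NB2 x y = of_bool (x = y) * cr (eve_mtx 0 x x)"
proof -
 let ?d = "int (fst y) - int (fst x)"
 have "integral {0..2 * pi} (%\<theta>. eve_state \<eta> NB1 NB2 0 \<theta> x y)
  = integral {0..2 * pi} (%\<theta>. cis (\<theta> * of_int ?d) * cr (eve_mtx 0 x y))" by (simp add: eve_state_eq)
 also have "... = integral {0..2 * pi} (%\<theta>. cis (\<theta> * of_int ?d)) * cr (eve_mtx 0 x y)"
  by (rule integral_mult_left)
 also have "... = of_real (2 * pi) * (of_bool (x = y) * cr (eve_mtx 0 x x))"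
 proof (cases "?d = 0")
  case True
  have "eve_mtx 0 x y = of_bool (x = y) * eve_mtx 0 x x"
   using True eve_mtx_support[of "fst x" "snd x" "fst y" "snd y" 0] by (cases x; cases y) auto
  then show ?thesis using True by (simp add: scaleR_conv_of_real)
 next
  case False
  then show ?thesis using integral_cis[OF False] by auto
 qed
 finally show ?thesis unfolding no_comm_state_def by simp
qed

definition tvd :: "nat => real => real"
 where "tvd n NS = (\<Sum>\<^sub>\<infinity>xs\<in>{xs. length xs = n}. \<bar>(\<Prod>i<n. eve_mtx NS (xs ! i) (xs ! i)) - (\<Prod>i<n. eve_mtx 0 (xs ! i) (xs ! i))\<bar>)"

lemma summable_affinity: "NS >= 0 ==> (%m. sqrt (eve_mtx NS m m * eve_mtx 0 m m)) summable_on UNIV"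
 using infsum_Cauchy_Schwarz(1)[of "%m. sqrt (eve_mtx NS m m)" UNIV 1 "%m. sqrt (eve_mtx 0 m m)" 1]
  trace_eve_mtx[of NS] trace_eve_mtx[of 0] by (simp add: real_sqrt_mult eve_mtx_nonneg)

text \<open>A finite set \<open>F\<close> of lists carries almost all diagonal weight of both
  states. If \<open>Q\<close> exceeds every letter total in \<open>F\<close>, no coherence touches
  these lists, because it would need photon numbers differing by at least \<open>Q\<close>. The
  other lists form finite blocks of total weight at most \<open>\<epsilon>\<close>.\<close>

lemma trace_norm_eve_average:
 assumes NS: "NS >= 0" and \<epsilon>: "\<epsilon> > 0"
 shows "\<exists>Q0. \<forall>Q\<ge>Q0. trace_norm (%x y. tensor_prod n (%_. eve_avg Q NS) x y - tensor_prod n (%_. no_comm_state \<eta> NB1 NB2) x y)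
  <= tvd n NS + \<epsilon>"
proof -
 define P where "P = (%N (xs :: (nat \<times> nat) list). if length xs = n then \<Prod>i<n. eve_mtx N (xs ! i) (xs ! i) else 0)"
 have P0: "P N xs >= 0" for N xs by (simp add: P_def prod_nonneg eve_mtx_nonneg)
 have Ps: "(P N has_sum 1) UNIV" if "N >= 0" for N
 proof -
  have "((%xs. \<Prod>i<n. eve_mtx N (xs ! i) (xs ! i)) has_sum 1) {xs. length xs = n}"
   using has_sum_prod_lists[of n "%_ x. eve_mtx N x x" "%_. 1"] trace_eve_mtx[OF that] eve_mtx_nonneg by simp
  then show ?thesis by (rule has_sum_cong_neutral[THEN iffD1, rotated -1]) (auto simp: P_def)
 qed
 have "eventually (%F. sum (P NS) F > 1 - \<epsilon> / 2) (finite_subsets_at_top UNIV)"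
  "eventually (%F. sum (P 0) F > 1 - \<epsilon> / 2) (finite_subsets_at_top UNIV)"
  using Ps[OF NS] Ps[of 0] \<epsilon> unfolding has_sum_def by (auto intro!: order_tendstoD(1))
 moreover have "eventually finite (finite_subsets_at_top (UNIV :: (nat \<times> nat) list set))"
  by (intro eventually_finite_subsets_at_top_weakI) auto
 ultimately have "eventually (%F. finite F & sum (P NS) F > 1 - \<epsilon> / 2 & sum (P 0) F > 1 - \<epsilon> / 2) (finite_subsets_at_top UNIV)"
  by (intro eventually_conj)
 then obtain F where F: "finite F" "sum (P NS) F > 1 - \<epsilon> / 2" "sum (P 0) F > 1 - \<epsilon> / 2"
  using eventually_happens'[OF finite_subsets_at_top_neq_bot] by blast
 define tot where "tot = (%z :: nat \<times> nat. fst z + snd z)"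
 define Q0 where "Q0 = Suc (Max (insert 0 (tot ` (\<Union>xs\<in>F. set xs))))"
 show ?thesis
 proof (intro exI[of _ Q0] allI impI)
  fix Q assume Q: "Q0 <= Q"
  then have Qpos: "Q > 0" by (simp add: Q0_def)
  \<comment> \<open>Lists of the wrong length have only zero entries and may count as
    singletons.\<close>
  define ok where "ok xs \<longleftrightarrow> length xs ~= n \<or> (\<forall>z\<in>set xs. tot z < Q)" for xs :: "(nat \<times> nat) list"
  have okF: "ok xs" if "xs \<in> F" for xs
  proof -
   have "tot z < Q" if "z \<in> set xs" for z
   proof -
    have "tot z <= Max (insert 0 (tot ` (\<Union>xs\<in>F. set xs)))"
     using F(1) \<open>xs \<in> F\<close> that by (intro Max_ge) auto
    then show ?thesis using Q by (simp add: Q0_def)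
   qed
   then show ?thesis by (simp add: ok_def)
  qed
  \<comment> \<open>Lists without coherence are blocks of their own; the others are grouped by their
    totals, which conservation respects and which leave finitely many lists per block.\<close>
  define blk where "blk xs = (if ok xs then Inl xs else Inr (map tot xs))" for xs
  define S1 where "S1 = tensor_prod n (%_. eve_avg Q NS)"
  define S2 where "S2 = tensor_prod n (%_. no_comm_state \<eta> NB1 NB2)"
  define T where "T = (%x y. S1 x y - S2 x y)"
  define g where "g x = (if {y. blk y = blk x} = {x} then cmod (T x x) else Re (S1 x x) + Re (S2 x x))" for x
  have S1d: "S1 x x = cr (P NS x)" and S2d: "S2 x x = cr (P 0 x)" for x
   by (auto simp: S1_def S2_def tensor_prod_def P_def eve_avg_def no_comm_state_eq)
  have Td: "cmod (T x x) = \<bar>P NS x - P 0 x\<bar>" for x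
   unfolding T_def S1d S2d by (simp only: of_real_diff[symmetric] norm_of_real)
  have fibre: "{y. blk y = blk x} = {x}" if "ok x" for x using that by (auto simp: blk_def split: if_splits)
  have gG: "g x <= \<bar>P NS x - P 0 x\<bar> + (if x \<in> F then 0 else P NS x + P 0 x)" for x
  proof (cases "ok x")
   case True
   then show ?thesis using fibre[OF True] P0 by (simp add: g_def Td)
  next
   case False
   then have "x \<notin> F" using okF by blast
   then show ?thesis using P0[of NS x] P0[of 0 x] by (simp add: g_def Td S1d S2d)
  qed
  have g0: "g x >= 0" for x using P0[of NS x] P0[of 0 x] by (simp add: g_def S1d S2d)
  have Dsum: "((%x. \<bar>P NS x - P 0 x\<bar>) has_sum tvd n NS) UNIV"
  proof -
   have "((%xs. \<bar>(\<Prod>i<n. eve_mtx NS (xs ! i) (xs ! i)) - (\<Prod>i<n. eve_mtx 0 (xs ! i) (xs ! i))\<bar>) has_sum tvd n NS) {xs. length xs = n}"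
    unfolding tvd_def
    by (intro has_sum_infsum total_variation_power_le(1)[OF trace_eve_mtx[OF NS] trace_eve_mtx[of 0] _ _ has_sum_infsum[OF summable_affinity[OF NS]]])
     (auto simp: eve_mtx_nonneg)
   then show ?thesis by (rule has_sum_cong_neutral[THEN iffD1, rotated -1]) (auto simp: P_def)
  qed
  have G: "((%x. \<bar>P NS x - P 0 x\<bar> + ((if x \<in> F then 0 else P NS x) + (if x \<in> F then 0 else P 0 x)))
   has_sum (tvd n NS + ((1 - sum (P NS) F) + (1 - sum (P 0) F)))) UNIV"
   by (intro has_sum_add Dsum has_sum_diff_finite Ps NS F) simp
  have gG': "g x <= \<bar>P NS x - P 0 x\<bar> + ((if x \<in> F then 0 else P NS x) + (if x \<in> F then 0 else P 0 x))" for x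
   using gG[of x] by (simp split: if_splits)
  have gs: "g summable_on UNIV"
   by (rule summable_on_comparison_test[OF has_sum_imp_summable[OF G]]) (use gG' g0 in auto)
  have "trace_norm T <= infsum g UNIV"
  proof (rule trace_norm_block_le[where blk = blk and ?S1.0 = S1 and ?S2.0 = S2])
   show "finite {x. blk x = b}" for b
   proof (cases b)
    case (Inl xs)
    then have "{x. blk x = b} \<subseteq> {xs}" by (auto simp: blk_def split: if_splits)
    then show ?thesis by (rule finite_subset) simp
   next
    case (Inr t)
    have "{x. blk x = b} \<subseteq> {xs. set xs \<subseteq> (\<Union>k\<in>set t. {z. tot z = k}) & length xs = length t}"
     using Inr by (auto simp: blk_def split: if_splits)
    moreover have "finite {z. tot z = k}" for k
    proof (rule finite_subset)
     show "{z. tot z = k} \<subseteq> {..k} \<times> {..k}" by (auto simp: tot_def)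
    qed auto
    then have "finite {xs. set xs \<subseteq> (\<Union>k\<in>set t. {z. tot z = k}) & length xs = length t}"
     by (intro finite_lists_length_eq) auto
    ultimately show ?thesis by (rule finite_subset)
   qed
   show "T x y = S1 x y - S2 x y" for x y by (simp add: T_def)
   show "positive_mtx S1" unfolding S1_def by (intro positive_tensor_prod positive_eve_avg NS Qpos)
   have "no_comm_state \<eta> NB1 NB2 = (%x y. of_bool (x = y) * cr (eve_mtx 0 x x))"
    by (simp add: no_comm_state_eq fun_eq_iff)
   then show "positive_mtx S2" unfolding S2_def
    by (intro positive_tensor_prod) (simp add: positive_mtx_diagonal eve_mtx_nonneg)
   show "T x y = 0" if b: "blk x ~= blk y" for x y
   proof (cases "length x = n & length y = n")
    case True
    have xy: "x ~= y" using b by auto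
    then obtain i where i: "i < n" "x ! i ~= y ! i" using True by (metis nth_equalityI)
    have "S2 x y = 0" using True i by (auto simp: S2_def tensor_prod_def no_comm_state_eq)
    moreover have "S1 x y = 0"
    proof (cases "map tot x = map tot y")
     case m: True
     have "ok x \<or> ok y" using b m by (auto simp: blk_def split: if_splits)
     have tt: "tot (x ! j) = tot (y ! j)" if "j < n" for j using arg_cong[OF m, of "%l. l ! j"] that True by simp
     have "tot (x ! i) < Q \<or> tot (y ! i) < Q"
      using \<open>ok x \<or> ok y\<close> True i(1) tt[OF i(1)] nth_mem[of i x] nth_mem[of i y] unfolding ok_def by metis
     then have "tot (x ! i) < Q" using tt[OF i(1)] by simp
     then have lt: "fst (x ! i) < Q" "fst (y ! i) < Q" using tt[OF i(1)] by (auto simp: tot_def)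
     have ne: "fst (x ! i) ~= fst (y ! i)" using tt[OF i(1)] i(2) by (auto simp: tot_def prod_eq_iff)
     have "\<not> int Q dvd int (fst (y ! i)) - int (fst (x ! i))"
      using lt ne zdvd_imp_le[of "int Q" "\<bar>int (fst (y ! i)) - int (fst (x ! i))\<bar>"] by auto
     then have "eve_avg Q NS (x ! i) (y ! i) = 0" by (simp add: eve_avg_def)
     then show ?thesis using True i by (auto simp: S1_def tensor_prod_def)
    next
     case False
     then obtain j where j: "j < n" "tot (x ! j) ~= tot (y ! j)"
      using True by (metis length_map nth_equalityI nth_map)
     then have "eve_mtx NS (x ! j) (y ! j) = 0"
      using eve_mtx_support[of "fst (x ! j)" "snd (x ! j)" "fst (y ! j)" "snd (y ! j)" NS] by (simp add: tot_def)
     then have "eve_avg Q NS (x ! j) (y ! j) = 0" by (simp add: eve_avg_def)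
     then show ?thesis using True j by (auto simp: S1_def tensor_prod_def)
    qed
    ultimately show ?thesis by (simp add: T_def)
   next
    case False
    then show ?thesis by (auto simp: T_def S1_def S2_def tensor_prod_def)
   qed
   show "g x = (if {y. blk y = blk x} = {x} then cmod (T x x) else Re (S1 x x) + Re (S2 x x))" for x
    by (simp add: g_def)
  qed (rule gs)
  also have "... <= tvd n NS + ((1 - sum (P NS) F) + (1 - sum (P 0) F))"
   using has_sum_mono[OF has_sum_infsum[OF gs] G] gG' by simp
  also have "... <= tvd n NS + \<epsilon>" using F by simp
  finally show "trace_norm (%x y. tensor_prod n (%_. eve_avg Q NS) x y - tensor_prod n (%_. no_comm_state \<eta> NB1 NB2) x y)
   <= tvd n NS + \<epsilon>" unfolding T_def S1_def S2_def .
 qed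
qed

text \<open>The key runs through all codebooks, so for every message the codeword is uniform over
  all phase sequences, and the average factors over the uses.\<close>

lemma eve_average_codebook:
 fixes cb :: "nat => nat => nat => nat"
 assumes NS: "NS >= 0" and Q: "Q > 0" and M: "num_msgs C >= 1"
  and cb: "bij_betw cb {1..num_keys C} (PiE {1..num_msgs C} (%_. PiE {..<n} (%_. {..<Q})))"
  and ph: "!!w k i. phases C w k i = 2 * pi * real (cb k w i) / real Q"
 shows "eve_average_state \<eta> NB1 NB2 NS n C = tensor_prod n (%_. eve_avg Q NS)"
proof (intro ext)
 fix x y
 let ?W = "PiE {..<n} (%_. {..<Q})" and ?M = "num_msgs C"
 let ?B = "PiE {1..?M} (%_. ?W)"
 define f where "f c = tensor_prod n (%i. eve_state \<eta> NB1 NB2 NS (2 * pi * real (c i) / real Q)) x y" for c :: "nat => nat"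
 have finW: "finite ?W" by (intro finite_PiE) auto
 have cW: "card ?W = Q ^ n" by (simp add: card_PiE)
 have K: "num_keys C = card ?W ^ ?M" using bij_betw_same_card[OF cb] by (simp add: card_PiE)
 have "(\<Sum>c\<in>?W. f c) = of_nat (card ?W) * tensor_prod n (%_. eve_avg Q NS) x y"
 proof (cases "length x = n & length y = n")
  case True
  have "(\<Sum>c\<in>?W. f c) = (\<Sum>c\<in>?W. \<Prod>i<n. eve_state \<eta> NB1 NB2 NS (2 * pi * real (c i) / real Q) (x ! i) (y ! i))"
   using True by (simp add: f_def tensor_prod_def)
  also have "... = (\<Prod>i<n. \<Sum>q<Q. eve_state \<eta> NB1 NB2 NS (2 * pi * real q / real Q) (x ! i) (y ! i))"
   by (rule prod_sum_PiE[symmetric]) auto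
  also have "... = (\<Prod>i<n. of_nat Q * eve_avg Q NS (x ! i) (y ! i))" by (simp add: sum_eve_state[OF NS Q])
  also have "... = of_nat (card ?W) * tensor_prod n (%_. eve_avg Q NS) x y"
   using True by (simp add: prod.distrib cW tensor_prod_def)
  finally show ?thesis .
 next
  case False
  then have "tensor_prod n A x y = 0" for A :: "nat => (nat \<times> nat) mtx" by (auto simp: tensor_prod_def)
  then show ?thesis by (simp add: f_def)
 qed
 note fsum = this
 have "(\<Sum>k\<in>{1..num_keys C}. tensor_prod n (%i. eve_state \<eta> NB1 NB2 NS (phases C w k i)) x y)
  = of_nat (num_keys C) * tensor_prod n (%_. eve_avg Q NS) x y" if w: "w \<in> {1..?M}" for w
 proof -
  have "(\<Sum>k\<in>{1..num_keys C}. tensor_prod n (%i. eve_state \<eta> NB1 NB2 NS (phases C w k i)) x y)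
   = (\<Sum>k\<in>{1..num_keys C}. f (cb k w))" by (simp add: f_def ph)
  also have "... = (\<Sum>c\<in>?B. f (c w))" by (rule sum.reindex_bij_betw[OF cb])
  also have "... = of_nat (card ?W ^ (?M - 1)) * (\<Sum>c\<in>?W. f c)"
   using sum_PiE_marginal[of "{1..?M}" ?W w f] finW w by simp
  also have "... = of_nat (card ?W ^ ?M) * tensor_prod n (%_. eve_avg Q NS) x y"
   using M unfolding fsum by (cases ?M) simp_all
  finally show ?thesis by (simp add: K)
 qed
 then have "(\<Sum>w\<in>{1..?M}. \<Sum>k\<in>{1..num_keys C}. tensor_prod n (%i. eve_state \<eta> NB1 NB2 NS (phases C w k i)) x y)
  = of_nat (?M * num_keys C) * tensor_prod n (%_. eve_avg Q NS) x y" by simp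
 moreover have "?M * num_keys C > 0" using M Q unfolding K cW by simp
 ultimately show "eve_average_state \<eta> NB1 NB2 NS n C x y = tensor_prod n (%_. eve_avg Q NS) x y"
  unfolding eve_average_state_def by (simp del: of_nat_mult)
qed

end

section \<open>A low-rank test for product states\<close>

lemma prod_add_subsets:
 fixes f g :: "nat => 'b::comm_semiring_1"
 shows "(\<Prod>j<n. f j + g j) = (\<Sum>S\<in>Pow {..<n}. \<Prod>j<n. if j \<in> S then f j else g j)"
proof -
 have "(\<Prod>j<n. f j + g j) = (\<Sum>S\<in>Pow {..<n}. (\<Prod>j\<in>S. f j) * (\<Prod>j\<in>{..<n} - S. g j))"
  by (rule prod_add) simp
 also have "... = (\<Sum>S\<in>Pow {..<n}. \<Prod>j<n. if j \<in> S then f j else g j)"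
 proof (rule sum.cong[OF refl])
  fix S assume "S \<in> Pow {..<n}"
  then have S: "{..<n} \<inter> S = S" "{..<n} \<inter> - S = {..<n} - S" by auto
  show "(\<Prod>j\<in>S. f j) * (\<Prod>j\<in>{..<n} - S. g j) = (\<Prod>j<n. if j \<in> S then f j else g j)"
   using prod.If_cases[of "{..<n}" "%j. j \<in> S" f g] S by simp
 qed
 finally show ?thesis .
qed

lemma pairing_projection_nonneg:
 assumes "finite F" "projection_on F A" "psd_on F B"
 shows "Re (pairing F A B) >= 0"
proof -
 obtain \<psi> where \<psi>: "!!x y. x \<in> F ==> y \<in> F ==> B x y = (\<Sum>k\<in>F. \<psi> k x * cnj (\<psi> k y))"
  using psd_on_gram[OF assms(1,3)] by metis
 have "pairing F A B = (\<Sum>k\<in>F. ip F (\<psi> k) (app F A (\<psi> k)))" by (rule pairing_gram) (rule \<psi>)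
 also have "... = (\<Sum>k\<in>F. cr (nsq F (app F A (\<psi> k))))"
  unfolding ip_self[symmetric] by (intro sum.cong refl ip_projection assms)
 finally show ?thesis by (simp add: nsq_nonneg sum_nonneg)
qed

lemma pairing_add: "pairing F A (%x y. \<Sum>k\<in>K. B k x y) = (\<Sum>k\<in>K. pairing F A (B k))"
proof -
 have "pairing F A (%x y. \<Sum>k\<in>K. B k x y) = (\<Sum>x\<in>F. \<Sum>y\<in>F. \<Sum>k\<in>K. A x y * B k y x)"
  by (simp add: pairing_def sum_distrib_left)
 also have "... = (\<Sum>x\<in>F. \<Sum>k\<in>K. \<Sum>y\<in>F. A x y * B k y x)" by (intro sum.cong refl sum.swap)
 also have "... = (\<Sum>k\<in>K. pairing F A (B k))" unfolding pairing_def by (rule sum.swap)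
 finally show ?thesis .
qed

text \<open>A positive matrix is split into a part that has rank one on each block, a block being a fibre
 of \<open>\<beta>\<close>, and a remainder.\<close>

locale rank_one_split =
 fixes X :: "'a set" and \<beta> :: "'a => 'a" and f :: "'a => real" and R :: "'a => 'a => real"
 assumes finite_X: "finite X" and base_X: "x \<in> X ==> \<beta> x \<in> X" and base_base: "\<beta> (\<beta> x) = \<beta> x"
  and positive_R: "positive_mtx (%x y. cr (R x y))"
begin

definition rank1 :: "'a => 'a => real"
 where "rank1 x y = of_bool (\<beta> x = \<beta> y) * (f x * f y)"

definition omega :: "'a => 'a => real"
 where "omega x y = rank1 x y + R x y"

text \<open>One term in the expansion of the product state: the remainder at the positions in
  \<open>S\<close>, the rank-one part elsewhere.\<close>

definition term_of :: "nat => nat set => 'a list mtx"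
 where "term_of n S = tensor_prod n (%j x y. cr (if j \<in> S then R x y else rank1 x y))"

lemma positive_rank1: "positive_mtx (%x y. cr (rank1 x y))"
 unfolding positive_mtx_iff_psd_on
proof (intro allI impI)
 fix F :: "'a set" assume F: "finite F"
 show "psd_on F (%x y. cr (rank1 x y))"
 proof (rule gram_psd_on[where K = "\<beta> ` F" and \<psi> = "%k x. of_bool (\<beta> x = k) * cr (f x)"])
  fix x y assume "x \<in> F" "y \<in> F"
  have "(\<Sum>k\<in>\<beta> ` F. of_bool (\<beta> x = k) * cr (f x) * cnj (of_bool (\<beta> y = k) * cr (f y)))
   = (\<Sum>k\<in>\<beta> ` F. of_bool (\<beta> x = k) * (of_bool (\<beta> y = k) * cr (f x * f y)))"
   by (simp add: mult_ac)
  also have "... = of_bool (\<beta> y = \<beta> x) * cr (f x * f y)"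
   using F \<open>x \<in> F\<close> by (subst sum_of_bool_mult) auto
  finally show "cr (rank1 x y) =
   (\<Sum>k\<in>\<beta> ` F. of_bool (\<beta> x = k) * cr (f x) * cnj (of_bool (\<beta> y = k) * cr (f y)))"
   by (cases "\<beta> x = \<beta> y") (auto simp: rank1_def)
 qed
qed

lemma R_diag_nonneg: "R x x >= 0"
 using positive_mtx_diag[OF positive_R, of x] by simp

lemma rank1_diag: "rank1 x x = (f x)\<^sup>2"
 by (simp add: rank1_def power2_eq_square)

lemma omega_diag_nonneg: "omega x x >= 0"
 by (simp add: omega_def rank1_diag R_diag_nonneg)

lemma tensor_omega: "tensor_prod n (%_ x y. cr (omega x y)) = (%x y. \<Sum>S\<in>Pow {..<n}. term_of n S x y)"
proof (intro ext)
 fix x y :: "'a list"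
 show "tensor_prod n (%_ x y. cr (omega x y)) x y = (\<Sum>S\<in>Pow {..<n}. term_of n S x y)"
 proof (cases "length x = n & length y = n")
  case True
  have "tensor_prod n (%_ x y. cr (omega x y)) x y
   = (\<Prod>j<n. cr (R (x ! j) (y ! j)) + cr (rank1 (x ! j) (y ! j)))"
   using True by (simp add: tensor_prod_def omega_def add.commute)
  also have "... = (\<Sum>S\<in>Pow {..<n}. \<Prod>j<n. if j \<in> S then cr (R (x ! j) (y ! j))
   else cr (rank1 (x ! j) (y ! j)))" by (rule prod_add_subsets)
  also have "... = (\<Sum>S\<in>Pow {..<n}. term_of n S x y)"
   using True by (intro sum.cong refl) (simp add: term_of_def tensor_prod_def if_distrib)
  finally show ?thesis .
 qed (auto simp: tensor_prod_def term_of_def)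
qed

lemma positive_term_of: "positive_mtx (term_of n S)"
 unfolding term_of_def
proof (rule positive_tensor_prod)
 fix i show "positive_mtx (%x y. cr (if i \<in> S then R x y else rank1 x y))"
  using positive_R positive_rank1 by (cases "i \<in> S") auto
qed

lemma term_of_diag: "length x = n ==> term_of n S x x = cr (\<Prod>j<n. if j \<in> S then R (x ! j) (x ! j) else (f (x ! j))\<^sup>2)"
 by (auto simp: term_of_def tensor_prod_def rank1_diag intro!: prod.cong)

text \<open>The test projects onto the span of the vectors that are products of the block vectors \<open>f\<close> off a
 small set \<open>S\<close> of positions and basis vectors on \<open>S\<close>.\<close>

definition gen :: "nat => nat set \<times> 'a list => 'a list => real"
 where "gen n = (%(S, z) x. \<Prod>j<n. if j \<in> S then of_bool (x ! j = z ! j) else of_bool (\<beta> (x ! j) = z ! j) * f (x ! j))"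

text \<open>Each column of a term is a combination of generators with the same \<open>S\<close>,
  where off \<open>S\<close> only block representatives have nonzero coefficients. A projection onto
  the generators therefore fixes the term.\<close>

lemma term_of_expand:
 assumes x: "length x = n" "set x \<subseteq> X" and y: "length y = n"
 shows "term_of n S x y = (\<Sum>z\<in>{z. set z \<subseteq> X & length z = n}.
  cr (\<Prod>j<n. if j \<in> S then R (z ! j) (y ! j) else of_bool (z ! j = \<beta> (y ! j)) * f (y ! j))
   * cr (gen n (S, z) x))"
proof -
 define h where "h j w = (if j \<in> S then of_bool (w = x ! j) * R w (y ! j)
  else of_bool (w = \<beta> (x ! j)) * (of_bool (w = \<beta> (y ! j)) * (f (x ! j) * f (y ! j))))" for j w
 have xj: "x ! j \<in> X" if "j < n" for j using x that nth_mem[of j x] by auto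
 have "(\<Sum>w\<in>X. h j w) = (if j \<in> S then R (x ! j) (y ! j) else rank1 (x ! j) (y ! j))" if "j < n" for j
  using xj[OF that] base_X[OF xj[OF that]] finite_X
  by (cases "j \<in> S") (auto simp: h_def sum_of_bool_mult rank1_def)
 then have "term_of n S x y = cr (\<Prod>j<n. \<Sum>w\<in>X. h j w)"
  using x y by (simp add: term_of_def tensor_prod_def)
 also have "(\<Prod>j<n. \<Sum>w\<in>X. h j w) = (\<Sum>z\<in>{z. set z \<subseteq> X & length z = n}. \<Prod>j<n. h j (z ! j))"
  by (rule sum_prod_lists[symmetric, OF finite_X])
 also have "... = (\<Sum>z\<in>{z. set z \<subseteq> X & length z = n}.
  (\<Prod>j<n. if j \<in> S then R (z ! j) (y ! j) else of_bool (z ! j = \<beta> (y ! j)) * f (y ! j)) * gen n (S, z) x)"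
  unfolding gen_def prod.case prod.distrib[symmetric] by (intro sum.cong refl prod.cong) (auto simp: h_def)
 finally show ?thesis by simp
qed

text \<open>The projection onto the generators with at most \<open>s\<close> exceptional positions
  fixes all terms with \<open>card S <= s\<close>, so acceptance loses only the other terms. Each
  orthonormal direction stays in one sequence of blocks, where every diagonal entry on
  \<open>G\<close> is at most \<open>\<kappa> ^ t\<close> times the product of block masses. Summing
  over generators costs a factor \<open>L\<close> per exceptional position.\<close>

lemma low_rank_test:
 fixes \<kappa> L r a :: real and Sp :: "'a set" and n t s :: nat
 assumes \<kappa>: "0 <= \<kappa>" "\<kappa> <= 1" and sp: "!!x. x \<in> Sp ==> x \<in> X ==> omega x x <= \<kappa> * omega (\<beta> x) (\<beta> x)"
  and total: "(\<Sum>x\<in>X. omega x x) <= 1"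
  and fibre: "!!d. d \<in> X ==> real (card {x \<in> X. \<beta> x = d}) <= L" and L: "L >= 0"
  and r: "(\<Sum>x\<in>X. R x x) <= r" and a: "(\<Sum>x\<in>X. (f x)\<^sup>2) <= a"
 defines "G \<equiv> {xs. length xs = n & set xs \<subseteq> X & t <= card {j. j < n & xs ! j \<in> Sp}}"
 shows "\<exists>(J :: (nat set \<times> 'a list) set) u. finite J & (\<forall>i\<in>J. \<forall>j\<in>J. ip G (u i) (u j) = of_bool (i = j)) &
  Re (pairing G (proj J u) (tensor_prod n (%_ x y. cr (omega x y))))
   >= (\<Sum>xs\<in>G. \<Prod>j<n. omega (xs ! j) (xs ! j)) - (\<Sum>S | S \<in> Pow {..<n} & s < card S. \<Prod>j<n. if j \<in> S then r else a) &
  (\<Sum>x\<in>G. Re (proj J u x x) * (\<Prod>j<n. omega (x ! j) (x ! j))) <= \<kappa> ^ t * (\<Sum>S | S \<in> Pow {..<n} & card S <= s. L ^ card S)"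
proof -
 let ?P = "%xs. \<Prod>j<n. omega (xs ! j) (xs ! j)"
 define Xn where "Xn = {z. set z \<subseteq> X & length z = n}"
 have finXn: "finite Xn" unfolding Xn_def by (rule finite_lists_length_eq[OF finite_X])
 have GX: "G \<subseteq> Xn" by (auto simp: G_def Xn_def)
 have finG: "finite G" by (rule finite_subset[OF GX finXn])
 have memX: "z ! j \<in> X" if "z \<in> Xn" "j < n" for z j using that nth_mem[of j z] by (auto simp: Xn_def)
 \<comment> \<open>Off \<open>S\<close> the letter of \<open>z\<close> only names a block and is
   normalised to its representative; on \<open>S\<close> it is free.\<close>
 define I where "I = {(S, z). S \<in> Pow {..<n} & card S <= s & z \<in> Xn & (\<forall>j<n. j \<notin> S --> \<beta> (z ! j) = z ! j)}"
 have finI: "finite I" by (rule finite_subset[of _ "Pow {..<n} \<times> Xn"]) (auto simp: I_def finXn)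
 define g where "g i x = cr (gen n i x)" for i x
 define B where "B = (%(S :: nat set, z). {x. length x = n & map \<beta> x = map \<beta> z})"
 have supp: "x \<in> B i" if "i \<in> I" "x \<in> G" "g i x ~= 0" for i x
 proof -
  obtain S z where i: "i = (S, z)" by force
  have len: "length x = n" "length z = n" using that by (auto simp: i I_def Xn_def G_def)
  have nz: "(if j \<in> S then of_bool (x ! j = z ! j) else of_bool (\<beta> (x ! j) = z ! j) * f (x ! j)) ~= 0" if "j < n" for j
   using \<open>g i x ~= 0\<close> that by (auto simp: g_def gen_def i)
  have "\<beta> (x ! j) = \<beta> (z ! j)" if "j < n" for j
   using nz[OF that] base_base[of "x ! j"] by (auto split: if_splits)
  then have "map \<beta> x = map \<beta> z" using len by (intro nth_equalityI) auto
  then show ?thesis using len by (simp add: B_def i)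
 qed
 have "\<exists>J u. J \<subseteq> I & (\<forall>i\<in>J. \<forall>j\<in>J. ip G (u i) (u j) = of_bool (i = j))
  & (\<forall>i\<in>J. \<forall>x\<in>G. u i x ~= 0 --> x \<in> B i)
  & (\<forall>i\<in>I. \<forall>x\<in>G. g i x = (\<Sum>k\<in>J. ip G (u k) (g i) * u k x))"
 proof (rule block_projection[OF finG finI supp])
  show "B i = B j \<or> B i \<inter> B j = {}" for i j
  proof (cases "map \<beta> (snd i) = map \<beta> (snd j)")
   case True
   then have "B i = B j" by (simp only: B_def case_prod_unfold)
   then show ?thesis ..
  next
   case False
   have "False" if "w \<in> B i" "w \<in> B j" for w
   proof -
    have "map \<beta> w = map \<beta> (snd i)" "map \<beta> w = map \<beta> (snd j)"
     using that by (simp_all only: B_def case_prod_unfold mem_Collect_eq)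
    then show False using False by simp
   qed
   then have "B i \<inter> B j = {}" by blast
   then show ?thesis ..
  qed
 qed
 then obtain J u where J: "J \<subseteq> I" and on': "\<forall>i\<in>J. \<forall>j\<in>J. ip G (u i) (u j) = of_bool (i = j)"
  and us': "\<forall>i\<in>J. \<forall>x\<in>G. u i x ~= 0 --> x \<in> B i"
  and span': "\<forall>i\<in>I. \<forall>x\<in>G. g i x = (\<Sum>k\<in>J. ip G (u k) (g i) * u k x)"
  by (elim exE conjE)
 note on = on'[rule_format] and us = us'[rule_format] and span = span'[rule_format]
 have finJ: "finite J" by (rule finite_subset[OF J finI])
 have pr: "projection_on G (proj J u)" by (rule projection_on_proj[OF finJ on])
 \<comment> \<open>Every column of such a term lies in the span of the generators, so the projection
   preserves its trace.\<close>
 have fixed: "pairing G (proj J u) (term_of n S) = (\<Sum>x\<in>G. term_of n S x x)" if S: "S \<in> Pow {..<n}" "card S <= s" for S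
 proof -
  have col: "(\<Sum>k\<in>J. ip G (u k) (%x. term_of n S x y) * u k x) = term_of n S x y" if xy: "x \<in> G" "y \<in> G" for x y
  proof -
   define c where "c z = cr (\<Prod>j<n. if j \<in> S then R (z ! j) (y ! j) else of_bool (z ! j = \<beta> (y ! j)) * f (y ! j))" for z
   have e: "term_of n S w y = (\<Sum>z\<in>Xn. c z * g (S, z) w)" if "w \<in> G" for w
    unfolding c_def g_def Xn_def using that xy(2) by (intro term_of_expand) (auto simp: G_def)
   have cI: "(S, z) \<in> I" if "z \<in> Xn" "c z ~= 0" for z
   proof -
    have nz: "(if j \<in> S then R (z ! j) (y ! j) else of_bool (z ! j = \<beta> (y ! j)) * f (y ! j)) ~= 0" if "j < n" for j
     using \<open>c z ~= 0\<close> that by (auto simp: c_def)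
    have "\<beta> (z ! j) = z ! j" if "j < n" "j \<notin> S" for j using nz[OF that(1)] that(2) base_base by auto
    then show ?thesis using S \<open>z \<in> Xn\<close> by (auto simp: I_def)
   qed
   have "(\<Sum>k\<in>J. ip G (u k) (%x. term_of n S x y) * u k x) = (\<Sum>k\<in>J. ip G (u k) (%w. \<Sum>z\<in>Xn. c z * g (S, z) w) * u k x)"
    by (intro sum.cong refl arg_cong2[where f = times] ip_cong) (auto simp: e)
   also have "... = (\<Sum>k\<in>J. \<Sum>z\<in>Xn. c z * (ip G (u k) (g (S, z)) * u k x))"
    unfolding ip_sum_right ip_scale_right by (simp add: sum_distrib_right mult.assoc)
   also have "... = (\<Sum>z\<in>Xn. c z * (\<Sum>k\<in>J. ip G (u k) (g (S, z)) * u k x))"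
    unfolding sum_distrib_left by (rule sum.swap)
   also have "... = (\<Sum>z\<in>Xn. c z * g (S, z) x)"
   proof (rule sum.cong[OF refl])
    fix z assume z: "z \<in> Xn"
    show "c z * (\<Sum>k\<in>J. ip G (u k) (g (S, z)) * u k x) = c z * g (S, z) x"
     using span[OF cI[OF z] xy(1)] by (cases "c z = 0") auto
   qed
   also have "... = term_of n S x y" using e[OF xy(1)] by simp
   finally show ?thesis .
  qed
  have "pairing G (proj J u) (term_of n S) = (\<Sum>x\<in>G. app G (proj J u) (%w. term_of n S w x) x)"
   by (simp add: pairing_def app_def)
  also have "... = (\<Sum>x\<in>G. term_of n S x x)" unfolding app_proj using col by (intro sum.cong) auto
  finally show ?thesis .
 qed
 have excess: "Re (\<Sum>x\<in>G. term_of n S x x) <= (\<Prod>j<n. if j \<in> S then r else a)" for S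
 proof -
  have "Re (\<Sum>x\<in>G. term_of n S x x) = (\<Sum>x\<in>G. \<Prod>j<n. if j \<in> S then R (x ! j) (x ! j) else (f (x ! j))\<^sup>2)"
   unfolding Re_sum by (intro sum.cong) (auto simp: G_def term_of_diag simp del: of_real_prod)
  also have "... <= (\<Sum>x\<in>Xn. \<Prod>j<n. if j \<in> S then R (x ! j) (x ! j) else (f (x ! j))\<^sup>2)"
   using GX finXn by (intro sum_mono2) (auto intro!: prod_nonneg R_diag_nonneg)
  also have "... = (\<Prod>j<n. \<Sum>x\<in>X. if j \<in> S then R x x else (f x)\<^sup>2)"
   unfolding Xn_def by (rule sum_prod_lists[OF finite_X])
  also have "... <= (\<Prod>j<n. if j \<in> S then r else a)"
   using r a by (intro prod_mono) (auto intro!: sum_nonneg R_diag_nonneg)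
  finally show ?thesis .
 qed
 have first: "Re (pairing G (proj J u) (tensor_prod n (%_ x y. cr (omega x y))))
   >= (\<Sum>xs\<in>G. ?P xs) - (\<Sum>S | S \<in> Pow {..<n} & s < card S. \<Prod>j<n. if j \<in> S then r else a)"
 proof -
  have trG: "(\<Sum>xs\<in>G. ?P xs) = (\<Sum>S\<in>Pow {..<n}. Re (\<Sum>x\<in>G. term_of n S x x))"
  proof -
   have "(\<Sum>S\<in>Pow {..<n}. Re (\<Sum>x\<in>G. term_of n S x x)) = Re (\<Sum>S\<in>Pow {..<n}. \<Sum>x\<in>G. term_of n S x x)"
    by simp
   also have "(\<Sum>S\<in>Pow {..<n}. \<Sum>x\<in>G. term_of n S x x) = (\<Sum>x\<in>G. \<Sum>S\<in>Pow {..<n}. term_of n S x x)" by (rule sum.swap)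
   also have "... = (\<Sum>x\<in>G. tensor_prod n (%_ x y. cr (omega x y)) x x)" unfolding tensor_omega ..
   also have "... = (\<Sum>x\<in>G. cr (?P x))" by (intro sum.cong) (auto simp: G_def tensor_prod_def)
   also have "Re (\<Sum>x\<in>G. cr (?P x)) = (\<Sum>x\<in>G. ?P x)" unfolding of_real_sum[symmetric] by (rule Re_complex_of_real)
   finally show ?thesis by (rule sym)
  qed
  have sp: "Pow {..<n} = {S \<in> Pow {..<n}. card S <= s} \<union> {S \<in> Pow {..<n}. s < card S}" by auto
  have split: "(\<Sum>S\<in>Pow {..<n}. h S) = (\<Sum>S | S \<in> Pow {..<n} & card S <= s. h S) + (\<Sum>S | S \<in> Pow {..<n} & s < card S. h S)" for h :: "nat set => real"
   by (subst sp, rule sum.union_disjoint) auto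
  have "(\<Sum>xs\<in>G. ?P xs) = (\<Sum>S | S \<in> Pow {..<n} & card S <= s. Re (\<Sum>x\<in>G. term_of n S x x))
   + (\<Sum>S | S \<in> Pow {..<n} & s < card S. Re (\<Sum>x\<in>G. term_of n S x x))" unfolding trG by (rule split)
  also have "(\<Sum>S | S \<in> Pow {..<n} & s < card S. Re (\<Sum>x\<in>G. term_of n S x x)) <= (\<Sum>S | S \<in> Pow {..<n} & s < card S. \<Prod>j<n. if j \<in> S then r else a)"
   by (intro sum_mono excess)
  also have "(\<Sum>S | S \<in> Pow {..<n} & card S <= s. Re (\<Sum>x\<in>G. term_of n S x x)) = (\<Sum>S | S \<in> Pow {..<n} & card S <= s. Re (pairing G (proj J u) (term_of n S)))"
   by (intro sum.cong) (auto simp: fixed)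
  also have "... <= (\<Sum>S\<in>Pow {..<n}. Re (pairing G (proj J u) (term_of n S)))"
   using positive_term_of[unfolded positive_mtx_iff_psd_on] finG
   by (intro sum_mono2) (auto intro!: pairing_projection_nonneg pr)
  also have "... = Re (pairing G (proj J u) (tensor_prod n (%_ x y. cr (omega x y))))"
   unfolding tensor_omega pairing_add by simp
  finally show ?thesis by simp
 qed
 \<comment> \<open>The mass of a block. An ordinary letter is bounded by the mass of its block, a
   special one by \<open>\<kappa>\<close> times that mass, through the base entry.\<close>
 define m where "m d = (\<Sum>x | x \<in> X & \<beta> x = d. omega x x)" for d
 have m0: "m d >= 0" for d by (simp add: m_def sum_nonneg omega_diag_nonneg)
 have mx: "omega x x <= m (\<beta> x)" if "x \<in> X" for x
  unfolding m_def using that finite_X by (intro member_le_sum) (auto simp: omega_diag_nonneg)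
 have Pbound: "?P x <= \<kappa> ^ t * (\<Prod>j<n. m (z ! j))" if x: "x \<in> G" "map \<beta> x = z" for x z
 proof -
  have len: "length x = n" using x by (simp add: G_def)
  have xj: "x ! j \<in> X" if "j < n" for j using memX x(1) GX that by blast
  let ?T = "{j. j < n & x ! j \<in> Sp}"
  have "?P x <= (\<Prod>j<n. (if x ! j \<in> Sp then \<kappa> else 1) * m (\<beta> (x ! j)))"
  proof (intro prod_mono conjI omega_diag_nonneg)
   fix j assume "j \<in> {..<n}"
   then have j: "x ! j \<in> X" using xj by simp
   show "omega (x ! j) (x ! j) <= (if x ! j \<in> Sp then \<kappa> else 1) * m (\<beta> (x ! j))"
   proof (cases "x ! j \<in> Sp")
    case True
    have "omega (x ! j) (x ! j) <= \<kappa> * omega (\<beta> (x ! j)) (\<beta> (x ! j))" by (rule sp[OF True j])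
    also have "... <= \<kappa> * m (\<beta> (x ! j))"
     using mx[OF base_X[OF j]] \<kappa> by (intro mult_left_mono) (auto simp: base_base)
    finally show ?thesis using True by simp
   qed (use mx[OF j] in simp)
  qed
  also have "... = \<kappa> ^ card ?T * (\<Prod>j<n. m (\<beta> (x ! j)))"
  proof -
   have "{..<n} \<inter> {j. x ! j \<in> Sp} = ?T" by auto
   then show ?thesis by (simp add: prod.distrib prod.If_cases)
  qed
  also have "... <= \<kappa> ^ t * (\<Prod>j<n. m (\<beta> (x ! j)))"
   using x(1) \<kappa> by (intro mult_right_mono power_decreasing prod_nonneg) (auto simp: G_def m0)
  also have "(\<Prod>j<n. m (\<beta> (x ! j))) = (\<Prod>j<n. m (z ! j))" using x(2) len by (intro prod.cong) auto
  finally show ?thesis .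
 qed
 have msum: "(\<Sum>z | z \<in> X & \<beta> z = z. m z) <= 1"
 proof -
  have "(\<Sum>z | z \<in> X & \<beta> z = z. m z) = (\<Sum>z\<in>{z\<in>X. \<beta> z = z}. \<Sum>x | x \<in> X & \<beta> x = z. omega x x)" by (simp add: m_def)
  also have "... = (\<Sum>x\<in>X. omega x x)" by (rule sum.group) (use finite_X base_X base_base in auto)
  finally show ?thesis using total by simp
 qed
 \<comment> \<open>A free letter meets every element of a block, at most \<open>L\<close> of them,
   so the block masses are counted at most \<open>L\<close> times.\<close>
 have msum': "(\<Sum>z\<in>X. m (\<beta> z)) <= L"
 proof -
  have "(\<Sum>z\<in>X. m (\<beta> z)) = (\<Sum>d\<in>{z\<in>X. \<beta> z = z}. \<Sum>x | x \<in> X & \<beta> x = d. m (\<beta> x))"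
   by (rule sum.group[symmetric]) (use finite_X base_X base_base in auto)
  also have "... = (\<Sum>d\<in>{z\<in>X. \<beta> z = z}. real (card {x \<in> X. \<beta> x = d}) * m d)"
   by (intro sum.cong) auto
  also have "... <= (\<Sum>d\<in>{z\<in>X. \<beta> z = z}. L * m d)"
   by (intro sum_mono mult_right_mono fibre) (auto simp: m0)
  also have "... = L * (\<Sum>d\<in>{z\<in>X. \<beta> z = z}. m d)" by (simp add: sum_distrib_left)
  also have "... <= L * 1" by (rule mult_left_mono[OF msum L])
  finally show ?thesis by simp
 qed
 have second: "(\<Sum>x\<in>G. Re (proj J u x x) * ?P x) <= \<kappa> ^ t * (\<Sum>S | S \<in> Pow {..<n} & card S <= s. L ^ card S)"
 proof -
  have "(\<Sum>x\<in>G. Re (proj J u x x) * ?P x) = (\<Sum>x\<in>G. \<Sum>k\<in>J. (cmod (u k x))\<^sup>2 * ?P x)"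
   unfolding proj_def by (intro sum.cong refl) (simp add: sum_distrib_right complex_norm_square[symmetric] del: of_real_power)
  also have "... = (\<Sum>k\<in>J. \<Sum>x\<in>G. (cmod (u k x))\<^sup>2 * ?P x)" by (rule sum.swap)
  also have "... <= (\<Sum>k\<in>J. \<kappa> ^ t * (\<Prod>j<n. m (\<beta> (snd k ! j))))"
  proof (rule sum_mono)
   fix k assume k: "k \<in> J"
   obtain S z where kz: "k = (S, z)" by force
   have zlen: "length z = n" using k J by (auto simp: kz I_def Xn_def)
   have "(\<Sum>x\<in>G. (cmod (u k x))\<^sup>2 * ?P x) <= (\<Sum>x\<in>G. (cmod (u k x))\<^sup>2 * (\<kappa> ^ t * (\<Prod>j<n. m (map \<beta> z ! j))))"
   proof (rule sum_mono)
    fix x assume x: "x \<in> G"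
    show "(cmod (u k x))\<^sup>2 * ?P x <= (cmod (u k x))\<^sup>2 * (\<kappa> ^ t * (\<Prod>j<n. m (map \<beta> z ! j)))"
    proof (cases "u k x = 0")
     case False
     then have "x \<in> B k" using us[OF k x] by blast
     then have "map \<beta> x = map \<beta> z" by (simp add: B_def kz)
     then show ?thesis using Pbound[OF x] by (intro mult_left_mono) auto
    qed simp
   qed
   also have "... = nsq G (u k) * (\<kappa> ^ t * (\<Prod>j<n. m (map \<beta> z ! j)))" by (simp add: nsq_def sum_distrib_right)
   also have "nsq G (u k) = 1" using on[OF k k] unfolding ip_self by (simp add: complex_eq_iff)
   also have "(\<Prod>j<n. m (map \<beta> z ! j)) = (\<Prod>j<n. m (\<beta> (snd k ! j)))"
    using zlen by (intro prod.cong) (auto simp: kz)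
   finally show "(\<Sum>x\<in>G. (cmod (u k x))\<^sup>2 * ?P x) <= \<kappa> ^ t * (\<Prod>j<n. m (\<beta> (snd k ! j)))" by simp
  qed
  also have "... <= (\<Sum>k\<in>I. \<kappa> ^ t * (\<Prod>j<n. m (\<beta> (snd k ! j))))"
   using J finI \<kappa> by (intro sum_mono2) (auto intro!: mult_nonneg_nonneg prod_nonneg m0)
  also have "... = \<kappa> ^ t * (\<Sum>k\<in>I. \<Prod>j<n. m (\<beta> (snd k ! j)))" by (simp add: sum_distrib_left)
  also have "(\<Sum>k\<in>I. \<Prod>j<n. m (\<beta> (snd k ! j))) = (\<Sum>S | S \<in> Pow {..<n} & card S <= s.
   \<Sum>z | z \<in> Xn & (\<forall>j<n. j \<notin> S --> \<beta> (z ! j) = z ! j). \<Prod>j<n. m (\<beta> (z ! j)))"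
  proof -
   have "I = Sigma {S \<in> Pow {..<n}. card S <= s} (%S. {z \<in> Xn. \<forall>j<n. j \<notin> S --> \<beta> (z ! j) = z ! j})"
    by (auto simp: I_def)
   then show ?thesis by (simp add: sum.Sigma finXn case_prod_unfold)
  qed
  also have "... <= (\<Sum>S | S \<in> Pow {..<n} & card S <= s. L ^ card S)"
  proof (rule sum_mono)
   fix S assume S: "S \<in> {S. S \<in> Pow {..<n} & card S <= s}"
   have "(\<Sum>z | z \<in> Xn & (\<forall>j<n. j \<notin> S --> \<beta> (z ! j) = z ! j). \<Prod>j<n. m (\<beta> (z ! j)))
    = (\<Sum>z | z \<in> Xn & (\<forall>j<n. j \<notin> S --> \<beta> (z ! j) = z ! j). \<Prod>j<n. (if j \<in> S then m (\<beta> (z ! j)) else of_bool (\<beta> (z ! j) = z ! j) * m (z ! j)))"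
    by (intro sum.cong prod.cong) auto
   also have "... <= (\<Sum>z\<in>Xn. \<Prod>j<n. (if j \<in> S then m (\<beta> (z ! j)) else of_bool (\<beta> (z ! j) = z ! j) * m (z ! j)))"
    using finXn by (intro sum_mono2) (auto intro!: prod_nonneg m0)
   also have "... = (\<Prod>j<n. \<Sum>z\<in>X. (if j \<in> S then m (\<beta> z) else of_bool (\<beta> z = z) * m z))"
    unfolding Xn_def by (rule sum_prod_lists[OF finite_X])
   also have "... <= (\<Prod>j<n. if j \<in> S then L else 1)"
   proof (intro prod_mono conjI)
    fix j
    show "0 <= (\<Sum>z\<in>X. (if j \<in> S then m (\<beta> z) else of_bool (\<beta> z = z) * m z))" by (intro sum_nonneg) (auto simp: m0)
    have "(\<Sum>z\<in>X. of_bool (\<beta> z = z) * m z) = (\<Sum>z | z \<in> X & \<beta> z = z. m z)"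
     using finite_X by (simp add: sum.inter_filter of_bool_def if_distrib[of "%a. a * b" for b] cong: if_cong)
    then show "(\<Sum>z\<in>X. (if j \<in> S then m (\<beta> z) else of_bool (\<beta> z = z) * m z)) <= (if j \<in> S then L else 1)"
     using msum msum' by auto
   qed
   also have "... = L ^ card S"
   proof -
    have "{..<n} \<inter> {j. j \<in> S} = S" using S by auto
    then show ?thesis by (simp add: prod.If_cases)
   qed
   finally show "(\<Sum>z | z \<in> Xn & (\<forall>j<n. j \<notin> S --> \<beta> (z ! j) = z ! j). \<Prod>j<n. m (\<beta> (z ! j))) <= L ^ card S" .
  qed
  finally show ?thesis using \<kappa> by (simp add: mult_left_mono)
 qed
 show ?thesis using finJ on first second by blast
qed

end

section \<open>Bob's single-use state\<close>

context roundtrip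
begin

text \<open>Rearranges the sum so that the outputs are summed first for fixed environment inputs,
  where orthogonality applies. The terms may have either sign, so summability is a hypothesis
  here.\<close>

lemma has_sum_outputs:
 fixes F :: "nat \<times> nat => nat \<times> nat \<times> nat => real"
 assumes row: "!!z. ((%y. F z y) has_sum q z) UNIV" and q: "(q has_sum Q) UNIV"
  and s: "(%(b, ((e1, e2), z)). F z (b, e1, e2)) summable_on UNIV"
 shows "((%(b, ((e1, e2), z)). F z (b, e1, e2)) has_sum Q) UNIV"
proof -
 let ?G = "%(b, ((e1, e2), z)). F z (b, e1, e2)"
 obtain T where T: "(?G has_sum T) UNIV" using s by (auto simp: summable_on_def)
 have "((%(z, y). F z y) has_sum T) UNIV"
  by (rule has_sum_bij[OF T, where i = "%(b, ((e1, e2), z)). (z, (b, e1, e2))" and j = "%(z, (b, e1, e2)). (b, ((e1, e2), z))"])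
   (auto split: prod.splits)
 then have "(q has_sum T) UNIV"
  by (intro has_sum_SigmaD[where B = "%_. UNIV" and f = "%(z, y). F z y"]) (auto simp: row)
 then have "T = Q" using q by (rule has_sum_unique)
 then show ?thesis using T by simp
qed

lemma has_sum_outputs_nonneg:
 fixes F :: "nat \<times> nat => nat \<times> nat \<times> nat => real"
 assumes row: "!!z. ((%y. F z y) has_sum q z) UNIV" and q: "(q has_sum Q) UNIV" and nn: "!!z y. F z y >= 0"
 shows "((%(b, ((e1, e2), z)). F z (b, e1, e2)) has_sum Q) UNIV"
proof -
 have "((%(z, y). F z y) has_sum Q) UNIV" by (rule has_sum_pair_nonneg[OF _ q]) (auto simp: row nn)
 then show ?thesis
  by (rule has_sum_bij[where j = "%(b, ((e1, e2), z)). (z, (b, e1, e2))" and i = "%(z, (b, e1, e2)). (b, ((e1, e2), z))"])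
   (auto split: prod.splits)
qed

definition bamp :: "nat => nat => (nat \<times> nat) \<times> (nat \<times> nat) => real"
 where "bamp s b = (%((e1, e2), (j, l)). sqrt (wt j l) * amp s j l b e1 e2)"

lemma bob_amp_eq: "NS >= 0 ==> bob_amp NS (b, i) k = sqrt (th NS i) * bamp i b k"
 by (auto simp: bob_amp_def bamp_def joint_def wt_def real_sqrt_mult mult_ac split: prod.splits)

lemma has_sum_bamp: "((%(b, k). (bamp s b k)\<^sup>2) has_sum 1) UNIV"
proof -
 have "((%(b, ((e1, e2), z)). (%(j, l) y. wt j l * (ampv (s, j, l) y * ampv (s, j, l) y)) z (b, e1, e2)) has_sum 1) UNIV"
 proof (rule has_sum_outputs_nonneg[where q = "%(j, l). wt j l"])
  show "((%y. (%(j, l) y. wt j l * (ampv (s, j, l) y * ampv (s, j, l) y)) z y) has_sum (%(j, l). wt j l) z) UNIV" for z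
   using has_sum_cmult_right[OF amp_orth[of "(s, fst z, snd z)" "(s, fst z, snd z)"], of "wt (fst z) (snd z)"]
   by (simp add: case_prod_unfold)
 qed (auto simp: has_sum_wt wt_nonneg split: prod.splits)
 then show ?thesis
  by (rule has_sum_eq_rule) (auto simp: bamp_def ampv_def power_mult_distrib wt_nonneg power2_eq_square[of "amp _ _ _ _ _ _"] split: prod.splits)
qed

lemma summable_bamp: "(%k. (bamp s b k)\<^sup>2) summable_on UNIV"
 using summable_on_SigmaD1[of "%b k. (bamp s b k)\<^sup>2" UNIV "%_. UNIV" b]
  has_sum_imp_summable[OF has_sum_bamp] by simp

text \<open>The distribution of Bob's photon number \<open>b\<close>, given \<open>s\<close> signal
  photons.\<close>

definition \<mu> :: "nat => nat => real"
 where "\<mu> s b = (\<Sum>\<^sub>\<infinity>k. (bamp s b k)\<^sup>2)"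

text \<open>The coherence between the letters \<open>(Suc b, 1)\<close> and \<open>(b, 0)\<close>,
  without the thermal weights of the signal.\<close>

definition coh :: "nat => real"
 where "coh b = (\<Sum>\<^sub>\<infinity>k. bamp 1 (Suc b) k * bamp 0 b k)"

lemma has_sum_mu: "((%k. (bamp s b k)\<^sup>2) has_sum \<mu> s b) UNIV"
 unfolding \<mu>_def by (rule has_sum_infsum[OF summable_bamp])

lemma has_sum_chi: "((%k. bamp 1 (Suc b) k * bamp 0 b k) has_sum coh b) UNIV"
 unfolding coh_def by (intro has_sum_infsum real_mult_summable summable_bamp)

lemma mu_nonneg: "\<mu> s b >= 0"
 unfolding \<mu>_def by (rule infsum_nonneg) simp

lemma sum_mu: "(\<mu> s has_sum 1) UNIV"
 by (rule has_sum_SigmaD[where B = "%_. UNIV" and f = "%(b, k). (bamp s b k)\<^sup>2"])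
  (use has_sum_bamp has_sum_mu in auto)

lemma mu_0_pos: "\<mu> 0 b > 0"
proof -
 have "amp 0 0 b b 0 0 > 0" using bs_column_0_pos[of b 0] bs_column_0_pos[of 0 0] by (simp add: amp_def)
 then have "bamp 0 b ((0, 0), (0, b)) > 0" unfolding bamp_def wt_def using NB1_pos NB2_pos by (simp add: th_pos)
 then have "0 < (\<Sum>k\<in>{((0, 0), (0, b))}. (bamp 0 b k)\<^sup>2)" by simp
 also have "... <= \<mu> 0 b" by (rule finite_sum_le_has_sum[OF has_sum_mu]) auto
 finally show ?thesis .
qed

lemma chi_sq_le: "(coh b)\<^sup>2 <= \<mu> 1 (Suc b) * \<mu> 0 b"
proof -
 have "\<bar>coh b\<bar> <= (\<Sum>\<^sub>\<infinity>k. \<bar>bamp 1 (Suc b) k\<bar> * \<bar>bamp 0 b k\<bar>)"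
  using norm_infsum_bound[of "%k. bamp 1 (Suc b) k * bamp 0 b k" UNIV]
   infsum_Cauchy_Schwarz(1)[OF has_sum_mu[of 1 "Suc b"] has_sum_mu[of 0 b]] by (simp add: coh_def abs_mult)
 also note infsum_Cauchy_Schwarz(2)[OF has_sum_mu[of 1 "Suc b"] has_sum_mu[of 0 b]]
 finally have "\<bar>coh b\<bar>\<^sup>2 <= (sqrt (\<mu> 1 (Suc b)) * sqrt (\<mu> 0 b))\<^sup>2" by (rule power_mono) simp
 then show ?thesis by (simp add: power_mult_distrib mu_nonneg)
qed

lemma bob_mtx_diag: "NS >= 0 ==> bob_mtx NS (b, i) (b, i) = th NS i * \<mu> i b"
proof -
 assume NS: "NS >= 0"
 have "((%k. bob_amp NS (b, i) k * bob_amp NS (b, i) k) has_sum th NS i * \<mu> i b) UNIV"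
  by (rule has_sum_eq_rule[OF has_sum_cmult_right[OF has_sum_mu]])
   (use NS in \<open>auto simp: bob_amp_eq th_nonneg power2_eq_square\<close>)
 from has_sum_unique[OF has_sum_bob_mtx[OF NS] this] show ?thesis .
qed

lemma bob_mtx_off: "NS >= 0 ==> bob_mtx NS (Suc b, 1) (b, 0) = sqrt (th NS 1 * th NS 0) * coh b"
proof -
 assume NS: "NS >= 0"
 have "((%k. bob_amp NS (Suc b, 1) k * bob_amp NS (b, 0) k) has_sum sqrt (th NS 1 * th NS 0) * coh b) UNIV"
  by (rule has_sum_eq_rule[OF has_sum_cmult_right[OF has_sum_chi[of b], of "sqrt (th NS 1 * th NS 0)"]])
   (use NS in \<open>auto simp: bob_amp_eq real_sqrt_mult mult_ac\<close>)
 from has_sum_unique[OF has_sum_bob_mtx[OF NS] this] show ?thesis .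
qed

text \<open>The mean number of environment photons that reach Bob.\<close>

definition N_eff :: real
 where "N_eff = (1 - \<eta>) * \<eta> * NB1 + (1 - \<eta>) * NB2"

lemma N_eff_nonneg: "N_eff >= 0"
 unfolding N_eff_def using eta_pos eta_less_1 NB1_pos NB2_pos by simp

lemma N_eff_eq: "N_eff = \<rho>^2 * \<tau>^2 * NB1 + \<rho>^2 * NB2"
proof -
 have r: "\<rho>^2 = 1 - \<eta>" and t: "\<tau>^2 = \<eta>" using rho_sq tau_sq by (auto simp: power2_eq_square)
 show ?thesis unfolding N_eff_def r t by simp
qed

lemma annihilated_norm:
 "((%y. (%(b, e1, e2). (sqrt (real (Suc b)) * amp s j l (Suc b) e1 e2)\<^sup>2) y) has_sum
  (\<eta>^2 * real s + \<rho>^2 * \<tau>^2 * real j + \<rho>^2 * real l)) UNIV"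
proof -
 define c where "c a = (if a = (0::nat) then \<eta> * sqrt (real s) else if a = 1 then \<rho> * \<tau> * sqrt (real j) else \<rho> * sqrt (real l))" for a
 define z where "z a = (if a = (0::nat) then (s - 1, j, l) else if a = 1 then (s, j - 1, l) else (s, j, l - 1))" for a
 have "((%y. (\<Sum>a\<in>{0, 1, 2}. c a * ampv (z a) y)\<^sup>2) has_sum (\<Sum>a\<in>{0, 1, 2}. (c a)\<^sup>2)) UNIV"
  by (rule combination_norm) (auto simp: c_def z_def split: if_splits)
 then show ?thesis
 proof (rule has_sum_eq_rule)
  fix y :: "nat \<times> nat \<times> nat"
  obtain b e1 e2 where y: "y = (b, e1, e2)" by (metis prod_cases3)
  show "(\<Sum>a\<in>{0, 1, 2}. c a * ampv (z a) y)\<^sup>2 = (%(b, e1, e2). (sqrt (real (Suc b)) * amp s j l (Suc b) e1 e2)\<^sup>2) y"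
   unfolding y prod.case amp_annihilate_b by (simp add: c_def z_def ampv_def add.assoc)
 next
  show "(\<Sum>a\<in>{0, 1, 2}. (c a)\<^sup>2) = \<eta>^2 * real s + \<rho>^2 * \<tau>^2 * real j + \<rho>^2 * real l"
   by (simp add: c_def power_mult_distrib)
 qed
qed

text \<open>The sum is Bob's mean photon number: Pythagoras for the annihilated amplitude, then the
  means of the two thermal inputs.\<close>

lemma has_sum_annihilated:
 "((%(b, k). real (Suc b) * (bamp s (Suc b) k)\<^sup>2) has_sum (\<eta>^2 * real s + N_eff)) UNIV"
proof -
 have "((%(b, ((e1, e2), z)). (%(j, l) y. wt j l * (%(b, e1, e2). (sqrt (real (Suc b)) * amp s j l (Suc b) e1 e2)\<^sup>2) y) z (b, e1, e2))
  has_sum (\<eta>^2 * real s + N_eff)) UNIV"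
 proof (rule has_sum_outputs_nonneg[where q = "%(j, l). wt j l * (\<eta>^2 * real s + \<rho>^2 * \<tau>^2 * real j + \<rho>^2 * real l)"])
  fix z :: "nat \<times> nat"
  obtain j l where z: "z = (j, l)" by force
  show "((%y. (%(j, l) y. wt j l * (%(b, e1, e2). (sqrt (real (Suc b)) * amp s j l (Suc b) e1 e2)\<^sup>2) y) z y)
   has_sum (%(j, l). wt j l * (\<eta>^2 * real s + \<rho>^2 * \<tau>^2 * real j + \<rho>^2 * real l)) z) UNIV"
   unfolding z prod.case by (intro has_sum_cmult_right annihilated_norm)
 next
  show "((%(j, l). wt j l * (\<eta>^2 * real s + \<rho>^2 * \<tau>^2 * real j + \<rho>^2 * real l)) has_sum (\<eta>^2 * real s + N_eff)) UNIV"
   by (rule has_sum_eq_rule[OF has_sum_wt_poly[of "\<eta>^2 * real s" "\<rho>^2 * \<tau>^2" "\<rho>^2" 0 0 0]]) (auto simp: N_eff_eq)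
 qed (auto simp: wt_nonneg split: prod.splits)
 then show ?thesis by (rule has_sum_eq_rule) (auto simp: bamp_def power_mult_distrib wt_nonneg split: prod.splits)
qed

lemma sum_Suc_mu: "((%b. real (Suc b) * \<mu> 0 b) has_sum (1 + N_eff)) UNIV"
proof -
 have "((%b. real (Suc b) * \<mu> 0 (Suc b)) has_sum N_eff) UNIV"
  by (rule has_sum_SigmaD[where B = "%_. UNIV" and f = "%(b, k). real (Suc b) * (bamp 0 (Suc b) k)\<^sup>2"])
   (use has_sum_annihilated[of 0] in \<open>auto intro!: has_sum_cmult_right has_sum_mu simp del: of_nat_Suc\<close>)
 then have "((%b. real b * \<mu> 0 b) has_sum N_eff) (range Suc)" by (subst has_sum_reindex) (auto simp: o_def)
 then have "((%b. real b * \<mu> 0 b) has_sum N_eff) UNIV"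
 proof (rule has_sum_cong_neutral[THEN iffD1, rotated -1])
  show "real b * \<mu> 0 b = 0" if "b \<in> UNIV - range Suc" for b using that by (cases b) auto
 qed auto
 from has_sum_add[OF sum_mu[of 0] this] show ?thesis by (rule has_sum_eq_rule) (auto simp: algebra_simps)
qed

text \<open>Annihilating a photon at Bob's output gives three terms; orthogonality to the
  vacuum-signal amplitudes leaves only the signal term, with coefficient
  \<open>\<eta>\<close>.\<close>

lemma sum_chi: "((%b. sqrt (real (Suc b)) * coh b) has_sum \<eta>) UNIV"
proof -
 define F where "F = (%(j, l) y. wt j l * (%(b, e1, e2). sqrt (real (Suc b)) * amp 1 j l (Suc b) e1 e2 * amp 0 j l b e1 e2) y)"
 have F_eq: "F z (b, e1, e2) = sqrt (real (Suc b)) * bamp 1 (Suc b) ((e1, e2), z) * bamp 0 b ((e1, e2), z)" for b e1 e2 z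
 proof -
  obtain j l where z: "z = (j, l)" by force
  have "sqrt (wt j l) * sqrt (wt j l) = wt j l" using wt_nonneg by simp
  then show ?thesis unfolding z F_def bamp_def prod.case by (simp add: algebra_simps)
 qed
 have "((%(b, ((e1, e2), z)). F z (b, e1, e2)) has_sum \<eta>) UNIV"
 proof (rule has_sum_outputs[where q = "%(j, l). wt j l * \<eta>"])
  fix z :: "nat \<times> nat"
  obtain j l where z: "z = (j, l)" by force
  have "((%y. \<eta> * (ampv (0, j, l) y * ampv (0, j, l) y) + \<rho> * \<tau> * sqrt (real j) * (ampv (1, j - 1, l) y * ampv (0, j, l) y)
    + \<rho> * sqrt (real l) * (ampv (1, j, l - 1) y * ampv (0, j, l) y)) has_sum
   (\<eta> * of_bool ((0, j, l) = (0 :: nat, j, l)) + \<rho> * \<tau> * sqrt (real j) * of_bool ((1 :: nat, j - 1, l) = (0, j, l))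
    + \<rho> * sqrt (real l) * of_bool ((1 :: nat, j, l - 1) = (0, j, l)))) UNIV"
   by (intro has_sum_add has_sum_cmult_right amp_orth)
  then have "((%y. (%(b, e1, e2). sqrt (real (Suc b)) * amp 1 j l (Suc b) e1 e2 * amp 0 j l b e1 e2) y) has_sum \<eta>) UNIV"
  proof (rule has_sum_eq_rule)
   fix y :: "nat \<times> nat \<times> nat"
   obtain b e1 e2 where y: "y = (b, e1, e2)" by (metis prod_cases3)
   show "\<eta> * (ampv (0, j, l) y * ampv (0, j, l) y) + \<rho> * \<tau> * sqrt (real j) * (ampv (1, j - 1, l) y * ampv (0, j, l) y)
    + \<rho> * sqrt (real l) * (ampv (1, j, l - 1) y * ampv (0, j, l) y)
    = (%(b, e1, e2). sqrt (real (Suc b)) * amp 1 j l (Suc b) e1 e2 * amp 0 j l b e1 e2) y"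
    unfolding y prod.case amp_annihilate_b by (simp add: ampv_def algebra_simps)
  qed auto
  then show "((%y. F z y) has_sum (%(j, l). wt j l * \<eta>) z) UNIV"
   unfolding z F_def prod.case by (rule has_sum_cmult_right)
 next
  show "((%(j, l). wt j l * \<eta>) has_sum \<eta>) UNIV"
   by (rule has_sum_eq_rule[OF has_sum_cmult_left[OF has_sum_wt, of \<eta>]]) auto
 next
  have a: "(%x. ((%(b, k). sqrt (real (Suc b)) * bamp 1 (Suc b) k) x)\<^sup>2) summable_on UNIV"
   by (rule has_sum_imp_summable, rule has_sum_eq_rule[OF has_sum_annihilated[of 1]]) (auto simp: power_mult_distrib)
  have b: "(%x. ((%(b, k). bamp 0 b k) x)\<^sup>2) summable_on UNIV"
   by (rule has_sum_imp_summable, rule has_sum_eq_rule[OF has_sum_bamp[of 0]]) auto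
  show "(%(b, (e1, e2), z). F z (b, e1, e2)) summable_on UNIV" using real_mult_summable[OF a b]
   by (rule summable_on_cong[THEN iffD1, rotated]) (auto simp: F_eq)
 qed
 then have "((%(b, k). sqrt (real (Suc b)) * (bamp 1 (Suc b) k * bamp 0 b k)) has_sum \<eta>) UNIV"
  by (rule has_sum_eq_rule) (auto simp: F_eq)
 then show ?thesis
  by (intro has_sum_SigmaD[where B = "%_. UNIV" and f = "%(b, k). sqrt (real (Suc b)) * (bamp 1 (Suc b) k * bamp 0 b k)"])
   (auto intro!: has_sum_cmult_right has_sum_chi simp del: of_nat_Suc One_nat_def)
qed

lemma sum_mu_Suc: "((%b. \<mu> 1 (Suc b)) has_sum (1 - \<mu> 1 0)) UNIV"
proof -
 have "((%b. \<mu> 1 b) has_sum 1 - \<mu> 1 0) (UNIV - {0})"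
  using has_sum_Diff[OF sum_mu[of 1] has_sum_finite[of "{0}" "\<mu> 1"]] by simp
 also have "UNIV - {0} = range Suc" by (auto simp: image_iff) (metis not0_implies_Suc)
 finally show ?thesis by (subst (asm) has_sum_reindex) (auto simp: o_def)
qed

text \<open>The fraction of the block-one weight that is coherent with the vacuum idler.\<close>

lemma chi_ratio_sum:
 assumes "!!b. (coh b)\<^sup>2 / \<mu> 0 b = c b"
 shows "\<exists>s. (c has_sum s) UNIV & s >= \<eta>^2 / (1 + N_eff) & s <= 1 - \<mu> 1 0"
proof -
 have c0: "c b >= 0" for b unfolding assms[symmetric] by (simp add: mu_nonneg)
 have cm: "c b <= \<mu> 1 (Suc b)" for b
  unfolding assms[symmetric] using chi_sq_le[of b] mu_0_pos[of b] by (simp add: field_simps)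
 note m1 = sum_mu_Suc
 have cs: "c summable_on UNIV"
  by (rule summable_on_comparison_test[OF has_sum_imp_summable[OF m1]]) (use cm c0 in auto)
 define s where "s = infsum c UNIV"
 have hs: "(c has_sum s) UNIV" unfolding s_def using cs by simp
 have "((%b. (sqrt (c b))\<^sup>2) has_sum s) UNIV" using hs c0 by simp
 note 1 = this
 have 2: "((%b. (sqrt (real (Suc b) * \<mu> 0 b))\<^sup>2) has_sum (1 + N_eff)) UNIV"
  using sum_Suc_mu mu_nonneg by (simp del: of_nat_Suc)
 have prod: "\<bar>sqrt (c b)\<bar> * \<bar>sqrt (real (Suc b) * \<mu> 0 b)\<bar> = \<bar>sqrt (real (Suc b)) * coh b\<bar>" for b
 proof -
  have "sqrt (c b) = \<bar>coh b\<bar> / sqrt (\<mu> 0 b)" unfolding assms[symmetric] by (simp add: real_sqrt_divide)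
  then show ?thesis using mu_0_pos[of b] by (simp add: real_sqrt_mult abs_mult del: of_nat_Suc)
 qed
 \<comment> \<open>The coherences are split as \<open>coh b / sqrt (\<mu> 0 b)\<close> times
   \<open>sqrt (\<mu> 0 b)\<close>. With the weights \<open>sqrt (real (Suc b))\<close> the second
   factors have squared norm \<open>1 + N_eff\<close>.\<close>
 have "\<eta> <= (\<Sum>\<^sub>\<infinity>b. \<bar>sqrt (c b)\<bar> * \<bar>sqrt (real (Suc b) * \<mu> 0 b)\<bar>)"
  using norm_infsum_bound[of "%b. sqrt (real (Suc b)) * coh b" UNIV] infsum_Cauchy_Schwarz(1)[OF 1 2] eta_pos
  unfolding prod by (simp add: infsumI[OF sum_chi] del: of_nat_Suc)
 also have "... <= sqrt s * sqrt (1 + N_eff)" by (rule infsum_Cauchy_Schwarz(2)[OF 1 2])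
 finally have "\<eta>^2 <= (sqrt s * sqrt (1 + N_eff))\<^sup>2" using eta_pos by (intro power_mono) auto
 also have "... = s * (1 + N_eff)" using N_eff_nonneg has_sum_nonneg[OF hs c0] by (simp add: power_mult_distrib)
 finally have "s >= \<eta>^2 / (1 + N_eff)" using N_eff_nonneg by (simp add: field_simps)
 moreover have "s <= 1 - \<mu> 1 0" using has_sum_mono[OF hs m1] cm by simp
 ultimately show ?thesis using hs by blast
qed

section \<open>Rank-one part and remainder of Bob's state\<close>

text \<open>The lowest letter of the block with constant \<open>b - i\<close>; truncated subtraction
  makes at least one component zero.\<close>

definition base :: "nat \<times> nat => nat \<times> nat"
 where "base = (%(b, i). (b - i, i - b))"

lemma base_base: "base (base x) = base x"
 by (cases x) (auto simp: base_def)

lemma bob_mtx_block: "base x ~= base y ==> bob_mtx NS x y = 0"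
 by (cases x; cases y) (auto simp: base_def intro!: bob_mtx_support)

text \<open>Scaled so that, when the base entry is positive, the rank-one part reproduces the row
  and column of the base letter in the block.\<close>

definition bvec :: "real => nat \<times> nat => real"
 where "bvec NS x = bob_mtx NS x (base x) / sqrt (bob_mtx NS (base x) (base x))"

definition brem :: "real => nat \<times> nat => nat \<times> nat => real"
 where "brem NS x y = bob_mtx NS x y - of_bool (base x = base y) * (bvec NS x * bvec NS y)"

text \<open>The Schur complement of the base entry of each block.\<close>

lemma positive_brem:
 assumes NS: "NS >= 0"
 shows "positive_mtx (%x y. cr (brem NS x y))"
proof (rule positive_mtx_ensemble)
 define c where "c x = bob_mtx NS x (base x) / bob_mtx NS (base x) (base x)" for x
 \<comment> \<open>The amplitude at \<open>x\<close> minus its projection on the amplitude at the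
   base letter; the Gram matrix of these residuals is the Schur complement.\<close>
 define \<psi> where "\<psi> k x = bob_amp NS x k - c x * bob_amp NS (base x) k" for k x
 have "((%k. \<psi> k x * \<psi> k y) has_sum brem NS x y) UNIV" for x y
 proof -
  have s: "((%k. bob_amp NS x k * bob_amp NS y k + (- c x) * (bob_amp NS (base x) k * bob_amp NS y k)
    + (- c y) * (bob_amp NS x k * bob_amp NS (base y) k) + (c x * c y) * (bob_amp NS (base x) k * bob_amp NS (base y) k))
   has_sum (bob_mtx NS x y + (- c x) * bob_mtx NS (base x) y + (- c y) * bob_mtx NS x (base y)
    + (c x * c y) * bob_mtx NS (base x) (base y))) UNIV" by (intro has_sum_add has_sum_cmult_right has_sum_bob_mtx NS)
  have v: "bob_mtx NS x y + (- c x) * bob_mtx NS (base x) y + (- c y) * bob_mtx NS x (base y)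
    + (c x * c y) * bob_mtx NS (base x) (base y) = brem NS x y"
  proof (cases "base x = base y")
   case True
   define z where "z = base x"
   have z: "base y = z" using True by (simp add: z_def)
   define w where "w = bob_mtx NS z z"
   have w0: "w >= 0" unfolding w_def by (rule bob_mtx_nonneg)
   show ?thesis
   \<comment> \<open>For a vanishing base entry \<open>c\<close> and \<open>bvec\<close> are zero by
     the convention for division.\<close>
   proof (cases "w = 0")
    case True
    then show ?thesis by (simp add: c_def brem_def bvec_def z z_def[symmetric] w_def[symmetric])
   next
    case False
    have "bvec NS x * bvec NS y = bob_mtx NS x z * bob_mtx NS y z / w"
     using w0 by (simp add: bvec_def z z_def[symmetric] w_def[symmetric])
    moreover have "bob_mtx NS z y = bob_mtx NS y z" by (rule bob_mtx_sym)
    ultimately show ?thesis using False by (simp add: c_def brem_def z z_def[symmetric] w_def[symmetric] field_simps)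
   qed
  next
   case False
   then have "bob_mtx NS x y = 0" "bob_mtx NS (base x) y = 0" "bob_mtx NS x (base y) = 0" "bob_mtx NS (base x) (base y) = 0"
    by (auto intro!: bob_mtx_block simp: base_base)
   then show ?thesis using False by (simp add: brem_def)
  qed
  show ?thesis by (rule has_sum_eq_rule[OF s _ v]) (simp add: \<psi>_def algebra_simps)
 qed
 note hs = this
 show "cr (brem NS x y) = (\<Sum>\<^sub>\<infinity>k. cr (\<psi> k x) * cnj (cr (\<psi> k y)))" for x y
  using infsumI[OF has_sum_of_real[OF hs[of x y], where 'a = complex]] by simp
 show "(%k. (cmod (cr (\<psi> k x)))\<^sup>2) summable_on UNIV" for x
  using has_sum_imp_summable[OF hs[of x x]] by (simp add: power2_eq_square)
qed

end

section \<open>Tail bounds for the test\<close>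

lemma exp_minus_ge: "1 - exp (- l) >= l - l^2" if "0 <= l" for l :: real
proof -
 have "exp (- l) = 1 / exp l" by (simp add: exp_minus field_simps)
 also have "... <= 1 / (1 + l)" using that exp_ge_add_one_self[of l] by (intro divide_left_mono) auto
 also have "... <= 1 - l + l^2"
 proof -
  have "1 <= (1 - l + l^2) * (1 + l)"
  proof -
   have "(1 - l + l^2) * (1 + l) = 1 + l ^ 3" by (simp add: algebra_simps power2_eq_square power3_eq_cube)
   then show ?thesis using that by simp
  qed
  then show ?thesis using that by (simp add: field_simps)
 qed
 finally show ?thesis by simp
qed

text \<open>A Chernoff bound for weights of total at most 1: every letter in \<open>Sp\<close> is
  tilted by \<open>exp (- l)\<close>.\<close>

lemma lower_tail_bound:
 fixes p :: "'a => real" and \<tau> l :: real and X Sp :: "'a set"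
 assumes "finite X" "!!x. p x >= 0" "(\<Sum>x\<in>X. p x) <= 1" "l >= 0"
 defines "ps \<equiv> (\<Sum>x\<in>X \<inter> Sp. p x)"
 shows "(\<Sum>xs | (set xs \<subseteq> X & length xs = n) & real (card {j. j < n & xs ! j \<in> Sp}) < \<tau>. \<Prod>j<n. p (xs ! j))
  <= exp (l * \<tau> - real n * ps * (1 - exp (- l)))"
proof -
 let ?Xn = "{xs. set xs \<subseteq> X & length xs = n}"
 define w where "w x = (if x \<in> Sp then exp (- l) else 1)" for x
 have fin: "finite ?Xn" by (rule finite_lists_length_eq[OF assms(1)])
 have "(\<Sum>xs | xs \<in> ?Xn & real (card {j. j < n & xs ! j \<in> Sp}) < \<tau>. \<Prod>j<n. p (xs ! j))
  <= (\<Sum>xs | xs \<in> ?Xn & real (card {j. j < n & xs ! j \<in> Sp}) < \<tau>. exp (l * \<tau>) * (\<Prod>j<n. p (xs ! j) * w (xs ! j)))"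
 proof (rule sum_mono)
  fix xs assume "xs \<in> {xs. xs \<in> ?Xn & real (card {j. j < n & xs ! j \<in> Sp}) < \<tau>}"
  then have c: "real (card {j. j < n & xs ! j \<in> Sp}) < \<tau>" by simp
  have e: "{..<n} \<inter> {j. xs ! j \<in> Sp} = {j. j < n & xs ! j \<in> Sp}" by auto
  have "(\<Prod>j<n. w (xs ! j)) = exp (- l) ^ card {j. j < n & xs ! j \<in> Sp}" by (simp add: w_def prod.If_cases e)
  also have "... = exp (- (l * real (card {j. j < n & xs ! j \<in> Sp})))"
   by (simp add: exp_of_nat_mult[symmetric] mult.commute)
  finally have "exp (l * \<tau>) * (\<Prod>j<n. w (xs ! j)) = exp (l * (\<tau> - real (card {j. j < n & xs ! j \<in> Sp})))"
   by (simp add: exp_add[symmetric] algebra_simps)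
  also have "... >= 1" using c assms(4) by simp
  finally have "1 <= exp (l * \<tau>) * (\<Prod>j<n. w (xs ! j))" .
  then have "(\<Prod>j<n. p (xs ! j)) * 1 <= (\<Prod>j<n. p (xs ! j)) * (exp (l * \<tau>) * (\<Prod>j<n. w (xs ! j)))"
   using assms(2) by (intro mult_left_mono prod_nonneg) auto
  then show "(\<Prod>j<n. p (xs ! j)) <= exp (l * \<tau>) * (\<Prod>j<n. p (xs ! j) * w (xs ! j))"
   by (simp add: prod.distrib mult_ac)
 qed
 also have "... <= (\<Sum>xs\<in>?Xn. exp (l * \<tau>) * (\<Prod>j<n. p (xs ! j) * w (xs ! j)))"
  using fin assms(2) by (intro sum_mono2) (auto intro!: mult_nonneg_nonneg prod_nonneg simp: w_def)
 also have "... = exp (l * \<tau>) * (\<Prod>j<n. \<Sum>x\<in>X. p x * w x)"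
  using sum_prod_lists[OF assms(1), of "%_ x. p x * w x" n] by (simp add: sum_distrib_left[symmetric])
 also have "... = exp (l * \<tau>) * (\<Sum>x\<in>X. p x * w x) ^ n" by simp
 also have "... <= exp (l * \<tau>) * exp (- (ps * (1 - exp (- l)))) ^ n"
 proof (intro mult_left_mono power_mono)
  have "(\<Sum>x\<in>X. p x * w x) = (\<Sum>x\<in>X. p x - (if x \<in> Sp then p x * (1 - exp (- l)) else 0))"
   by (intro sum.cong) (auto simp: w_def algebra_simps)
  also have "... = (\<Sum>x\<in>X. p x) - ps * (1 - exp (- l))"
   using assms(1) by (simp add: sum_subtractf ps_def sum.inter_restrict[symmetric] sum_distrib_right)
  also have "... <= 1 + (- (ps * (1 - exp (- l))))" using assms(3) by simp
  also have "... <= exp (- (ps * (1 - exp (- l))))" by (rule exp_ge_add_one_self)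
  finally show "(\<Sum>x\<in>X. p x * w x) <= exp (- (ps * (1 - exp (- l))))" .
  show "0 <= (\<Sum>x\<in>X. p x * w x)" using assms(2) by (intro sum_nonneg) (auto simp: w_def)
 qed simp
 also have "... = exp (l * \<tau> - real n * ps * (1 - exp (- l)))"
  by (simp add: exp_of_nat_mult[symmetric] exp_add[symmetric] algebra_simps)
 finally show ?thesis by simp
qed

lemma upper_tail_bound:
 fixes r \<sigma> l :: real
 assumes r: "0 <= r" "r <= 1" and l: "l >= 0"
 shows "(\<Sum>S | S \<in> Pow {..<n} & \<sigma> < real (card S). \<Prod>j<n. if j \<in> S then r else 1 - r)
  <= exp (real n * r * (exp l - 1) - l * \<sigma>)"
proof -
 have "(\<Sum>S | S \<in> Pow {..<n} & \<sigma> < real (card S). \<Prod>j<n. if j \<in> S then r else 1 - r)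
  <= (\<Sum>S | S \<in> Pow {..<n} & \<sigma> < real (card S). exp (- (l * \<sigma>)) * (\<Prod>j<n. if j \<in> S then r * exp l else 1 - r))"
 proof (rule sum_mono)
  fix S assume "S \<in> {S. S \<in> Pow {..<n} & \<sigma> < real (card S)}"
  then have S: "S \<subseteq> {..<n}" "\<sigma> < real (card S)" by auto
  have e: "{..<n} \<inter> S = S" using S by auto
  have "(\<Prod>j<n. if j \<in> S then exp l else 1) = exp l ^ card S" by (simp add: prod.If_cases e)
  also have "... = exp (l * real (card S))" by (simp add: exp_of_nat_mult[symmetric] mult.commute)
  finally have "exp (- (l * \<sigma>)) * (\<Prod>j<n. if j \<in> S then exp l else 1) = exp (l * (real (card S) - \<sigma>))"
   by (simp add: exp_add[symmetric] algebra_simps)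
  also have "... >= 1" using S l by simp
  finally have "1 <= exp (- (l * \<sigma>)) * (\<Prod>j<n. if j \<in> S then exp l else 1)" .
  then have "(\<Prod>j<n. if j \<in> S then r else 1 - r) * 1
   <= (\<Prod>j<n. if j \<in> S then r else 1 - r) * (exp (- (l * \<sigma>)) * (\<Prod>j<n. if j \<in> S then exp l else 1))"
   using r by (intro mult_left_mono prod_nonneg) auto
  also have "... = exp (- (l * \<sigma>)) * (\<Prod>j<n. (if j \<in> S then r else 1 - r) * (if j \<in> S then exp l else 1))"
   by (simp add: prod.distrib mult_ac)
  also have "(\<Prod>j<n. (if j \<in> S then r else 1 - r) * (if j \<in> S then exp l else 1)) = (\<Prod>j<n. if j \<in> S then r * exp l else 1 - r)"
   by (intro prod.cong) auto
  finally show "(\<Prod>j<n. if j \<in> S then r else 1 - r) <= exp (- (l * \<sigma>)) * (\<Prod>j<n. if j \<in> S then r * exp l else 1 - r)" by simp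
 qed
 also have "... <= (\<Sum>S\<in>Pow {..<n}. exp (- (l * \<sigma>)) * (\<Prod>j<n. if j \<in> S then r * exp l else 1 - r))"
  using r by (intro sum_mono2) (auto intro!: mult_nonneg_nonneg prod_nonneg)
 also have "... = exp (- (l * \<sigma>)) * (\<Prod>j<n. r * exp l + (1 - r))"
  using prod_add_subsets[of "%_. r * exp l" "%_. 1 - r" n] by (simp add: sum_distrib_left[symmetric])
 also have "... = exp (- (l * \<sigma>)) * (1 + r * (exp l - 1)) ^ n" by (simp add: algebra_simps)
 also have "... <= exp (- (l * \<sigma>)) * exp (r * (exp l - 1)) ^ n"
  using r l by (intro mult_left_mono power_mono exp_ge_add_one_self) (auto intro!: add_nonneg_nonneg mult_nonneg_nonneg)
 also have "... = exp (real n * r * (exp l - 1) - l * \<sigma>)"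
  by (simp add: exp_of_nat_mult[symmetric] exp_add[symmetric] algebra_simps)
 finally show ?thesis .
qed

text \<open>Tilting with \<open>x <= 1\<close>, where \<open>x ^ s <= x ^ card S\<close> bounds the
  indicator of small sets. The application takes \<open>x = NS\<close>, so an exceptional position
  costs a factor \<open>1 / NS\<close>.\<close>

lemma small_subset_count:
 fixes L x :: real
 assumes x: "0 < x" "x <= 1" and L: "L >= 0"
 shows "(\<Sum>S | S \<in> Pow {..<n} & card S <= s. L ^ card S) <= exp (real n * L * x) / x ^ s"
proof -
 have "(\<Sum>S | S \<in> Pow {..<n} & card S <= s. L ^ card S) <= (\<Sum>S | S \<in> Pow {..<n} & card S <= s. (L * x) ^ card S / x ^ s)"
 proof (rule sum_mono)
  fix S assume "S \<in> {S. S \<in> Pow {..<n} & card S <= s}"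
  then have "x ^ s <= x ^ card S" using x by (intro power_decreasing) auto
  then have "L ^ card S * x ^ s <= (L * x) ^ card S"
   unfolding power_mult_distrib using L by (intro mult_left_mono) auto
  then show "L ^ card S <= (L * x) ^ card S / x ^ s" using x by (simp add: field_simps)
 qed
 also have "... <= (\<Sum>S\<in>Pow {..<n}. (L * x) ^ card S / x ^ s)" using x L by (intro sum_mono2) auto
 also have "... = (\<Sum>S\<in>Pow {..<n}. \<Prod>j<n. if j \<in> S then L * x else 1) / x ^ s"
 proof -
  have "(\<Prod>j<n. if j \<in> S then L * x else 1) = (L * x) ^ card S" if "S \<in> Pow {..<n}" for S
  proof -
   have "{..<n} \<inter> S = S" using that by auto
   then show ?thesis by (simp add: prod.If_cases)
  qed
  then show ?thesis by (simp add: sum_divide_distrib)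
 qed
 also have "(\<Sum>S\<in>Pow {..<n}. \<Prod>j<n. if j \<in> S then L * x else 1) = (\<Prod>j<n. L * x + 1)"
  by (rule prod_add_subsets[symmetric])
 also have "... = (1 + L * x) ^ n" by (simp add: add.commute)
 also have "... <= exp (L * x) ^ n" using x L by (intro power_mono exp_ge_add_one_self) auto
 also have "... = exp (real n * L * x)" by (simp add: exp_of_nat_mult[symmetric] mult_ac)
 finally show ?thesis using x by (simp add: divide_right_mono)
qed

section \<open>The test for Bob's product state\<close>

context roundtrip
begin

text \<open>The lower bound of \<open>chi_ratio_sum\<close> for the coherent part of the one-photon
  weight; it becomes the exponent per signal photon in units of \<open>ln (1 / NS)\<close>.\<close>

definition rate :: real
 where "rate = \<eta>^2 / (1 + N_eff)"

lemma brem_level_0: "NS > 0 ==> brem NS (b, 0) (b, 0) = 0"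
proof -
 assume NS: "NS > 0"
 have "bob_mtx NS (b, 0) (b, 0) > 0" using NS mu_0_pos[of b] by (simp add: bob_mtx_diag th_pos)
 then show ?thesis by (simp add: brem_def bvec_def base_def)
qed

lemma brem_level_1_0: "brem NS (0, 1) (0, 1) = 0"
 using bob_mtx_nonneg[of NS "(0, 1)"] by (simp add: brem_def bvec_def base_def)

lemma brem_level_1: 
 assumes NS: "NS > 0"
 shows "brem NS (Suc b, 1) (Suc b, 1) = th NS 1 * (\<mu> 1 (Suc b) - (coh b)\<^sup>2 / \<mu> 0 b)"
proof -
 have "bvec NS (Suc b, 1) = sqrt (th NS 1 * th NS 0) * coh b / sqrt (th NS 0 * \<mu> 0 b)"
  using NS bob_mtx_off[of NS b] bob_mtx_diag[of NS b 0] by (simp add: bvec_def base_def)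
 then have "(bvec NS (Suc b, 1))\<^sup>2 = th NS 1 * th NS 0 * (coh b)\<^sup>2 / (th NS 0 * \<mu> 0 b)"
  using NS mu_nonneg[of 0 b] by (simp add: power_divide power_mult_distrib th_nonneg)
 also have "... = th NS 1 * ((coh b)\<^sup>2 / \<mu> 0 b)" using th_pos[OF NS, of 0] by simp
 finally show ?thesis using NS bob_mtx_diag[of NS "Suc b" 1] by (simp add: brem_def power2_eq_square algebra_simps)
qed

lemma brem_nonneg: "NS >= 0 ==> brem NS x x >= 0"
 using positive_mtx_diag[OF positive_brem, of NS x] by simp

lemma brem_le: "brem NS x x <= bob_mtx NS x x"
 by (simp add: brem_def)

text \<open>Letters with idler number 0, and the letter \<open>(0, 1)\<close>, are their own base
  and have no remainder. The other letters with idler number 1 keep their incoherent part, and idler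
  number 2 is estimated by its full second-order weight.\<close>

lemma sum_brem_le:
 assumes NS: "NS > 0" and s: "((%b. (coh b)\<^sup>2 / \<mu> 0 b) has_sum q) UNIV"
 shows "(\<Sum>x\<in>{..m} \<times> {..2}. brem NS x x) <= th NS 1 * (1 - \<mu> 1 0 - q) + th NS 2"
proof -
 have "(\<Sum>x\<in>{..m} \<times> {..2}. brem NS x x) = (\<Sum>b\<le>m. \<Sum>i\<le>2. brem NS (b, i) (b, i))"
  by (simp add: sum.cartesian_product)
 also have "... = (\<Sum>b\<le>m. brem NS (b, 0) (b, 0) + brem NS (b, 1) (b, 1) + brem NS (b, 2) (b, 2))"
  by (simp add: eval_nat_numeral)
 also have "... = (\<Sum>b\<le>m. brem NS (b, 1) (b, 1)) + (\<Sum>b\<le>m. brem NS (b, 2) (b, 2))"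
  by (simp add: sum.distrib brem_level_0[OF NS])
 also have "(\<Sum>b\<le>m. brem NS (b, 1) (b, 1)) = (\<Sum>b<m. brem NS (Suc b, 1) (Suc b, 1))"
  by (simp add: sum.atMost_shift brem_level_1_0[unfolded One_nat_def])
 also have "... = th NS 1 * (\<Sum>b<m. \<mu> 1 (Suc b) - (coh b)\<^sup>2 / \<mu> 0 b)"
  by (simp add: brem_level_1[OF NS, unfolded One_nat_def] sum_distrib_left)
 also have "... <= th NS 1 * (1 - \<mu> 1 0 - q)"
 proof (rule mult_left_mono)
  show "(\<Sum>b<m. \<mu> 1 (Suc b) - (coh b)\<^sup>2 / \<mu> 0 b) <= 1 - \<mu> 1 0 - q"
  proof (rule finite_sum_le_has_sum[OF has_sum_diff[OF sum_mu_Suc s]])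
   show "0 <= \<mu> 1 (Suc b) - (coh b)\<^sup>2 / \<mu> 0 b" for b
    using chi_sq_le[of b] mu_0_pos[of b] by (simp add: field_simps)
  qed auto
  show "0 <= th NS 1" using NS by (simp add: th_nonneg)
 qed
 also have "(\<Sum>b\<le>m. brem NS (b, 2) (b, 2)) <= (\<Sum>b\<le>m. bob_mtx NS (b, 2) (b, 2))"
  by (intro sum_mono brem_le)
 also have "... = th NS 2 * (\<Sum>b\<le>m. \<mu> 2 b)" using NS by (simp add: bob_mtx_diag sum_distrib_left)
 also have "... <= th NS 2 * 1" using finite_sum_le_has_sum[OF sum_mu[of 2], of "{..m}"] NS
  by (intro mult_left_mono) (auto simp: mu_nonneg th_nonneg)
 finally show ?thesis by simp
qed

text \<open>Idler numbers above 2 have weight of order \<open>NS ^ 3\<close>, so n uses lose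
  \<open>n * NS ^ 3\<close>, which vanishes for \<open>NS\<close> of order
  \<open>1 / sqrt n\<close>. A cutoff at 1 would lose \<open>n * NS^2\<close>, which does
  not.\<close>

lemma bob_mass_box:
 assumes NS: "NS > 0"
 shows "\<exists>m0. \<forall>m\<ge>m0. (\<Sum>x\<in>{..m} \<times> {..2}. bob_mtx NS x x) >= 1 - 2 * NS ^ 3"
proof -
 have "eventually (%m. 1 - NS ^ 3 < (\<Sum>b<m. \<mu> i b)) sequentially" for i
  using has_sum_imp_sums[OF sum_mu[of i]] NS unfolding sums_def by (intro order_tendstoD(1)) auto
 then have "eventually (%m. \<forall>i\<in>{..2::nat}. 1 - NS ^ 3 < (\<Sum>b<m. \<mu> i b)) sequentially"
  by (intro eventually_ball_finite) auto
 then obtain m0 where m0: "!!m i. m >= m0 ==> i <= 2 ==> 1 - NS ^ 3 < (\<Sum>b<m. \<mu> i b)"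
  unfolding eventually_sequentially by auto
 show ?thesis
 proof (intro exI allI impI)
  fix m assume m: "m0 <= m"
  have "(\<Sum>x\<in>{..m} \<times> {..2}. bob_mtx NS x x) = (\<Sum>b\<le>m. \<Sum>i\<le>2. bob_mtx NS (b, i) (b, i))"
   by (simp add: sum.cartesian_product)
  also have "... = (\<Sum>i\<le>2. \<Sum>b\<le>m. bob_mtx NS (b, i) (b, i))" by (rule sum.swap)
  also have "... = (\<Sum>i\<le>2. th NS i * (\<Sum>b\<le>m. \<mu> i b))"
   using NS by (simp add: bob_mtx_diag sum_distrib_left)
  finally have a: "(\<Sum>x\<in>{..m} \<times> {..2}. bob_mtx NS x x) = (\<Sum>i\<le>2. th NS i * (\<Sum>b\<le>m. \<mu> i b))" .
  have b: "(\<Sum>i\<le>2. th NS i * (\<Sum>b\<le>m. \<mu> i b)) >= (\<Sum>i\<le>2. th NS i * (1 - NS ^ 3))"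
  proof (intro sum_mono mult_left_mono)
   fix i :: nat assume "i \<in> {..2}"
   then have "1 - NS ^ 3 < (\<Sum>b<m. \<mu> i b)" using m0[OF m] by simp
   also have "... <= (\<Sum>b\<le>m. \<mu> i b)" by (intro sum_mono2) (auto simp: mu_nonneg)
   finally show "1 - NS ^ 3 <= (\<Sum>b\<le>m. \<mu> i b)" by simp
   show "0 <= th NS i" using NS by (simp add: th_nonneg)
  qed
  have c: "(\<Sum>i\<le>2. th NS i * (1 - NS ^ 3)) = (\<Sum>i\<le>2. th NS i) - NS ^ 3 * (\<Sum>i\<le>2. th NS i)"
   by (simp add: sum_distrib_left sum_subtractf algebra_simps)
  have d: "NS ^ 3 * (\<Sum>i\<le>2. th NS i) <= NS ^ 3 * 1"
   using finite_sum_le_has_sum[OF has_sum_th[of NS], of "{..2}"] NS by (intro mult_left_mono) (auto simp: th_nonneg)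
  have e: "(\<Sum>i\<le>2. th NS i) >= 1 - NS ^ 3"
  proof -
   have z: "1 / z + (z - 1) / z^2 + (z - 1)\<^sup>2 / z ^ 3 = 1 - (z - 1) ^ 3 / z ^ 3" if "z > 0" for z :: real
    using that by (simp add: field_simps power2_eq_square power3_eq_cube)
   have "(\<Sum>i\<le>2. th NS i) = th NS 0 + th NS 1 + th NS 2" by (simp add: eval_nat_numeral)
   also have "... = 1 - NS ^ 3 / (1 + NS) ^ 3" using z[of "1 + NS"] NS unfolding th_0_1_2 by simp
   finally have "(\<Sum>i\<le>2. th NS i) = 1 - NS ^ 3 / (1 + NS) ^ 3" .
   moreover have "NS ^ 3 / (1 + NS) ^ 3 <= NS ^ 3 / 1" using NS by (intro divide_left_mono) auto
   ultimately show ?thesis by simp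
  qed
  show "1 - 2 * NS ^ 3 <= (\<Sum>x\<in>{..m} \<times> {..2}. bob_mtx NS x x)" using a b c d e by linarith
 qed
qed

text \<open>The test projection \<open>proj J u\<close> on \<open>G\<close> accepts the modulated state with probability at least \<open>1 - \<alpha>\<close>
 and a randomly modulated one with probability at most \<open>\<beta>\<close>: dephasing leaves only the diagonal.\<close>

definition good_test :: "nat => real => real => real => (nat \<times> nat) list set => 'i set => ('i => (nat \<times> nat) list => complex) => bool"
 where "good_test n NS \<alpha> \<beta> G J u \<longleftrightarrow> finite G & G \<subseteq> {xs. length xs = n & (\<forall>z\<in>set xs. snd z <= 2)} & finite J &
  (\<forall>i\<in>J. \<forall>j\<in>J. ip G (u i) (u j) = of_bool (i = j)) &
  Re (pairing G (proj J u) (tensor_prod n (%_ x y. cr (bob_mtx NS x y)))) >= 1 - \<alpha> &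
  (\<Sum>x\<in>G. Re (proj J u x x) * (\<Prod>j<n. bob_mtx NS (x ! j) (x ! j))) <= \<beta>"

text \<open>About \<open>n * ps\<close> positions are special and gain a factor of order
  \<open>NS\<close> each; about \<open>n * r\<close> are exceptional and lose it again. The net
  exponent \<open>n * (ps - r)\<close> is the coherent one-photon weight, up to the margins
  \<open>\<gamma>\<close>.\<close>

lemma bob_test:
 assumes \<gamma>: "0 < \<gamma>" "\<gamma> <= 1"
 shows "\<exists>N0>0. \<exists>K. \<forall>NS n. 0 < NS & NS < N0 -->
  (\<exists>G (J :: (nat set \<times> (nat \<times> nat) list) set) u. good_test n NS
   (2 * real n * NS ^ 3 + 2 * exp (- (\<gamma>^2 / 4 * (real n * NS))))
   (exp (real n * NS * (K - ln (1 / NS) * (rate - 4 * \<gamma>)))) G J u)"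
proof -
 obtain q where q: "((%b. (coh b)\<^sup>2 / \<mu> 0 b) has_sum q) UNIV" "q >= rate" "q <= 1 - \<mu> 1 0"
  using chi_ratio_sum[of "%b. (coh b)\<^sup>2 / \<mu> 0 b"] by (auto simp: rate_def)
 have "eventually (%D. 1 - \<mu> 1 0 - \<gamma> < (\<Sum>b<D. \<mu> 1 (Suc b))) sequentially"
  using has_sum_imp_sums[OF sum_mu_Suc] \<gamma> unfolding sums_def by (intro order_tendstoD(1)) auto
 \<comment> \<open>Finitely many levels carry all but \<open>\<gamma>\<close> of the one-photon
   weight above \<open>b = 0\<close>; on them \<open>1 / \<mu> 0 b\<close> is bounded by
   \<open>K1\<close>, which is independent of \<open>NS\<close>.\<close>
 then obtain D where D: "1 - \<mu> 1 0 - \<gamma> < (\<Sum>b<D. \<mu> 1 (Suc b))"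
  unfolding eventually_sequentially by auto
 define K1 where "K1 = 1 + (\<Sum>b<D. 1 / \<mu> 0 b)"
 have K1b: "1 / \<mu> 0 b <= K1" if "b < D" for b
  using member_le_sum[of b "{..<D}" "%b. 1 / \<mu> 0 b"] that by (simp add: K1_def mu_nonneg)
 have K1: "K1 >= 1" by (simp add: K1_def sum_nonneg mu_nonneg)
 define K where "K = ln K1 + 3"
 define N0 where "N0 = min (\<gamma> / 3) (1 / K1)"
 have "N0 > 0" using \<gamma> K1 by (simp add: N0_def)
 moreover have "\<exists>G (J :: (nat set \<times> (nat \<times> nat) list) set) u. good_test n NS
   (2 * real n * NS ^ 3 + 2 * exp (- (\<gamma>^2 / 4 * (real n * NS))))
   (exp (real n * NS * (K - ln (1 / NS) * (rate - 4 * \<gamma>)))) G J u"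
  if N: "0 < NS & NS < N0" for NS n
 proof -
  have NS: "NS > 0" "NS < \<gamma> / 3" "K1 * NS < 1" using N K1 by (auto simp: N0_def field_simps)
  have NS1: "NS < 1" using NS \<gamma> by simp
  obtain m0 where m0: "!!m. m >= m0 ==> (\<Sum>x\<in>{..m} \<times> {..2}. bob_mtx NS x x) >= 1 - 2 * NS ^ 3"
   using bob_mass_box[OF NS(1)] by blast
  define m where "m = max m0 D"
  define X where "X = {..m} \<times> {..2 :: nat}"
  interpret T: rank_one_split X base "bvec NS" "brem NS"
  proof
   show "finite X" by (simp add: X_def)
   show "base x \<in> X" if "x \<in> X" for x using that by (auto simp: X_def base_def)
   show "base (base x) = base x" for x by (rule base_base)
   show "positive_mtx (%x y. cr (brem NS x y))" using NS by (intro positive_brem) simp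
  qed
  have om: "T.omega x y = bob_mtx NS x y" for x y by (simp add: T.omega_def T.rank1_def brem_def)
  \<comment> \<open>One idler photon, in a block whose base has none: the diagonal entry is at most
    \<open>K1 * NS\<close> times the base entry.\<close>
  define Sp where "Sp = (%b. (Suc b, 1 :: nat)) ` {..<D}"
  have SpX: "X \<inter> Sp = Sp" by (auto simp: X_def Sp_def m_def)
  define ps where "ps = (\<Sum>x\<in>X \<inter> Sp. bob_mtx NS x x)"
  define r where "r = (\<Sum>x\<in>X. brem NS x x)"
  have th1: "th NS 1 <= NS" "th NS 1 >= NS * (1 - 2 * NS)" "th NS 2 <= NS^2" "th NS 1 + th NS 2 <= NS" "th NS 1 > 0"
  proof -
   have "th NS 1 <= NS / 1" unfolding th_0_1_2 using NS by (intro divide_left_mono) auto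
   then show "th NS 1 <= NS" by simp
   have "(1 - 2 * NS) * (1 + NS)\<^sup>2 <= 1"
   proof -
    have "(1 - 2 * NS) * (1 + NS)\<^sup>2 = 1 - (3 * NS^2 + 2 * NS ^ 3)" by (simp add: power2_eq_square power3_eq_cube algebra_simps)
    moreover have "3 * NS^2 + 2 * NS ^ 3 >= 0" using NS by simp
    ultimately show ?thesis by linarith
   qed
   then have "1 - 2 * NS <= 1 / (1 + NS)\<^sup>2" using NS by (simp add: field_simps)
   then show "th NS 1 >= NS * (1 - 2 * NS)" unfolding th_0_1_2 using NS mult_left_mono[of "1 - 2 * NS" "1 / (1 + NS)\<^sup>2" NS] by simp
   have "th NS 2 <= NS^2 / 1" unfolding th_0_1_2 using NS by (intro divide_left_mono) auto
   then show "th NS 2 <= NS^2" by simp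
   have z: "(z - 1) / z^2 + (z - 1)\<^sup>2 / z ^ 3 = (z - 1) * ((2 * z - 1) / z ^ 3)" if "z > 0" for z :: real
    using that by (simp add: field_simps power2_eq_square power3_eq_cube)
   have "2 * (1 + NS) - 1 <= (1 + NS) ^ 3" using NS by (simp add: power3_eq_cube algebra_simps)
   then have "(2 * (1 + NS) - 1) / (1 + NS) ^ 3 <= 1" using NS by simp
   then have "NS * ((2 * (1 + NS) - 1) / (1 + NS) ^ 3) <= NS * 1" using NS by (intro mult_left_mono) auto
   then show "th NS 1 + th NS 2 <= NS" using z[of "1 + NS"] NS unfolding th_0_1_2 by simp
   show "th NS 1 > 0" using NS by (simp add: th_pos)
  qed
  have r_le: "r <= th NS 1 * (1 - \<mu> 1 0 - q) + th NS 2" unfolding r_def X_def by (rule sum_brem_le[OF NS(1) q(1)])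
  have r0: "r >= 0" unfolding r_def using NS by (intro sum_nonneg brem_nonneg) simp
  have qn: "q >= 0" using q(1) by (rule has_sum_nonneg) (simp add: mu_nonneg)
  have rN: "r <= NS"
  proof -
   have "th NS 1 * (1 - \<mu> 1 0 - q) <= th NS 1 * 1"
    using th1(5) qn mu_nonneg[of 1 0] by (intro mult_left_mono) auto
   then show ?thesis using r_le th1(4) by linarith
  qed
  have ps_eq: "ps = th NS 1 * (\<Sum>b<D. \<mu> 1 (Suc b))"
  proof -
   have "ps = (\<Sum>b<D. bob_mtx NS (Suc b, 1) (Suc b, 1))"
    unfolding ps_def SpX unfolding Sp_def by (subst sum.reindex) (auto simp: inj_on_def)
   then show ?thesis using NS bob_mtx_diag[of NS _ 1] by (simp add: sum_distrib_left)
  qed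
  have ps_le: "ps <= NS"
  proof -
   have "(\<Sum>b<D. \<mu> 1 (Suc b)) <= 1 - \<mu> 1 0" by (rule finite_sum_le_has_sum[OF sum_mu_Suc]) (auto simp: mu_nonneg)
   then have "ps <= th NS 1 * 1" unfolding ps_eq using th1(5) mu_nonneg[of 1 0] by (intro mult_left_mono) auto
   then show ?thesis using th1(1) by simp
  qed
  \<comment> \<open>The incoherent one-photon weight occurs in both \<open>ps\<close> and
    \<open>r\<close> and cancels; \<open>q >= rate\<close> remains up to \<open>\<gamma>\<close> and
    second-order terms.\<close>
  have gain: "ps - r >= NS * (rate - 2 * \<gamma>)"
  proof -
   have "ps >= th NS 1 * (1 - \<mu> 1 0 - \<gamma>)" unfolding ps_eq using th1(5) D by (intro mult_left_mono) auto
   then have "ps - r >= th NS 1 * (1 - \<mu> 1 0 - \<gamma>) - th NS 1 * (1 - \<mu> 1 0 - q) - th NS 2" using r_le by linarith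
   also have "th NS 1 * (1 - \<mu> 1 0 - \<gamma>) - th NS 1 * (1 - \<mu> 1 0 - q) = th NS 1 * (q - \<gamma>)" by (simp add: algebra_simps)
   finally have "ps - r >= th NS 1 * (q - \<gamma>) - NS^2" using th1(3) by linarith
   moreover have "th NS 1 * (q - \<gamma>) >= NS * (q - \<gamma>) - 2 * NS^2"
   proof (cases "q >= \<gamma>")
    case True
    have "th NS 1 * (q - \<gamma>) >= NS * (1 - 2 * NS) * (q - \<gamma>)" using True th1(2) by (intro mult_right_mono) auto
    moreover have "NS * (1 - 2 * NS) * (q - \<gamma>) = NS * (q - \<gamma>) - 2 * NS^2 * (q - \<gamma>)"
     by (simp add: power2_eq_square algebra_simps)
    moreover have "2 * NS^2 * (q - \<gamma>) <= 2 * NS^2 * 1"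
     using q(3) mu_nonneg[of 1 0] \<gamma> by (intro mult_left_mono) auto
    ultimately show ?thesis by linarith
   next
    case False
    have "NS * (q - \<gamma>) <= th NS 1 * (q - \<gamma>)" using False th1(1) by (intro mult_right_mono_neg) auto
    then show ?thesis using zero_le_power2[of NS] by linarith
   qed
   ultimately have "ps - r >= NS * (q - \<gamma>) - 3 * NS^2" by linarith
   moreover have "3 * NS^2 <= NS * \<gamma>" using NS mult_left_mono[of "3 * NS" \<gamma> NS] by (simp add: power2_eq_square)
   moreover have "NS * rate <= NS * q" using NS q(2) by (intro mult_left_mono) auto
   ultimately show ?thesis by (simp add: algebra_simps)
  qed
  \<comment> \<open>A lower threshold for the number of special positions and an upper one for
    exceptional positions, both with margin \<open>\<gamma> * n * NS\<close>.\<close>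
  define \<tau> where "\<tau> = real n * (ps - \<gamma> * NS)"
  define \<sigma> where "\<sigma> = real n * (r + \<gamma> * NS)"
  define t where "t = nat \<lceil>\<tau>\<rceil>"
  define s where "s = nat \<lfloor>\<sigma>\<rfloor>"
  have \<sigma>0: "\<sigma> >= 0" unfolding \<sigma>_def using r0 \<gamma> NS by simp
  \<comment> \<open>The minimiser of \<open>l^2 - l * \<gamma>\<close>, the exponent per signal
    photon in both tail bounds.\<close>
  define l where "l = \<gamma> / 2"
  have l: "0 <= l" "l <= 1" using \<gamma> by (auto simp: l_def)
  define \<kappa> where "\<kappa> = K1 * NS"
  have \<kappa>: "0 <= \<kappa>" "\<kappa> <= 1" "\<kappa> > 0" using NS K1 by (auto simp: \<kappa>_def)
  have total: "(\<Sum>x\<in>X. T.omega x x) <= 1"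
   unfolding om using NS trace_bob_mtx[of NS] by (intro finite_sum_le_has_sum) (auto simp: bob_mtx_nonneg X_def)
  define G where "G = {xs. length xs = n & set xs \<subseteq> X & t <= card {j. j < n & xs ! j \<in> Sp}}"
  have "\<exists>(J :: (nat set \<times> (nat \<times> nat) list) set) u. finite J & (\<forall>i\<in>J. \<forall>j\<in>J. ip G (u i) (u j) = of_bool (i = j)) &
   Re (pairing G (proj J u) (tensor_prod n (%_ x y. cr (T.omega x y))))
    >= (\<Sum>xs\<in>G. \<Prod>j<n. T.omega (xs ! j) (xs ! j)) - (\<Sum>S | S \<in> Pow {..<n} & s < card S. \<Prod>j<n. if j \<in> S then r else 1 - r) &
   (\<Sum>x\<in>G. Re (proj J u x x) * (\<Prod>j<n. T.omega (x ! j) (x ! j))) <= \<kappa> ^ t * (\<Sum>S | S \<in> Pow {..<n} & card S <= s. 3 ^ card S)"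
   unfolding G_def
  proof (rule T.low_rank_test[OF \<kappa>(1,2) _ total])
   fix x assume "x \<in> Sp" "x \<in> X"
   then obtain b where b: "x = (Suc b, 1)" "b < D" by (auto simp: Sp_def)
   have "bob_mtx NS x x = th NS 1 * \<mu> 1 (Suc b)" using NS by (simp add: b bob_mtx_diag)
   also have "\<mu> 1 (Suc b) <= 1" using finite_sum_le_has_sum[OF sum_mu[of 1], of "{Suc b}"] by (simp add: mu_nonneg)
   then have "th NS 1 * \<mu> 1 (Suc b) <= th NS 1 * (K1 * \<mu> 0 b)"
   proof (intro mult_left_mono)
    have "1 <= K1 * \<mu> 0 b" using K1b[OF b(2)] mu_0_pos[of b] by (simp add: field_simps)
    then show "\<mu> 1 (Suc b) <= 1 ==> \<mu> 1 (Suc b) <= K1 * \<mu> 0 b" by linarith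
   qed (use th1(5) in auto)
   also have "th NS 1 * (K1 * \<mu> 0 b) = th NS 1 / th NS 0 * K1 * (th NS 0 * \<mu> 0 b)"
    using th_pos[OF NS(1), of 0] by simp
   also have "... <= NS * K1 * (th NS 0 * \<mu> 0 b)"
   proof (intro mult_right_mono)
    have "th NS 1 / th NS 0 = NS / (1 + NS)" unfolding th_0_1_2 using NS by (simp add: power2_eq_square)
    also have "... <= NS / 1" using NS by (intro divide_left_mono) auto
    finally show "th NS 1 / th NS 0 <= NS" by simp
   qed (use K1 NS in \<open>auto simp: mu_nonneg th_nonneg\<close>)
   also have "... = \<kappa> * bob_mtx NS (base x) (base x)" using NS by (simp add: b base_def bob_mtx_diag \<kappa>_def)
   finally show "T.omega x x <= \<kappa> * T.omega (base x) (base x)" unfolding om .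
  next
   fix d
   have inj: "inj_on snd {x \<in> X. base x = d}" by (auto simp: inj_on_def base_def split: prod.splits)
   have "card {x \<in> X. base x = d} = card (snd ` {x \<in> X. base x = d})" by (rule card_image[OF inj, symmetric])
   also have "... <= card {..2 :: nat}" by (intro card_mono) (auto simp: X_def)
   finally show "real (card {x \<in> X. base x = d}) <= 3" by simp
  next
   have "(\<Sum>x\<in>X. (bvec NS x)\<^sup>2) + r = (\<Sum>x\<in>X. T.omega x x)"
    by (simp add: r_def T.omega_def T.rank1_diag sum.distrib)
   then show "(\<Sum>x\<in>X. (bvec NS x)\<^sup>2) <= 1 - r" using total by simp
  qed (simp_all add: r_def)
  then obtain J :: "(nat set \<times> (nat \<times> nat) list) set" and u where J: "finite J" "\<forall>i\<in>J. \<forall>j\<in>J. ip G (u i) (u j) = of_bool (i = j)"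
   and low: "Re (pairing G (proj J u) (tensor_prod n (%_ x y. cr (T.omega x y))))
    >= (\<Sum>xs\<in>G. \<Prod>j<n. T.omega (xs ! j) (xs ! j)) - (\<Sum>S | S \<in> Pow {..<n} & s < card S. \<Prod>j<n. if j \<in> S then r else 1 - r)"
   and up: "(\<Sum>x\<in>G. Re (proj J u x x) * (\<Prod>j<n. T.omega (x ! j) (x ! j))) <= \<kappa> ^ t * (\<Sum>S | S \<in> Pow {..<n} & card S <= s. 3 ^ card S)"
   by (elim exE conjE)
  let ?Xn = "{xs. set xs \<subseteq> X & length xs = n}"
  have finXn: "finite ?Xn" by (rule finite_lists_length_eq[OF T.finite_X])
  have GX: "G \<subseteq> ?Xn" by (auto simp: G_def)
  have finG: "finite G" by (rule finite_subset[OF GX finXn])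
  have Gsub: "G \<subseteq> {xs. length xs = n & (\<forall>z\<in>set xs. snd z <= 2)}" by (auto simp: G_def X_def)
  have quad: "l^2 - l * \<gamma> = - (\<gamma>^2 / 4)" by (simp add: l_def power2_eq_square field_simps)
  have excess: "(\<Sum>S | S \<in> Pow {..<n} & s < card S. \<Prod>j<n. if j \<in> S then r else 1 - r) <= exp (- (\<gamma>^2 / 4 * (real n * NS)))"
  proof -
   have eq: "{S. S \<in> Pow {..<n} & s < card S} = {S. S \<in> Pow {..<n} & \<sigma> < real (card S)}"
   proof -
    have "s < c \<longleftrightarrow> \<sigma> < real c" for c unfolding s_def using \<sigma>0 by linarith
    then show ?thesis by simp
   qed
   have "(\<Sum>S | S \<in> Pow {..<n} & \<sigma> < real (card S). \<Prod>j<n. if j \<in> S then r else 1 - r) <= exp (real n * r * (exp l - 1) - l * \<sigma>)"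
    using r0 rN NS1 l by (intro upper_tail_bound) auto
   also have "... <= exp (- (\<gamma>^2 / 4 * (real n * NS)))"
   proof -
    have "exp l - 1 <= l + l^2" using exp_bound[OF l] by simp
    then have "real n * r * (exp l - 1) - l * \<sigma> <= real n * r * (l + l^2) - l * \<sigma>"
     using r0 by (intro diff_right_mono mult_left_mono) auto
    also have "... = real n * (r * l^2 - l * \<gamma> * NS)" by (simp add: \<sigma>_def algebra_simps)
    also have "... <= real n * (NS * l^2 - l * \<gamma> * NS)" using rN by (intro mult_left_mono diff_right_mono mult_right_mono) auto
    also have "... = real n * NS * (l^2 - l * \<gamma>)" by (simp add: algebra_simps)
    finally show ?thesis unfolding quad by (simp add: mult_ac)
   qed
   finally show ?thesis unfolding eq .
  qed
  have mass: "(\<Sum>xs\<in>G. \<Prod>j<n. T.omega (xs ! j) (xs ! j)) >= 1 - 2 * real n * NS ^ 3 - exp (- (\<gamma>^2 / 4 * (real n * NS)))"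
  proof -
   let ?P = "%xs. \<Prod>j<n. T.omega (xs ! j) (xs ! j)"
   let ?H = "{xs. xs \<in> ?Xn & real (card {j. j < n & xs ! j \<in> Sp}) < \<tau>}"
   have un: "?Xn = G \<union> ?H"
   proof -
    have "t <= c \<or> real c < \<tau>" for c unfolding t_def by linarith
    then show ?thesis by (auto simp: G_def)
   qed
   have P0: "?P xs >= 0" for xs by (simp add: prod_nonneg T.omega_diag_nonneg)
   have "(\<Sum>xs\<in>?Xn. ?P xs) <= (\<Sum>xs\<in>G. ?P xs) + (\<Sum>xs\<in>?H. ?P xs)"
   proof -
    have "(\<Sum>xs\<in>?Xn. ?P xs) = (\<Sum>xs\<in>G \<union> ?H. ?P xs)" by (rule arg_cong[OF un])
    also have "... <= (\<Sum>xs\<in>G. ?P xs) + (\<Sum>xs\<in>?H. ?P xs)"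
    proof -
     have "finite ?H" by (rule finite_subset[OF _ finXn]) auto
     from sum.union_inter[OF finG this, of ?P] sum_nonneg[of "G \<inter> ?H" ?P, OF P0]
     show ?thesis by linarith
    qed
    finally show ?thesis .
   qed
   moreover have "(\<Sum>xs\<in>?H. ?P xs) <= exp (- (\<gamma>^2 / 4 * (real n * NS)))"
   proof -
    have "(\<Sum>xs\<in>?H. ?P xs) <= exp (l * \<tau> - real n * (\<Sum>x\<in>X \<inter> Sp. T.omega x x) * (1 - exp (- l)))"
     using lower_tail_bound[OF T.finite_X T.omega_diag_nonneg total l(1), where Sp = Sp and n = n and \<tau> = \<tau>] by simp
    also have "(\<Sum>x\<in>X \<inter> Sp. T.omega x x) = ps" by (simp add: ps_def om)
    also have "exp (l * \<tau> - real n * ps * (1 - exp (- l))) <= exp (- (\<gamma>^2 / 4 * (real n * NS)))"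
    proof -
     have ps0: "ps >= 0" unfolding ps_def by (intro sum_nonneg bob_mtx_nonneg)
     have "l * \<tau> - real n * ps * (1 - exp (- l)) <= l * \<tau> - real n * ps * (l - l^2)"
      using ps0 exp_minus_ge[OF l(1)] by (intro diff_left_mono mult_left_mono) auto
     also have "... = real n * (ps * l^2 - l * \<gamma> * NS)" by (simp add: \<tau>_def algebra_simps)
     also have "... <= real n * (NS * l^2 - l * \<gamma> * NS)" using ps_le by (intro mult_left_mono diff_right_mono mult_right_mono) auto
     also have "... = real n * NS * (l^2 - l * \<gamma>)" by (simp add: algebra_simps)
     finally show ?thesis unfolding quad by (simp add: mult_ac)
    qed
    finally show ?thesis .
   qed
   moreover have "(\<Sum>xs\<in>?Xn. ?P xs) >= 1 - 2 * real n * NS ^ 3"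
   proof -
    have "(\<Sum>xs\<in>?Xn. ?P xs) = (\<Sum>x\<in>X. bob_mtx NS x x) ^ n"
     using sum_prod_lists[OF T.finite_X, of "%_ x. T.omega x x" n] by (simp add: om)
    also have "... >= 1 - 2 * real n * NS ^ 3"
    proof (cases "2 * NS ^ 3 <= 1")
     case True
     have "1 + real n * (- (2 * NS ^ 3)) <= (1 + (- (2 * NS ^ 3))) ^ n"
      using True by (intro Bernoulli_inequality) simp
     also have "... <= (\<Sum>x\<in>X. bob_mtx NS x x) ^ n"
      using m0[of m] True unfolding X_def by (intro power_mono) (auto simp: m_def)
     finally show ?thesis by (simp add: algebra_simps)
    next
     case False
     have "(\<Sum>x\<in>X. bob_mtx NS x x) ^ n >= 0" by (intro zero_le_power sum_nonneg bob_mtx_nonneg)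
     show ?thesis
     proof (cases "n = 0")
      case False
      have "1 * 1 <= real n * (2 * NS ^ 3)" using \<open>\<not> 2 * NS ^ 3 <= 1\<close> False by (intro mult_mono) auto
      then show ?thesis using \<open>(\<Sum>x\<in>X. bob_mtx NS x x) ^ n >= 0\<close> by (simp add: algebra_simps)
     qed simp
    qed
    finally show ?thesis .
   qed
   ultimately show ?thesis by linarith
  qed
  have "Re (pairing G (proj J u) (tensor_prod n (%_ x y. cr (bob_mtx NS x y))))
   >= 1 - (2 * real n * NS ^ 3 + 2 * exp (- (\<gamma>^2 / 4 * (real n * NS))))"
   using low excess mass unfolding om by linarith
  moreover have "(\<Sum>x\<in>G. Re (proj J u x x) * (\<Prod>j<n. bob_mtx NS (x ! j) (x ! j))) <= exp (real n * NS * (K - ln (1 / NS) * (rate - 4 * \<gamma>)))"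
  proof -
   have "(\<Sum>x\<in>G. Re (proj J u x x) * (\<Prod>j<n. bob_mtx NS (x ! j) (x ! j))) <= \<kappa> ^ t * (\<Sum>S | S \<in> Pow {..<n} & card S <= s. 3 ^ card S)"
    using up unfolding om .
   \<comment> \<open>The tilt \<open>NS\<close> turns the count of small sets into
     \<open>1 / NS ^ s\<close>, to be weighed against
     \<open>\<kappa> ^ t = (K1 * NS) ^ t\<close>.\<close>
   also have "... <= \<kappa> ^ t * (exp (real n * 3 * NS) / NS ^ s)"
    using NS NS1 \<kappa> by (intro mult_left_mono small_subset_count) auto
   also have "\<kappa> ^ t * (exp (real n * 3 * NS) / NS ^ s) = exp (real t * ln \<kappa> + 3 * (real n * NS) - real s * ln NS)"
    using \<kappa>(3) NS(1) by (simp add: exp_add exp_diff exp_of_nat_mult mult_ac)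
   also have "... <= exp (real n * NS * (K - ln (1 / NS) * (rate - 4 * \<gamma>)))"
   proof -
    define e where "e = ln (1 / NS)"
    have e0: "e > 0" unfolding e_def using NS NS1 by simp
    have lnN: "ln NS = - e" unfolding e_def using NS by (simp add: ln_div)
    have ln\<kappa>: "ln \<kappa> = ln K1 - e" unfolding \<kappa>_def using K1 NS by (simp add: ln_mult lnN)
    have "ln \<kappa> <= 0" using \<kappa> by simp
    moreover have "real t >= \<tau>" unfolding t_def by linarith
    ultimately have "real t * ln \<kappa> <= \<tau> * ln \<kappa>" by (intro mult_right_mono_neg)
    also have "... = \<tau> * ln K1 - \<tau> * e" by (simp add: ln\<kappa> algebra_simps)
    also have "\<tau> * ln K1 <= real n * NS * ln K1"
    proof (rule mult_right_mono)
     have "real n * (ps - \<gamma> * NS) <= real n * NS" using ps_le NS \<gamma> by (intro mult_left_mono) (auto intro: order_trans[of _ ps])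
     then show "\<tau> <= real n * NS" by (simp add: \<tau>_def)
     show "0 <= ln K1" using K1 by simp
    qed
    finally have 1: "real t * ln \<kappa> <= real n * NS * ln K1 - \<tau> * e" by simp
    have "real s <= \<sigma>" unfolding s_def using \<sigma>0 by linarith
    then have 2: "real s * e <= \<sigma> * e" using e0 by (intro mult_right_mono) auto
    have "\<tau> - \<sigma> = real n * ((ps - r) - 2 * \<gamma> * NS)" by (simp add: \<tau>_def \<sigma>_def algebra_simps)
    also have "... >= real n * (NS * (rate - 4 * \<gamma>))"
     using gain by (intro mult_left_mono) (auto simp: algebra_simps)
    finally have "(\<tau> - \<sigma>) * e >= real n * (NS * (rate - 4 * \<gamma>)) * e" using e0 by (intro mult_right_mono) auto
    then have "real t * ln \<kappa> + 3 * (real n * NS) - real s * ln NS <= real n * NS * ln K1 + 3 * (real n * NS) - real n * (NS * (rate - 4 * \<gamma>)) * e"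
     using 1 2 unfolding lnN by (simp add: algebra_simps)
    also have "... = real n * NS * (K - e * (rate - 4 * \<gamma>))" by (simp add: K_def algebra_simps)
    finally show ?thesis unfolding e_def by simp
   qed
   finally show ?thesis .
  qed
  ultimately show ?thesis unfolding good_test_def using finG Gsub J by blast
 qed
 ultimately show ?thesis by blast
qed

end

section \<open>Random coding with a sequential decoder\<close>

lemma positive_mtx_add:
 assumes "positive_mtx A" "positive_mtx B"
 shows "positive_mtx (%x y. A x y + B x y)" using assms unfolding positive_mtx_def
 by (simp add: distrib_left distrib_right sum.distrib nonneg_Reals_add_I)

lemma pairing_psd_nonneg:
 assumes "finite F" "psd_on F A" "psd_on F B"
 shows "Re (pairing F A B) >= 0"
proof -
 obtain \<psi> where \<psi>: "!!x y. x \<in> F ==> y \<in> F ==> B x y = (\<Sum>k\<in>F. \<psi> k x * cnj (\<psi> k y))"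
  using psd_on_gram[OF assms(1,3)] by metis
 have "pairing F A B = (\<Sum>k\<in>F. ip F (\<psi> k) (app F A (\<psi> k)))" by (rule pairing_gram) (rule \<psi>)
 moreover have "Re (ip F (\<psi> k) (app F A (\<psi> k))) >= 0" for k
  using assms(2)[unfolded psd_on_def quad_eq_ip, rule_format, of "\<psi> k"] by (simp add: complex_nonneg_Reals_iff)
 ultimately show ?thesis by (simp add: sum_nonneg)
qed

text \<open>The decoder's effects are finite matrices plus a multiple of the identity outside
  \<open>G\<close>; the infinite trace becomes a finite pairing and the missing mass.\<close>

lemma mtx_trace_split:
 fixes A B :: "'a mtx"
 assumes fin: "finite G" and A: "!!x y. x \<notin> G \<or> y \<notin> G ==> A x y = 0"
  and tr: "((%x. B x x) has_sum T) UNIV" and D: "!!x y. D x y = c * of_bool (x = y & x \<notin> G)"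
 shows "mtx_trace ((%x y. A x y + D x y) \<odot> B) = pairing G A B + c * (T - (\<Sum>x\<in>G. B x x))"
proof -
 have row: "((%x y. A x y + D x y) \<odot> B) x x = (if x \<in> G then \<Sum>y\<in>G. A x y * B y x else c * B x x)" for x
 proof (cases "x \<in> G")
  case True
  have "((%z. (A x z + D x z) * B z x) has_sum (\<Sum>z\<in>G. A x z * B z x)) UNIV"
   by (rule has_sum_finite_neutralI[OF fin]) (use A True D in \<open>auto intro!: sum.cong\<close>)
  then show ?thesis using True by (simp add: mtx_mult_def infsumI)
 next
  case False
  have "((%z. (A x z + D x z) * B z x) has_sum (c * B x x)) UNIV"
   by (rule has_sum_finite_neutralI[of "{x}"]) (use A False D in auto)
  then show ?thesis using False by (simp add: mtx_mult_def infsumI)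
 qed
 have 1: "((%x. if x \<in> G then \<Sum>y\<in>G. A x y * B y x else 0) has_sum pairing G A B) UNIV"
  by (rule has_sum_finite_neutralI[OF fin]) (auto simp: pairing_def intro!: sum.cong)
 have 2: "((%x. if x \<in> G then B x x else 0) has_sum (\<Sum>x\<in>G. B x x)) UNIV"
  by (rule has_sum_finite_neutralI[OF fin]) (auto intro!: sum.cong)
 have "((%x. (if x \<in> G then \<Sum>y\<in>G. A x y * B y x else 0) + c * (B x x + (- 1) * (if x \<in> G then B x x else 0)))
  has_sum (pairing G A B + c * (T + (- 1) * (\<Sum>x\<in>G. B x x)))) UNIV"
  by (intro has_sum_add has_sum_cmult_right 1 2 tr)
 then have "((%x. ((%x y. A x y + D x y) \<odot> B) x x) has_sum (pairing G A B + c * (T - (\<Sum>x\<in>G. B x x)))) UNIV"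
  by (rule has_sum_eq_rule) (auto simp: row)
 then show ?thesis unfolding mtx_trace_def by (rule infsumI)
qed

section \<open>Bob's output for a codeword and the decoder\<close>

context roundtrip
begin

definition bob_avg :: "nat => real => (nat \<times> nat) mtx"
 where "bob_avg Q NS x y = of_bool (int Q dvd int (snd x) - int (snd y)) * cr (bob_mtx NS x y)"

lemma sum_bob_state:
 assumes NS: "NS >= 0" and Q: "Q > 0"
 shows "(\<Sum>q<Q. bob_state \<eta> NB1 NB2 NS (2 * pi * real q / real Q) x y) = of_nat Q * bob_avg Q NS x y"
 using sum_roots_of_unity[OF Q, of "int (snd x) - int (snd y)"]
 by (simp add: bob_state_eq[OF NS] bob_avg_def sum_distrib_right[symmetric])

text \<open>Idler numbers up to 2 differ by less than \<open>Q\<close>, so averaging removes all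
  coherences between different ones; within one idler number the block condition fixes
  \<open>b\<close>.\<close>

lemma bob_avg_diag:
 assumes Q: "Q >= 3" and x: "snd x <= 2" "snd y <= 2"
 shows "bob_avg Q NS x y = of_bool (x = y) * cr (bob_mtx NS x x)"
proof (cases "snd x = snd y")
 case True
 then show ?thesis
  using bob_mtx_support[of "fst x" "snd y" "fst y" "snd x" NS] by (cases x; cases y) (auto simp: bob_avg_def)
next
 case False
 have "\<not> int Q dvd int (snd x) - int (snd y)"
  using Q x False zdvd_imp_le[of "int Q" "\<bar>int (snd x) - int (snd y)\<bar>"] by auto
 then show ?thesis using False by (auto simp: bob_avg_def)
qed

definition bob_out :: "real => nat => nat => (nat => nat) => (nat \<times> nat) list mtx"
 where "bob_out NS n Q c = tensor_prod n (%i. bob_state \<eta> NB1 NB2 NS (2 * pi * real (c i) / real Q))"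

text \<open>A codeword acts on Bob's state as a diagonal unitary, so its test is the common test
  conjugated by the same phases.\<close>

definition phs :: "nat => nat => (nat => nat) => (nat \<times> nat) list => complex"
 where "phs n Q c x = (\<Prod>j<n. cis (2 * pi * real (c j) / real Q * real (snd (x ! j))))"

lemma phs_unit: "phs n Q c x * cnj (phs n Q c x) = 1" "cnj (phs n Q c x) * phs n Q c x = 1"
proof -
 have "cmod (phs n Q c x) = 1" by (simp add: phs_def prod_norm[symmetric])
 then show "phs n Q c x * cnj (phs n Q c x) = 1" by (simp add: complex_norm_square[symmetric] del: of_real_power)
 then show "cnj (phs n Q c x) * phs n Q c x = 1" by (simp add: mult.commute)
qed

lemma bob_out_eq:
 assumes NS: "NS >= 0"
 shows "bob_out NS n Q c x y = phs n Q c x * cnj (phs n Q c y) * tensor_prod n (%_ x y. cr (bob_mtx NS x y)) x y"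
proof (cases "length x = n & length y = n")
 case True
 have "cis (a * (r - s)) = cis (a * r) * cnj (cis (a * s))" for a r s :: real
  by (simp add: cis_mult cis_cnj algebra_simps)
 note cis_split = this
 show ?thesis using True
  unfolding bob_out_def tensor_prod_def phs_def bob_state_eq[OF NS] cis_split by (simp add: prod.distrib)
qed (auto simp: bob_out_def tensor_prod_def)

lemma positive_bob_out: "NS >= 0 ==> positive_mtx (bob_out NS n Q c)"
 unfolding bob_out_def by (intro positive_tensor_prod positive_bob_state)

lemma trace_bob_out:
 assumes NS: "NS >= 0"
 shows "((%x. bob_out NS n Q c x x) has_sum 1) UNIV"
proof -
 have "((%xs. \<Prod>i<n. bob_mtx NS (xs ! i) (xs ! i)) has_sum 1) {xs. length xs = n}"
  using has_sum_prod_lists[of n "%_ x. bob_mtx NS x x" "%_. 1"] trace_bob_mtx[OF NS] bob_mtx_nonneg by simp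
 then have "((%xs. cr (if length xs = n then \<Prod>i<n. bob_mtx NS (xs ! i) (xs ! i) else 0)) has_sum cr 1) UNIV"
  by (intro has_sum_of_real) (erule has_sum_cong_neutral[THEN iffD1, rotated -1], auto)
 then show ?thesis
 proof (rule has_sum_eq_rule)
  fix xs
  show "cr (if length xs = n then \<Prod>i<n. bob_mtx NS (xs ! i) (xs ! i) else 0) = bob_out NS n Q c xs xs"
   unfolding bob_out_eq[OF NS] phs_unit by (simp add: tensor_prod_def)
 qed simp
qed

lemma sum_bob_out:
 assumes NS: "NS >= 0" and Q: "Q >= 3"
  and x: "length x = n" "\<forall>z\<in>set x. snd z <= 2" and y: "length y = n" "\<forall>z\<in>set y. snd z <= 2"
 shows "(\<Sum>c\<in>PiE {..<n} (%_. {..<Q}). bob_out NS n Q c x y)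
  = of_nat (Q ^ n) * (of_bool (x = y) * cr (\<Prod>j<n. bob_mtx NS (x ! j) (x ! j)))"
proof -
 have "(\<Sum>c\<in>PiE {..<n} (%_. {..<Q}). bob_out NS n Q c x y)
  = (\<Sum>c\<in>PiE {..<n} (%_. {..<Q}). \<Prod>i<n. bob_state \<eta> NB1 NB2 NS (2 * pi * real (c i) / real Q) (x ! i) (y ! i))"
  using x y by (simp add: bob_out_def tensor_prod_def)
 also have "... = (\<Prod>i<n. \<Sum>q<Q. bob_state \<eta> NB1 NB2 NS (2 * pi * real q / real Q) (x ! i) (y ! i))"
  by (rule prod_sum_PiE[symmetric]) auto
 also have "... = (\<Prod>i<n. of_nat Q * (of_bool (x ! i = y ! i) * cr (bob_mtx NS (x ! i) (x ! i))))"
 proof (rule prod.cong[OF refl])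
  fix i assume i: "i \<in> {..<n}"
  have s: "snd (x ! i) <= 2" "snd (y ! i) <= 2" using x y i nth_mem[of i x] nth_mem[of i y] by auto
  show "(\<Sum>q<Q. bob_state \<eta> NB1 NB2 NS (2 * pi * real q / real Q) (x ! i) (y ! i))
   = of_nat Q * (of_bool (x ! i = y ! i) * cr (bob_mtx NS (x ! i) (x ! i)))"
   using Q by (simp add: sum_bob_state[OF NS] bob_avg_diag[OF Q s])
 qed
 also have "... = of_nat (Q ^ n) * (of_bool (x = y) * cr (\<Prod>j<n. bob_mtx NS (x ! j) (x ! j)))"
 proof (cases "x = y")
  case False
  then obtain i where "i < n" "x ! i ~= y ! i" using x y by (metis nth_equalityI)
  then show ?thesis using False by (auto simp: prod_zero_iff)
 qed (simp add: prod.distrib)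
 finally show ?thesis .
qed

text \<open>Since the key enumerates all codebooks, averaging over it is the random coding average.
  The right test rejects with probability at most \<open>a\<close>; every earlier test belongs to an
  independent codeword and accepts with average probability at most \<open>b\<close>. The factor 4
  is that of \<open>seq_effect_bound\<close>.\<close>

lemma random_code:
 fixes u :: "'i => (nat \<times> nat) list => complex"
 assumes NS: "NS >= 0" and Q: "Q >= 3" and M: "M >= 1"
  and test: "good_test n NS a b G J u"
 shows "\<exists>C. is_code n C & num_msgs C = M & eve_average_state \<eta> NB1 NB2 NS n C = tensor_prod n (%_. eve_avg Q NS)
  & (\<Sum>k\<in>{1..num_keys C}. error_prob \<eta> NB1 NB2 NS n C k) / real (num_keys C) <= 4 * a + 4 * real M * b"
proof -
 have G: "finite G" "G \<subseteq> {xs. length xs = n & (\<forall>z\<in>set xs. snd z <= 2)}"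
  and J: "finite J" "\<forall>i\<in>J. \<forall>j\<in>J. ip G (u i) (u j) = of_bool (i = j)"
  and accept: "Re (pairing G (proj J u) (tensor_prod n (%_ x y. cr (bob_mtx NS x y)))) >= 1 - a"
  and confuse: "(\<Sum>x\<in>G. Re (proj J u x x) * (\<Prod>j<n. bob_mtx NS (x ! j) (x ! j))) <= b"
  using test unfolding good_test_def by blast+
 let ?W = "PiE {..<n} (%_. {..<Q})"
 let ?B = "PiE {1..M} (%_. ?W)"
 have Q0: "Q > 0" using Q by simp
 have finW: "finite ?W" by (intro finite_PiE) auto
 have cW: "card ?W = Q ^ n" by (simp add: card_PiE)
 have finB: "finite ?B" by (intro finite_PiE finW) auto
 have cB: "card ?B = card ?W ^ M" by (simp add: card_PiE)
 have K0: "card ?B > 0" unfolding cB cW using Q0 by simp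
 obtain cb where cb: "bij_betw cb {1..card ?B} ?B" using ex_bij_betw_nat_finite_1[OF finB] by blast
 define uc where "uc c k x = phs n Q c x * u k x" for c k x
 define A where "A c = proj J (uc c)" for c
 \<comment> \<open>The identity on lists of length \<open>n\<close> outside \<open>G\<close>.
   Message 1 receives it together with \<open>seq_rest\<close>, which completes the
   measurement.\<close>
 define off where "off = (%x y :: (nat \<times> nat) list. of_bool (length x = n & x = y & x \<notin> G) :: complex)"
 define \<Lambda> where "\<Lambda> k w = (%x y. seq_effect G (%i. A (cb k i)) w x y
  + (if w = 1 then seq_rest G (%i. A (cb k i)) M x y + off x y else 0))" for k w
 define C where "C = \<lparr>num_msgs = M, num_keys = card ?B, phases = (%w k i. 2 * pi * real (cb k w i) / real Q), decoder = \<Lambda>\<rparr>"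
 have orth: "ip G (uc c i) (uc c j) = of_bool (i = j)" if "i \<in> J" "j \<in> J" for c i j
 proof -
  have "cnj (phs n Q c x * u i x) * (phs n Q c x * u j x) = cnj (u i x) * u j x" for x
  proof -
   have "cnj (phs n Q c x * u i x) * (phs n Q c x * u j x) = (cnj (phs n Q c x) * phs n Q c x) * (cnj (u i x) * u j x)"
    by (simp add: mult_ac)
   then show ?thesis unfolding phs_unit by simp
  qed
  then have "ip G (uc c i) (uc c j) = ip G (u i) (u j)" unfolding ip_def uc_def by (intro sum.cong refl)
  then show ?thesis using J that by simp
 qed
 have proj: "projection_on G (A c)" for c unfolding A_def by (rule projection_on_proj[OF J(1) orth])
 have Axy: "A c x y = phs n Q c x * cnj (phs n Q c y) * proj J u x y" for c x y
  by (simp add: A_def proj_def uc_def sum_distrib_left mult_ac)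
 have pos_off: "positive_mtx off"
 proof -
  have "off = (%x y. of_bool (x = y) * cr (of_bool (length x = n & x \<notin> G)))" by (auto simp: off_def fun_eq_iff)
  then show ?thesis by (simp only:) (rule positive_mtx_diagonal, simp)
 qed
 have code: "is_code n C" unfolding is_code_def
 proof (intro conjI ballI)
  show "1 <= num_msgs C" using M by (simp add: C_def)
  show "1 <= num_keys C" using K0 by (simp add: C_def del: One_nat_def)
  fix k
  have "positive_mtx (\<Lambda> k w)" for w
  proof (cases "w = 1")
   case True
   show ?thesis unfolding \<Lambda>_def using True
    by (simp del: One_nat_def) (intro positive_mtx_add positive_seq pos_off)
  qed (simp add: \<Lambda>_def positive_seq)
  moreover have "(\<Sum>w\<in>{1..M}. \<Lambda> k w x y) = tensor_id n x y" for x y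
  proof -
   have "(\<Sum>w\<in>{1..M}. \<Lambda> k w x y) = (\<Sum>w=1..M. seq_effect G (%i. A (cb k i)) w x y)
    + (seq_rest G (%i. A (cb k i)) M x y + off x y)" using M by (simp add: \<Lambda>_def sum.distrib)
   also have "... = of_bool (x = y & x \<in> G) + off x y"
    using seq_complete[OF G(1), of M "%i. A (cb k i)" x y] proj by (simp add: algebra_simps)
   also have "... = tensor_id n x y" using G(2) by (auto simp: off_def tensor_id_def)
   finally show ?thesis .
  qed
  ultimately show "povm n {1..num_msgs C} (decoder C k)" by (simp add: povm_def C_def fun_eq_iff)
 qed
 have eve: "eve_average_state \<eta> NB1 NB2 NS n C = tensor_prod n (%_. eve_avg Q NS)"
  by (rule eve_average_codebook[OF NS Q0, where cb = cb]) (use M cb in \<open>auto simp: C_def\<close>)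
 let ?\<rho> = "bob_out NS n Q"
 have psd: "psd_on G (?\<rho> c)" for c using positive_bob_out[OF NS] G(1) unfolding positive_mtx_iff_psd_on by blast
 have tG: "Re (\<Sum>x\<in>G. ?\<rho> c x x) <= 1" for c
 proof -
  have "Re (\<Sum>x\<in>G. ?\<rho> c x x) = (\<Sum>x\<in>G. Re (?\<rho> c x x))" by simp
  also have "... <= 1"
  proof (rule finite_sum_le_has_sum)
   show "((%x. Re (?\<rho> c x x)) has_sum 1) UNIV" using has_sum_Re[OF trace_bob_out[OF NS]] by simp
   show "0 <= Re (?\<rho> c x x)" for x
    using positive_mtx_diag[OF positive_bob_out[OF NS]] by (auto simp: complex_nonneg_Reals_iff)
  qed (use G in auto)
  finally show ?thesis .
 qed
 define E where "E k w = (%x y. seq_effect G (%i. A (cb k i)) w x y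
  + (if w = 1 then seq_rest G (%i. A (cb k i)) M x y else 0))" for k w
 define c1 where "c1 w = (if w = (1::nat) then 1 else 0 :: complex)" for w
 have dec: "decision_prob \<eta> NB1 NB2 NS n C k w w' = Re (pairing G (E k w') (?\<rho> (cb k w))
  + c1 w' * (1 - (\<Sum>x\<in>G. ?\<rho> (cb k w) x x)))" for k w w'
 proof -
  have "mtx_trace (\<Lambda> k w' \<odot> ?\<rho> (cb k w)) = mtx_trace ((%x y. E k w' x y + c1 w' * of_bool (x = y & x \<notin> G)) \<odot> ?\<rho> (cb k w))"
  proof -
   have "(\<Lambda> k w' x z) * ?\<rho> (cb k w) z x = (E k w' x z + c1 w' * of_bool (x = z & x \<notin> G)) * ?\<rho> (cb k w) z x" for x z
   proof (cases "length x = n")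
    case True
    then show ?thesis by (auto simp: \<Lambda>_def E_def off_def c1_def algebra_simps)
   next
    case False
    then have "?\<rho> (cb k w) z x = 0" by (simp add: bob_out_def tensor_prod_def)
    then show ?thesis by simp
   qed
   then show ?thesis unfolding mtx_trace_def mtx_mult_def by (intro infsum_cong)
  qed
  also have "... = pairing G (E k w') (?\<rho> (cb k w)) + c1 w' * (1 - (\<Sum>x\<in>G. ?\<rho> (cb k w) x x))"
   by (rule mtx_trace_split[where G = G and A = "E k w'" and B = "?\<rho> (cb k w)" and T = 1 and c = "c1 w'"
     and D = "%x y. c1 w' * of_bool (x = y & x \<notin> G)", OF G(1) _ trace_bob_out[OF NS]])
    (auto simp: E_def seq_effect_def seq_rest_def)
  finally show ?thesis by (simp add: decision_prob_def C_def bob_out_def)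
 qed
 have sumE: "(\<Sum>w'\<in>{1..M}. pairing G (E k w') B) = (\<Sum>x\<in>G. B x x)" for k B
 proof -
  have "(\<Sum>w'\<in>{1..M}. pairing G (E k w') B) = pairing G (%x y. \<Sum>w'\<in>{1..M}. E k w' x y) B"
  proof -
   have "pairing G (%x y. \<Sum>w'\<in>{1..M}. E k w' x y) B = (\<Sum>x\<in>G. \<Sum>y\<in>G. \<Sum>w'\<in>{1..M}. E k w' x y * B y x)"
    by (simp add: pairing_def sum_distrib_right)
   also have "... = (\<Sum>x\<in>G. \<Sum>w'\<in>{1..M}. \<Sum>y\<in>G. E k w' x y * B y x)" by (intro sum.cong refl sum.swap)
   also have "... = (\<Sum>w'\<in>{1..M}. pairing G (E k w') B)" unfolding pairing_def by (rule sum.swap)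
   finally show ?thesis by simp
  qed
  also have "(%x y. \<Sum>w'\<in>{1..M}. E k w' x y) = (%x y. of_bool (x = y & x \<in> G))"
  proof (intro ext)
   fix x y
   have "(\<Sum>w'\<in>{1..M}. E k w' x y) = (\<Sum>w=1..M. seq_effect G (%i. A (cb k i)) w x y) + seq_rest G (%i. A (cb k i)) M x y"
    using M by (simp add: E_def sum.distrib)
   then show "(\<Sum>w'\<in>{1..M}. E k w' x y) = of_bool (x = y & x \<in> G)"
    using seq_complete[OF G(1), of M "%i. A (cb k i)" x y] proj by (simp add: algebra_simps)
  qed
  also have "pairing G (%x y. of_bool (x = y & x \<in> G)) B = (\<Sum>x\<in>G. B x x)"
  proof -
   have "(\<Sum>y\<in>G. of_bool (x = y & x \<in> G) * B y x) = B x x" if "x \<in> G" for x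
    using that G(1) by (subst sum_of_bool_mult(3)[of G x "%y. B y x", symmetric]) (auto intro!: sum.cong)
   then show ?thesis by (simp add: pairing_def)
  qed
  finally show ?thesis .
 qed
 have total: "(\<Sum>w'\<in>{1..M}. decision_prob \<eta> NB1 NB2 NS n C k w w') = 1" for k w
 proof -
  have "(\<Sum>w'\<in>{1..M}. decision_prob \<eta> NB1 NB2 NS n C k w w')
   = Re ((\<Sum>w'\<in>{1..M}. pairing G (E k w') (?\<rho> (cb k w))) + (\<Sum>w'\<in>{1..M}. c1 w' * (1 - (\<Sum>x\<in>G. ?\<rho> (cb k w) x x))))"
   unfolding dec by (simp add: sum.distrib)
  also have "(\<Sum>w'\<in>{1..M}. c1 w' * (1 - (\<Sum>x\<in>G. ?\<rho> (cb k w) x x))) = 1 - (\<Sum>x\<in>G. ?\<rho> (cb k w) x x)"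
   using M by (simp add: c1_def sum_distrib_right[symmetric] del: One_nat_def)
  finally show ?thesis unfolding sumE by simp
 qed
 have accept': "Re (pairing G (A c) (?\<rho> c)) >= 1 - a" for c
 proof -
  have "A c x y * ?\<rho> c y x = proj J u x y * tensor_prod n (%_ x y. cr (bob_mtx NS x y)) y x" for x y
  proof -
   have "A c x y * ?\<rho> c y x = (phs n Q c x * cnj (phs n Q c x)) * (cnj (phs n Q c y) * phs n Q c y)
    * (proj J u x y * tensor_prod n (%_ x y. cr (bob_mtx NS x y)) y x)"
    unfolding Axy bob_out_eq[OF NS] by (simp only: mult_ac)
   then show ?thesis unfolding phs_unit by simp
  qed
  then have "pairing G (A c) (?\<rho> c) = pairing G (proj J u) (tensor_prod n (%_ x y. cr (bob_mtx NS x y)))"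
   by (simp add: pairing_def)
  then show ?thesis using accept by simp
 qed
 define err where "err i w k = Re (pairing G (A (cb k i)) (?\<rho> (cb k w)))" for i w k
 have each: "(\<Sum>w'\<in>{1..M} - {w}. decision_prob \<eta> NB1 NB2 NS n C k w w') <= 4 * a + 4 * (\<Sum>i=1..<w. err i w k)"
  if w: "w \<in> {1..M}" for w k
 proof -
  let ?t = "Re (\<Sum>x\<in>G. ?\<rho> (cb k w) x x)"
  have "(\<Sum>w'\<in>{1..M} - {w}. decision_prob \<eta> NB1 NB2 NS n C k w w') = 1 - decision_prob \<eta> NB1 NB2 NS n C k w w"
   using total[of k w] sum.remove[of "{1..M}" w "%w'. decision_prob \<eta> NB1 NB2 NS n C k w w'"] w by simp
  moreover have "decision_prob \<eta> NB1 NB2 NS n C k w w >= Re (pairing G (seq_effect G (%i. A (cb k i)) w) (?\<rho> (cb k w)))"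
  proof (cases "w = 1")
   case True
   have "pairing G (E k w) (?\<rho> (cb k w)) = pairing G (seq_effect G (%i. A (cb k i)) w) (?\<rho> (cb k w))
    + pairing G (seq_rest G (%i. A (cb k i)) M) (?\<rho> (cb k w))"
    using True by (simp add: E_def pairing_def distrib_right sum.distrib)
   moreover have "Re (pairing G (seq_rest G (%i. A (cb k i)) M) (?\<rho> (cb k w))) >= 0"
    using positive_seq(2)[of G "%i. A (cb k i)" M] G(1)
    by (intro pairing_psd_nonneg psd) (auto simp: positive_mtx_iff_psd_on)
   ultimately show ?thesis unfolding dec using tG[of "cb k w"] True by (simp add: c1_def)
  next
   case False
   then show ?thesis unfolding dec by (simp add: c1_def E_def)
  qed
  moreover have "?t - Re (pairing G (seq_effect G (%i. A (cb k i)) w) (?\<rho> (cb k w)))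
   <= 4 * (?t - Re (pairing G (A (cb k w)) (?\<rho> (cb k w))) + (\<Sum>i=1..<w. Re (pairing G (A (cb k i)) (?\<rho> (cb k w)))))"
   by (rule seq_effect_bound[OF G(1), where M = M]) (use w proj psd in auto)
  moreover have "x <= 4 * a + 4 * S" if "x = 1 - d" "e <= d" "t - e <= 4 * (t - p + S)" "t <= 1" "1 - a <= p" for x d e t p S :: real
   using that by argo
  ultimately show ?thesis unfolding err_def using tG[of "cb k w"] accept'[of "cb k w"] by blast
 qed
 \<comment> \<open>For \<open>i\<close> different from \<open>w\<close> the sum over codebooks
   factors. Averaging the codeword \<open>w\<close> leaves the diagonal of the state, and on the
   diagonal the phases of the test \<open>A\<close> cancel.\<close>
 have avg: "(\<Sum>k\<in>{1..card ?B}. err i w k) <= real (card ?B) * b" if iw: "i \<in> {1..M}" "w \<in> {1..M}" "i ~= w" for i w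
 proof -
  have M2: "M >= 2" using iw by auto
  have "(\<Sum>k\<in>{1..card ?B}. pairing G (A (cb k i)) (?\<rho> (cb k w))) = (\<Sum>c\<in>?B. pairing G (A (c i)) (?\<rho> (c w)))"
   by (rule sum.reindex_bij_betw[OF cb])
  also have "... = (\<Sum>x\<in>G. \<Sum>y\<in>G. \<Sum>c\<in>?B. A (c i) x y * ?\<rho> (c w) y x)"
  proof -
   have "(\<Sum>c\<in>?B. pairing G (A (c i)) (?\<rho> (c w))) = (\<Sum>x\<in>G. \<Sum>c\<in>?B. \<Sum>y\<in>G. A (c i) x y * ?\<rho> (c w) y x)"
    unfolding pairing_def by (rule sum.swap)
   also have "... = (\<Sum>x\<in>G. \<Sum>y\<in>G. \<Sum>c\<in>?B. A (c i) x y * ?\<rho> (c w) y x)"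
    by (intro sum.cong refl sum.swap)
   finally show ?thesis .
  qed
  also have "... = (\<Sum>x\<in>G. \<Sum>y\<in>G. of_nat (card ?W ^ (M - 2)) * ((\<Sum>c\<in>?W. A c x y) * (\<Sum>c\<in>?W. ?\<rho> c y x)))"
   using sum_PiE_marginal_pair[of "{1..M}" ?W i w "%c. A c _ _" "%c. ?\<rho> c _ _"] finW iw by simp
  also have "... = (\<Sum>x\<in>G. \<Sum>y\<in>G. of_bool (y = x) * (of_nat (card ?W ^ (M - 1)) * ((\<Sum>c\<in>?W. A c x y)
   * cr (\<Prod>j<n. bob_mtx NS (y ! j) (y ! j)))))"
  proof (intro sum.cong refl)
   fix x y assume xy: "x \<in> G" "y \<in> G"
   have "M - 1 = Suc (M - 2)" using M2 by simp
   moreover have "(\<Sum>c\<in>?W. ?\<rho> c y x) = of_nat (card ?W) * (of_bool (y = x) * cr (\<Prod>j<n. bob_mtx NS (y ! j) (y ! j)))"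
    unfolding cW using xy G(2) by (intro sum_bob_out NS Q) auto
   ultimately show "of_nat (card ?W ^ (M - 2)) * ((\<Sum>c\<in>?W. A c x y) * (\<Sum>c\<in>?W. ?\<rho> c y x))
    = of_bool (y = x) * (of_nat (card ?W ^ (M - 1)) * ((\<Sum>c\<in>?W. A c x y) * cr (\<Prod>j<n. bob_mtx NS (y ! j) (y ! j))))"
    by (simp only: power_Suc of_nat_mult mult_ac)
  qed
  also have "... = (\<Sum>x\<in>G. of_nat (card ?W ^ (M - 1)) * ((\<Sum>c\<in>?W. A c x x) * cr (\<Prod>j<n. bob_mtx NS (x ! j) (x ! j))))"
   by (intro sum.cong refl sum_of_bool_mult(1) G(1))
  also have "... = (\<Sum>x\<in>G. of_nat (card ?B) * (proj J u x x * cr (\<Prod>j<n. bob_mtx NS (x ! j) (x ! j))))"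
  proof (intro sum.cong refl)
   fix x
   have s: "(\<Sum>c\<in>?W. A c x x) = of_nat (card ?W) * proj J u x x" unfolding Axy phs_unit by simp
   have m: "M = Suc (M - 1)" using M by simp
   have "card ?B = card ?W * card ?W ^ (M - 1)" unfolding cB by (subst m) (rule power_Suc)
   then show "of_nat (card ?W ^ (M - 1)) * ((\<Sum>c\<in>?W. A c x x) * cr (\<Prod>j<n. bob_mtx NS (x ! j) (x ! j)))
    = of_nat (card ?B) * (proj J u x x * cr (\<Prod>j<n. bob_mtx NS (x ! j) (x ! j)))"
    unfolding s by (simp only: of_nat_mult mult_ac)
  qed
  finally have "(\<Sum>k\<in>{1..card ?B}. pairing G (A (cb k i)) (?\<rho> (cb k w)))
   = of_nat (card ?B) * (\<Sum>x\<in>G. proj J u x x * cr (\<Prod>j<n. bob_mtx NS (x ! j) (x ! j)))"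
   by (simp add: sum_distrib_left)
  then have "(\<Sum>k\<in>{1..card ?B}. err i w k)
   = Re (of_nat (card ?B) * (\<Sum>x\<in>G. proj J u x x * cr (\<Prod>j<n. bob_mtx NS (x ! j) (x ! j))))"
   unfolding err_def Re_sum[symmetric] by (rule arg_cong)
  also have "... = real (card ?B) * (\<Sum>x\<in>G. Re (proj J u x x) * (\<Prod>j<n. bob_mtx NS (x ! j) (x ! j)))"
   by (simp del: of_real_prod)
  also have "... <= real (card ?B) * b" using confuse by (intro mult_left_mono) auto
  finally show ?thesis .
 qed
 have b0: "b >= 0"
 proof -
  have "Re (proj J u x x) >= 0" for x by (simp add: proj_def sum_nonneg)
  then have "0 <= (\<Sum>x\<in>G. Re (proj J u x x) * (\<Prod>j<n. bob_mtx NS (x ! j) (x ! j)))"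
   by (intro sum_nonneg mult_nonneg_nonneg prod_nonneg) (auto simp: bob_mtx_nonneg)
  then show ?thesis using confuse by simp
 qed
 have "(\<Sum>k\<in>{1..card ?B}. error_prob \<eta> NB1 NB2 NS n C k)
  <= (\<Sum>k\<in>{1..card ?B}. (\<Sum>w\<in>{1..M}. 4 * a + 4 * (\<Sum>i=1..<w. err i w k)) / real M)"
  using each by (intro sum_mono) (auto simp: error_prob_def C_def intro!: divide_right_mono sum_mono)
 also have "... = (\<Sum>w\<in>{1..M}. \<Sum>k\<in>{1..card ?B}. 4 * a + 4 * (\<Sum>i=1..<w. err i w k)) / real M"
  unfolding sum_divide_distrib[symmetric] by (subst sum.swap) simp
 also have "... <= (\<Sum>w\<in>{1..M}. real (card ?B) * (4 * a + 4 * real M * b)) / real M"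
 proof (intro divide_right_mono sum_mono)
  fix w assume w: "w \<in> {1..M}"
  have "(\<Sum>k\<in>{1..card ?B}. 4 * a + 4 * (\<Sum>i=1..<w. err i w k)) = real (card ?B) * (4 * a) + 4 * (\<Sum>i=1..<w. \<Sum>k\<in>{1..card ?B}. err i w k)"
   by (subst sum.swap[where A = "{1..<w}"]) (simp add: sum.distrib sum_distrib_left)
  also have "... <= real (card ?B) * (4 * a) + 4 * (\<Sum>i=1..<w. real (card ?B) * b)"
   using w by (intro add_left_mono mult_left_mono sum_mono avg) auto
  also have "(\<Sum>i=1..<w. real (card ?B) * b) <= real M * (real (card ?B) * b)"
   using w b0 by (simp, intro mult_right_mono) auto
  finally show "(\<Sum>k\<in>{1..card ?B}. 4 * a + 4 * (\<Sum>i=1..<w. err i w k)) <= real (card ?B) * (4 * a + 4 * real M * b)"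
   by (simp add: algebra_simps)
 qed simp
 also have "... = real (card ?B) * (4 * a + 4 * real M * b)" using M by simp
 finally have "(\<Sum>k\<in>{1..num_keys C}. error_prob \<eta> NB1 NB2 NS n C k) / real (num_keys C) <= 4 * a + 4 * real M * b"
  using K0 by (simp add: C_def field_simps)
 then show ?thesis using code eve by (intro exI[of _ C]) (simp add: C_def)
qed

end

section \<open>Square-root-log scaling\<close>

lemma floor_exp_ln_bounds:
 fixes x :: real
 assumes "x >= 0"
 shows "x - ln 2 <= ln (real (nat \<lfloor>exp x\<rfloor>))" "ln (real (nat \<lfloor>exp x\<rfloor>)) <= x" "real (nat \<lfloor>exp x\<rfloor>) <= exp x" "nat \<lfloor>exp x\<rfloor> >= 1"
proof -
 have e: "exp x >= 1" using assms by simp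
 show 1: "nat \<lfloor>exp x\<rfloor> >= 1" using e by linarith
 show 2: "real (nat \<lfloor>exp x\<rfloor>) <= exp x" using e by linarith
 have "exp x < real (nat \<lfloor>exp x\<rfloor>) + 1" using e by linarith
 then have 3: "exp x / 2 <= real (nat \<lfloor>exp x\<rfloor>)" using 1 by linarith
 have "ln (exp x / 2) <= ln (real (nat \<lfloor>exp x\<rfloor>))" using 3 by (intro ln_mono) auto
 then show "x - ln 2 <= ln (real (nat \<lfloor>exp x\<rfloor>))" by (simp add: ln_div)
 have "ln (real (nat \<lfloor>exp x\<rfloor>)) <= ln (exp x)" using 2 1 by (intro ln_mono) (linarith | simp)+
 then show "ln (real (nat \<lfloor>exp x\<rfloor>)) <= x" by simp
qed

text \<open>Rounding down changes the logarithm by at most \<open>ln 2\<close>, which the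
  normalisation sends to zero.\<close>

lemma message_rate_limit:
 assumes r: "r > 0" and M: "!!n. n >= n0 ==> M n = nat \<lfloor>exp (r * sqrt (real n) * ln (real n))\<rfloor>"
 shows "(%n. ln (real (M n)) / (sqrt (real n) * ln (real n))) \<longlonglongrightarrow> r"
proof (rule tendsto_sandwich)
 have ev: "eventually (%n. n >= max n0 2) sequentially" by (rule eventually_ge_at_top)
 show "eventually (%n. r - ln 2 / (sqrt (real n) * ln (real n)) <= ln (real (M n)) / (sqrt (real n) * ln (real n))) sequentially"
  using ev
 proof eventually_elim
  case (elim n)
  have p: "sqrt (real n) * ln (real n) > 0" using elim by (intro mult_pos_pos) auto
  have "r * sqrt (real n) * ln (real n) - ln 2 <= ln (real (M n))"
   using floor_exp_ln_bounds(1)[of "r * sqrt (real n) * ln (real n)"] r elim by (simp add: M)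
  then have "(r * (sqrt (real n) * ln (real n)) - ln 2) / (sqrt (real n) * ln (real n)) <= ln (real (M n)) / (sqrt (real n) * ln (real n))"
   using p by (intro divide_right_mono) (auto simp: mult.assoc)
  moreover have "(r * y - ln 2) / y = r - ln 2 / y" if "y > 0" for y using that by (simp add: diff_divide_distrib)
  ultimately show ?case using p by metis
 qed
 show "eventually (%n. ln (real (M n)) / (sqrt (real n) * ln (real n)) <= r) sequentially" using ev
 proof eventually_elim
  case (elim n)
  have p: "sqrt (real n) * ln (real n) > 0" using elim by (intro mult_pos_pos) auto
  have "ln (real (M n)) <= r * sqrt (real n) * ln (real n)"
   using floor_exp_ln_bounds(2)[of "r * sqrt (real n) * ln (real n)"] r elim by (simp add: M)
  then show ?case using p by (simp add: divide_le_eq mult.assoc)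
 qed
 show "(%n. r - ln 2 / (sqrt (real n) * ln (real n))) \<longlonglongrightarrow> r" by real_asymp
qed simp

text \<open>As \<open>n * N n\<close> is asymptotic to \<open>a * sqrt n\<close> and
  \<open>ln (1 / N n)\<close> to \<open>ln n / 2\<close>, the exponent is
  \<open>sqrt n * ln n\<close> times a factor tending to \<open>r - a * R / 2 < 0\<close>. This is
  the origin of the factor 1/2 in the rate.\<close>

lemma confusion_exponent:
 fixes a R K :: real and k :: nat
 assumes a: "a > 0" and r: "r < a * R / 2"
 defines "N \<equiv> %n. a / sqrt (real (n + k))"
 shows "filterlim (%n. r * sqrt (real n) * ln (real n) + real n * N n * (K - ln (1 / N n) * R)) at_bot sequentially"
proof -
 define th where "th n = sqrt (real n / real (n + k))" for n
 define h where "h n = r + a * th n * ((K + R * ln a) / ln (real n) - R / 2 * (ln (real (n + k)) / ln (real n)))" for n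
 have th: "th \<longlonglongrightarrow> 1" unfolding th_def by real_asymp
 have q: "(%n. ln (real (n + k)) / ln (real n)) \<longlonglongrightarrow> 1" by real_asymp
 have q': "(%n. (K + R * ln a) / ln (real n)) \<longlonglongrightarrow> 0" by real_asymp
 have h: "h \<longlonglongrightarrow> r + a * 1 * (0 - R / 2 * 1)" unfolding h_def by (intro tendsto_intros th q q')
 have g: "filterlim (%n. sqrt (real n) * ln (real n)) at_top sequentially" by real_asymp
 have "filterlim (%n. h n * (sqrt (real n) * ln (real n))) at_bot sequentially"
  by (rule filterlim_tendsto_neg_mult_at_bot[OF h _ g]) (use r in simp)
 moreover have "eventually (%n. h n * (sqrt (real n) * ln (real n))
  = r * sqrt (real n) * ln (real n) + real n * N n * (K - ln (1 / N n) * R)) sequentially"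
  using eventually_ge_at_top[of 2]
 proof eventually_elim
  case (elim n)
  have ln: "ln (real n) > 0" using elim by simp
  have s: "sqrt (real (n + k)) > 0" using elim by simp
  have "ln (1 / N n) = ln (real (n + k)) / 2 - ln a" using a s elim by (simp add: N_def ln_div ln_sqrt)
  then have e1: "K - ln (1 / N n) * R = (K + R * ln a) - R / 2 * ln (real (n + k))"
   by (simp only:) (simp add: algebra_simps)
  have "real n = sqrt (real n) * sqrt (real n)" by simp
  then have e2: "real n * N n = a * th n * sqrt (real n)"
   unfolding N_def th_def real_sqrt_divide by (simp add: field_simps)
  have "h n * (sqrt (real n) * ln (real n)) = r * sqrt (real n) * ln (real n)
   + a * th n * sqrt (real n) * (((K + R * ln a) / ln (real n)) * ln (real n) - R / 2 * ((ln (real (n + k)) / ln (real n)) * ln (real n)))"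
   by (simp add: h_def algebra_simps)
  also have "... = r * sqrt (real n) * ln (real n) + real n * N n * (K - ln (1 / N n) * R)"
   unfolding e1 e2 using ln by simp
  finally show ?case .
 qed
 ultimately show ?thesis by (rule filterlim_cong[OF refl refl, THEN iffD1, rotated])
qed

lemma rejection_limit:
 fixes a g :: real and k :: nat
 assumes "a > 0" "g > 0"
 defines "N \<equiv> %n. a / sqrt (real (n + k))"
 shows "(%n. 2 * real n * N n ^ 3 + 2 * exp (- (g * (real n * N n)))) \<longlonglongrightarrow> 0"
 unfolding N_def using assms(1,2) by real_asymp

section \<open>Choice of the signal strength\<close>

context roundtrip
begin

lemma covert_const_pos: "covert_const \<eta> NB1 NB2 > 0"
proof -
 have e: "1 - \<eta> > 0" "\<eta>^2 - \<eta> + 1 > 0" using eta_pos eta_less_1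
  by (auto simp: add_pos_pos) (smt (verit) zero_less_power2)
 have sq: "\<eta>^2 * NB2 > 0" using eta_pos NB2_pos by simp
 have a1: "2 * \<eta>^2 * NB2 + \<eta>^2 - \<eta> + 1 > 0" and a2: "\<eta>^2 * NB2 + \<eta>^2 - \<eta> + 1 > 0"
  using sq e(2) by linarith+
 have p1: "NB1 ^ 3 * (2 * \<eta>^2 * NB2 + \<eta>^2 - \<eta> + 1) > 0" using a1 NB1_pos by simp
 have p2: "NB1^2 * (4 * \<eta> ^ 3 * NB2^2 + \<eta> * (4 * \<eta>^2 + 3) * NB2 + 1) > 0"
  using eta_pos NB1_pos NB2_pos by (intro mult_pos_pos add_pos_pos) auto
 have p3: "NB1 * NB2 * \<eta> * (2 * \<eta> ^ 3 * NB2^2 + \<eta> * (3 * \<eta>^2 + \<eta> + 3) * NB2 + \<eta> ^ 3 + 2 * \<eta>^2 + \<eta> + 2) > 0"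
  using eta_pos NB1_pos NB2_pos by (intro mult_pos_pos add_pos_pos) auto
 have p4: "\<eta>^2 * NB2^2 * (\<eta> * NB2 + 1) > 0" using eta_pos NB2_pos by (intro mult_pos_pos add_pos_pos) auto
 have d1: "NB1 * (2 * \<eta>^2 * NB2 + \<eta>^2 - \<eta> + 1) + \<eta> * NB2 > 0"
  using mult_pos_pos[OF NB1_pos a1] mult_pos_pos[OF eta_pos NB2_pos] by linarith
 have "NB1 * (\<eta>^2 * NB2 + \<eta>^2 - \<eta> + 1) + \<eta> * NB2 + 1 > 0"
  using mult_pos_pos[OF NB1_pos a2] mult_pos_pos[OF eta_pos NB2_pos] by linarith
 then have d2: "4 * \<eta>^2 * NB1 * NB2 * (NB1 * (\<eta>^2 * NB2 + \<eta>^2 - \<eta> + 1) + \<eta> * NB2 + 1) > 0"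
  using eta_pos NB1_pos NB2_pos by (intro mult_pos_pos) auto
 show ?thesis unfolding covert_const_def
  by (intro mult_pos_pos[OF mult_pos_pos] divide_pos_pos d1 d2 add_pos_pos[OF add_pos_pos[OF add_pos_pos]] p1 p2 p3 p4)
   (use e in auto)
qed

text \<open>Bernoulli's inequality gives
  \<open>1 - \<beta> ^ (2 * n) <= 2 * n * (1 - \<beta>)\<close>, so half the classical distance is
  at most \<open>d\<close>; coherences left by finitely many phases add
  \<open>\<epsilon>\<close>.\<close>

lemma covert_bound:
 assumes NS: "NS > 0" and BC: "1 - (\<Sum>\<^sub>\<infinity>m. sqrt (eve_mtx NS m m * eve_mtx 0 m m)) <= c * NS^2"
  and d: "2 * c * (real n * NS^2) <= d^2" "d >= 0" and \<epsilon>: "\<epsilon> > 0"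
 shows "\<exists>Q0. \<forall>Q\<ge>Q0. \<forall>C. eve_average_state \<eta> NB1 NB2 NS n C = tensor_prod n (%_. eve_avg Q NS)
  --> covert \<eta> NB1 NB2 NS n (d + \<epsilon>) C"
proof -
 define \<beta> where "\<beta> = (\<Sum>\<^sub>\<infinity>m. sqrt (eve_mtx NS m m * eve_mtx 0 m m))"
 have nn: "NS >= 0" using NS by simp
 have hs: "((%m. sqrt (eve_mtx NS m m * eve_mtx 0 m m)) has_sum \<beta>) UNIV"
  unfolding \<beta>_def by (rule has_sum_infsum[OF summable_affinity[OF nn]])
 have \<beta>0: "\<beta> >= 0" unfolding \<beta>_def by (intro infsum_nonneg) (simp add: eve_mtx_nonneg)
 have "tvd n NS <= 2 * sqrt (1 - (\<beta> ^ n)\<^sup>2)"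
  unfolding tvd_def by (rule total_variation_power_le(2)[OF trace_eve_mtx[OF nn] trace_eve_mtx[of 0] _ _ hs]) (auto simp: eve_mtx_nonneg)
 also have "sqrt (1 - (\<beta> ^ n)\<^sup>2) <= d"
 proof -
  have "1 + real (2 * n) * (\<beta> - 1) <= (1 + (\<beta> - 1)) ^ (2 * n)" using \<beta>0 by (intro Bernoulli_inequality) simp
  then have "1 - (\<beta> ^ n)\<^sup>2 <= 2 * real n * (1 - \<beta>)" by (simp add: power_mult[symmetric] mult.commute algebra_simps)
  also have "... <= 2 * real n * (c * NS^2)" using BC unfolding \<beta>_def by (intro mult_left_mono) auto
  also have "... <= d^2" using d(1) by (simp add: mult_ac)
  finally show ?thesis using d(2) by (simp add: real_le_lsqrt)
 qed
 finally have D: "tvd n NS <= 2 * d" by simp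
 have "2 * \<epsilon> > 0" using \<epsilon> by simp
 from trace_norm_eve_average[OF nn this, of n] obtain Q0 where
  Q0: "!!Q. Q >= Q0 ==> trace_norm (%x y. tensor_prod n (%_. eve_avg Q NS) x y - tensor_prod n (%_. no_comm_state \<eta> NB1 NB2) x y) <= tvd n NS + 2 * \<epsilon>"
  by blast
 show ?thesis
 proof (intro exI[of _ Q0] allI impI)
  fix Q C assume Q: "Q0 <= Q" and C: "eve_average_state \<eta> NB1 NB2 NS n C = tensor_prod n (%_. eve_avg Q NS)"
  show "covert \<eta> NB1 NB2 NS n (d + \<epsilon>) C" unfolding covert_def C using Q0[OF Q] D by simp
 qed
qed

text \<open>The slack \<open>\<kappa>\<close> is divided: the signal strength uses
  \<open>\<delta> - \<kappa> / 2\<close>, the classical distance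
  \<open>\<delta> - \<kappa> / 4\<close>, the finite number of phases the last
  \<open>\<kappa> / 4\<close>, and the gap between \<open>\<delta> - \<kappa>\<close> and
  \<open>\<delta> - \<kappa> / 2\<close> pays for the loss of rate.\<close>

lemma covert_codes:
 assumes \<epsilon>: "0 < \<epsilon>" and \<delta>: "0 < \<delta>" "\<delta> < 1" and \<kappa>: "0 < \<kappa>" "\<kappa> < \<delta> / 2"
 defines "r \<equiv> rate / 2 * ((\<delta> - \<kappa>) / sqrt (covert_const \<eta> NB1 NB2))"
 shows "\<exists>(NS :: nat => real) (C :: nat => phase_code) n0.
  (\<forall>n\<ge>1. NS n > 0 & is_code n (C n) & reliable \<eta> NB1 NB2 (NS n) n \<epsilon> (C n) & covert \<eta> NB1 NB2 (NS n) n \<delta> (C n)) &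
  (\<forall>n\<ge>n0. num_msgs (C n) = nat \<lfloor>exp (r * sqrt (real n) * ln (real n))\<rfloor>)"
proof -
 let ?C = "covert_const \<eta> NB1 NB2"
 have C0: "?C > 0" by (rule covert_const_pos)
 have rate: "0 < rate" "rate <= 1"
 proof -
  show "0 < rate" unfolding rate_def using eta_pos N_eff_nonneg by (intro divide_pos_pos) auto
  have "\<eta>^2 <= 1 + N_eff" using eta_pos eta_less_1 N_eff_nonneg power_le_one[of \<eta> 2] by simp
  then show "rate <= 1" unfolding rate_def using N_eff_nonneg by simp
 qed
 define a where "a = (\<delta> - \<kappa> / 2) / sqrt ?C"
 have a: "a > 0" unfolding a_def using \<delta> \<kappa> C0 by (intro divide_pos_pos) auto
 \<comment> \<open>The exponent loses \<open>4 * \<gamma> = rate * \<kappa> / 4\<close>, which is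
   affordable because \<open>(\<delta> - \<kappa> / 2) * (1 - \<kappa> / 4)\<close> still exceeds
   \<open>\<delta> - \<kappa>\<close>.\<close>
 define \<gamma> where "\<gamma> = rate * \<kappa> / 16"
 have \<gamma>: "0 < \<gamma>" "\<gamma> <= 1" using rate \<kappa> \<delta> by (auto simp: \<gamma>_def intro!: mult_le_one[THEN order_trans])
 have r0: "r > 0" unfolding r_def using rate \<delta> \<kappa> C0 by (intro mult_pos_pos divide_pos_pos) auto
 have r_lt: "r < a * (rate - 4 * \<gamma>) / 2"
 proof -
  have "\<kappa> * \<delta> <= \<kappa> * 1" using \<kappa> \<delta> by (intro mult_left_mono) auto
  moreover have "(\<delta> - \<kappa> / 2) * (1 - \<kappa> / 4) = \<delta> - \<kappa> / 2 - \<kappa> * \<delta> / 4 + \<kappa> * \<kappa> / 8" by (simp add: algebra_simps)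
  moreover have "\<kappa> * \<kappa> > 0" using \<kappa> by simp
  ultimately have "\<delta> - \<kappa> < (\<delta> - \<kappa> / 2) * (1 - \<kappa> / 4)" using \<kappa> by linarith
  then have "rate / 2 / sqrt ?C * (\<delta> - \<kappa>) < rate / 2 / sqrt ?C * ((\<delta> - \<kappa> / 2) * (1 - \<kappa> / 4))"
   using rate C0 by (intro mult_strict_left_mono) auto
  then show ?thesis by (simp add: r_def a_def \<gamma>_def field_simps)
 qed
 \<comment> \<open>The largest constant for which \<open>n * NS^2 <= a^2\<close> keeps the distance
   below \<open>\<delta> - \<kappa> / 4\<close>. It exceeds \<open>covert_const / 2\<close> because
   \<open>a\<close> was formed with the larger deduction \<open>\<kappa> / 2\<close>.\<close>
 define c where "c = (\<delta> - \<kappa> / 4)\<^sup>2 / (2 * a^2)"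
 have c: "c > ?C / 2"
 proof -
  have "(\<delta> - \<kappa> / 2)\<^sup>2 < (\<delta> - \<kappa> / 4)\<^sup>2" using \<kappa> \<delta> by (intro power_strict_mono) auto
  moreover have "a^2 * ?C = (\<delta> - \<kappa> / 2)\<^sup>2" unfolding a_def using C0 by (simp add: power_divide)
  ultimately have "a^2 * ?C < (\<delta> - \<kappa> / 4)\<^sup>2" by simp
  then show ?thesis unfolding c_def using a by (simp add: field_simps)
 qed
 obtain N1 where N1: "N1 > 0" "!!N. 0 < N ==> N < N1 ==> 1 - (\<Sum>\<^sub>\<infinity>m. sqrt (eve_mtx N m m * eve_mtx 0 m m)) <= c * N^2"
  using eve_affinity[OF c] by blast
 from bob_test[OF \<gamma>] obtain N2 K where N2: "N2 > 0" and test: "\<forall>NS n. 0 < NS & NS < N2 -->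
  (\<exists>G (J :: (nat set \<times> (nat \<times> nat) list) set) u. good_test n NS
   (2 * real n * NS ^ 3 + 2 * exp (- (\<gamma>^2 / 4 * (real n * NS))))
   (exp (real n * NS * (K - ln (1 / NS) * (rate - 4 * \<gamma>)))) G J u)" by (elim exE conjE)
 \<comment> \<open>The shift by \<open>k\<close> keeps \<open>N n\<close> below both thresholds for
   every \<open>n\<close>, without affecting the asymptotics.\<close>
 obtain k :: nat where k: "(a / min N1 N2)\<^sup>2 < real k" using reals_Archimedean2 by blast
 define N where "N n = a / sqrt (real (n + k))" for n
 have k0: "k > 0" using k by (cases k) (auto simp: not_less[symmetric])
 have N0: "N n > 0" for n using a k0 by (simp add: N_def)
 have Nlt: "N n < N1" "N n < N2" for n
 proof -
  have m: "min N1 N2 > 0" using N1 N2 by simp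
  have "a / min N1 N2 = sqrt ((a / min N1 N2)\<^sup>2)" using a m by simp
  also have "... < sqrt (real (n + k))" using k by (intro real_sqrt_less_mono) simp
  finally have "a / min N1 N2 < sqrt (real (n + k))" .
  moreover have "a / s < m" if "a / m < s" "m > 0" "s > 0" for s m :: real using that by (simp add: field_simps)
  moreover have "sqrt (real (n + k)) > 0" using k0 by simp
  ultimately have "N n < min N1 N2" unfolding N_def using m by blast
  then show "N n < N1" "N n < N2" by auto
 qed
 have Nsq: "real n * (N n)\<^sup>2 <= a^2" for n
 proof -
  have "real n * (N n)\<^sup>2 = a^2 * (real n / real (n + k))" using k0 by (simp add: N_def power_divide)
  also have "... <= a^2 * 1" by (intro mult_left_mono) (use k0 in auto)
  finally show ?thesis by simp
 qed
 define x where "x n = r * sqrt (real n) * ln (real n)" for n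
 define \<alpha> where "\<alpha> n = 2 * real n * N n ^ 3 + 2 * exp (- (\<gamma>^2 / 4 * (real n * N n)))" for n
 define b where "b n = exp (real n * N n * (K - ln (1 / N n) * (rate - 4 * \<gamma>)))" for n
 have "(%n. 4 * \<alpha> n + 4 * exp (x n + real n * N n * (K - ln (1 / N n) * (rate - 4 * \<gamma>)))) \<longlonglongrightarrow> 4 * 0 + 4 * 0"
 proof (intro tendsto_intros)
  show "\<alpha> \<longlonglongrightarrow> 0" unfolding \<alpha>_def N_def using \<gamma> by (intro rejection_limit a) simp
  show "(%n. exp (x n + real n * N n * (K - ln (1 / N n) * (rate - 4 * \<gamma>)))) \<longlonglongrightarrow> 0"
   unfolding x_def N_def by (rule filterlim_compose[OF exp_at_bot confusion_exponent[OF a r_lt]])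
 qed
 then have "eventually (%n. 4 * \<alpha> n + 4 * exp (x n + real n * N n * (K - ln (1 / N n) * (rate - 4 * \<gamma>))) < \<epsilon>) sequentially"
  using \<epsilon> by (intro order_tendstoD(2)) auto
 then obtain n1 where n1: "!!n. n >= n1 ==> 4 * \<alpha> n + 4 * exp (x n + real n * N n * (K - ln (1 / N n) * (rate - 4 * \<gamma>))) < \<epsilon>"
  unfolding eventually_sequentially by blast
 define n0 where "n0 = max n1 1"
 define M where "M n = (if n >= n0 then nat \<lfloor>exp (x n)\<rfloor> else 1)" for n
 have x0: "x n >= 0" if "n >= n0" for n using that r0 by (simp add: x_def n0_def)
 have M1: "M n >= 1" for n using floor_exp_ln_bounds(4)[OF x0, of n] by (simp add: M_def)
 have "\<exists>C. is_code n C & reliable \<eta> NB1 NB2 (N n) n \<epsilon> C & covert \<eta> NB1 NB2 (N n) n \<delta> C & num_msgs C = M n" if "n >= 1" for n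
 proof -
  have nn: "N n >= 0" using N0[of n] by simp
  have d: "2 * c * (real n * (N n)\<^sup>2) <= (\<delta> - \<kappa> / 4)\<^sup>2"
  proof -
   have "2 * c * (real n * (N n)\<^sup>2) <= 2 * c * a^2" using Nsq c C0 by (intro mult_left_mono) auto
   also have "... = (\<delta> - \<kappa> / 4)\<^sup>2" using a by (simp add: c_def)
   finally show ?thesis .
  qed
  have "\<delta> - \<kappa> / 4 >= 0" "\<kappa> / 4 > 0" using \<kappa> \<delta> by auto
  from covert_bound[OF N0 N1(2)[OF N0 Nlt(1)] d this] obtain Q0 where
   Q0: "!!Q C. Q >= Q0 ==> eve_average_state \<eta> NB1 NB2 (N n) n C = tensor_prod n (%_. eve_avg Q (N n)) ==> covert \<eta> NB1 NB2 (N n) n (\<delta> - \<kappa> / 4 + \<kappa> / 4) C"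
   by blast
  \<comment> \<open>\<open>Q0\<close> depends on \<open>n\<close>, so each block length has its own
    number of phases; Bob's averaging needs at least 3.\<close>
  define Q where "Q = max 3 Q0"
  have Q: "Q >= 3" "Q >= Q0" by (auto simp: Q_def)
  show ?thesis
  proof (cases "n >= n0")
   case False
   then have M: "M n = 1" by (simp add: M_def)
   \<comment> \<open>The empty test, with \<open>a = 1\<close> and \<open>b = 0\<close>: for short
     blocks a single message makes reliability trivial while covertness still holds.\<close>
   obtain C where C: "is_code n C" "num_msgs C = 1" "eve_average_state \<eta> NB1 NB2 (N n) n C = tensor_prod n (%_. eve_avg Q (N n))"
    using random_code[OF nn Q(1), of 1 n 1 0 "{}" "{} :: nat set" "%_ _. 0"] by (auto simp: pairing_def good_test_def)
   have "error_prob \<eta> NB1 NB2 (N n) n C j = 0" for j by (simp add: error_prob_def C(2))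
   then have "reliable \<eta> NB1 NB2 (N n) n \<epsilon> C" using \<epsilon> by (simp add: reliable_def)
   then show ?thesis using C M Q0[OF Q(2) C(3)] by auto
  next
   case True
   obtain G and J :: "(nat set \<times> (nat \<times> nat) list) set" and u where test: "good_test n (N n) (\<alpha> n) (b n) G J u"
    using test[rule_format, OF conjI[OF N0[of n] Nlt(2)[of n]], of n] unfolding \<alpha>_def b_def by (elim exE)
   from random_code[OF nn Q(1) M1 test] obtain C where
    C: "is_code n C" "num_msgs C = M n" "eve_average_state \<eta> NB1 NB2 (N n) n C = tensor_prod n (%_. eve_avg Q (N n))"
    and err: "(\<Sum>k\<in>{1..num_keys C}. error_prob \<eta> NB1 NB2 (N n) n C k) / real (num_keys C) <= 4 * \<alpha> n + 4 * real (M n) * b n"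
    by blast
   have "real (M n) * b n <= exp (x n) * b n"
    using floor_exp_ln_bounds(3)[OF x0[OF True]] True by (intro mult_right_mono) (auto simp: M_def b_def)
   also have "... = exp (x n + real n * N n * (K - ln (1 / N n) * (rate - 4 * \<gamma>)))" by (simp add: b_def exp_add)
   finally have "4 * \<alpha> n + 4 * real (M n) * b n < \<epsilon>" using n1[of n] True by (simp add: n0_def)
   then have "reliable \<eta> NB1 NB2 (N n) n \<epsilon> C" using err by (simp add: reliable_def)
   then show ?thesis using C Q0[OF Q(2) C(3)] by auto
  qed
 qed
 then obtain C where C: "!!n. n >= 1 ==> is_code n (C n) & reliable \<eta> NB1 NB2 (N n) n \<epsilon> (C n) & covert \<eta> NB1 NB2 (N n) n \<delta> (C n) & num_msgs (C n) = M n"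
  by metis
 have "\<forall>n\<ge>n0. num_msgs (C n) = nat \<lfloor>exp (r * sqrt (real n) * ln (real n))\<rfloor>"
 proof (intro allI impI)
  fix n assume n: "n0 <= n"
  then have "n >= 1" by (simp add: n0_def)
  then show "num_msgs (C n) = nat \<lfloor>exp (r * sqrt (real n) * ln (real n))\<rfloor>" using C n by (simp add: M_def x_def)
 qed
 moreover have "\<forall>n\<ge>1. N n > 0 & is_code n (C n) & reliable \<eta> NB1 NB2 (N n) n \<epsilon> (C n) & covert \<eta> NB1 NB2 (N n) n \<delta> (C n)"
  using C N0 by blast
 ultimately show ?thesis by blast
qed

end

theorem theorem5:
  fixes \<eta> NB1 NB2 \<epsilon> \<delta> \<kappa> :: real
  assumes "0 < \<eta>" "\<eta> < 1"
    and "NB1 > 0" "NB2 > 0"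
    and "0 < \<epsilon>" "\<epsilon> < 1"
    and "0 < \<delta>" "\<delta> < 1"
    and "0 < \<kappa>" "\<kappa> < \<delta> / 2"
  shows "\<exists>(NS :: nat \<Rightarrow> real) (C :: nat \<Rightarrow> phase_code).
    (\<forall>n\<ge>1. NS n > 0 \<and> is_code n (C n)
        \<and> reliable \<eta> NB1 NB2 (NS n) n \<epsilon> (C n)
        \<and> covert \<eta> NB1 NB2 (NS n) n \<delta> (C n)) \<and>
    (\<exists>l. (\<lambda>n. ln (real (num_msgs (C n))) / (sqrt (real n) * ln (real n))) \<longlonglongrightarrow> l \<and>
      l \<ge> \<eta>\<^sup>2 / (2 * ((1 - \<eta>) * \<eta> * NB1 + (1 - \<eta>) * NB2 + 1))
            * (1 / sqrt (covert_const \<eta> NB1 NB2)) * (\<delta> - \<kappa>))"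
proof -
 interpret roundtrip \<eta> NB1 NB2 by unfold_locales (use assms in auto)
 define r where "r = rate / 2 * ((\<delta> - \<kappa>) / sqrt (covert_const \<eta> NB1 NB2))"
 obtain NS C n0 where
  C: "\<forall>n\<ge>1. NS n > 0 & is_code n (C n) & reliable \<eta> NB1 NB2 (NS n) n \<epsilon> (C n) & covert \<eta> NB1 NB2 (NS n) n \<delta> (C n)"
  and M: "!!n. n >= n0 ==> num_msgs (C n) = nat \<lfloor>exp (r * sqrt (real n) * ln (real n))\<rfloor>"
  using covert_codes[OF assms(5,7-10)] unfolding r_def by blast
 have "rate > 0" unfolding rate_def using assms N_eff_nonneg by (intro divide_pos_pos) auto
 then have "r > 0" unfolding r_def using assms covert_const_pos by (intro mult_pos_pos divide_pos_pos) auto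
 then have "(%n. ln (real (num_msgs (C n))) / (sqrt (real n) * ln (real n))) \<longlonglongrightarrow> r"
  by (rule message_rate_limit) (rule M)
 moreover have "r = \<eta>^2 / (2 * ((1 - \<eta>) * \<eta> * NB1 + (1 - \<eta>) * NB2 + 1))
   * (1 / sqrt (covert_const \<eta> NB1 NB2)) * (\<delta> - \<kappa>)"
  by (simp add: r_def rate_def N_eff_def add_ac mult_ac)
 ultimately show ?thesis using C by blast
qed

end
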